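(* Let $(L,R)$ be a Lie--Rinehart algebra over a field $\mathbb{K}$ of characteristic $0$ with universal enveloping algebra $\mathsf{U}=\mathsf{U}(L,R)$, and let $\nabla$ be a ${\rm Der}(R)$-connection on $L$. With the maps $\mathfrak{s}^k$ defined in the context, the map \[ \Phi:(\phi_0,\ldots,\phi_n)\mapsto\Big(\sum_{i=0}^n\mathfrak{s}^i(\phi_i),\ \sum_{i=0}^{n-1}\mathfrak{s}^i(\phi_{i+1}),\ \ldots,\ \mathfrak{s}^0(\phi_{n-1})+\mathfrak{s}^1(\phi_n),\ \mathfrak{s}^0(\phi_n)\Big), \] where $\phi_i\in{\rm Hom}(\bigwedge^{n-i}L,\bigwedge^i_R{\rm Der}(R)\otimes_R{\rm Sym}_R(L))$ (so the $j$-th component of the image, $j=0,\ldots,n$, is $\sum_{i=0}^{n-j}\mathfrak{s}^i(\phi_{i+j})\in{\rm Hom}(\bigwedge^{n-j}L,C^j(R,\mathsf{U}))$), defines a morphism of cochain complexes \[ \Phi:\big(\mathsf{\Omega}_{\rm nl}(L,{\rm Sym}({\rm ad}(L))),\ \delta_{\mathsf{CE}}\pm(-\delta)\big)\longrightarrow\big(\mathsf{\Omega}(L,C^\bullet(R,\mathsf{U})),\ \delta_{\mathsf{CE}}\pm b\big). \]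
   Context: A Lie--Rinehart algebra $(L,R)$ over $\mathbb{K}$: $R$ is a commutative $\mathbb{K}$-algebra, $L$ is a $\mathbb{K}$-Lie algebra and an $R$-module, with a Lie algebra morphism (anchor) $\rho:L\to{\rm Der}(R)$ satisfying $[X,rY]=X(r)Y+r[X,Y]$, where $X(r):=\rho(X)(r)$. $\mathsf{U}(L,R)$ is the universal algebra generated by $R$ (as an algebra) and $L$ (as a Lie algebra), subject to $r\cdot X=rX$ and $Xr-rX=X(r)$. Unadorned ${\rm Hom}$, $\bigwedge$, $\otimes$ are over $\mathbb{K}$. Notation: $\vec D=D_1\wedge\cdots\wedge D_p$ ($D_i\in{\rm Der}(R)$), $\vec X=X_1\cdots X_q$ ($X_j\in L$); $\vec D_{(i)},\vec X_{(j)},\vec Y_{(i)}$ denote removal of the indicated entry. Source: ${\rm Sym}({\rm ad}(L))=\bigwedge^\bullet_R{\rm Der}(R)\otimes_R{\rm Sym}_R(L)$, graded by exterior degree, with $\delta(\vec D\otimes\vec X)=\sum_i\rho(X_i)\wedge\vec D\otimes\vec X_{(i)}$ and differential $-\delta$; $L$-action $\mathcal{L}_X$ extending $\mathcal{L}_X(D)=[\rho(X),D]$, $\mathcal{L}_X(Y)=[X,Y]$, $\mathcal{L}_X(r)=X(r)$ as a derivation; and $h_{r,X}(\vec D\otimes\vec X)=\sum_i(-1)^{i+1}D_i(r)\vec D_{(i)}\otimes\vec X X$. Target: $C^m(R,\mathsf{U})={\rm Hom}(R^{\otimes m},\mathsf{U})$ with Hochschild differential $b\varphi(r_1,\ldots,r_{m+1})=r_1\varphi(r_2,\ldots,r_{m+1})+\sum_{i=1}^m(-1)^i\varphi(\ldots,r_ir_{i+1},\ldots)+(-1)^{m+1}\varphi(r_1,\ldots,r_m)r_{m+1}$,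 $L$-action $\mathcal{L}_X(\varphi)(r_1,\ldots,r_m)=\sum_{i=1}^m\varphi(r_1,\ldots,X(r_i),\ldots,r_m)+[X,\varphi(r_1,\ldots,r_m)]$, and cup product $(\varphi\cup\psi)(r_1,\ldots,r_{k+l})=\varphi(r_1,\ldots,r_k)\psi(r_{k+1},\ldots,r_{k+l})$. Also ${\rm Der}(R)\subset C^1(R,\mathsf{U})$, and for $X\in L$, $(X\varphi)(r_1,\ldots)=X\cdot\varphi(r_1,\ldots)$. For a complex $M$ with $L$-action commuting with its differential $d$, $\mathsf{\Omega}(L,M)$ is the total complex of the double complex ${\rm Hom}(\bigwedge^pL,M^q)$ with the two commuting differentials $d$ (post-composition) and \[ (\delta_{\mathsf{CE}}\phi)(X_1,\ldots,X_{k+1})=\sum_i(-1)^{i+1}\mathcal{L}_{X_i}\phi(\ldots,\widehat X_i,\ldots)+\sum_{i<j}(-1)^{i+j}\phi([X_i,X_j],\ldots,\widehat X_i,\ldots,\widehat X_j,\ldots); \] its differential is written $\delta_{\mathsf{CE}}\pm d$, where $\pm$ stands for the sign of the total complex. $\mathsf{\Omega}^n_{\rm nl}(L,{\rm Sym}({\rm ad}(L)))$ is the subspace (a subcomplex) of tuples $(\phi_0,\ldots,\phi_n)$ with $\phi_i(X_1,\ldots,rX_{n-i})-r\phi_i(X_1,\ldots,X_{n-i})=h_{r,X_{n-i}}(\phi_{i+1}(X_1,\ldots,X_{n-i-1}))$. A connection $\nabla:{\rm Der}(R)\to{\rm End}(L)$ is an $R$-linear map with $\nabla_D(rX)=D(r)X+r\nabla_DX$.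 Its basic connection is $\nabla^b_X(Y)=\nabla_{\rho(Y)}X+[X,Y]$ on $L$ and $\nabla^b_X(D)=\rho(\nabla_DX)+[\rho(X),D]$ on ${\rm Der}(R)$, extended to ${\rm Sym}({\rm ad}(L))$ as a derivation. Put $\eta_Y(D,X)=[Y,\nabla_DX]-\nabla_{[\rho(Y),D]}X-\nabla_D[Y,X]\in L$ and $F_Y(\vec D\otimes\vec X)=\sum_{i,j}(-1)^{i+1}\vec D_{(i)}\otimes\eta_Y(D_i,X_j)\vec X_{(j)}$. For $k\ge0$ and $\vec Y=Y_1\wedge\cdots\wedge Y_k\in\bigwedge^kL$, maps $s^{k,p,q}_{\vec Y}:\bigwedge^p_R{\rm Der}(R)\otimes_R{\rm Sym}^q_R(L)\to C^{p-k}(R,\mathsf{U})$ are defined recursively, starting from the inclusion $s^{0,0,0}:R\to\mathsf{U}$ (and with $s^{k,p,q}=0$ when $p<k$), by \begin{align*} s^{k,p,q}_{\vec Y}(\vec D\otimes\vec X)=&\sum_{i=1}^p(-1)^{i+1+k}D_i\cup s^{k,p-1,q}_{\vec Y}(\vec D_{(i)}\otimes\vec X)+\sum_{j=1}^qX_j\,s^{k,p,q-1}_{\vec Y}(\vec D\otimes\vec X_{(j)})\\ &-\sum_{j=1}^qs^{k,p,q-1}_{\vec Y}(\nabla^b_{X_j}(\vec D\otimes\vec X_{(j)}))+\sum_{i=1}^k(-1)^{i+k}s^{k-1,p-1,q}_{\vec Y_{(i)}}(F_{Y_i}(\vec D\otimes\vec X)). \end{align*} Write $s^k_{\vec Y}$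 for the collection of these maps over all $p,q$. For $\phi\in{\rm Hom}(\bigwedge^iL,\bigwedge^p_R{\rm Der}(R)\otimes_R{\rm Sym}_R(L))$ define $\mathfrak{s}^k\phi\in{\rm Hom}(\bigwedge^{i+k}L,C^{p-k}(R,\mathsf{U}))$ by \[ (\mathfrak{s}^k\phi)(Y_1,\ldots,Y_{k+i})=\frac{1}{k!\,i!}\sum_{\sigma\in S_{k+i}}{\rm sgn}(\sigma)\,s^k_{Y_{\sigma(1)},\ldots,Y_{\sigma(k)}}\big(\phi(Y_{\sigma(k+1)},\ldots,Y_{\sigma(k+i)})\big). \]
   Formalization: The sum over X(r_i) in L_X(φ) on C^m(R,U) is taken with a minus sign, 𝔰^k on Hom(⋀^i L,–) carries the extra sign (-1)^{ki+k(k-1)/2}, and the anchor is assumed R-linear (needed for δ); with the signs as printed the claim is false. *)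

theory Defs
  imports
    Complex_Main
    "HOL-Library.Poly_Mapping"
    "HOL-Library.Function_Algebras"
    "HOL-Combinatorics.Permutations"
begin

section \<open>Cochain complexes\<close>

locale cochain_complex = vector_space scale
  for scale :: "'k::field \<Rightarrow> 'a::ab_group_add \<Rightarrow> 'a" +
  fixes C :: "nat \<Rightarrow> 'a set"
    and d :: "nat \<Rightarrow> 'a \<Rightarrow> 'a"
  assumes subspace_C: "subspace (C n)"
    and d_in: "x \<in> C n \<Longrightarrow> d n x \<in> C (Suc n)"
    and d_add: "x \<in> C n \<Longrightarrow> y \<in> C n \<Longrightarrow> d n (x + y) = d n x + d n y"
    and d_scale: "x \<in> C n \<Longrightarrow> d n (scale c x) = scale c (d n x)"
    and d_d: "x \<in> C n \<Longrightarrow> d (Suc n) (d n x) = 0"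

locale cochain_map =
  src: cochain_complex scale1 C1 d1 + tgt: cochain_complex scale2 C2 d2
  for scale1 :: "'k::field \<Rightarrow> 'a::ab_group_add \<Rightarrow> 'a"
    and C1 :: "nat \<Rightarrow> 'a set" and d1 :: "nat \<Rightarrow> 'a \<Rightarrow> 'a"
    and scale2 :: "'k \<Rightarrow> 'b::ab_group_add \<Rightarrow> 'b"
    and C2 :: "nat \<Rightarrow> 'b set" and d2 :: "nat \<Rightarrow> 'b \<Rightarrow> 'b" +
  fixes f :: "nat \<Rightarrow> 'a \<Rightarrow> 'b"
  assumes f_in: "x \<in> C1 n \<Longrightarrow> f n x \<in> C2 n"
    and f_add: "x \<in> C1 n \<Longrightarrow> y \<in> C1 n \<Longrightarrow> f n (x + y) = f n x + f n y"
    and f_scale: "x \<in> C1 n \<Longrightarrow> f n (scale1 c x) = scale2 c (f n x)"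
    and f_d: "x \<in> C1 n \<Longrightarrow> f (Suc n) (d1 n x) = d2 n (f n x)"


section \<open>Lie--Rinehart algebras and connections\<close>

record ('k, 'r, 'l) lie_rinehart_data =
  scR :: "'k \<Rightarrow> 'r \<Rightarrow> 'r"
  scL :: "'k \<Rightarrow> 'l \<Rightarrow> 'l"
  act :: "'r \<Rightarrow> 'l \<Rightarrow> 'l"
  brk :: "'l \<Rightarrow> 'l \<Rightarrow> 'l"
  anc :: "'l \<Rightarrow> 'r \<Rightarrow> 'r"

definition Der :: "('k::field, 'r::comm_ring_1, 'l) lie_rinehart_data \<Rightarrow> ('r \<Rightarrow> 'r) set" where
  "Der A = {D. Vector_Spaces.linear (scR A) (scR A) D \<and> (\<forall>a b. D (a * b) = D a * b + a * D b)}"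

definition der_scale :: "'r::comm_ring_1 \<Rightarrow> ('r \<Rightarrow> 'r) \<Rightarrow> 'r \<Rightarrow> 'r" where
  "der_scale r D = (\<lambda>a. r * D a)"

definition der_bracket :: "('r::comm_ring_1 \<Rightarrow> 'r) \<Rightarrow> ('r \<Rightarrow> 'r) \<Rightarrow> 'r \<Rightarrow> 'r" where
  "der_bracket D E = (\<lambda>a. D (E a) - E (D a))"

text \<open>
  The anchor is a morphism of Lie algebras and, as in Rinehart's definition, of \<open>R\<close>-modules;
  the latter is what makes the differential of \<open>Sym(ad(L))\<close> well defined over \<open>R\<close>.
\<close>
locale lie_rinehart =
  fixes A :: "('k::field, 'r::comm_ring_1, 'l::ab_group_add) lie_rinehart_data"
  assumes R_vector_space: "vector_space (scR A)"
    and R_algebra: "scR A c (a * b) = scR A c a * b"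
    and L_vector_space: "vector_space (scL A)"
    and L_module: "module (act A)"
    and act_scalar: "act A (scR A c 1) X = scL A c X"
    and brk_linear_left: "Vector_Spaces.linear (scL A) (scL A) (\<lambda>X. brk A X Y)"
    and brk_linear_right: "Vector_Spaces.linear (scL A) (scL A) (brk A X)"
    and brk_self: "brk A X X = 0"
    and jacobi: "brk A X (brk A Y Z) + brk A Y (brk A Z X) + brk A Z (brk A X Y) = 0"
    and anc_Der: "anc A X \<in> Der A"
    and anc_add: "anc A (X + Y) = anc A X + anc A Y"
    and anc_act: "anc A (act A r X) = der_scale r (anc A X)"
    and anc_brk: "anc A (brk A X Y) = der_bracket (anc A X) (anc A Y)"
    and leibniz: "brk A X (act A r Y) = act A (anc A X r) Y + act A r (brk A X Y)"

locale connection =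
  fixes A :: "('k::field, 'r::comm_ring_1, 'l::ab_group_add) lie_rinehart_data"
    and nab :: "('r \<Rightarrow> 'r) \<Rightarrow> 'l \<Rightarrow> 'l"
  assumes nab_linear: "D \<in> Der A \<Longrightarrow> Vector_Spaces.linear (scL A) (scL A) (nab D)"
    and nab_add: "D \<in> Der A \<Longrightarrow> E \<in> Der A \<Longrightarrow> nab (D + E) X = nab D X + nab E X"
    and nab_scale: "D \<in> Der A \<Longrightarrow> nab (der_scale r D) X = act A r (nab D X)"
    and nab_leibniz: "D \<in> Der A \<Longrightarrow> nab D (act A r X) = act A (D r) X + act A r (nab D X)"


section \<open>Modules given by generators and relations\<close>

text \<open>
  The universal objects below depend on the structure maps of \<open>(L, R)\<close>, so they cannot be types of
  their own. They are characterised up to unique isomorphism by a presentation: the free module on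
  the set \<open>G\<close> of generators consists of the finitely supported functions on \<open>G\<close>, and the module is
  its quotient by the submodule spanned by the relations.
\<close>

definition linear_extension ::
    "('a::zero \<Rightarrow> 'm::comm_monoid_add \<Rightarrow> 'm) \<Rightarrow> ('g \<Rightarrow> 'm) \<Rightarrow> ('g \<Rightarrow>\<^sub>0 'a) \<Rightarrow> 'm" where
  "linear_extension sc ev f =
     (\<Sum>g\<in>Poly_Mapping.keys f. sc (Poly_Mapping.lookup f g) (ev g))"

definition free_scale :: "'a::comm_ring_1 \<Rightarrow> ('g \<Rightarrow>\<^sub>0 'a) \<Rightarrow> ('g \<Rightarrow>\<^sub>0 'a)" where
  "free_scale a f = Poly_Mapping.map ((*) a) f"

definition presented_module ::
    "('a::comm_ring_1 \<Rightarrow> 'm::ab_group_add \<Rightarrow> 'm) \<Rightarrow> 'g set \<Rightarrow> ('g \<Rightarrow>\<^sub>0 'a) set \<Rightarrow> ('g \<Rightarrow> 'm) \<Rightarrow> bool"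
  where
  "presented_module sc G Rel ev \<longleftrightarrow>
     module sc \<and>
     (\<forall>m. \<exists>f. Poly_Mapping.keys f \<subseteq> G \<and> linear_extension sc ev f = m) \<and>
     (\<forall>f. Poly_Mapping.keys f \<subseteq> G \<longrightarrow>
        (linear_extension sc ev f = 0 \<longleftrightarrow> f \<in> module.span free_scale Rel))"

text \<open>The formal linear combination with the listed terms.\<close>
definition formal :: "('a::comm_ring_1 \<times> 'g) list \<Rightarrow> 'g \<Rightarrow>\<^sub>0 'a" where
  "formal ts = sum_list (map (\<lambda>(c, g). Poly_Mapping.single g c) ts)"

definition multilinear_rels ::
    "'m::plus set \<Rightarrow> ('a::comm_ring_1 \<Rightarrow> 'm \<Rightarrow> 'm) \<Rightarrow> ('m list \<Rightarrow>\<^sub>0 'a) set" where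
  "multilinear_rels M sc =
     {formal [(1, us @ (x + y) # vs), (-1, us @ x # vs), (-1, us @ y # vs)] |us vs x y.
        set us \<union> set vs \<union> {x, y} \<subseteq> M} \<union>
     {formal [(1, us @ sc a x # vs), (- a, us @ x # vs)] |us vs a x.
        set us \<union> set vs \<union> {x} \<subseteq> M}"

text \<open>The generator \<open>wedge [x\<^sub>1, \<dots>, x\<^sub>p]\<close> is \<open>x\<^sub>1 \<and> \<dots> \<and> x\<^sub>p\<close>, and \<open>wedge []\<close> is the unit.\<close>
definition exterior_algebra ::
    "'m::plus set \<Rightarrow> ('a::comm_ring_1 \<Rightarrow> 'm \<Rightarrow> 'm) \<Rightarrow>
     ('a \<Rightarrow> 'e::ab_group_add \<Rightarrow> 'e) \<Rightarrow> ('m list \<Rightarrow> 'e) \<Rightarrow> bool" where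
  "exterior_algebra M sc scE wedge \<longleftrightarrow>
     presented_module scE {us. set us \<subseteq> M}
       (multilinear_rels M sc \<union> {formal [(1, us)] |us. set us \<subseteq> M \<and> \<not> distinct us})
       wedge"

definition symmetric_algebra ::
    "'m::plus set \<Rightarrow> ('a::comm_ring_1 \<Rightarrow> 'm \<Rightarrow> 'm) \<Rightarrow>
     ('a \<Rightarrow> 's::ab_group_add \<Rightarrow> 's) \<Rightarrow> ('m list \<Rightarrow> 's) \<Rightarrow> bool" where
  "symmetric_algebra M sc scS symprod \<longleftrightarrow>
     presented_module scS {us. set us \<subseteq> M}
       (multilinear_rels M sc \<union>
        {formal [(1, us @ x # y # vs), (-1, us @ y # x # vs)] |us vs x y.
           set us \<union> set vs \<union> {x, y} \<subseteq> M})
       symprod"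

definition tensor_product ::
    "('a::comm_ring_1 \<Rightarrow> 'e::ab_group_add \<Rightarrow> 'e) \<Rightarrow> ('a \<Rightarrow> 's::ab_group_add \<Rightarrow> 's) \<Rightarrow>
     ('a \<Rightarrow> 'w::ab_group_add \<Rightarrow> 'w) \<Rightarrow> ('e \<Rightarrow> 's \<Rightarrow> 'w) \<Rightarrow> bool" where
  "tensor_product scE scS scW tns \<longleftrightarrow>
     presented_module scW UNIV
       ({formal [(1, (x + y, z)), (-1, (x, z)), (-1, (y, z))] |x y z. True} \<union>
        {formal [(1, (x, y + z)), (-1, (x, y)), (-1, (x, z))] |x y z. True} \<union>
        {formal [(1, (scE a x, y)), (- a, (x, y))] |a x y. True} \<union>
        {formal [(1, (x, scS a y)), (- a, (x, y))] |a x y. True})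
       (\<lambda>(x, y). tns x y)"


section \<open>The universal enveloping algebra\<close>

record ('k, 'r, 'l, 'u) envelope_data =
  scU :: "'k \<Rightarrow> 'u \<Rightarrow> 'u"
  inR :: "'r \<Rightarrow> 'u"
  inL :: "'l \<Rightarrow> 'u"

text \<open>
  Relations of \<open>U(L, R)\<close> in the free \<open>K\<close>-algebra on the disjoint union of \<open>R\<close> and \<open>L\<close>, whose
  monomials are words in \<open>'r + 'l\<close>.
\<close>
inductive_set envelope_rels ::
    "('k::field, 'r::comm_ring_1, 'l::ab_group_add) lie_rinehart_data \<Rightarrow> ('k \<times> ('r + 'l) list) list set"
  for A where
  R_add: "[(1, [Inl (a + b)]), (-1, [Inl a]), (-1, [Inl b])] \<in> envelope_rels A"
| R_scale: "[(1, [Inl (scR A c a)]), (- c, [Inl a])] \<in> envelope_rels A"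
| R_mult: "[(1, [Inl (a * b)]), (-1, [Inl a, Inl b])] \<in> envelope_rels A"
| R_one: "[(1, [Inl 1]), (-1, [])] \<in> envelope_rels A"
| L_add: "[(1, [Inr (X + Y)]), (-1, [Inr X]), (-1, [Inr Y])] \<in> envelope_rels A"
| L_scale: "[(1, [Inr (scL A c X)]), (- c, [Inr X])] \<in> envelope_rels A"
| L_brk: "[(1, [Inr X, Inr Y]), (-1, [Inr Y, Inr X]), (-1, [Inr (brk A X Y)])] \<in> envelope_rels A"
| act: "[(1, [Inl r, Inr X]), (-1, [Inr (act A r X)])] \<in> envelope_rels A"
| anchor: "[(1, [Inr X, Inl r]), (-1, [Inl r, Inr X]), (-1, [Inl (anc A X r)])] \<in> envelope_rels A"

text \<open>The two-sided ideal generated by the relations is spanned by their multiples by words.\<close>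
definition universal_envelope ::
    "('k::field, 'r::comm_ring_1, 'l::ab_group_add) lie_rinehart_data \<Rightarrow>
     ('k, 'r, 'l, 'u::ring_1) envelope_data \<Rightarrow> bool" where
  "universal_envelope A U \<longleftrightarrow>
     (\<forall>c u v. scU U c (u * v) = scU U c u * v \<and> scU U c (u * v) = u * scU U c v) \<and>
     presented_module (scU U) UNIV
       {formal (map (\<lambda>(c, w). (c, us @ w @ vs)) ts) |us vs ts. ts \<in> envelope_rels A}
       (\<lambda>w. prod_list (map (case_sum (inR U) (inL U)) w))"


section \<open>Signs and lists\<close>

definition alt_sign :: "nat \<Rightarrow> 'm::group_add \<Rightarrow> 'm" where
  "alt_sign n x = (if even n then x else - x)"

definition remove_nth :: "nat \<Rightarrow> 'x list \<Rightarrow> 'x list" where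
  "remove_nth i xs = take i xs @ drop (Suc i) xs"

text \<open>
  A \<open>K\<close>-multilinear map in \<open>m\<close> arguments is a function on lists of length \<open>m\<close>, extended by zero to
  lists of any other length. Positions in lists are counted from \<open>0\<close>, which shifts the
  exponents of signs.
\<close>
definition multilinear ::
    "('k::field \<Rightarrow> 'x::ab_group_add \<Rightarrow> 'x) \<Rightarrow> ('k \<Rightarrow> 'm::ab_group_add \<Rightarrow> 'm) \<Rightarrow> nat \<Rightarrow> ('x list \<Rightarrow> 'm) \<Rightarrow> bool"
  where
  "multilinear scX scM m \<phi> \<longleftrightarrow>
     (\<forall>xs. length xs \<noteq> m \<longrightarrow> \<phi> xs = 0) \<and>
     (\<forall>xs i. length xs = m \<longrightarrow> i < m \<longrightarrow> Vector_Spaces.linear scX scM (\<lambda>x. \<phi> (xs[i := x])))"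


section \<open>The complex \<open>Sym(ad(L))\<close>\<close>

record ('r, 'l, 'e, 's, 'w) sym_ad_data =
  scE :: "'r \<Rightarrow> 'e \<Rightarrow> 'e"
  wedge :: "('r \<Rightarrow> 'r) list \<Rightarrow> 'e"
  scS :: "'r \<Rightarrow> 's \<Rightarrow> 's"
  symprod :: "'l list \<Rightarrow> 's"
  scW :: "'r \<Rightarrow> 'w \<Rightarrow> 'w"
  tns :: "'e \<Rightarrow> 's \<Rightarrow> 'w"

definition sym_ad ::
    "('k::field, 'r::comm_ring_1, 'l::ab_group_add) lie_rinehart_data \<Rightarrow>
     ('r, 'l, 'e::ab_group_add, 's::ab_group_add, 'w::ab_group_add) sym_ad_data \<Rightarrow> bool" where
  "sym_ad A S \<longleftrightarrow>
     exterior_algebra (Der A) der_scale (scE S) (wedge S) \<and>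
     symmetric_algebra UNIV (act A) (scS S) (symprod S) \<and>
     tensor_product (scE S) (scS S) (scW S) (tns S)"

definition ten :: "('r, 'l, 'e, 's, 'w) sym_ad_data \<Rightarrow> ('r \<Rightarrow> 'r) list \<Rightarrow> 'l list \<Rightarrow> 'w" where
  "ten S Ds Xs = tns S (wedge S Ds) (symprod S Xs)"

definition scWK ::
    "('k::field, 'r::comm_ring_1, 'l::ab_group_add) lie_rinehart_data \<Rightarrow>
     ('r, 'l, 'e, 's, 'w) sym_ad_data \<Rightarrow> 'k \<Rightarrow> 'w \<Rightarrow> 'w" where
  "scWK A S c w = scW S (scR A c 1) w"

definition sym_ad_degree ::
    "('k::field, 'r::comm_ring_1, 'l::ab_group_add) lie_rinehart_data \<Rightarrow>
     ('r, 'l, 'e, 's, 'w::ab_group_add) sym_ad_data \<Rightarrow> nat \<Rightarrow> 'w set" where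
  "sym_ad_degree A S p =
     module.span (scW S) {ten S Ds Xs |Ds Xs. set Ds \<subseteq> Der A \<and> length Ds = p}"

definition R_linear_map ::
    "('k::field, 'r::comm_ring_1, 'l::ab_group_add) lie_rinehart_data \<Rightarrow>
     ('r, 'l, 'e, 's, 'w::ab_group_add) sym_ad_data \<Rightarrow>
     (('r \<Rightarrow> 'r) list \<Rightarrow> 'l list \<Rightarrow> 'w) \<Rightarrow> 'w \<Rightarrow> 'w" where
  "R_linear_map A S f =
     (THE g. (\<forall>v w. g (v + w) = g v + g w) \<and>
             (\<forall>r w. g (scW S r w) = scW S r (g w)) \<and>
             (\<forall>Ds Xs. set Ds \<subseteq> Der A \<longrightarrow> g (ten S Ds Xs) = f Ds Xs))"

text \<open>
  The derivation over \<open>\<rho>(X)\<close> with prescribed values on \<open>Der(R)\<close> and \<open>L\<close>; on \<open>R\<close>, the part with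
  \<open>Ds = []\<close> and \<open>Xs = []\<close>, it is \<open>r \<mapsto> X(r)\<close>.
\<close>
definition derivation_map ::
    "('k::field, 'r::comm_ring_1, 'l::ab_group_add) lie_rinehart_data \<Rightarrow>
     ('r, 'l, 'e, 's, 'w::ab_group_add) sym_ad_data \<Rightarrow>
     'l \<Rightarrow> (('r \<Rightarrow> 'r) \<Rightarrow> ('r \<Rightarrow> 'r)) \<Rightarrow> ('l \<Rightarrow> 'l) \<Rightarrow> 'w \<Rightarrow> 'w" where
  "derivation_map A S X f g =
     (THE h. (\<forall>v w. h (v + w) = h v + h w) \<and>
             (\<forall>r w. h (scW S r w) = scW S (anc A X r) w + scW S r (h w)) \<and>
             (\<forall>Ds Xs. set Ds \<subseteq> Der A \<longrightarrow>
                h (ten S Ds Xs) =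
                  (\<Sum>i<length Ds. ten S (Ds[i := f (Ds ! i)]) Xs) +
                  (\<Sum>j<length Xs. ten S Ds (Xs[j := g (Xs ! j)]))))"

definition sym_delta ::
    "('k::field, 'r::comm_ring_1, 'l::ab_group_add) lie_rinehart_data \<Rightarrow>
     ('r, 'l, 'e, 's, 'w::ab_group_add) sym_ad_data \<Rightarrow> 'w \<Rightarrow> 'w" where
  "sym_delta A S =
     R_linear_map A S
       (\<lambda>Ds Xs. \<Sum>i<length Xs. ten S (anc A (Xs ! i) # Ds) (remove_nth i Xs))"

definition sym_lie ::
    "('k::field, 'r::comm_ring_1, 'l::ab_group_add) lie_rinehart_data \<Rightarrow>
     ('r, 'l, 'e, 's, 'w::ab_group_add) sym_ad_data \<Rightarrow> 'l \<Rightarrow> 'w \<Rightarrow> 'w" where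
  "sym_lie A S X = derivation_map A S X (der_bracket (anc A X)) (brk A X)"

definition sym_h ::
    "('k::field, 'r::comm_ring_1, 'l::ab_group_add) lie_rinehart_data \<Rightarrow>
     ('r, 'l, 'e, 's, 'w::ab_group_add) sym_ad_data \<Rightarrow> 'r \<Rightarrow> 'l \<Rightarrow> 'w \<Rightarrow> 'w" where
  "sym_h A S r X =
     R_linear_map A S
       (\<lambda>Ds Xs. \<Sum>i<length Ds.
          alt_sign i (scW S ((Ds ! i) r) (ten S (remove_nth i Ds) (Xs @ [X]))))"

definition basic_connection ::
    "('k::field, 'r::comm_ring_1, 'l::ab_group_add) lie_rinehart_data \<Rightarrow>
     (('r \<Rightarrow> 'r) \<Rightarrow> 'l \<Rightarrow> 'l) \<Rightarrow> ('r, 'l, 'e, 's, 'w::ab_group_add) sym_ad_data \<Rightarrow> 'l \<Rightarrow> 'w \<Rightarrow> 'w" where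
  "basic_connection A nab S X =
     derivation_map A S X
       (\<lambda>D. anc A (nab D X) + der_bracket (anc A X) D)
       (\<lambda>Y. nab (anc A Y) X + brk A X Y)"

definition eta ::
    "('k::field, 'r::comm_ring_1, 'l::ab_group_add) lie_rinehart_data \<Rightarrow>
     (('r \<Rightarrow> 'r) \<Rightarrow> 'l \<Rightarrow> 'l) \<Rightarrow> 'l \<Rightarrow> ('r \<Rightarrow> 'r) \<Rightarrow> 'l \<Rightarrow> 'l" where
  "eta A nab Y D X =
     brk A Y (nab D X) - nab (der_bracket (anc A Y) D) X - nab D (brk A Y X)"

definition F_map ::
    "('k::field, 'r::comm_ring_1, 'l::ab_group_add) lie_rinehart_data \<Rightarrow>
     (('r \<Rightarrow> 'r) \<Rightarrow> 'l \<Rightarrow> 'l) \<Rightarrow> ('r, 'l, 'e, 's, 'w::ab_group_add) sym_ad_data \<Rightarrow> 'l \<Rightarrow> 'w \<Rightarrow> 'w" where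
  "F_map A nab S Y =
     R_linear_map A S
       (\<lambda>Ds Xs. \<Sum>i<length Ds. \<Sum>j<length Xs.
          alt_sign i (ten S (remove_nth i Ds) (eta A nab Y (Ds ! i) (Xs ! j) # remove_nth j Xs)))"


section \<open>The Hochschild complex \<open>C(R, U)\<close>\<close>

definition hochschild_cochains ::
    "('k::field, 'r::comm_ring_1, 'l::ab_group_add) lie_rinehart_data \<Rightarrow>
     ('k, 'r, 'l, 'u::ring_1) envelope_data \<Rightarrow> nat \<Rightarrow> ('r list \<Rightarrow> 'u) set" where
  "hochschild_cochains A U m = {\<phi>. multilinear (scR A) (scU U) m \<phi>}"

definition scC :: "('k, 'r, 'l, 'u) envelope_data \<Rightarrow> 'k \<Rightarrow> ('r list \<Rightarrow> 'u) \<Rightarrow> 'r list \<Rightarrow> 'u" where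
  "scC U c \<phi> = (\<lambda>rs. scU U c (\<phi> rs))"

definition left_mult :: "'u::ring_1 \<Rightarrow> ('r list \<Rightarrow> 'u) \<Rightarrow> 'r list \<Rightarrow> 'u" where
  "left_mult u \<phi> = (\<lambda>rs. u * \<phi> rs)"

definition hochschild_b ::
    "('k, 'r::comm_ring_1, 'l, 'u::ring_1) envelope_data \<Rightarrow> ('r list \<Rightarrow> 'u) \<Rightarrow> 'r list \<Rightarrow> 'u" where
  "hochschild_b U \<phi> rs =
     (if rs = [] then 0
      else inR U (hd rs) * \<phi> (tl rs)
         + (\<Sum>i<length rs - 1.
              alt_sign (Suc i) (\<phi> (take i rs @ (rs ! i * rs ! Suc i) # drop (i + 2) rs)))
         + alt_sign (length rs) (\<phi> (butlast rs) * inR U (last rs)))"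

text \<open>
  The sign of the first sum is the one for which \<open>X \<mapsto> \<L>\<^sub>X\<close> is a Lie algebra action commuting
  with \<open>b\<close> and restricting to \<open>D \<mapsto> [\<rho>(X), D]\<close> on \<open>Der(R)\<close>.
\<close>
definition hochschild_lie ::
    "('k, 'r, 'l) lie_rinehart_data \<Rightarrow> ('k, 'r, 'l, 'u::ring_1) envelope_data \<Rightarrow>
     'l \<Rightarrow> ('r list \<Rightarrow> 'u) \<Rightarrow> 'r list \<Rightarrow> 'u" where
  "hochschild_lie A U X \<phi> rs =
     - (\<Sum>i<length rs. \<phi> (rs[i := anc A X (rs ! i)]))
     + (inL U X * \<phi> rs - \<phi> rs * inL U X)"

text \<open>The cup product of a cochain of degree \<open>k\<close> with a cochain of any degree.\<close>
definition cup :: "nat \<Rightarrow> ('r list \<Rightarrow> 'u::ring_1) \<Rightarrow> ('r list \<Rightarrow> 'u) \<Rightarrow> 'r list \<Rightarrow> 'u" where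
  "cup k \<phi> \<psi> = (\<lambda>rs. \<phi> (take k rs) * \<psi> (drop k rs))"

definition der_cochain ::
    "('k, 'r, 'l, 'u::ring_1) envelope_data \<Rightarrow> ('r \<Rightarrow> 'r) \<Rightarrow> 'r list \<Rightarrow> 'u" where
  "der_cochain U D rs = (if length rs = 1 then inR U (D (hd rs)) else 0)"


section \<open>Chevalley--Eilenberg cochains with values in a complex\<close>

text \<open>
  A module \<open>M = (M\<^sup>q)\<close> is a type with subspaces \<open>M q\<close>. An element of degree \<open>n\<close> of the total
  complex is the tuple \<open>(\<phi>\<^sub>0, \<dots>, \<phi>\<^sub>n)\<close> with \<open>\<phi>\<^sub>i\<close> an alternating multilinear map
  in \<open>n - i\<close> arguments from \<open>L\<close> to \<open>M\<^sup>i\<close>, extended by zero to a sequence.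
\<close>

definition ce_cochains ::
    "('k::field \<Rightarrow> 'l::ab_group_add \<Rightarrow> 'l) \<Rightarrow> ('k \<Rightarrow> 'm::ab_group_add \<Rightarrow> 'm) \<Rightarrow> nat \<Rightarrow> 'm set \<Rightarrow>
     ('l list \<Rightarrow> 'm) set" where
  "ce_cochains sc scM p M =
     {\<phi>. multilinear sc scM p \<phi> \<and>
          (\<forall>Xs. \<not> distinct Xs \<longrightarrow> \<phi> Xs = 0) \<and>
          (\<forall>Xs. length Xs = p \<longrightarrow> \<phi> Xs \<in> M)}"

definition Omega ::
    "('k::field \<Rightarrow> 'l::ab_group_add \<Rightarrow> 'l) \<Rightarrow> ('k \<Rightarrow> 'm::ab_group_add \<Rightarrow> 'm) \<Rightarrow> (nat \<Rightarrow> 'm set) \<Rightarrow>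
     nat \<Rightarrow> (nat \<Rightarrow> 'l list \<Rightarrow> 'm) set" where
  "Omega sc scM M n =
     {\<phi>. (\<forall>i\<le>n. \<phi> i \<in> ce_cochains sc scM (n - i) (M i)) \<and> (\<forall>i>n. \<phi> i = 0)}"

definition tuple_scale ::
    "('k \<Rightarrow> 'm \<Rightarrow> 'm) \<Rightarrow> 'k \<Rightarrow> (nat \<Rightarrow> 'l list \<Rightarrow> 'm) \<Rightarrow> nat \<Rightarrow> 'l list \<Rightarrow> 'm" where
  "tuple_scale scM c \<phi> = (\<lambda>i Xs. scM c (\<phi> i Xs))"

definition ce_delta ::
    "('l \<Rightarrow> 'l \<Rightarrow> 'l) \<Rightarrow> ('l \<Rightarrow> 'm::ab_group_add \<Rightarrow> 'm) \<Rightarrow> ('l list \<Rightarrow> 'm) \<Rightarrow> 'l list \<Rightarrow> 'm" where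
  "ce_delta br lie \<phi> Xs =
     (\<Sum>i<length Xs. alt_sign i (lie (Xs ! i) (\<phi> (remove_nth i Xs)))) +
     (\<Sum>j<length Xs. \<Sum>i<j.
        alt_sign (i + j) (\<phi> (br (Xs ! i) (Xs ! j) # remove_nth i (remove_nth j Xs))))"

text \<open>The differential \<open>\<delta>\<^sub>C\<^sub>E + (-1)\<^sup>p d\<close> on the summand with \<open>p\<close> arguments from \<open>L\<close>.\<close>
definition total_diff ::
    "('l \<Rightarrow> 'l \<Rightarrow> 'l) \<Rightarrow> ('l \<Rightarrow> 'm::ab_group_add \<Rightarrow> 'm) \<Rightarrow> ('m \<Rightarrow> 'm) \<Rightarrow>
     (nat \<Rightarrow> 'l list \<Rightarrow> 'm) \<Rightarrow> nat \<Rightarrow> 'l list \<Rightarrow> 'm" where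
  "total_diff br lie d \<phi> i Xs =
     ce_delta br lie (\<phi> i) Xs +
     (if i = 0 then 0 else alt_sign (length Xs) (d (\<phi> (i - 1) Xs)))"

definition Omega_nl ::
    "('k::field, 'r::comm_ring_1, 'l::ab_group_add) lie_rinehart_data \<Rightarrow>
     ('r, 'l, 'e, 's, 'w::ab_group_add) sym_ad_data \<Rightarrow> nat \<Rightarrow> (nat \<Rightarrow> 'l list \<Rightarrow> 'w) set" where
  "Omega_nl A S n =
     {\<phi> \<in> Omega (scL A) (scWK A S) (sym_ad_degree A S) n.
        \<forall>i<n. \<forall>Xs X r. length Xs = n - i - 1 \<longrightarrow>
          \<phi> i (Xs @ [act A r X]) - scW S r (\<phi> i (Xs @ [X])) = sym_h A S r X (\<phi> (i + 1) Xs)}"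


section \<open>The maps \<open>s\<close> and \<open>\<Phi>\<close>\<close>

text \<open>
  \<open>s Ys\<close> collects the maps \<open>s\<^sup>k\<^sup>,\<^sup>p\<^sup>,\<^sup>q\<close> over all \<open>p\<close> and \<open>q\<close>, with \<open>k = length Ys\<close>. The recursion
  gives the values on decomposable tensors; \<open>s Ys\<close> is their \<open>R\<close>-linear extension, where \<open>R\<close> acts on
  cochains by left multiplication.
\<close>
definition is_s_family ::
    "('k::field, 'r::comm_ring_1, 'l::ab_group_add) lie_rinehart_data \<Rightarrow>
     ('k, 'r, 'l, 'u::ring_1) envelope_data \<Rightarrow> ('r, 'l, 'e, 's, 'w::ab_group_add) sym_ad_data \<Rightarrow>
     (('r \<Rightarrow> 'r) \<Rightarrow> 'l \<Rightarrow> 'l) \<Rightarrow> ('l list \<Rightarrow> 'w \<Rightarrow> 'r list \<Rightarrow> 'u) \<Rightarrow> bool" where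
  "is_s_family A U S nab s \<longleftrightarrow>
     (\<forall>Ys v w. s Ys (v + w) = s Ys v + s Ys w) \<and>
     (\<forall>Ys r w. s Ys (scW S r w) = left_mult (inR U r) (s Ys w)) \<and>
     s [] (ten S [] []) = (\<lambda>rs. if rs = [] then 1 else 0) \<and>
     (\<forall>Ys Ds Xs. set Ds \<subseteq> Der A \<longrightarrow> length Ds < length Ys \<longrightarrow> s Ys (ten S Ds Xs) = 0) \<and>
     (\<forall>Ys Ds Xs. set Ds \<subseteq> Der A \<longrightarrow> length Ys \<le> length Ds \<longrightarrow> (Ds, Xs) \<noteq> ([], []) \<longrightarrow>
        s Ys (ten S Ds Xs) =
          (\<Sum>i<length Ds. alt_sign (i + length Ys)
             (cup 1 (der_cochain U (Ds ! i)) (s Ys (ten S (remove_nth i Ds) Xs))))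
        + (\<Sum>j<length Xs. left_mult (inL U (Xs ! j)) (s Ys (ten S Ds (remove_nth j Xs))))
        - (\<Sum>j<length Xs. s Ys (basic_connection A nab S (Xs ! j) (ten S Ds (remove_nth j Xs))))
        + (\<Sum>i<length Ys. alt_sign (i + 1 + length Ys)
             (s (remove_nth i Ys) (F_map A nab S (Ys ! i) (ten S Ds Xs)))))"

definition s_map ::
    "('k::field, 'r::comm_ring_1, 'l::ab_group_add) lie_rinehart_data \<Rightarrow>
     ('k, 'r, 'l, 'u::ring_1) envelope_data \<Rightarrow> ('r, 'l, 'e, 's, 'w::ab_group_add) sym_ad_data \<Rightarrow>
     (('r \<Rightarrow> 'r) \<Rightarrow> 'l \<Rightarrow> 'l) \<Rightarrow> 'l list \<Rightarrow> 'w \<Rightarrow> 'r list \<Rightarrow> 'u" where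
  "s_map A U S nab = (THE s. is_s_family A U S nab s)"

text \<open>
  The map taking alternating maps in \<open>i\<close> arguments to alternating maps in \<open>k + i\<close> arguments. The
  outer sign, of exponent \<open>k i + k (k - 1) / 2\<close>, reverses the block of the \<open>k\<close> arguments of \<open>s\<close> and
  moves it behind the \<open>i\<close> arguments of \<open>\<phi>\<close>: the summands amount to
  \<open>sgn(\<sigma>) s[Y\<^sub>\<sigma>(k+i), \<dots>, Y\<^sub>\<sigma>(i+1)](\<phi>(Y\<^sub>\<sigma>(1), \<dots>, Y\<^sub>\<sigma>(i)))\<close>. Without it the
  sums do not commute with the total differentials, whose sign \<open>(-1)\<^sup>p\<close> is forced by the stability
  of \<open>Omega_nl\<close>.
\<close>
definition frak_s ::
    "('k::field_char_0, 'r::comm_ring_1, 'l::ab_group_add) lie_rinehart_data \<Rightarrow>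
     ('k, 'r, 'l, 'u::ring_1) envelope_data \<Rightarrow> ('r, 'l, 'e, 's, 'w::ab_group_add) sym_ad_data \<Rightarrow>
     (('r \<Rightarrow> 'r) \<Rightarrow> 'l \<Rightarrow> 'l) \<Rightarrow> nat \<Rightarrow> nat \<Rightarrow> ('l list \<Rightarrow> 'w) \<Rightarrow> 'l list \<Rightarrow> 'r list \<Rightarrow> 'u" where
  "frak_s A U S nab k i \<phi> Ys =
     (if length Ys = k + i then
        alt_sign (k * i + k * (k - 1) div 2)
          (scC U (1 / (fact k * fact i))
            (\<Sum>\<sigma> | \<sigma> permutes {..<k + i}.
               scC U (of_int (sign \<sigma>))
                 (s_map A U S nab (map (\<lambda>t. Ys ! \<sigma> t) [0..<k])
                    (\<phi> (map (\<lambda>t. Ys ! \<sigma> t) [k..<k + i])))))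
      else 0)"

definition Phi ::
    "('k::field_char_0, 'r::comm_ring_1, 'l::ab_group_add) lie_rinehart_data \<Rightarrow>
     ('k, 'r, 'l, 'u::ring_1) envelope_data \<Rightarrow> ('r, 'l, 'e, 's, 'w::ab_group_add) sym_ad_data \<Rightarrow>
     (('r \<Rightarrow> 'r) \<Rightarrow> 'l \<Rightarrow> 'l) \<Rightarrow> nat \<Rightarrow> (nat \<Rightarrow> 'l list \<Rightarrow> 'w) \<Rightarrow> nat \<Rightarrow> 'l list \<Rightarrow> 'r list \<Rightarrow> 'u" where
  "Phi A U S nab n \<phi> j =
     (if j \<le> n then \<Sum>i\<le>n - j. frak_s A U S nab i (n - (i + j)) (\<phi> (i + j)) else 0)"

end

theory Submission
  imports Defs
begin

text \<open>
  A tuple in the total complex is a function \<open>\<psi>\<close> on lists over \<open>L\<close>, and cochains are handled by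
  recursion on the first argument, so that the antisymmetrised sums \<open>\<ss>\<^sup>k\<close> become one
  product \<open>\<psi> \<star> t\<close> that satisfies a Leibniz rule for \<open>\<delta>\<^sub>C\<^sub>E\<close>; here \<open>t\<^sub>Y\<close> is
  \<open>(-1)\<^sup>k\<^sup>(\<^sup>k\<^sup>-\<^sup>1\<^sup>)\<^sup>/\<^sup>2 s\<^sub>Y\<close>. Compatibility of \<open>\<psi> \<mapsto> \<psi> \<star> t\<close> with the differentials
  amounts to the identity
  \<open>\<delta>\<^sub>C\<^sub>E t + (-1)\<^sup>k b \<circ> t + t \<circ> \<delta> = 0\<close>.

  Contracting with derivations (\<open>J\<close>) and summing over the symmetric factors (\<open>Q\<close>), the recursion for
  \<open>s\<close> reads \<open>t = (-1)\<^sup>k J t + Q t + F \<star> t + \<epsilon>\<close>. The commutators of \<open>J\<close>, \<open>Q\<close> and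
  \<open>F\<close> with the Lie derivatives, with \<open>b\<close> and with \<open>\<delta>\<close> show that the left side of the identity
  solves the homogeneous recursion up to a sign in front of \<open>J\<close> and \<open>F\<close>. Since \<open>J\<close> and \<open>Q\<close> lower
  the number of tensor factors, the solutions of such a recursion are unique, and it vanishes by
  induction on \<open>k\<close>.
\<close>

section \<open>Cochains as functions on lists\<close>

text \<open>Differentials and products obey a Cartan-type rule for inserting a first argument:
  insertion is an antiderivation of \<open>star\<close>, and its anticommutator with the
  differential is a Lie derivative (for b, the operator \<open>hochschild_N\<close>). Read as
  recursions, these rules replace double sums and sums over permutations by short inductions. The
  obstacle is that Sym(ad(L)) is known only by a presentation over R, while many operators on it are
  additive but not R-linear. Hence an extension principle for additive maps, after which an operator
  is determined by its commutators with multiplication by scalars, by D and by X. The identity rests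
  on two facts: \<eta>_Y is the Lie derivative of \<nabla> along Y, so that Y \<mapsto> F_Y is
  closed; and the failure of the basic connection to be L-invariant is the anticommutator of
  \<delta> with a contraction by \<eta>. One more term, \<open>Kop\<close>, comes both from moving b
  past Q and from moving \<delta> past J, and cancels. The exponent k(k-1)/2 turns the sign
  (-1)^(i+k) of the F-term in the recursion for s into the sign of a product with a
  one-cochain.\<close>

lemma alt_sign_simps [simp]:
  "alt_sign 0 x = x" "alt_sign (Suc n) x = - alt_sign n x" "alt_sign n (0::'m::group_add) = 0"
  by (auto simp: alt_sign_def)

lemma alt_sign_linear:
  fixes x y :: "'m::ab_group_add"
  shows "alt_sign n (x + y) = alt_sign n x + alt_sign n y"
    and "alt_sign n (- x) = - alt_sign n x"
    and "alt_sign n (x - y) = alt_sign n x - alt_sign n y"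
  by (auto simp: alt_sign_def)

lemma alt_sign_alt_sign [simp]: "alt_sign m (alt_sign n x) = alt_sign (m + n) (x::'m::group_add)"
  by (auto simp: alt_sign_def)

lemma alt_sign_cong: "even m = even n \<Longrightarrow> alt_sign m x = alt_sign n x"
  by (simp add: alt_sign_def)

lemma alt_sign_sum: "alt_sign n (sum f I) = (\<Sum>i\<in>I. alt_sign n (f i :: 'm::ab_group_add))"
  by (auto simp: alt_sign_def sum_negf)

lemma additive_alt_sign: "additive f \<Longrightarrow> f (alt_sign n x) = alt_sign n (f x)"
  by (auto simp: alt_sign_def additive.minus)

text \<open>The grading involution. The degree of a cochain is read off from the length of the
  argument list, so sign rules need no separate record of degrees.\<close>

definition bar :: "('x list \<Rightarrow> 'm::group_add) \<Rightarrow> 'x list \<Rightarrow> 'm" where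
  "bar \<phi> Xs = alt_sign (length Xs) (\<phi> Xs)"

lemma bar_Cons: "(\<lambda>Xs. bar \<phi> (Y # Xs)) = (\<lambda>Xs. - bar (\<lambda>Xs. \<phi> (Y # Xs)) Xs)"
  by (simp add: bar_def)

lemma bar_Nil [simp]: "bar \<phi> [] = \<phi> []"
  by (simp add: bar_def)

lemma bar_bar [simp]: "bar (bar \<phi>) = \<phi>"
  by (simp add: bar_def fun_eq_iff) (simp add: alt_sign_def)

lemma bar_linear:
  fixes \<phi> \<psi> :: "'x list \<Rightarrow> 'm::ab_group_add"
  shows "bar (\<lambda>Xs. \<phi> Xs + \<psi> Xs) = (\<lambda>Xs. bar \<phi> Xs + bar \<psi> Xs)"
    and "bar (\<lambda>Xs. - \<phi> Xs) = (\<lambda>Xs. - bar \<phi> Xs)"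
    and "bar (\<lambda>Xs. \<phi> Xs - \<psi> Xs) = (\<lambda>Xs. bar \<phi> Xs - bar \<psi> Xs)"
  by (simp_all add: bar_def fun_eq_iff alt_sign_linear)

text \<open>No length is fixed: one function carries components of all degrees, and the class is
  stable under inserting a first argument.\<close>

definition multiadditive :: "('x::plus list \<Rightarrow> 'm::plus) \<Rightarrow> bool" where
  "multiadditive \<phi> \<longleftrightarrow>
     (\<forall>us x y vs. \<phi> (us @ (x + y) # vs) = \<phi> (us @ x # vs) + \<phi> (us @ y # vs))"

definition multihomogeneous ::
    "('k \<Rightarrow> 'x \<Rightarrow> 'x) \<Rightarrow> ('k \<Rightarrow> 'm \<Rightarrow> 'm) \<Rightarrow> ('x list \<Rightarrow> 'm) \<Rightarrow> bool" where
  "multihomogeneous scX scM \<phi> \<longleftrightarrow>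
     (\<forall>us c x vs. \<phi> (us @ scX c x # vs) = scM c (\<phi> (us @ x # vs)))"

definition alternating :: "('x list \<Rightarrow> 'm::zero) \<Rightarrow> bool" where
  "alternating \<phi> \<longleftrightarrow> (\<forall>us x vs. \<phi> (us @ x # x # vs) = 0)"

lemma multiadditive_Cons: "multiadditive \<phi> \<Longrightarrow> multiadditive (\<lambda>Xs. \<phi> (Z # Xs))"
  unfolding multiadditive_def by (metis append_Cons)

lemma multihomogeneous_Cons:
  "multihomogeneous scX scM \<phi> \<Longrightarrow> multihomogeneous scX scM (\<lambda>Xs. \<phi> (Z # Xs))"
  unfolding multihomogeneous_def by (metis append_Cons)

lemma alternating_Cons: "alternating \<phi> \<Longrightarrow> alternating (\<lambda>Xs. \<phi> (Z # Xs))"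
  unfolding alternating_def by (metis append_Cons)

lemma multiadditive_hd:
  fixes \<phi> :: "'x::ab_group_add list \<Rightarrow> 'm::ab_group_add"
  assumes "multiadditive \<phi>"
  shows "\<phi> ((x + y) # vs) = \<phi> (x # vs) + \<phi> (y # vs)"
    and "\<phi> ((x - y) # vs) = \<phi> (x # vs) - \<phi> (y # vs)"
    and "\<phi> ((- x) # vs) = - \<phi> (x # vs)"
    and "\<phi> (0 # vs) = 0"
proof -
  have add: "\<phi> ((x + y) # vs) = \<phi> (x # vs) + \<phi> (y # vs)" for x y
    using assms unfolding multiadditive_def by (metis append_Nil)
  then interpret additive "\<lambda>x. \<phi> (x # vs)"
    by unfold_locales
  show "\<phi> ((x + y) # vs) = \<phi> (x # vs) + \<phi> (y # vs)" "\<phi> ((x - y) # vs) = \<phi> (x # vs) - \<phi> (y # vs)"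
    "\<phi> ((- x) # vs) = - \<phi> (x # vs)" "\<phi> (0 # vs) = 0"
    by (simp_all add: add diff minus zero)
qed

text \<open>Expand \<phi> on two adjacent entries x + y. The set \<open>M\<close> is everything for
  cochains on L, and Der(R) for the entries of an exterior product, which are constrained to a
  subset of a function type.\<close>

lemma swap_adjacent:
  fixes \<phi> :: "'x::plus list \<Rightarrow> 'm::ab_group_add"
  assumes add: "\<And>us x y vs. set us \<union> set vs \<union> {x, y} \<subseteq> M \<Longrightarrow>
      \<phi> (us @ (x + y) # vs) = \<phi> (us @ x # vs) + \<phi> (us @ y # vs)"
    and alt: "\<And>us x vs. set us \<union> set vs \<union> {x} \<subseteq> M \<Longrightarrow> \<phi> (us @ x # x # vs) = 0"
    and closed: "\<And>x y. x \<in> M \<Longrightarrow> y \<in> M \<Longrightarrow> x + y \<in> M"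
    and M: "set us \<union> set vs \<union> {x, y} \<subseteq> M"
  shows "\<phi> (us @ x # y # vs) = - \<phi> (us @ y # x # vs)"
proof -
  have xy: "x + y \<in> M"
    using closed M by auto
  have "\<phi> (us @ x # (x + y) # vs) = \<phi> (us @ x # x # vs) + \<phi> (us @ x # y # vs)"
    using add[of "us @ [x]" vs x y] M by auto
  moreover have "\<phi> (us @ y # (x + y) # vs) = \<phi> (us @ y # x # vs) + \<phi> (us @ y # y # vs)"
    using add[of "us @ [y]" vs x y] M by auto
  moreover have "\<phi> (us @ (x + y) # (x + y) # vs) =
      \<phi> (us @ x # (x + y) # vs) + \<phi> (us @ y # (x + y) # vs)"
    using add[of us "(x + y) # vs" x y] M xy by auto
  ultimately have "\<phi> (us @ x # y # vs) + \<phi> (us @ y # x # vs) = 0"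
    using alt[of us vs x] alt[of us vs y] alt[of us vs "x + y"] M xy by auto
  then show ?thesis
    by (simp add: eq_neg_iff_add_eq_0)
qed

text \<open>Swaps bring two equal entries together. Vanishing on adjacent repetitions is the form
  that suits the recursions; the definitions of \<open>ce_cochains\<close> and
  \<open>exterior_algebra\<close> speak of arbitrary repetitions.\<close>

lemma not_distinct_eq_0:
  fixes \<phi> :: "'x::plus list \<Rightarrow> 'm::ab_group_add"
  assumes add: "\<And>us x y vs. set us \<union> set vs \<union> {x, y} \<subseteq> M \<Longrightarrow>
      \<phi> (us @ (x + y) # vs) = \<phi> (us @ x # vs) + \<phi> (us @ y # vs)"
    and alt: "\<And>us x vs. set us \<union> set vs \<union> {x} \<subseteq> M \<Longrightarrow> \<phi> (us @ x # x # vs) = 0"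
    and closed: "\<And>x y. x \<in> M \<Longrightarrow> y \<in> M \<Longrightarrow> x + y \<in> M"
    and M: "set Xs \<subseteq> M" and nd: "\<not> distinct Xs"
  shows "\<phi> Xs = 0"
proof -
  have *: "\<phi> (us @ x # ws @ x # vs) = 0" if "set us \<union> set ws \<union> set vs \<union> {x} \<subseteq> M" for us ws vs x
    using that
  proof (induction ws arbitrary: us)
    case Nil
    then show ?case using alt by auto
  next
    case (Cons w ws)
    have "\<phi> (us @ x # w # ws @ x # vs) = - \<phi> (us @ w # x # ws @ x # vs)"
      by (rule swap_adjacent[OF add alt closed]) (use Cons.prems in auto)
    also have "\<phi> (us @ w # x # ws @ x # vs) = 0"
      using Cons.IH[of "us @ [w]"] Cons.prems by auto
    finally show ?case by simp
  qed
  from not_distinct_decomp[OF nd] obtain us ws vs x where "Xs = us @ [x] @ ws @ [x] @ vs"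
    by blast
  then show ?thesis
    using *[of us ws vs x] M by auto
qed

lemma alternating_swap:
  fixes \<phi> :: "'x::plus list \<Rightarrow> 'm::ab_group_add"
  assumes "multiadditive \<phi>" "alternating \<phi>"
  shows "\<phi> (us @ x # y # vs) = - \<phi> (us @ y # x # vs)"
  by (rule swap_adjacent[where M = UNIV])
    (use assms in \<open>auto simp: multiadditive_def alternating_def\<close>)

lemma alternating_not_distinct:
  fixes \<phi> :: "'x::plus list \<Rightarrow> 'm::ab_group_add"
  assumes "multiadditive \<phi>" "alternating \<phi>" "\<not> distinct Xs"
  shows "\<phi> Xs = 0"
  by (rule not_distinct_eq_0[where M = UNIV])
    (use assms in \<open>auto simp: multiadditive_def alternating_def\<close>)

lemma alternating_Cons_snoc:
  fixes \<phi> :: "'x::plus list \<Rightarrow> 'm::ab_group_add"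
  assumes "multiadditive \<phi>" "alternating \<phi>"
  shows "\<phi> (us @ x # Xs) = alt_sign (length Xs) (\<phi> (us @ Xs @ [x]))"
proof (induction Xs arbitrary: us)
  case (Cons y Xs)
  have "\<phi> (us @ x # y # Xs) = - \<phi> ((us @ [y]) @ x # Xs)"
    using alternating_swap[OF assms, of us x y Xs] by simp
  also have "\<dots> = - alt_sign (length Xs) (\<phi> ((us @ [y]) @ Xs @ [x]))"
    by (simp only: Cons.IH)
  finally show ?case by simp
qed simp

text \<open>Separates the degree, which becomes a support condition, from linearity, which is stated
  for lists of all lengths; the recursions work with the latter.\<close>

lemma multilinear_iff:
  fixes \<phi> :: "'x::ab_group_add list \<Rightarrow> 'm::ab_group_add"
  assumes "vector_space scX" "vector_space scM"
  shows "multilinear scX scM m \<phi> \<longleftrightarrow>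
    (\<forall>xs. length xs \<noteq> m \<longrightarrow> \<phi> xs = 0) \<and> multiadditive \<phi> \<and> multihomogeneous scX scM \<phi>"
    (is "_ \<longleftrightarrow> ?supp \<and> ?rest")
proof
  assume l: "multilinear scX scM m \<phi>"
  then have supp: ?supp
    by (simp add: multilinear_def)
  interpret M: vector_space scM by fact
  have lin: "Vector_Spaces.linear scX scM (\<lambda>x. \<phi> (us @ x # vs))" if "Suc (length us + length vs) = m" for us vs
  proof -
    \<comment> \<open>The placeholder \<open>undefined\<close> only occupies the position that the
      list update overwrites.\<close>
    have "length (us @ undefined # vs) = m" "length us < m"
      using that by auto
    then have "Vector_Spaces.linear scX scM (\<lambda>x. \<phi> ((us @ undefined # vs)[length us := x]))"
      using l unfolding multilinear_def by blast
    then show ?thesis by simp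
  qed
  have "\<phi> (us @ (x + y) # vs) = \<phi> (us @ x # vs) + \<phi> (us @ y # vs)" for us x y vs
  proof (cases "Suc (length us + length vs) = m")
    case True
    from lin[OF this] show ?thesis
      unfolding Vector_Spaces.linear_def module_hom_def module_hom_axioms_def by blast
  qed (simp add: supp)
  moreover have "\<phi> (us @ scX c x # vs) = scM c (\<phi> (us @ x # vs))" for us c x vs
  proof (cases "Suc (length us + length vs) = m")
    case True
    from lin[OF this] show ?thesis
      unfolding Vector_Spaces.linear_def module_hom_def module_hom_axioms_def by blast
  qed (simp add: supp)
  ultimately show "?supp \<and> ?rest"
    using supp by (auto simp: multiadditive_def multihomogeneous_def)
next
  assume r: "?supp \<and> ?rest"
  interpret pair: vector_space_pair scX scM
    using assms by (simp add: vector_space_pair_def)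
  have "Vector_Spaces.linear scX scM (\<lambda>x. \<phi> (xs[i := x]))" if "length xs = m" "i < m" for xs i
    using r that
    by (auto simp: Vector_Spaces.linear_iff assms upd_conv_take_nth_drop multiadditive_def multihomogeneous_def)
  then show "multilinear scX scM m \<phi>"
    using r by (auto simp: multilinear_def)
qed

subsection \<open>Lie derivatives and the Chevalley--Eilenberg differential\<close>

text \<open>With a = [Z, -] this is the Lie derivative of Chevalley--Eilenberg cochains, with a =
  \<rho>(X) the action of X on Hochschild cochains.\<close>

primrec lie_der :: "('x \<Rightarrow> 'x) \<Rightarrow> ('m \<Rightarrow> 'm) \<Rightarrow> ('x list \<Rightarrow> 'm::ab_group_add) \<Rightarrow> 'x list \<Rightarrow> 'm" where
  "lie_der a m \<phi> [] = m (\<phi> [])"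
| "lie_der a m \<phi> (Z # Xs) = lie_der a m (\<lambda>Ys. \<phi> (Z # Ys)) Xs - \<phi> (a Z # Xs)"

text \<open>Cartan's formula i_Z d + d i_Z = L_Z, taken as a recursion for d.\<close>

primrec ced :: "('x \<Rightarrow> 'x \<Rightarrow> 'x) \<Rightarrow> ('x \<Rightarrow> 'm \<Rightarrow> 'm) \<Rightarrow> ('x list \<Rightarrow> 'm::ab_group_add) \<Rightarrow> 'x list \<Rightarrow> 'm"
  where
  "ced br lie \<phi> [] = 0"
| "ced br lie \<phi> (Z # Xs) = lie_der (br Z) (lie Z) \<phi> Xs - ced br lie (\<lambda>Ys. \<phi> (Z # Ys)) Xs"

lemma lie_der_linear:
  assumes "additive m"
  shows lie_der_add: "lie_der a m (\<lambda>Xs. \<phi> Xs + \<psi> Xs) Xs = lie_der a m \<phi> Xs + lie_der a m \<psi> Xs"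
    and lie_der_minus: "lie_der a m (\<lambda>Xs. - \<phi> Xs) Xs = - lie_der a m \<phi> Xs"
    and lie_der_diff: "lie_der a m (\<lambda>Xs. \<phi> Xs - \<psi> Xs) Xs = lie_der a m \<phi> Xs - lie_der a m \<psi> Xs"
    and lie_der_zero: "lie_der a m (\<lambda>Xs. 0) Xs = 0"
  by (induction Xs arbitrary: \<phi> \<psi>)
    (simp_all add: additive.add[OF assms] additive.minus[OF assms] additive.diff[OF assms] additive.zero[OF assms])

lemma lie_der_bar:
  assumes "additive m"
  shows "lie_der a m (bar \<phi>) Xs = bar (lie_der a m \<phi>) Xs"
proof (induction Xs arbitrary: \<phi>)
  case (Cons Z Xs)
  then show ?case
    by (simp add: bar_Cons lie_der_minus[OF assms]) (simp add: bar_def alt_sign_linear)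
qed (simp add: bar_def)

lemma ced_linear:
  assumes "\<And>Z. additive (lie Z)"
  shows ced_add: "ced br lie (\<lambda>Xs. \<phi> Xs + \<psi> Xs) Xs = ced br lie \<phi> Xs + ced br lie \<psi> Xs"
    and ced_minus: "ced br lie (\<lambda>Xs. - \<phi> Xs) Xs = - ced br lie \<phi> Xs"
    and ced_diff: "ced br lie (\<lambda>Xs. \<phi> Xs - \<psi> Xs) Xs = ced br lie \<phi> Xs - ced br lie \<psi> Xs"
    and ced_zero: "ced br lie (\<lambda>Xs. 0) Xs = 0"
  by (induction Xs arbitrary: \<phi> \<psi>)
    (simp_all add: lie_der_linear[OF assms] algebra_simps)

text \<open>\<open>ced\<close> adds one argument, so it anticommutes with the degree sign.\<close>

lemma ced_bar:
  assumes "\<And>Z. additive (lie Z)"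
  shows "ced br lie (bar \<phi>) Xs = - bar (ced br lie \<phi>) Xs"
proof (induction Xs arbitrary: \<phi>)
  case (Cons Z Xs)
  then show ?case
    by (simp add: bar_Cons ced_minus[OF assms] lie_der_bar[OF assms])
      (simp add: bar_def alt_sign_linear)
qed (simp add: bar_def)

lemma remove_nth_Cons [simp]:
  "remove_nth 0 (x # xs) = xs" "remove_nth (Suc i) (x # xs) = x # remove_nth i xs"
  by (simp_all add: remove_nth_def)

text \<open>The explicit formula satisfies Cartan's formula: the terms in which the first argument Z
  acts or is bracketed form the Lie derivative along Z, the others are minus the formula for the
  cochain with Z inserted. Alternation exchanges Z with the bracket, which stands in front of it in
  the explicit formula.\<close>

lemma ce_delta_eq_ced:
  fixes \<phi> :: "'x::plus list \<Rightarrow> 'm::ab_group_add"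
  assumes add: "\<And>Z. additive (lie Z)" and "multiadditive \<phi>" "alternating \<phi>"
  shows "ce_delta br lie \<phi> Xs = ced br lie \<phi> Xs"
  using assms(2,3)
proof (induction Xs arbitrary: \<phi>)
  case (Cons Z Xs)
  have lie_der: "lie_der (br Z) (lie Z) \<phi> Ys =
      lie Z (\<phi> Ys) - (\<Sum>j<length Ys. alt_sign j (\<phi> (br Z (Ys ! j) # remove_nth j Ys)))"
    if "multiadditive \<phi>" "alternating \<phi>" for \<phi> :: "'x list \<Rightarrow> 'm" and Ys
    using that
  proof (induction Ys arbitrary: \<phi>)
    case (Cons Y Ys)
    have "\<phi> (br Z (Ys ! j) # Y # remove_nth j Ys) = - \<phi> (Y # br Z (Ys ! j) # remove_nth j Ys)" for j
      using alternating_swap[OF Cons.prems, of "[]" _ Y] by simp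
    then show ?case
      using Cons
      by (simp add: multiadditive_Cons alternating_Cons sum.lessThan_Suc_shift sum_negf alt_sign_linear
          del: sum.lessThan_Suc)
  qed simp
  have sw: "\<phi> (br x y # Z # Ys) = - \<phi> (Z # br x y # Ys)" for x y Ys
    using alternating_swap[OF Cons.prems, of "[]" _ Z] by simp
  have s1: "(\<Sum>i<length (Z # Xs). alt_sign i (lie ((Z # Xs) ! i) (\<phi> (remove_nth i (Z # Xs))))) =
      lie Z (\<phi> Xs) - (\<Sum>i<length Xs. alt_sign i (lie (Xs ! i) (\<phi> (Z # remove_nth i Xs))))"
    by (simp add: sum.lessThan_Suc_shift sum_negf del: sum.lessThan_Suc)
  have "(\<Sum>j<length (Z # Xs). \<Sum>i<j. alt_sign (i + j)
        (\<phi> (br ((Z # Xs) ! i) ((Z # Xs) ! j) # remove_nth i (remove_nth j (Z # Xs))))) =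
      (\<Sum>j<length Xs. \<Sum>i<Suc j. alt_sign (i + Suc j)
        (\<phi> (br ((Z # Xs) ! i) (Xs ! j) # remove_nth i (Z # remove_nth j Xs))))"
    by (simp add: sum.lessThan_Suc_shift del: sum.lessThan_Suc)
  also have "\<dots> = (\<Sum>j<length Xs. - alt_sign j (\<phi> (br Z (Xs ! j) # remove_nth j Xs)) -
       (\<Sum>i<j. alt_sign (i + j) (\<phi> (Z # br (Xs ! i) (Xs ! j) # remove_nth i (remove_nth j Xs)))))"
    by (subst sum.lessThan_Suc_shift) (simp add: sw alt_sign_linear sum_negf)
  finally have s2: "(\<Sum>j<length (Z # Xs). \<Sum>i<j. alt_sign (i + j)
        (\<phi> (br ((Z # Xs) ! i) ((Z # Xs) ! j) # remove_nth i (remove_nth j (Z # Xs))))) =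
      - (\<Sum>j<length Xs. alt_sign j (\<phi> (br Z (Xs ! j) # remove_nth j Xs))) -
      (\<Sum>j<length Xs. \<Sum>i<j. alt_sign (i + j)
         (\<phi> (Z # br (Xs ! i) (Xs ! j) # remove_nth i (remove_nth j Xs))))"
    by (simp add: sum_subtractf sum_negf)
  have "ce_delta br lie \<phi> (Z # Xs) =
      lie_der (br Z) (lie Z) \<phi> Xs - ce_delta br lie (\<lambda>Ys. \<phi> (Z # Ys)) Xs"
    unfolding lie_der[OF Cons.prems] unfolding ce_delta_def s1 s2 by simp
  then show ?case
    using Cons.IH[of "\<lambda>Ys. \<phi> (Z # Ys)"] Cons.prems
    by (simp add: multiadditive_Cons alternating_Cons)
qed (simp add: ce_delta_def)

lemma lie_der_in:
  assumes "\<And>x y. x \<in> M \<Longrightarrow> y \<in> M \<Longrightarrow> x - y \<in> M" "\<And>x. x \<in> M \<Longrightarrow> m x \<in> M" "\<And>Xs. \<phi> Xs \<in> M"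
  shows "lie_der a m \<phi> Xs \<in> M"
  using assms(3) by (induction Xs arbitrary: \<phi>) (auto intro!: assms(1,2))

lemma ced_in:
  assumes "0 \<in> M" "\<And>x y. x \<in> M \<Longrightarrow> y \<in> M \<Longrightarrow> x - y \<in> M" "\<And>Z x. x \<in> M \<Longrightarrow> lie Z x \<in> M" "\<And>Xs. \<phi> Xs \<in> M"
  shows "ced br lie \<phi> Xs \<in> M"
  using assms(4)
proof (induction Xs arbitrary: \<phi>)
  case (Cons Z Xs)
  show ?case
    using assms Cons by (simp add: lie_der_in)
qed (simp add: assms)

lemma lie_der_multiadditive:
  fixes \<phi> :: "'x::ab_group_add list \<Rightarrow> 'm::ab_group_add"
  assumes a: "additive a" and m: "additive m" and "multiadditive \<phi>"
  shows "multiadditive (lie_der a m \<phi>)"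
proof -
  have "lie_der a m \<phi> (us @ (x + y) # vs) =
      lie_der a m \<phi> (us @ x # vs) + lie_der a m \<phi> (us @ y # vs)" for us x y vs
    using assms(3)
  proof (induction us arbitrary: \<phi>)
    case Nil
    then show ?case
      by (simp add: multiadditive_hd[OF Nil] lie_der_add m additive.add[OF a])
  next
    case (Cons Z us)
    have "lie_der a m (\<lambda>Ys. \<phi> (Z # Ys)) (us @ (x + y) # vs) =
        lie_der a m (\<lambda>Ys. \<phi> (Z # Ys)) (us @ x # vs) + lie_der a m (\<lambda>Ys. \<phi> (Z # Ys)) (us @ y # vs)"
      by (rule Cons.IH[OF multiadditive_Cons]) fact
    moreover have "\<phi> (a Z # us @ (x + y) # vs) = \<phi> (a Z # us @ x # vs) + \<phi> (a Z # us @ y # vs)"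
      using multiadditive_Cons[OF Cons.prems] unfolding multiadditive_def by blast
    ultimately show ?case by simp
  qed
  then show ?thesis by (simp add: multiadditive_def)
qed

lemma lie_der_multihomogeneous:
  assumes "multihomogeneous scX scM \<phi>" "\<And>c. additive (scM c)"
    and "\<And>c Y. a (scX c Y) = scX c (a Y)" "\<And>c x. x \<in> M \<Longrightarrow> m (scM c x) = scM c (m x)"
    and "\<And>Xs. \<phi> Xs \<in> M"
  shows "multihomogeneous scX scM (lie_der a m \<phi>)"
proof -
  have *: "lie_der a m (\<lambda>Xs. scM c (\<phi> Xs)) Xs = scM c (lie_der a m \<phi> Xs)"
    if "\<And>Xs. \<phi> Xs \<in> M" for \<phi> c Xs
    using that by (induction Xs arbitrary: \<phi>) (simp_all add: assms(4) additive.diff[OF assms(2)])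
  have "lie_der a m \<phi> (us @ scX c x # vs) = scM c (lie_der a m \<phi> (us @ x # vs))"
    for us c x vs
    using assms(1,5)
  proof (induction us arbitrary: \<phi>)
    case Nil
    have "\<phi> (scX c x # vs) = scM c (\<phi> (x # vs))" for c x vs
      using Nil(1) unfolding multihomogeneous_def by (metis append_Nil)
    then show ?case
      by (simp add: * Nil assms(3) additive.diff[OF assms(2)])
  next
    case (Cons Z us)
    have "\<phi> (a Z # us @ scX c x # vs) = scM c (\<phi> (a Z # us @ x # vs))"
      using multihomogeneous_Cons[OF Cons.prems(1)] unfolding multihomogeneous_def by blast
    then show ?case
      using Cons by (simp add: multihomogeneous_Cons additive.diff[OF assms(2)])
  qed
  then show ?thesis by (simp add: multihomogeneous_def)
qed

lemma lie_der_eq_sum: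
  "lie_der a m \<phi> Xs = m (\<phi> Xs) - (\<Sum>i<length Xs. \<phi> (Xs[i := a (Xs ! i)]))"
  by (induction Xs arbitrary: \<phi>) (simp_all add: sum.lessThan_Suc_shift del: sum.lessThan_Suc)

lemma lie_der_commutator:
  fixes \<phi> :: "'x::ab_group_add list \<Rightarrow> 'm::ab_group_add"
  assumes "additive m" "additive m'" and a: "\<And>Z. a'' Z = a (a' Z) - a' (a Z)"
    and m: "\<And>x. x \<in> M \<Longrightarrow> m'' x = m (m' x) - m' (m x)" and "\<And>Xs. \<phi> Xs \<in> M" "multiadditive \<phi>"
  shows "lie_der a m (lie_der a' m' \<phi>) Xs - lie_der a' m' (lie_der a m \<phi>) Xs = lie_der a'' m'' \<phi> Xs"
  using assms(5,6)
proof (induction Xs arbitrary: \<phi>)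
  case (Cons Z Xs)
  have IH: "lie_der a m (lie_der a' m' (\<lambda>Ys. \<phi> (Z # Ys))) Xs -
      lie_der a' m' (lie_der a m (\<lambda>Ys. \<phi> (Z # Ys))) Xs = lie_der a'' m'' (\<lambda>Ys. \<phi> (Z # Ys)) Xs"
    by (rule Cons.IH) (simp_all add: Cons.prems multiadditive_Cons)
  show ?case
    using IH
    by (simp add: a[of Z] lie_der_diff assms(1,2) multiadditive_hd[OF Cons.prems(2)])
qed (simp add: m)

text \<open>The action identities are required on a subset \<open>M\<close> of the type of values.
  For Hochschild cochains, linearity in X and compatibility with brackets hold for multiadditive
  functions on lists, which do not form a type.\<close>

locale lie_module =
  fixes br :: "'x::ab_group_add \<Rightarrow> 'x \<Rightarrow> 'x" and lie :: "'x \<Rightarrow> 'm::ab_group_add \<Rightarrow> 'm" and M :: "'m set"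
  assumes br_add: "br (X + Y) Z = br X Z + br Y Z" "br X (Y + Z) = br X Y + br X Z"
    and br_self: "br X X = 0"
    and br_br: "br (br X Y) Z = br X (br Y Z) - br Y (br X Z)"
    and lie_additive: "additive (lie Z)"
    and lie_add: "x \<in> M \<Longrightarrow> lie (X + Y) x = lie X x + lie Y x"
    and lie_br: "x \<in> M \<Longrightarrow> lie (br X Y) x = lie X (lie Y x) - lie Y (lie X x)"
    and lie_in: "x \<in> M \<Longrightarrow> lie Z x \<in> M"
    and M_diff: "x \<in> M \<Longrightarrow> y \<in> M \<Longrightarrow> x - y \<in> M"
    and M_zero: "0 \<in> M"
begin

lemma br_additive: "additive (br X)"
  by (simp add: additive_def br_add)

text \<open>Cartan's recursion leaves the same claim for a shorter list and the commutator of the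
  Lie derivatives along Y and Z; the latter is the Lie derivative along [Y, Z], produced on the
  other side by the bracket in the first argument.\<close>

lemma lie_der_ced:
  assumes "\<And>Xs. \<phi> Xs \<in> M" "multiadditive \<phi>"
  shows "lie_der (br Y) (lie Y) (ced br lie \<phi>) Xs = ced br lie (lie_der (br Y) (lie Y) \<phi>) Xs"
  using assms
proof (induction Xs arbitrary: \<phi>)
  case Nil
  show ?case by (simp add: additive.zero[OF lie_additive])
next
  case (Cons Z Xs)
  have IH: "lie_der (br Y) (lie Y) (ced br lie (\<lambda>Ys. \<phi> (Z # Ys))) Xs =
      ced br lie (lie_der (br Y) (lie Y) (\<lambda>Ys. \<phi> (Z # Ys))) Xs"
    by (rule Cons.IH) (simp_all add: Cons.prems multiadditive_Cons)
  have "lie_der (br Y) (lie Y) (lie_der (br Z) (lie Z) \<phi>) Xs -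
      lie_der (br Z) (lie Z) (lie_der (br Y) (lie Y) \<phi>) Xs = lie_der (br (br Y Z)) (lie (br Y Z)) \<phi> Xs"
    by (rule lie_der_commutator[where M = M]) (use Cons.prems lie_br br_br lie_additive in auto)
  then show ?case
    using IH by (simp add: lie_der_diff lie_additive ced_diff algebra_simps)
qed

text \<open>Inserting Z into d d \<phi> gives L_Z d - d L_Z + d d i_Z applied to \<phi>. The first
  two terms cancel by \<open>lie_der_ced\<close>, the last vanishes by induction.\<close>

lemma ced_ced:
  assumes "\<And>Xs. \<phi> Xs \<in> M" "multiadditive \<phi>"
  shows "ced br lie (ced br lie \<phi>) Xs = 0"
  using assms
proof (induction Xs arbitrary: \<phi>)
  case (Cons Z Xs)
  have IH: "ced br lie (ced br lie (\<lambda>Ys. \<phi> (Z # Ys))) Xs = 0"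
    by (rule Cons.IH) (simp_all add: Cons.prems multiadditive_Cons)
  show ?case
    using IH by (simp add: lie_der_ced[OF Cons.prems] ced_diff lie_additive)
qed simp

lemma lie_der_alternating:
  assumes "multiadditive \<phi>" "alternating \<phi>"
  shows "alternating (lie_der (br Y) (lie Y) \<phi>)"
proof -
  have "lie_der (br Y) (lie Y) \<phi> (us @ x # x # vs) = 0" for us x vs
    using assms
  proof (induction us arbitrary: \<phi>)
    case Nil
    have "\<phi> (x # br Y x # vs) = - \<phi> (br Y x # x # vs)"
      using alternating_swap[OF Nil, of "[]" x "br Y x"] by simp
    moreover have "(\<lambda>Ys. \<phi> (x # x # Ys)) = (\<lambda>_. 0)"
      using Nil(2) unfolding alternating_def by (metis append_Nil)
    ultimately show ?case
      by (simp add: lie_der_zero lie_additive)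
  next
    case (Cons Z us)
    then show ?case
      using alternating_Cons[OF Cons.prems(2), of "br Y Z", unfolded alternating_def]
      by (simp add: multiadditive_Cons alternating_Cons)
  qed
  then show ?thesis by (simp add: alternating_def)
qed

lemma lie_der_add_fun:
  assumes "\<And>Xs. \<phi> Xs \<in> M" "multiadditive \<phi>"
  shows "lie_der (br (x + y)) (lie (x + y)) \<phi> Xs =
    lie_der (br x) (lie x) \<phi> Xs + lie_der (br y) (lie y) \<phi> Xs"
  using assms
  by (induction Xs arbitrary: \<phi>)
    (simp_all add: lie_add multiadditive_Cons br_add multiadditive_hd)

lemma ced_multiadditive:
  assumes "\<And>Xs. \<phi> Xs \<in> M" "multiadditive \<phi>"
  shows "multiadditive (ced br lie \<phi>)"
proof -
  have "ced br lie \<phi> (us @ (x + y) # vs) = ced br lie \<phi> (us @ x # vs) + ced br lie \<phi> (us @ y # vs)"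
    for us x y vs
    using assms
  proof (induction us arbitrary: \<phi>)
    case Nil
    then show ?case
      by (simp add: lie_der_add_fun ced_add lie_additive multiadditive_hd(1)[OF Nil(2)])
  next
    case (Cons Z us)
    then show ?case
      using lie_der_multiadditive[OF br_additive lie_additive Cons.prems(2), of Z]
      by (simp add: multiadditive_Cons) (simp add: multiadditive_def)
  qed
  then show ?thesis by (simp add: multiadditive_def)
qed

lemma ced_alternating:
  assumes "multiadditive \<phi>" "alternating \<phi>"
  shows "alternating (ced br lie \<phi>)"
proof -
  have "ced br lie \<phi> (us @ x # x # vs) = 0" for us x vs
    using assms
  proof (induction us arbitrary: \<phi>)
    case Nil
    have "(\<lambda>Ys. \<phi> (x # x # Ys)) = (\<lambda>_. 0)"
      using Nil(2) unfolding alternating_def by (metis append_Nil)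
    then show ?case
      by (simp add: ced_zero lie_additive br_self multiadditive_hd[OF Nil(1)])
  next
    case (Cons Z us)
    then show ?case
      using lie_der_alternating[OF Cons.prems, of Z, unfolded alternating_def]
      by (simp add: multiadditive_Cons alternating_Cons)
  qed
  then show ?thesis by (simp add: alternating_def)
qed

lemma ced_multihomogeneous:
  assumes "multihomogeneous scX scM \<phi>" "\<And>c. additive (scM c)"
    and br: "\<And>c X Y. br X (scX c Y) = scX c (br X Y)" "\<And>c X Y. br (scX c X) Y = scX c (br X Y)"
    and lie: "\<And>c X x. x \<in> M \<Longrightarrow> lie X (scM c x) = scM c (lie X x)"
      "\<And>c X x. x \<in> M \<Longrightarrow> lie (scX c X) x = scM c (lie X x)"
    and "\<And>Xs. \<phi> Xs \<in> M"
  shows "multihomogeneous scX scM (ced br lie \<phi>)"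
proof -
  have l: "lie_der (br Y) (lie Y) (\<lambda>Xs. scM c (\<phi> Xs)) Xs = scM c (lie_der (br Y) (lie Y) \<phi> Xs)"
    if "\<And>Xs. \<phi> Xs \<in> M" for \<phi> c Xs Y
    using that by (induction Xs arbitrary: \<phi>) (simp_all add: lie(1) additive.diff[OF assms(2)])
  have *: "ced br lie (\<lambda>Xs. scM c (\<phi> Xs)) Xs = scM c (ced br lie \<phi> Xs)"
    if "\<And>Xs. \<phi> Xs \<in> M" for \<phi> c Xs
    using that
    by (induction Xs arbitrary: \<phi>) (simp_all add: l additive.diff[OF assms(2)] additive.zero[OF assms(2)])
  have l': "lie_der (br (scX c Y)) (lie (scX c Y)) \<phi> Xs = scM c (lie_der (br Y) (lie Y) \<phi> Xs)"
    if "\<And>Xs. \<phi> Xs \<in> M" "multihomogeneous scX scM \<phi>" for \<phi> c Xs Y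
    using that
  proof (induction Xs arbitrary: \<phi>)
    case (Cons Z Xs)
    have "\<phi> (scX c x # vs) = scM c (\<phi> (x # vs))" for c x vs
      using Cons.prems(2) unfolding multihomogeneous_def by (metis append_Nil)
    then show ?case
      using Cons by (simp add: br additive.diff[OF assms(2)] multihomogeneous_Cons)
  qed (simp add: lie)
  have "ced br lie \<phi> (us @ scX c x # vs) = scM c (ced br lie \<phi> (us @ x # vs))"
    for us c x vs
    using assms(1,7)
  proof (induction us arbitrary: \<phi>)
    case Nil
    have "\<phi> (scX c x # vs) = scM c (\<phi> (x # vs))" for c x vs
      using Nil(1) unfolding multihomogeneous_def by (metis append_Nil)
    then show ?case
      by (simp add: l' Nil * additive.diff[OF assms(2)])
  next
    case (Cons Z us)
    have "lie_der (br Z) (lie Z) \<phi> (us @ scX c x # vs) = scM c (lie_der (br Z) (lie Z) \<phi> (us @ x # vs))"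
      using lie_der_multihomogeneous[where M = M and m = "lie Z" and a = "br Z", OF Cons.prems(1) assms(2) br(1) lie(1) Cons.prems(2)]
      unfolding multihomogeneous_def by blast
    then show ?case
      using Cons by (simp add: multihomogeneous_Cons additive.diff[OF assms(2)])
  qed
  then show ?thesis by (simp add: multihomogeneous_def)
qed

end

subsection \<open>Products of cochains\<close>

text \<open>The wedge product of cochains whose values are paired by \<open>P\<close>, given by the
  antiderivation rule for insertion. Unfolded it is the signed sum over all shuffles of the
  arguments, free of factorials.\<close>

primrec star ::
    "('a \<Rightarrow> 'b \<Rightarrow> 'm) \<Rightarrow> ('x list \<Rightarrow> 'a::group_add) \<Rightarrow> ('x list \<Rightarrow> 'b) \<Rightarrow> 'x list \<Rightarrow> 'm::ab_group_add" where
  "star P \<phi> c [] = P (\<phi> []) (c [])"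
| "star P \<phi> c (Y # Ys) = star P (\<lambda>Xs. \<phi> (Y # Xs)) c Ys + star P (bar \<phi>) (\<lambda>Xs. c (Y # Xs)) Ys"

text \<open>In the instances, \<open>P\<close> applies c to an element or composes it with an
  endomorphism. Additivity in the left factor is then additivity of c itself, whence the restriction
  to c in \<open>B\<close>.\<close>

locale pairing =
  fixes P :: "'a::ab_group_add \<Rightarrow> 'b::ab_group_add \<Rightarrow> 'm::ab_group_add" and B :: "'b set"
  assumes P_left: "c \<in> B \<Longrightarrow> P (x + x') c = P x c + P x' c"
    and P_right: "P x (c + c') = P x c + P x c'"
    and B_diff: "c \<in> B \<Longrightarrow> c' \<in> B \<Longrightarrow> c - c' \<in> B"
    and B_zero: "0 \<in> B"
begin

lemma P_additive: "c \<in> B \<Longrightarrow> additive (\<lambda>x. P x c)" "additive (P x)"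
  by (simp_all add: additive_def P_left P_right)

lemmas P_left_simps = P_left P_additive(1)[THEN additive.zero] P_additive(1)[THEN additive.minus]
  P_additive(1)[THEN additive.diff]
lemmas P_right_simps = P_right P_additive(2)[THEN additive.zero] P_additive(2)[THEN additive.minus]
  P_additive(2)[THEN additive.diff]

lemma star_left:
  assumes "\<And>Xs. c Xs \<in> B"
  shows star_add_left: "star P (\<lambda>Xs. \<phi> Xs + \<psi> Xs) c Ys = star P \<phi> c Ys + star P \<psi> c Ys"
    and star_minus_left: "star P (\<lambda>Xs. - \<phi> Xs) c Ys = - star P \<phi> c Ys"
    and star_diff_left: "star P (\<lambda>Xs. \<phi> Xs - \<psi> Xs) c Ys = star P \<phi> c Ys - star P \<psi> c Ys"
    and star_zero_left: "star P (\<lambda>Xs. 0) c Ys = 0"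
proof -
  show add: "star P (\<lambda>Xs. \<phi> Xs + \<psi> Xs) c Ys = star P \<phi> c Ys + star P \<psi> c Ys" for \<phi> \<psi>
    using assms
    by (induction Ys arbitrary: \<phi> \<psi> c) (simp_all add: P_left bar_linear)
  have "additive (\<lambda>\<phi>. star P \<phi> c Ys)"
    by (simp add: additive_def plus_fun_def add)
  from additive.minus[OF this] additive.diff[OF this] additive.zero[OF this]
  show "star P (\<lambda>Xs. - \<phi> Xs) c Ys = - star P \<phi> c Ys"
    "star P (\<lambda>Xs. \<phi> Xs - \<psi> Xs) c Ys = star P \<phi> c Ys - star P \<psi> c Ys"
    "star P (\<lambda>Xs. 0) c Ys = 0"
    by (simp_all add: fun_Compl_def fun_diff_def zero_fun_def)
qed

lemma star_right:
  shows star_add_right: "star P \<phi> (\<lambda>Xs. c Xs + d Xs) Ys = star P \<phi> c Ys + star P \<phi> d Ys"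
    and star_minus_right: "star P \<phi> (\<lambda>Xs. - c Xs) Ys = - star P \<phi> c Ys"
    and star_diff_right: "star P \<phi> (\<lambda>Xs. c Xs - d Xs) Ys = star P \<phi> c Ys - star P \<phi> d Ys"
    and star_zero_right: "star P \<phi> (\<lambda>Xs. 0) Ys = 0"
proof -
  show add: "star P \<phi> (\<lambda>Xs. c Xs + d Xs) Ys = star P \<phi> c Ys + star P \<phi> d Ys" for c d
    by (induction Ys arbitrary: \<phi> c d) (simp_all add: P_right)
  have "additive (\<lambda>c. star P \<phi> c Ys)"
    by (simp add: additive_def plus_fun_def add)
  from additive.minus[OF this] additive.diff[OF this] additive.zero[OF this]
  show "star P \<phi> (\<lambda>Xs. - c Xs) Ys = - star P \<phi> c Ys"
    "star P \<phi> (\<lambda>Xs. c Xs - d Xs) Ys = star P \<phi> c Ys - star P \<phi> d Ys"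
    "star P \<phi> (\<lambda>Xs. 0) Ys = 0"
    by (simp_all add: fun_Compl_def fun_diff_def zero_fun_def)
qed

lemma star_multiadditive:
  assumes "\<And>Xs. c Xs \<in> B" "multiadditive \<phi>" "multiadditive c"
  shows "multiadditive (star P \<phi> c)"
proof -
  have "star P \<phi> c (us @ (x + y) # vs) = star P \<phi> c (us @ x # vs) + star P \<phi> c (us @ y # vs)" for us x y vs
    using assms
  proof (induction us arbitrary: \<phi> c)
    case Nil
    have "\<phi> ((x + y) # vs) = \<phi> (x # vs) + \<phi> (y # vs)" "c ((x + y) # vs) = c (x # vs) + c (y # vs)" for vs
      using Nil(2,3) unfolding multiadditive_def by (metis append_Nil)+
    then show ?case
      by (simp add: star_add_left[OF Nil(1)] star_add_right)
  next
    case (Cons Z us)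
    have "multiadditive (bar \<phi>)"
      using Cons.prems(2) by (simp add: multiadditive_def bar_def alt_sign_linear)
    then show ?case
      using Cons by (simp add: multiadditive_Cons)
  qed
  then show ?thesis by (simp add: multiadditive_def)
qed

lemma star_alternating:
  assumes "\<And>Xs. c Xs \<in> B" "alternating \<phi>" "alternating c"
  shows "alternating (star P \<phi> c)"
proof -
  have "star P \<phi> c (us @ x # x # vs) = 0" for us x vs
    using assms
  proof (induction us arbitrary: \<phi> c)
    case Nil
    have "\<phi> (x # x # vs) = 0" "c (x # x # vs) = 0" for vs
      using Nil(2,3) unfolding alternating_def by (metis append_Nil)+
    then show ?case
      by (simp add: star_zero_left[OF Nil(1)] star_zero_right star_minus_left Nil(1) bar_Cons)
  next
    case (Cons Z us)
    have "alternating (bar \<phi>)"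
      using Cons.prems(2) by (simp add: alternating_def bar_def)
    then show ?case
      using Cons by (simp add: alternating_Cons)
  qed
  then show ?thesis by (simp add: alternating_def)
qed

lemma star_multihomogeneous:
  assumes P: "\<And>a x c. c \<in> B \<Longrightarrow> P (scA a x) c = scM a (P x c)" "\<And>a x c. c \<in> B \<Longrightarrow> P x (scB a c) = scM a (P x c)"
    and scM: "\<And>a. additive (scM a)" and scA: "\<And>a. additive (scA a)"
    and "\<And>Xs. c Xs \<in> B" "multihomogeneous scX scA \<phi>" "multihomogeneous scX scB c"
  shows "multihomogeneous scX scM (star P \<phi> c)"
proof -
  have bar_sc: "bar (\<lambda>Xs. scA a (\<phi> Xs)) = (\<lambda>Xs. scA a (bar \<phi> Xs))" for a and \<phi> :: "'d list \<Rightarrow> 'a"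
    by (simp add: bar_def additive_alt_sign[OF scA] fun_eq_iff)
  have l: "star P (\<lambda>Xs. scA a (\<phi> Xs)) c Ys = scM a (star P \<phi> c Ys)" if "\<And>Xs. c Xs \<in> B"
    for a \<phi> c and Ys :: "'d list"
    using that by (induction Ys arbitrary: \<phi> c) (simp_all add: P bar_sc additive.add[OF scM])
  have r: "star P \<phi> (\<lambda>Xs. scB a (c Xs)) Ys = scM a (star P \<phi> c Ys)" if "\<And>Xs. c Xs \<in> B"
    for a \<phi> c and Ys :: "'d list"
    using that by (induction Ys arbitrary: \<phi> c) (simp_all add: P additive.add[OF scM])
  have "star P \<phi> c (us @ scX a x # vs) = scM a (star P \<phi> c (us @ x # vs))" for us a x vs
    using assms(5-7)
  proof (induction us arbitrary: \<phi> c)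
    case Nil
    have "\<phi> (scX a x # vs) = scA a (\<phi> (x # vs))" "c (scX a x # vs) = scB a (c (x # vs))" for vs
      using Nil(2,3) unfolding multihomogeneous_def by (metis append_Nil)+
    then show ?case
      by (simp add: l r Nil additive.add[OF scM])
  next
    case (Cons Z us)
    have "multihomogeneous scX scA (bar \<phi>)"
      using Cons.prems(2) by (simp add: multihomogeneous_def bar_def additive_alt_sign[OF scA] additive.minus[OF scA])
    then show ?case
      using Cons by (simp add: multihomogeneous_Cons additive.add[OF scM])
  qed
  then show ?thesis by (simp add: multihomogeneous_def)
qed

lemma lie_der_star:
  assumes m: "additive m1" "additive m3" "\<And>c. c \<in> B \<Longrightarrow> m2 c \<in> B"
    "\<And>x c. c \<in> B \<Longrightarrow> m3 (P x c) = P (m1 x) c + P x (m2 c)"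
    and "\<And>Xs. c Xs \<in> B"
  shows "lie_der a m3 (star P \<phi> c) Ys = star P (lie_der a m1 \<phi>) c Ys + star P \<phi> (lie_der a m2 c) Ys"
  using assms(5)
proof (induction Ys arbitrary: \<phi> c)
  case (Cons Y Ys)
  have IH: "lie_der a m3 (star P \<phi> (\<lambda>Xs. c (Y # Xs))) Ys =
      star P (lie_der a m1 \<phi>) (\<lambda>Xs. c (Y # Xs)) Ys + star P \<phi> (lie_der a m2 (\<lambda>Xs. c (Y # Xs))) Ys" for \<phi>
    by (rule Cons.IH) (simp add: Cons.prems)
  have bar: "lie_der a m1 (bar \<phi>) = bar (lie_der a m1 \<phi>)" for \<phi> :: "'c list \<Rightarrow> 'a"
    using lie_der_bar[OF m(1)] by (rule ext)
  show ?case
    by (simp add: lie_der_add[OF m(2)] IH Cons.IH[OF Cons.prems] bar star_diff_left Cons.prems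
        star_diff_right algebra_simps)
qed (simp add: m)

text \<open>After inserting the first argument, Cartan's formula, the Leibniz rule of the Lie
  derivative and the antiderivation rule of \<open>star\<close> give the same recursion on both
  sides; \<open>bar\<close> appears since \<open>ced\<close> is odd.\<close>

theorem ced_star:
  assumes m: "\<And>Z. additive (lie1 Z)" "\<And>Z. additive (lie3 Z)" "\<And>Z c. c \<in> B \<Longrightarrow> lie2 Z c \<in> B"
    "\<And>Z x c. c \<in> B \<Longrightarrow> lie3 Z (P x c) = P (lie1 Z x) c + P x (lie2 Z c)"
    and "\<And>Xs. c Xs \<in> B"
  shows "ced br lie3 (star P \<phi> c) Ys = star P (ced br lie1 \<phi>) c Ys + star P (bar \<phi>) (ced br lie2 c) Ys"
  using assms(5)
proof (induction Ys arbitrary: \<phi> c)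
  case Nil
  then show ?case by (simp add: P_left_simps P_right_simps)
next
  case (Cons Y Ys)
  have IH: "ced br lie3 (star P \<phi> (\<lambda>Xs. c (Y # Xs))) Ys =
      star P (ced br lie1 \<phi>) (\<lambda>Xs. c (Y # Xs)) Ys + star P (bar \<phi>) (ced br lie2 (\<lambda>Xs. c (Y # Xs))) Ys" for \<phi>
    by (rule Cons.IH) (simp add: Cons.prems)
  have bar: "ced br lie1 (bar \<phi>) = (\<lambda>Xs. - bar (ced br lie1 \<phi>) Xs)" for \<phi> :: "'c list \<Rightarrow> 'a"
    using ced_bar[OF m(1)] by (rule ext)
  have ced_B: "ced br lie2 c Xs \<in> B" for Xs
    by (rule ced_in) (use B_zero B_diff m Cons.prems in auto)
  have "lie_der (br Y) (lie3 Y) (star P \<phi> c) Ys =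
      star P (lie_der (br Y) (lie1 Y) \<phi>) c Ys + star P \<phi> (lie_der (br Y) (lie2 Y) c) Ys"
    by (rule lie_der_star) (use m Cons.prems in auto)
  then show ?case
    by (simp add: ced_add[OF m(2)] IH Cons.IH[OF Cons.prems] bar star_diff_left Cons.prems bar_Cons
        star_minus_left ced_B star_diff_right algebra_simps)
qed

end

text \<open>The product with a one-cochain, of which only the operation T(Z, -) on values is kept.
  Commutators of Lie derivatives with operators enter in this shape, and T need not come from a
  pairing.\<close>

primrec one_star :: "('x \<Rightarrow> 'b \<Rightarrow> 'm) \<Rightarrow> ('x list \<Rightarrow> 'b) \<Rightarrow> 'x list \<Rightarrow> 'm::ab_group_add" where
  "one_star T c [] = 0"
| "one_star T c (Z # Ys) = T Z (c Ys) - one_star T (\<lambda>Xs. c (Z # Xs)) Ys"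

definition one_cochain :: "('x \<Rightarrow> 'a::zero) \<Rightarrow> 'x list \<Rightarrow> 'a" where
  "one_cochain F Xs = (case Xs of [Z] \<Rightarrow> F Z | _ \<Rightarrow> 0)"

lemma one_star_eq_sum:
  "one_star T c Ys = (\<Sum>i<length Ys. alt_sign i (T (Ys ! i) (c (remove_nth i Ys))))"
  by (induction Ys arbitrary: c)
    (simp_all add: sum.lessThan_Suc_shift sum_negf del: sum.lessThan_Suc)

lemma (in pairing) star_one_cochain:
  assumes "\<And>Xs. c Xs \<in> B"
  shows "star P (one_cochain F) c Ys = one_star (\<lambda>Z. P (F Z)) c Ys"
  using assms
proof (induction Ys arbitrary: c)
  case Nil
  then show ?case by (simp add: one_cochain_def P_left_simps)
next
  case (Cons Z Ys)
  have "bar (one_cochain F) = (\<lambda>Xs. - one_cochain F Xs)"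
    by (auto simp: bar_def one_cochain_def fun_eq_iff split: list.split)
  moreover have "star P (\<lambda>Xs. one_cochain F (Z # Xs)) c Ys = P (F Z) (c Ys)"
  proof -
    have "star P (\<lambda>Xs. if Xs = [] then x else 0) c Ys = P x (c Ys)" if "\<And>Xs. c Xs \<in> B" for x c
      using that
    proof (induction Ys arbitrary: c)
      case (Cons Y Ys)
      have "bar (\<lambda>Xs::'c list. if Xs = [] then x else 0) = (\<lambda>Xs. if Xs = [] then x else 0)"
        by (auto simp: bar_def fun_eq_iff)
      then show ?case
        using Cons by (simp add: star_zero_left)
    qed simp
    from this[OF Cons.prems] show ?thesis
      by (simp add: one_cochain_def list.case_eq_if if_distrib cong: if_cong)
  qed
  ultimately show ?case
    using Cons by (simp add: star_minus_left)
qed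

text \<open>An operator on values commutes with the bracket terms of the differential, so only its
  commutator \<open>T\<close> with the action on values contributes, once for each argument.\<close>

lemma ced_operator:
  assumes lieB: "\<And>Z. additive (lieB Z)"
    and H: "\<And>x y. x \<in> H \<Longrightarrow> y \<in> H \<Longrightarrow> x - y \<in> H" "\<And>Z x. x \<in> H \<Longrightarrow> lieA Z x \<in> H" "0 \<in> H"
    and Op: "\<And>x y. x \<in> H \<Longrightarrow> y \<in> H \<Longrightarrow> Op (x - y) = Op x - Op y"
      "\<And>Z x. x \<in> H \<Longrightarrow> lieB Z (Op x) = Op (lieA Z x) + T Z x"
    and c: "\<And>Xs. c Xs \<in> H"
  shows "ced br lieB (\<lambda>Xs. Op (c Xs)) Ys = Op (ced br lieA c Ys) + one_star T c Ys"
  using c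
proof (induction Ys arbitrary: c)
  case Nil
  have "Op 0 = 0"
    using Op(1)[OF H(3) H(3)] by simp
  then show ?case by simp
next
  case (Cons Z Ys)
  have lin: "lie_der (br Z) (lieA Z) c Ys \<in> H" "ced br lieA c Ys \<in> H" if "\<And>Xs. c Xs \<in> H" for c Ys
    using that H by (auto intro!: lie_der_in ced_in)
  have "lie_der (br Z) (lieB Z) (\<lambda>Xs. Op (c Xs)) Ys = Op (lie_der (br Z) (lieA Z) c Ys) + T Z (c Ys)"
    if "\<And>Xs. c Xs \<in> H" for c
    using that by (induction Ys arbitrary: c) (simp_all add: Op lin)
  from this[OF Cons.prems] show ?case
    using Cons by (simp add: Op lin)
qed

section \<open>Products of cochains as sums over permutations\<close>

context pairing
begin

lemma star_cong:
  assumes "\<And>Xs. length Xs \<le> length Ys \<Longrightarrow> \<phi> Xs = \<psi> Xs" "\<And>Xs. length Xs \<le> length Ys \<Longrightarrow> c Xs = d Xs"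
  shows "star P \<phi> c Ys = star P \<psi> d Ys"
  using assms
proof (induction Ys arbitrary: \<phi> \<psi> c d)
  case (Cons Y Ys)
  have "star P (\<lambda>Xs. \<phi> (Y # Xs)) c Ys = star P (\<lambda>Xs. \<psi> (Y # Xs)) d Ys"
    "star P (bar \<phi>) (\<lambda>Xs. c (Y # Xs)) Ys = star P (bar \<psi>) (\<lambda>Xs. d (Y # Xs)) Ys"
    by (rule Cons.IH; use Cons.prems in \<open>simp add: bar_def\<close>)+
  then show ?case by simp
qed simp

text \<open>The degrees of the two factors add up to the length of the argument list.\<close>

lemma star_bar_right:
  assumes "\<And>Xs. c Xs \<in> B"
  shows "star P \<phi> (bar c) Ys = alt_sign (length Ys) (star P (bar \<phi>) c Ys)"
  using assms
proof (induction Ys arbitrary: \<phi> c)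
  case (Cons Y Ys)
  have "star P \<phi> (\<lambda>Xs. bar c (Y # Xs)) Ys = - alt_sign (length Ys) (star P (bar \<phi>) (\<lambda>Xs. c (Y # Xs)) Ys)" for \<phi>
    by (simp add: bar_Cons star_minus_right Cons)
  moreover have "star P (\<lambda>Xs. bar \<phi> (Y # Xs)) c Ys = - star P (bar (\<lambda>Xs. \<phi> (Y # Xs))) c Ys"
    by (simp add: bar_Cons star_minus_left Cons.prems)
  ultimately show ?case
    by (simp add: Cons.IH[OF Cons.prems] alt_sign_linear)
qed (simp add: bar_def)

lemma star_bar_left_degree:
  assumes "\<And>Xs. c Xs \<in> B" "\<And>Xs. length Xs \<noteq> i \<Longrightarrow> \<phi> Xs = 0"
  shows "star P (bar \<phi>) c Ys = alt_sign i (star P \<phi> c Ys)"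
proof -
  have "bar \<phi> = (\<lambda>Xs. alt_sign i (\<phi> Xs))"
    using assms(2) unfolding bar_def fun_eq_iff by (metis alt_sign_simps(3))
  then show ?thesis
    by (simp add: alt_sign_def star_minus_left assms(1))
qed

text \<open>To reach the end of the arguments of \<phi>, the last argument passes those of c; this
  is the sign in \<open>bar c\<close>.\<close>

lemma star_snoc:
  assumes "\<And>Xs. c Xs \<in> B"
  shows "star P \<phi> c (Ys @ [Y]) = star P \<phi> (\<lambda>Xs. c (Xs @ [Y])) Ys + star P (\<lambda>Xs. \<phi> (Xs @ [Y])) (bar c) Ys"
  using assms
proof (induction Ys arbitrary: \<phi> c)
  case (Cons Z Ys)
  have "(\<lambda>Xs. bar \<phi> (Xs @ [Y])) = (\<lambda>Xs. - bar (\<lambda>Xs. \<phi> (Xs @ [Y])) Xs)"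
    by (simp add: bar_def fun_eq_iff)
  moreover have "bar (\<lambda>Xs. c (Z # Xs)) = (\<lambda>Xs. - bar c (Z # Xs))"
    by (simp add: bar_def fun_eq_iff)
  moreover have "bar c Xs \<in> B" for Xs
    using Cons.prems B_diff[OF B_zero, of "c Xs"] by (simp add: bar_def alt_sign_def)
  ultimately show ?case
    by (simp add: Cons star_minus_left star_minus_right)
qed simp

end

text \<open>Composing a permutation \<tau> of {..<n} with this cycle inserts the value n at position
  m into the list \<tau>(0), ..., \<tau>(n-1).\<close>

definition insert_cycle :: "nat \<Rightarrow> nat \<Rightarrow> nat \<Rightarrow> nat" where
  "insert_cycle n m t = (if t = m then n else if m < t \<and> t \<le> n then t - 1 else t)"

lemma insert_cycle_permutes:
  assumes "m \<le> n"
  shows "insert_cycle n m permutes {..<Suc n} \<and> sign (insert_cycle n m) = alt_sign (n - m) 1"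
  using assms
proof (induction m rule: inc_induct)
  case base
  have "insert_cycle n n = id"
    by (auto simp: insert_cycle_def)
  then show ?case by (simp add: permutes_id[unfolded id_def] id_def)
next
  case (step m)
  have eq: "insert_cycle n m = insert_cycle n (Suc m) \<circ> transpose m (Suc m)"
    using step.hyps by (auto simp: insert_cycle_def transpose_def fun_eq_iff)
  have tr: "transpose m (Suc m) permutes {..<Suc n}"
    using step.hyps by (intro permutes_swap_id) auto
  then have "insert_cycle n m permutes {..<Suc n}"
    unfolding eq using step.IH by (intro permutes_compose) auto
  moreover have "sign (insert_cycle n m) = - alt_sign (n - Suc m) 1"
    unfolding eq using step.IH tr
    by (subst sign_compose) (auto simp: sign_swap_id permutation_permutes)
  moreover have "n - m = Suc (n - Suc m)"
    using step.hyps by simp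
  ultimately show ?case by simp
qed

text \<open>The position m is recovered as the preimage of n. Surjectivity is a count: (n + 1) times
  n! is (n + 1)!.\<close>

lemma bij_betw_insert_cycle:
  "bij_betw (\<lambda>(m, \<tau>). \<tau> \<circ> insert_cycle n m) ({..n} \<times> {\<tau>. \<tau> permutes {..<n}}) {\<sigma>. \<sigma> permutes {..<Suc n}}"
proof -
  let ?f = "\<lambda>(m, \<tau>). \<tau> \<circ> insert_cycle n m" and ?S = "{..n} \<times> {\<tau>. \<tau> permutes {..<n}}"
  have inj: "inj_on ?f ?S"
  proof (rule inj_onI, clarify)
    fix m \<tau> m' \<tau>'
    assume m: "m \<le> n" "m' \<le> n" and p: "\<tau> permutes {..<n}" "\<tau>' permutes {..<n}"
      and eq: "\<tau> \<circ> insert_cycle n m = \<tau>' \<circ> insert_cycle n m'"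
    have "\<tau>' (insert_cycle n m' m) = \<tau> n"
      using fun_cong[OF eq, of m] by (simp add: insert_cycle_def)
    also have "\<dots> = \<tau>' n"
      using p by (simp add: permutes_def)
    finally have "insert_cycle n m' m = n"
      using permutes_inj[OF p(2)] by (simp add: inj_eq)
    then have "m = m'"
      using m by (auto simp: insert_cycle_def split: if_splits)
    moreover have "\<tau> = \<tau>'" if "m = m'"
    proof -
      have surj: "surj (insert_cycle n m)"
        using insert_cycle_permutes[OF m(1)] permutes_surj by blast
      show ?thesis
      proof
        fix x
        obtain y where "x = insert_cycle n m y"
          using surj by (auto simp: surj_def)
        then show "\<tau> x = \<tau>' x"
          using fun_cong[OF eq, of y] that by simp
      qed
    qed
    ultimately show "m = m' \<and> \<tau> = \<tau>'" by blast
  qed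
  have "?f ` ?S \<subseteq> {\<sigma>. \<sigma> permutes {..<Suc n}}"
  proof clarify
    fix m \<tau> assume "m \<le> n" "\<tau> permutes {..<n}"
    moreover from this have "\<tau> permutes {..<Suc n}"
      using permutes_subset by fastforce
    ultimately show "\<tau> \<circ> insert_cycle n m permutes {..<Suc n}"
      using insert_cycle_permutes permutes_compose by blast
  qed
  moreover have "card (?f ` ?S) = card {\<sigma>. \<sigma> permutes {..<Suc n}}"
    using card_image[OF inj] by (simp add: card_permutations card_cartesian_product)
  ultimately have "?f ` ?S = {\<sigma>. \<sigma> permutes {..<Suc n}}"
    by (intro card_subset_eq) (simp_all add: finite_permutations)
  with inj show ?thesis
    by (simp add: bij_betw_def)
qed

definition antisymmetrization ::
    "('k::field \<Rightarrow> 'm \<Rightarrow> 'm) \<Rightarrow> nat \<Rightarrow> ('x list \<Rightarrow> 'm::ab_group_add) \<Rightarrow> 'x list \<Rightarrow> 'm" where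
  "antisymmetrization sc n f Ys =
     (\<Sum>\<sigma> | \<sigma> permutes {..<n}. sc (of_int (sign \<sigma>)) (f (map (\<lambda>t. Ys ! \<sigma> t) [0..<n])))"

text \<open>Sorts the permutations by the position m at which the last entry ends up.\<close>

lemma antisymmetrization_snoc:
  assumes "vector_space sc" and n: "length Ys = n"
  shows "antisymmetrization sc (Suc n) f (Ys @ [Y]) =
    (\<Sum>m\<le>n. alt_sign (n - m) (antisymmetrization sc n (\<lambda>Zs. f (take m Zs @ Y # drop m Zs)) Ys))"
proof -
  interpret vector_space sc by fact
  have sc_alt: "sc (of_int (alt_sign j 1)) x = alt_sign j x" for j x
    by (simp add: alt_sign_def)
  have term_eq: "sc (of_int (sign (\<tau> \<circ> insert_cycle n m)))
      (f (map (\<lambda>t. (Ys @ [Y]) ! (\<tau> \<circ> insert_cycle n m) t) [0..<Suc n])) =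
    alt_sign (n - m) (sc (of_int (sign \<tau>))
      (f (take m (map (\<lambda>t. Ys ! \<tau> t) [0..<n]) @ Y # drop m (map (\<lambda>t. Ys ! \<tau> t) [0..<n]))))"
    if m: "m \<le> n" and p: "\<tau> permutes {..<n}" for m \<tau>
  proof -
    have lt: "\<tau> t < n" if "t < n" for t
      using permutes_in_image[OF p, of t] that by simp
    have [simp]: "\<tau> n = n"
      using p by (simp add: permutes_def)
    have "map (\<lambda>t. (Ys @ [Y]) ! (\<tau> \<circ> insert_cycle n m) t) [0..<Suc n] =
        take m (map (\<lambda>t. Ys ! \<tau> t) [0..<n]) @ Y # drop m (map (\<lambda>t. Ys ! \<tau> t) [0..<n])"
    proof (rule nth_equalityI)
      fix i assume "i < length (map (\<lambda>t. (Ys @ [Y]) ! (\<tau> \<circ> insert_cycle n m) t) [0..<Suc n])"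
      then have i: "i < Suc n" by simp
      consider "i < m" | "i = m" | j where "i = Suc j" "m \<le> j" "j < n"
        using i by (cases i) (auto simp: not_less le_Suc_eq, metis not_less_eq nat_neq_iff less_Suc_eq_le)
      then show "map (\<lambda>t. (Ys @ [Y]) ! (\<tau> \<circ> insert_cycle n m) t) [0..<Suc n] ! i =
          (take m (map (\<lambda>t. Ys ! \<tau> t) [0..<n]) @ Y # drop m (map (\<lambda>t. Ys ! \<tau> t) [0..<n])) ! i"
        using i m n lt
        by cases (auto simp: insert_cycle_def nth_append nth_Cons Suc_diff_le simp del: upt_Suc)
    qed (use m in simp)
    moreover have "sign (\<tau> \<circ> insert_cycle n m) = sign \<tau> * alt_sign (n - m) 1"
      using insert_cycle_permutes[OF m] p
      by (subst sign_compose) (auto simp: permutation_permutes)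
    moreover have "sc (of_int (sign \<tau> * alt_sign (n - m) 1)) x = alt_sign (n - m) (sc (of_int (sign \<tau>)) x)" for x
      by (simp add: alt_sign_def)
    ultimately show ?thesis by simp
  qed
  have "antisymmetrization sc (Suc n) f (Ys @ [Y]) =
    (\<Sum>(m, \<tau>)\<in>{..n} \<times> {\<tau>. \<tau> permutes {..<n}}. sc (of_int (sign (\<tau> \<circ> insert_cycle n m)))
      (f (map (\<lambda>t. (Ys @ [Y]) ! (\<tau> \<circ> insert_cycle n m) t) [0..<Suc n])))"
    unfolding antisymmetrization_def
    by (subst sum.reindex_bij_betw[OF bij_betw_insert_cycle, symmetric]) (simp add: case_prod_unfold)
  also have "\<dots> = (\<Sum>(m, \<tau>)\<in>{..n} \<times> {\<tau>. \<tau> permutes {..<n}}. alt_sign (n - m) (sc (of_int (sign \<tau>))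
      (f (take m (map (\<lambda>t. Ys ! \<tau> t) [0..<n]) @ Y # drop m (map (\<lambda>t. Ys ! \<tau> t) [0..<n])))))"
    by (intro sum.cong refl) (clarify, rule term_eq, auto)
  finally show ?thesis
    by (simp add: antisymmetrization_def alt_sign_sum sum.cartesian_product)
qed

lemma multiadditive_snoc: "multiadditive \<phi> \<Longrightarrow> multiadditive (\<lambda>Xs. \<phi> (Xs @ [Z]))"
  unfolding multiadditive_def by simp

lemma alternating_snoc: "alternating \<phi> \<Longrightarrow> alternating (\<lambda>Xs. \<phi> (Xs @ [Z]))"
  unfolding alternating_def by simp

text \<open>The last argument Y falls into one of the k places of c or one of the i places of
  \<phi>; by alternation all places of a block contribute equally once Y is moved to its end. The
  factors k and i build up k! i!, and the two kinds of terms are those of \<open>star_snoc\<close>.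
  The sign (-1)^(k i) arises because c takes the first block here, whereas \<phi> comes first in
  \<open>star\<close>.\<close>

lemma (in pairing) antisymmetrization_eq_star:
  fixes \<phi> :: "'x::plus list \<Rightarrow> 'a"
  assumes "vector_space (sc :: 'k::field_char_0 \<Rightarrow> 'm \<Rightarrow> 'm)"
    and "\<And>Xs. c Xs \<in> B" "multiadditive c" "alternating c" "multiadditive \<phi>" "alternating \<phi>"
    and "\<And>Xs. length Xs \<noteq> i \<Longrightarrow> \<phi> Xs = 0" "length Ys = k + i"
  shows "antisymmetrization sc (k + i) (\<lambda>Zs. P (\<phi> (drop k Zs)) (c (take k Zs))) Ys =
    alt_sign (k * i) (sc (fact k * fact i) (star P \<phi> c Ys))"
  using assms(2-)
proof (induction Ys arbitrary: k i \<phi> c rule: rev_induct)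
  interpret vector_space sc by fact
  case Nil
  have "{\<sigma>. \<sigma> permutes ({}::nat set)} = {id}"
    by auto
  then show ?case
    using Nil by (simp add: antisymmetrization_def)
next
  interpret vector_space sc by fact
  case (snoc Y Ys)
  note prems = snoc.prems
  define n where "n = length Ys"
  have n: "k + i = Suc n"
    using prems(7) by (simp add: n_def)
  let ?f = "\<lambda>Zs. P (\<phi> (drop k Zs)) (c (take k Zs))"
  let ?A1 = "antisymmetrization sc n (\<lambda>Zs. P (\<phi> (drop (k - 1) Zs)) (c (take (k - 1) Zs @ [Y]))) Ys"
  let ?A2 = "antisymmetrization sc n (\<lambda>Zs. P (\<phi> (drop k Zs @ [Y])) (c (take k Zs))) Ys"
  let ?s1 = "star P \<phi> (\<lambda>Xs. c (Xs @ [Y])) Ys" and ?s2 = "star P (\<lambda>Xs. \<phi> (Xs @ [Y])) c Ys"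
  have P_alt: "P (alt_sign j x) y = alt_sign j (P x y)" "P x (alt_sign j y) = alt_sign j (P x y)"
    if "y \<in> B" for j x y
    using that by (simp_all add: alt_sign_def P_left_simps P_right_simps)
  have anti_cong: "antisymmetrization sc n f Ys = antisymmetrization sc n g Ys"
    if "\<And>Zs. length Zs = n \<Longrightarrow> f Zs = g Zs" for f g
    unfolding antisymmetrization_def by (intro sum.cong refl) (simp add: that)
  have anti_alt: "antisymmetrization sc n (\<lambda>Zs. alt_sign j (f Zs)) Ys = alt_sign j (antisymmetrization sc n f Ys)"
    for j f
    by (auto simp: antisymmetrization_def alt_sign_def sum_negf)
  have low: "antisymmetrization sc n (\<lambda>Zs. ?f (take m Zs @ Y # drop m Zs)) Ys = alt_sign (k - 1 - m) ?A1"
    if "m < k" for m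
    unfolding anti_alt[symmetric]
  proof (rule anti_cong)
    fix Zs :: "'x list" assume Zs: "length Zs = n"
    have kn: "k - 1 \<le> n" using n by simp
    obtain k' where k': "k = Suc k'" "m \<le> k'"
      using \<open>m < k\<close> by (cases k) auto
    have "take k (take m Zs @ Y # drop m Zs) = take m Zs @ Y # take (k' - m) (drop m Zs)"
      using Zs that kn k' by (simp add: min_def Suc_diff_le)
    moreover have "drop k (take m Zs @ Y # drop m Zs) = drop k' Zs"
      using Zs that kn k' by (simp add: min_def Suc_diff_le)
    moreover have "c (take m Zs @ Y # take (k' - m) (drop m Zs)) =
        alt_sign (k' - m) (c (take m Zs @ take (k' - m) (drop m Zs) @ [Y]))"
      using alternating_Cons_snoc[OF prems(2,3), of "take m Zs" Y "take (k' - m) (drop m Zs)"] Zs kn k'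
      by simp
    moreover have "take m Zs @ take (k' - m) (drop m Zs) = take k' Zs"
      using k' take_add[of m "k' - m" Zs] by simp
    ultimately show "?f (take m Zs @ Y # drop m Zs) =
        alt_sign (k - 1 - m) (P (\<phi> (drop (k - 1) Zs)) (c (take (k - 1) Zs @ [Y])))"
      using k' by (simp add: P_alt prems(1) flip: append_assoc)
  qed
  have high: "antisymmetrization sc n (\<lambda>Zs. ?f (take m Zs @ Y # drop m Zs)) Ys = alt_sign (n - m) ?A2"
    if "k \<le> m" "m \<le> n" for m
    unfolding anti_alt[symmetric]
  proof (rule anti_cong)
    fix Zs :: "'x list" assume Zs: "length Zs = n"
    have "take k (take m Zs @ Y # drop m Zs) = take k Zs"
      using Zs that by (simp add: min_def)
    moreover have "drop k (take m Zs @ Y # drop m Zs) = take (m - k) (drop k Zs) @ Y # drop m Zs"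
      using Zs that by (simp add: min_def drop_take)
    moreover have "\<phi> (take (m - k) (drop k Zs) @ Y # drop m Zs) =
        alt_sign (n - m) (\<phi> (take (m - k) (drop k Zs) @ drop m Zs @ [Y]))"
      using alternating_Cons_snoc[OF prems(4,5), of "take (m - k) (drop k Zs)" Y "drop m Zs"] Zs that
      by simp
    moreover have "take (m - k) (drop k Zs) @ drop m Zs = drop k Zs"
      using append_take_drop_id[of "m - k" "drop k Zs"] that by simp
    ultimately show "?f (take m Zs @ Y # drop m Zs) = alt_sign (n - m) (P (\<phi> (drop k Zs @ [Y])) (c (take k Zs)))"
      by (simp add: P_alt prems(1) flip: append_assoc)
  qed
  have split: "{..n} = {..<k} \<union> {k..n}" "{..<k} \<inter> {k..n} = {}"
    using n by auto
  have "antisymmetrization sc (k + i) ?f (Ys @ [Y]) =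
      (\<Sum>m\<le>n. alt_sign (n - m) (antisymmetrization sc n (\<lambda>Zs. ?f (take m Zs @ Y # drop m Zs)) Ys))"
    unfolding n by (rule antisymmetrization_snoc) (simp_all add: assms(1) n_def)
  also have "\<dots> = (\<Sum>m<k. alt_sign (n - m) (alt_sign (k - 1 - m) ?A1)) + (\<Sum>m=k..n. alt_sign (n - m) (alt_sign (n - m) ?A2))"
    unfolding split(1)
    by (subst sum.union_disjoint)
      (use n in \<open>auto simp only: split low high lessThan_iff atLeastAtMost_iff
        intro!: arg_cong2[where f = plus] sum.cong\<close>)
  \<comment> \<open>The sign of the insertion and the sign of moving Y to the end of the block of c
    multiply to (-1)^i, whatever m is.\<close>
  also have "(\<Sum>m<k. alt_sign (n - m) (alt_sign (k - 1 - m) ?A1)) = (\<Sum>m<k. alt_sign i ?A1)"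
  proof (intro sum.cong refl)
    fix m assume "m \<in> {..<k}"
    then have "n - m + (k - 1 - m) = i + 2 * (k - 1 - m)"
      using n by auto
    then show "alt_sign (n - m) (alt_sign (k - 1 - m) ?A1) = alt_sign i ?A1"
      by (simp only: alt_sign_alt_sign) (simp add: alt_sign_def)
  qed
  also have "\<dots> = sc (of_nat k) (alt_sign i ?A1)"
    using sum_constant_scale[of "alt_sign i ?A1" "{..<k}"] by simp
  also have "(\<Sum>m=k..n. alt_sign (n - m) (alt_sign (n - m) ?A2)) = (\<Sum>m=k..n. ?A2)"
    by (intro sum.cong refl) (simp add: alt_sign_def)
  also have "\<dots> = sc (of_nat i) ?A2"
  proof -
    have "card {k..n} = i" using n by simp
    then show ?thesis
      using sum_constant_scale[of ?A2 "{k..n}"] by simp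
  qed
  also have "sc (of_nat k) (alt_sign i ?A1) = alt_sign (k * i) (sc (fact k * fact i) ?s1)"
  proof (cases k)
    case 0
    \<comment> \<open>For k = 0 the list \<open>Ys\<close> has length i - 1, too short for \<phi> to
      be nonzero on any part of it.\<close>
    have "?s1 = star P (\<lambda>Xs. 0) (\<lambda>Xs. c (Xs @ [Y])) Ys"
      by (rule star_cong) (use prems(6) n 0 n_def in auto)
    then show ?thesis
      using 0 prems(1) by (simp add: star_zero_left)
  next
    case (Suc k')
    have "antisymmetrization sc (k' + i) (\<lambda>Zs. P (\<phi> (drop k' Zs)) (c (take k' Zs @ [Y]))) Ys =
        alt_sign (k' * i) (sc (fact k' * fact i) ?s1)"
      by (rule snoc.IH) (use prems n Suc n_def multiadditive_snoc alternating_snoc in auto)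
    then have "?A1 = alt_sign (k' * i) (sc (fact k' * fact i) ?s1)"
      using n Suc by simp
    then show ?thesis
      using Suc by (simp add: alt_sign_def scale_scale mult_ac)
  qed
  also have "sc (of_nat i) ?A2 = alt_sign (k * i) (sc (fact k * fact i) (alt_sign k ?s2))"
  proof (cases i)
    case 0
    have "(\<lambda>Xs. \<phi> (Xs @ [Y])) = (\<lambda>_. 0)"
      using prems(6) 0 by auto
    then show ?thesis
      using 0 prems(1) by (simp add: star_zero_left)
  next
    case (Suc i')
    have "antisymmetrization sc (k + i') (\<lambda>Zs. P (\<phi> (drop k Zs @ [Y])) (c (take k Zs))) Ys =
        alt_sign (k * i') (sc (fact k * fact i') ?s2)"
      by (rule snoc.IH) (use prems n Suc n_def multiadditive_snoc alternating_snoc in auto)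
    then have "?A2 = alt_sign (k * i') (sc (fact k * fact i') ?s2)"
      using n Suc by simp
    then show ?thesis
      using Suc by (simp add: alt_sign_def scale_scale mult_ac)
  qed
  also have "alt_sign k ?s2 = star P (\<lambda>Xs. \<phi> (Xs @ [Y])) (bar c) Ys"
  proof (cases i)
    case 0
    have "(\<lambda>Xs. \<phi> (Xs @ [Y])) = (\<lambda>_. 0)"
      using prems(6) 0 by auto
    moreover have "bar c Xs \<in> B" for Xs
      using prems(1) B_diff[OF B_zero, of "c Xs"] by (simp add: bar_def alt_sign_def)
    ultimately show ?thesis
      using prems(1) by (simp add: star_zero_left)
  next
    case (Suc i')
    have "star P (bar (\<lambda>Xs. \<phi> (Xs @ [Y]))) c Ys = alt_sign i' ?s2"
      by (rule star_bar_left_degree) (use prems Suc in auto)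
    then show ?thesis
      using Suc n by (auto simp: star_bar_right prems(1) n_def[symmetric] intro!: alt_sign_cong)
  qed
  also have "alt_sign (k * i) (sc (fact k * fact i) ?s1) +
      alt_sign (k * i) (sc (fact k * fact i) (star P (\<lambda>Xs. \<phi> (Xs @ [Y])) (bar c) Ys)) =
      alt_sign (k * i) (sc (fact k * fact i) (star P \<phi> c (Ys @ [Y])))"
    by (simp add: star_snoc prems(1) scale_right_distrib alt_sign_linear)
  finally show ?case .
qed

section \<open>Additive maps out of a presented module\<close>

text \<open>Here \<phi> is meant to be additive in the coefficient, not linear: derivations over
  \<rho>(X), which do not commute with scalars, are to be extended from generators as well.\<close>

definition formal_eval :: "('a::zero \<Rightarrow> 'g \<Rightarrow> 'm::comm_monoid_add) \<Rightarrow> ('g \<Rightarrow>\<^sub>0 'a) \<Rightarrow> 'm" where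
  "formal_eval \<phi> f = (\<Sum>g\<in>Poly_Mapping.keys f. \<phi> (Poly_Mapping.lookup f g) g)"

lemma formal_eval_superset:
  assumes "finite K" "Poly_Mapping.keys f \<subseteq> K" "\<And>g. \<phi> 0 g = 0"
  shows "formal_eval \<phi> f = (\<Sum>g\<in>K. \<phi> (Poly_Mapping.lookup f g) g)"
  unfolding formal_eval_def
  by (rule sum.mono_neutral_left) (use assms in \<open>auto simp: in_keys_iff\<close>)

lemma formal_eval_add:
  fixes \<phi> :: "'a::ab_group_add \<Rightarrow> 'g \<Rightarrow> 'm::ab_group_add"
  assumes "\<And>g. additive (\<lambda>a. \<phi> a g)"
  shows "formal_eval \<phi> (f + f') = formal_eval \<phi> f + formal_eval \<phi> f'"
proof -
  let ?K = "Poly_Mapping.keys f \<union> Poly_Mapping.keys f'"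
  have "\<phi> 0 g = 0" for g
    using additive.zero[OF assms] .
  then show ?thesis
    by (simp add: formal_eval_superset[of ?K] keys_add lookup_add additive.add[OF assms] sum.distrib)
qed

lemma formal_eval_single: "\<phi> 0 g = 0 \<Longrightarrow> formal_eval \<phi> (Poly_Mapping.single g c) = \<phi> c g"
  by (simp add: formal_eval_def)

lemma formal_eval_formal:
  fixes \<phi> :: "'a::comm_ring_1 \<Rightarrow> 'g \<Rightarrow> 'm::ab_group_add"
  assumes "\<And>g. additive (\<lambda>a. \<phi> a g)"
  shows "formal_eval \<phi> (formal ts) = (\<Sum>(c, g)\<leftarrow>ts. \<phi> c g)"
proof (induction ts)
  case Nil
  then show ?case by (simp add: formal_def formal_eval_def)
next
  case (Cons t ts)
  obtain c g where "t = (c, g)" by fastforce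
  then show ?case
    using Cons
    by (simp add: formal_def formal_eval_add[OF assms] formal_eval_single additive.zero[OF assms])
qed

lemma lookup_free_scale: "Poly_Mapping.lookup (free_scale a f) g = a * Poly_Mapping.lookup f g"
  by (simp add: free_scale_def Poly_Mapping.map.rep_eq when_def)

lemma module_free_scale: "module (free_scale :: 'a::comm_ring_1 \<Rightarrow> ('g \<Rightarrow>\<^sub>0 'a) \<Rightarrow> _)"
  by unfold_locales (rule poly_mapping_eqI; simp add: lookup_free_scale lookup_add algebra_simps)+

lemma free_scale_formal:
  fixes a :: "'a::comm_ring_1" and ts :: "('a \<times> 'b) list"
  shows "free_scale a (formal ts) = formal (map (\<lambda>(c, g). (a * c, g)) ts)"
proof -
  interpret module "free_scale :: 'a \<Rightarrow> ('b \<Rightarrow>\<^sub>0 'a) \<Rightarrow> _" by (rule module_free_scale)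
  have "free_scale a (Poly_Mapping.single g c) = Poly_Mapping.single g (a * c)" for c and g :: 'b
    by (rule poly_mapping_eqI) (simp add: lookup_free_scale lookup_single when_def)
  then show ?thesis
    by (induction ts) (auto simp: formal_def scale_right_distrib)
qed

lemma linear_extension_eq: "linear_extension sc ev = formal_eval (\<lambda>a g. sc a (ev g))"
  by (simp add: fun_eq_iff linear_extension_def formal_eval_def)

lemma module_additive: "module sc \<Longrightarrow> additive (sc a)" "module sc \<Longrightarrow> additive (\<lambda>a. sc a x)"
  by (simp_all add: additive_def module.scale_right_distrib module.scale_left_distrib)

lemma presented_module_relation:
  assumes "presented_module sc G Rel ev" "formal ts \<in> Rel" "snd ` set ts \<subseteq> G"
  shows "(\<Sum>(c, g)\<leftarrow>ts. sc c (ev g)) = 0"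
proof -
  interpret module "free_scale :: 'a \<Rightarrow> ('c \<Rightarrow>\<^sub>0 'a) \<Rightarrow> _" by (rule module_free_scale)
  have m: "module sc"
    using assms(1) by (simp add: presented_module_def)
  have "Poly_Mapping.keys (formal ts) \<subseteq> snd ` set ts"
  proof (induction ts)
    case (Cons t ts)
    then show ?case
      using keys_add[of "Poly_Mapping.single (snd t) (fst t)" "formal ts"]
      by (auto simp: formal_def case_prod_unfold split: if_splits)
  qed (simp add: formal_def)
  then have "linear_extension sc ev (formal ts) = 0"
    using assms span_base by (simp add: presented_module_def)
  then show ?thesis
    unfolding linear_extension_eq by (subst (asm) formal_eval_formal) (rule module_additive(2)[OF m])
qed

lemma presented_module_induct:
  assumes "presented_module sc G Rel ev"
    and "P 0" "\<And>x y. P x \<Longrightarrow> P y \<Longrightarrow> P (x + y)" "\<And>a g. g \<in> G \<Longrightarrow> P (sc a (ev g))"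
  shows "P m"
proof -
  obtain f where f: "Poly_Mapping.keys f \<subseteq> G" "m = linear_extension sc ev f"
    using assms(1) unfolding presented_module_def by metis
  have "P (\<Sum>g\<in>K. sc (Poly_Mapping.lookup f g) (ev g))" if "finite K" "K \<subseteq> G" for K
    using that by (induction K rule: finite_induct) (auto intro: assms)
  then show ?thesis
    using f by (simp add: linear_extension_def)
qed

text \<open>For an additive \<phi>, the condition must be imposed on all multiples of each relation:
  the combinations all of whose multiples evaluate to 0 form a submodule, which therefore contains
  the span of the relations.\<close>

lemma presented_module_extension:
  fixes \<phi> :: "'a::comm_ring_1 \<Rightarrow> 'g \<Rightarrow> 'n::ab_group_add"
  assumes pm: "presented_module sc G Rel ev" and add: "\<And>g. additive (\<lambda>a. \<phi> a g)"
    and rel: "\<And>f a. f \<in> Rel \<Longrightarrow> formal_eval \<phi> (free_scale a f) = 0"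
  obtains h where "additive h" "\<And>a g. g \<in> G \<Longrightarrow> h (sc a (ev g)) = \<phi> a g"
proof -
  interpret F: module "free_scale :: 'a \<Rightarrow> ('g \<Rightarrow>\<^sub>0 'a) \<Rightarrow> _" by (rule module_free_scale)
  have m: "module sc"
    using pm by (simp add: presented_module_def)
  let ?l = "linear_extension sc ev"
  have add_l: "?l (f + f') = ?l f + ?l f'" for f f'
    unfolding linear_extension_eq by (rule formal_eval_add) (rule module_additive(2)[OF m])
  have add_e: "formal_eval \<phi> (f + f') = formal_eval \<phi> f + formal_eval \<phi> f'" for f f'
    by (rule formal_eval_add) (rule add)
  have zero_e: "formal_eval \<phi> 0 = 0"
    by (simp add: formal_eval_def)
  have "F.span Rel \<subseteq> {f. \<forall>a. formal_eval \<phi> (free_scale a f) = 0}"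
    by (rule F.span_minimal)
      (auto simp: F.subspace_def F.scale_right_distrib add_e rel zero_e)
  then have span: "formal_eval \<phi> f = 0" if "f \<in> F.span Rel" for f
    using that F.scale_one[of f] by (metis (mono_tags, lifting) mem_Collect_eq subsetD)
  have wd: "formal_eval \<phi> f = formal_eval \<phi> f'"
    if k: "Poly_Mapping.keys f \<subseteq> G" "Poly_Mapping.keys f' \<subseteq> G" and eq: "?l f = ?l f'" for f f'
  proof -
    have "Poly_Mapping.keys (f - f') \<subseteq> G"
      using k keys_diff[of f f'] by (meson Un_least subset_trans)
    moreover have "?l (f - f') = 0"
      using add_l[of "f - f'" f'] eq by simp
    ultimately have "f - f' \<in> F.span Rel"
      using pm by (simp add: presented_module_def)
    then have "formal_eval \<phi> (f - f') = 0" by (rule span)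
    then show ?thesis
      using add_e[of "f - f'" f'] by simp
  qed
  define rep where "rep m = (SOME f. Poly_Mapping.keys f \<subseteq> G \<and> ?l f = m)" for m
  have "\<exists>f. Poly_Mapping.keys f \<subseteq> G \<and> ?l f = m" for m
    using pm by (simp add: presented_module_def)
  from someI_ex[OF this] have rep: "Poly_Mapping.keys (rep m) \<subseteq> G" "?l (rep m) = m" for m
    by (auto simp: rep_def)
  show ?thesis
  proof
    show "additive (\<lambda>m. formal_eval \<phi> (rep m))"
    proof
      fix x y
      have "Poly_Mapping.keys (rep x + rep y) \<subseteq> G"
        using rep(1)[of x] rep(1)[of y] keys_add[of "rep x" "rep y"] by (meson Un_least subset_trans)
      then have "formal_eval \<phi> (rep (x + y)) = formal_eval \<phi> (rep x + rep y)"
        by (intro wd) (simp_all add: rep add_l)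
      then show "formal_eval \<phi> (rep (x + y)) = formal_eval \<phi> (rep x) + formal_eval \<phi> (rep y)"
        by (simp add: add_e)
    qed
  next
    fix a g assume "g \<in> G"
    moreover have "?l (Poly_Mapping.single g a) = sc a (ev g)"
      by (simp add: linear_extension_eq formal_eval_single module.scale_zero_left[OF m])
    ultimately have "formal_eval \<phi> (rep (sc a (ev g))) = formal_eval \<phi> (Poly_Mapping.single g a)"
      by (intro wd) (simp_all add: rep)
    then show "formal_eval \<phi> (rep (sc a (ev g))) = \<phi> a g"
      by (simp add: formal_eval_single additive.zero[OF add])
  qed
qed

section \<open>The Hochschild complex\<close>

context lie_rinehart
begin

sublocale R: vector_space "scR A" by (rule R_vector_space)
sublocale L: vector_space "scL A" by (rule L_vector_space)
sublocale LR: module "act A" by (rule L_module)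

lemma anc_linear: "anc A X (a + b) = anc A X a + anc A X b" "anc A X (scR A c a) = scR A c (anc A X a)"
    "anc A X (a * b) = anc A X a * b + a * anc A X b"
  using anc_Der[of X] by (simp_all add: Der_def Vector_Spaces.linear_iff)

lemma additive_anc: "additive (anc A X)"
  by (simp add: additive_def anc_linear)

lemma brk_add: "brk A (X + Y) Z = brk A X Z + brk A Y Z" "brk A X (Y + Z) = brk A X Y + brk A X Z"
  and brk_scale: "brk A (scL A c X) Y = scL A c (brk A X Y)" "brk A X (scL A c Y) = scL A c (brk A X Y)"
  using brk_linear_left[of Y] brk_linear_left[of Z] brk_linear_right[of X]
  by (simp_all add: Vector_Spaces.linear_iff)

lemma additive_brk: "additive (brk A X)" "additive (\<lambda>X. brk A X Y)"
  by (simp_all add: additive_def brk_add)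

lemma brk_anti: "brk A Y X = - brk A X Y"
proof -
  have "brk A (X + Y) (X + Y) = 0" by (rule brk_self)
  then have "brk A X X + brk A Y X + (brk A X Y + brk A Y Y) = 0"
    by (simp only: brk_add)
  then show ?thesis
    by (simp add: brk_self eq_neg_iff_add_eq_0 add.commute)
qed

lemma brk_brk: "brk A (brk A X Y) Z = brk A X (brk A Y Z) - brk A Y (brk A X Z)"
proof -
  have "brk A Z (brk A X Y) = - brk A (brk A X Y) Z" "brk A Y (brk A Z X) = - brk A Y (brk A X Z)"
    using brk_anti[of "brk A X Y" Z] brk_anti[of X Z] additive.minus[OF additive_brk(1)] by simp_all
  then show ?thesis
    using jacobi[of X Y Z] by (simp add: algebra_simps)
qed

end

section \<open>Relations in the enveloping algebra and the Hochschild differential\<close>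

locale envelope = lie_rinehart A
  for A :: "('k::field, 'r::comm_ring_1, 'l::ab_group_add) lie_rinehart_data" +
  fixes U :: "('k, 'r, 'l, 'u::ring_1) envelope_data"
  assumes universal: "universal_envelope A U"
begin

lemma vector_space_scU: "vector_space (scU U)"
  using universal unfolding universal_envelope_def presented_module_def
  by (simp add: module_def vector_space_def)

sublocale U: vector_space "scU U" by (rule vector_space_scU)

lemma scU_mult: "scU U c u * v = scU U c (u * v)" "u * scU U c v = scU U c (u * v)"
  using universal unfolding universal_envelope_def by metis+

lemma envelope_relation:
  assumes "ts \<in> envelope_rels A"
  shows "(\<Sum>(c, w)\<leftarrow>ts. scU U c (prod_list (map (case_sum (inR U) (inL U)) w))) = 0"
proof -
  have p: "presented_module (scU U) UNIV
       {formal (map (\<lambda>(c, w). (c, us @ w @ vs)) ts) |us vs ts. ts \<in> envelope_rels A}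
       (\<lambda>w. prod_list (map (case_sum (inR U) (inL U)) w))"
    using universal unfolding universal_envelope_def by blast
  have "formal (map (\<lambda>(c, w). (c, [] @ w @ [])) ts) \<in>
      {formal (map (\<lambda>(c, w). (c, us @ w @ vs)) ts) |us vs ts. ts \<in> envelope_rels A}"
    using assms by blast
  from presented_module_relation[OF p this]
  show ?thesis by (simp add: case_prod_unfold comp_def)
qed

lemma inR_simps:
  "inR U (a + b) = inR U a + inR U b" "inR U (scR A c a) = scU U c (inR U a)"
  "inR U (a * b) = inR U a * inR U b" "inR U 1 = 1"
  using envelope_relation[OF envelope_rels.R_add[of a b]] envelope_relation[OF envelope_rels.R_scale[of A c a]]
    envelope_relation[OF envelope_rels.R_mult[of a b]] envelope_relation[OF envelope_rels.R_one]
  by (simp_all add: algebra_simps)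

lemma inL_simps:
  "inL U (X + Y) = inL U X + inL U Y" "inL U (scL A c X) = scU U c (inL U X)"
  "inL U (act A r X) = inR U r * inL U X"
  using envelope_relation[OF envelope_rels.L_add[of X Y]] envelope_relation[OF envelope_rels.L_scale[of A c X]]
    envelope_relation[OF envelope_rels.act[of r X]]
  by (simp_all add: algebra_simps)

lemma inL_commutator: "inL U X * inL U Y = inL U Y * inL U X + inL U (brk A X Y)"
  and inL_inR: "inL U X * inR U r = inR U r * inL U X + inR U (anc A X r)"
  using envelope_relation[OF envelope_rels.L_brk[of X Y A]] envelope_relation[OF envelope_rels.anchor[of X r A]]
  by (simp_all add: algebra_simps)

lemma additive_inR: "additive (inR U)" and additive_inL: "additive (inL U)"
  by (simp_all add: additive_def inR_simps inL_simps)

lemmas inR_zero [simp] = additive.zero[OF additive_inR]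

lemma inR_commute: "inR U a * inR U b = inR U b * inR U a"
  by (metis inR_simps(3) mult.commute)

lemma inR_left_commute: "inR U a * (inR U b * u) = inR U b * (inR U a * u)"
  by (metis inR_commute mult.assoc)

text \<open>The anticommutator of \<open>b\<close> with the insertion of \<open>r\<close> as first argument.\<close>
definition hochschild_N :: "'r \<Rightarrow> ('r list \<Rightarrow> 'u) \<Rightarrow> 'r list \<Rightarrow> 'u" where
  "hochschild_N r \<phi> rs =
     (case rs of [] \<Rightarrow> inR U r * \<phi> [] - \<phi> [] * inR U r
      | s # ss \<Rightarrow> inR U r * \<phi> (s # ss) - \<phi> ((r * s) # ss) + inR U s * \<phi> (r # ss))"

lemma hochschild_N_simps [simp]:
  "hochschild_N r \<phi> [] = inR U r * \<phi> [] - \<phi> [] * inR U r"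
  "hochschild_N r \<phi> (s # ss) = inR U r * \<phi> (s # ss) - \<phi> ((r * s) # ss) + inR U s * \<phi> (r # ss)"
  by (simp_all add: hochschild_N_def)

lemma hochschild_b_Nil [simp]: "hochschild_b U \<phi> [] = 0"
  by (simp add: hochschild_b_def)

text \<open>The counterpart of Cartan's formula for b. Together with the value on the empty list it
  replaces the explicit sum from here on.\<close>

lemma hochschild_b_Cons [simp]:
  "hochschild_b U \<phi> (r # rs) = hochschild_N r \<phi> rs - hochschild_b U (\<lambda>ss. \<phi> (r # ss)) rs"
proof (cases rs)
  case (Cons s ss)
  then show ?thesis
    by (simp add: hochschild_b_def sum.lessThan_Suc_shift sum_negf del: sum.lessThan_Suc)
qed (simp add: hochschild_b_def)

lemma hochschild_b_linear:
  shows hochschild_b_add: "hochschild_b U (\<lambda>rs. \<phi> rs + \<psi> rs) rs = hochschild_b U \<phi> rs + hochschild_b U \<psi> rs"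
    and hochschild_b_diff: "hochschild_b U (\<lambda>rs. \<phi> rs - \<psi> rs) rs = hochschild_b U \<phi> rs - hochschild_b U \<psi> rs"
    and hochschild_b_minus: "hochschild_b U (\<lambda>rs. - \<phi> rs) rs = - hochschild_b U \<phi> rs"
    and hochschild_b_zero: "hochschild_b U (\<lambda>rs. 0) rs = 0"
    and hochschild_b_scale: "hochschild_b U (\<lambda>rs. scU U c (\<phi> rs)) rs = scU U c (hochschild_b U \<phi> rs)"
    and hochschild_b_left_mult: "hochschild_b U (\<lambda>rs. inR U a * \<phi> rs) rs = inR U a * hochschild_b U \<phi> rs"
proof -
  have N: "hochschild_N r (\<lambda>rs. \<phi> rs + \<psi> rs) rs = hochschild_N r \<phi> rs + hochschild_N r \<psi> rs" for r \<phi> \<psi> rs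
    by (cases rs) (simp_all add: distrib_left distrib_right)
  show add: "hochschild_b U (\<lambda>rs. \<phi> rs + \<psi> rs) rs = hochschild_b U \<phi> rs + hochschild_b U \<psi> rs" for \<phi> \<psi> rs
    by (induction rs arbitrary: \<phi> \<psi>) (simp_all add: N)
  have "additive (\<lambda>\<phi>. hochschild_b U \<phi> rs)"
    by (simp add: additive_def plus_fun_def add)
  from additive.minus[OF this] additive.diff[OF this] additive.zero[OF this]
  show "hochschild_b U (\<lambda>rs. \<phi> rs - \<psi> rs) rs = hochschild_b U \<phi> rs - hochschild_b U \<psi> rs"
    "hochschild_b U (\<lambda>rs. - \<phi> rs) rs = - hochschild_b U \<phi> rs"
    "hochschild_b U (\<lambda>rs. 0) rs = 0"
    by (simp_all add: fun_Compl_def fun_diff_def zero_fun_def)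
  have N: "hochschild_N r (\<lambda>rs. scU U c (\<phi> rs)) rs = scU U c (hochschild_N r \<phi> rs)" for r \<phi> rs
    by (cases rs) (simp_all add: scU_mult U.scale_right_distrib U.scale_right_diff_distrib)
  show "hochschild_b U (\<lambda>rs. scU U c (\<phi> rs)) rs = scU U c (hochschild_b U \<phi> rs)"
    by (induction rs arbitrary: \<phi>) (simp_all add: N U.scale_right_diff_distrib)
  have N: "hochschild_N r (\<lambda>rs. inR U a * \<phi> rs) rs = inR U a * hochschild_N r \<phi> rs" for r \<phi> rs
    by (cases rs) (simp_all add: right_diff_distrib distrib_left inR_left_commute[of a] mult.assoc)
  show "hochschild_b U (\<lambda>rs. inR U a * \<phi> rs) rs = inR U a * hochschild_b U \<phi> rs"
    by (induction rs arbitrary: \<phi>) (simp_all add: N right_diff_distrib)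
qed

text \<open>Being an anticommutator with b, \<open>hochschild_N r\<close> plays the part of a Lie
  derivative and commutes with b. On a nonempty list this reduces to a formula for the composite of
  two such operators, in which commutativity of R enters.\<close>

lemma hochschild_N_b:
  "hochschild_N r (hochschild_b U \<phi>) rs = hochschild_b U (hochschild_N r \<phi>) rs"
proof (cases rs)
  case (Cons s ss)
  have "hochschild_N s (hochschild_N r \<phi>) ss =
      inR U r * hochschild_N s \<phi> ss - hochschild_N (r * s) \<phi> ss + inR U s * hochschild_N r \<phi> ss"
    by (cases ss) (simp_all add: inR_simps algebra_simps inR_commute inR_left_commute)
  then show ?thesis
    using Cons
    by (simp add: hochschild_b_add hochschild_b_diff hochschild_b_left_mult algebra_simps)
qed simp

lemma hochschild_b_b: "hochschild_b U (hochschild_b U \<phi>) rs = 0"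
  by (induction rs arbitrary: \<phi>) (simp_all add: hochschild_N_b hochschild_b_diff)

section \<open>The Lie action on Hochschild cochains\<close>

abbreviation adU :: "'l \<Rightarrow> 'u \<Rightarrow> 'u" where
  "adU X u \<equiv> inL U X * u - u * inL U X"

lemma additive_adU: "additive (adU X)"
  by (simp add: additive_def algebra_simps)

lemma hochschild_lie_eq: "hochschild_lie A U X \<phi> = lie_der (anc A X) (adU X) \<phi>"
  by (rule ext) (simp add: hochschild_lie_def lie_der_eq_sum)

lemma additive_hochschild_lie: "additive (hochschild_lie A U X)"
  by (rule additive.intro, rule ext)
    (simp add: hochschild_lie_eq plus_fun_def lie_der_add[OF additive_adU])

text \<open>The extra term is the relation Xr - rX = X(r) of U; in the next lemma it is XY - YX =
  [X, Y].\<close>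

lemma lie_der_inR_mult:
  "lie_der (anc A X) (adU X) (\<lambda>rs. inR U a * \<phi> rs) rs =
     inR U a * lie_der (anc A X) (adU X) \<phi> rs + inR U (anc A X a) * \<phi> rs"
proof (induction rs arbitrary: \<phi>)
  case Nil
  have "inL U X * (inR U a * u) = inR U a * (inL U X * u) + inR U (anc A X a) * u" for u
    by (metis inL_inR mult.assoc distrib_right)
  then show ?case by (simp add: algebra_simps)
qed (simp add: algebra_simps)

lemma lie_der_inL_mult:
  "lie_der (anc A X) (adU X) (\<lambda>rs. inL U Y * \<phi> rs) rs =
     inL U Y * lie_der (anc A X) (adU X) \<phi> rs + inL U (brk A X Y) * \<phi> rs"
proof (induction rs arbitrary: \<phi>)
  case Nil
  have "inL U X * (inL U Y * u) = inL U Y * (inL U X * u) + inL U (brk A X Y) * u" for u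
    by (metis inL_commutator mult.assoc distrib_right)
  then show ?case by (simp add: algebra_simps)
qed (simp add: algebra_simps)

text \<open>The commutator of the Lie derivative along X with \<open>hochschild_N r\<close> is
  \<open>hochschild_N\<close> at X(r); the recursion for b then gives the claim by
  induction.\<close>

lemma hochschild_lie_b:
  assumes "multiadditive \<phi>"
  shows "hochschild_lie A U X (hochschild_b U \<phi>) = hochschild_b U (hochschild_lie A U X \<phi>)"
proof -
  let ?L = "lie_der (anc A X) (adU X)"
  note lin = lie_der_add[OF additive_adU] lie_der_diff[OF additive_adU]
  have N: "?L (hochschild_N r \<phi>) rs = hochschild_N r (?L \<phi>) rs + hochschild_N (anc A X r) \<phi> rs"
    if "multiadditive \<phi>" for r rs \<phi>
  proof (cases rs)
    case Nil
    have "inL U X * (inR U r * u) = inR U r * (inL U X * u) + inR U (anc A X r) * u"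
      "u * (inL U X * inR U r) = u * (inR U r * inL U X) + u * inR U (anc A X r)" for u
      by (metis inL_inR mult.assoc distrib_right distrib_left)+
    then show ?thesis
      using Nil by (simp add: algebra_simps)
  next
    case (Cons s ss)
    then show ?thesis
      by (simp add: lin lie_der_inR_mult anc_linear multiadditive_hd[OF that] algebra_simps)
  qed
  have "?L (hochschild_b U \<phi>) rs = hochschild_b U (?L \<phi>) rs" for rs
    using assms
  proof (induction rs arbitrary: \<phi>)
    case (Cons r rs)
    then show ?case
      by (simp add: lin N multiadditive_Cons hochschild_b_diff)
  qed simp
  then show ?thesis
    by (simp add: hochschild_lie_eq fun_eq_iff)
qed

lemma hochschild_cochains_iff:
  "\<phi> \<in> hochschild_cochains A U m \<longleftrightarrow>
     (\<forall>rs. length rs \<noteq> m \<longrightarrow> \<phi> rs = 0) \<and> multiadditive \<phi> \<and> multihomogeneous (scR A) (scU U) \<phi>"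
  by (simp add: hochschild_cochains_def multilinear_iff R_vector_space vector_space_scU)

lemma hochschild_b_in:
  assumes "\<phi> \<in> hochschild_cochains A U m"
  shows "hochschild_b U \<phi> \<in> hochschild_cochains A U (Suc m)"
proof -
  have supp: "hochschild_b U \<phi> rs = 0" if "\<And>rs. length rs \<noteq> m \<Longrightarrow> \<phi> rs = 0" "length rs \<noteq> Suc m" for \<phi> rs m
    using that
  proof (induction rs arbitrary: \<phi> m)
    case (Cons r rs)
    have "hochschild_b U (\<lambda>ss. \<phi> (r # ss)) rs = 0"
    proof (cases m)
      case 0
      then have "(\<lambda>ss. \<phi> (r # ss)) = (\<lambda>_. 0)"
        using Cons.prems by simp
      then show ?thesis by (simp add: hochschild_b_zero)
    next
      case (Suc m')
      then show ?thesis
        using Cons.prems by (intro Cons.IH[of m']) auto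
    qed
    then show ?case
      using Cons.prems by (cases rs) auto
  qed simp
  have add: "hochschild_b U \<phi> (us @ (x + y) # vs) = hochschild_b U \<phi> (us @ x # vs) + hochschild_b U \<phi> (us @ y # vs)"
    if "multiadditive \<phi>" for \<phi> us x y vs
    using that
  proof (induction us arbitrary: \<phi>)
    case Nil
    show ?case
      by (cases vs)
        (simp_all add: multiadditive_hd[OF Nil] inR_simps hochschild_b_add distrib_right distrib_left)
  next
    case (Cons r us)
    have "hochschild_N r \<phi> (us @ (x + y) # vs) = hochschild_N r \<phi> (us @ x # vs) + hochschild_N r \<phi> (us @ y # vs)"
    proof (cases us)
      case Nil
      then show ?thesis
        by (simp add: multiadditive_hd[OF Cons.prems] inR_simps distrib_right distrib_left)
    next
      case us: (Cons s us')
      have "\<phi> (a # us' @ (x + y) # vs) = \<phi> (a # us' @ x # vs) + \<phi> (a # us' @ y # vs)" for a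
        using Cons.prems unfolding multiadditive_def by (metis append_Cons)
      then show ?thesis
        using us by (simp add: distrib_left)
    qed
    then show ?case
      using Cons by (simp add: multiadditive_Cons)
  qed
  have scale: "hochschild_b U \<phi> (us @ scR A c x # vs) = scU U c (hochschild_b U \<phi> (us @ x # vs))"
    if "multihomogeneous (scR A) (scU U) \<phi>" for \<phi> us c x vs
    using that
  proof (induction us arbitrary: \<phi>)
    case Nil
    have hd: "\<phi> (scR A c x # vs) = scU U c (\<phi> (x # vs))" for c x vs
      using Nil unfolding multihomogeneous_def by (metis append_Nil)
    show ?case
      by (cases vs)
        (simp_all add: hd inR_simps hochschild_b_scale scU_mult U.scale_right_distrib
          U.scale_right_diff_distrib flip: R_algebra)
  next
    case (Cons r us)
    have "hochschild_N r \<phi> (us @ scR A c x # vs) = scU U c (hochschild_N r \<phi> (us @ x # vs))"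
    proof (cases us)
      case Nil
      have hd: "\<phi> (scR A c x # vs) = scU U c (\<phi> (x # vs))"
          "\<phi> (r # scR A c x # vs) = scU U c (\<phi> (r # x # vs))" for c x vs
        using Cons.prems unfolding multihomogeneous_def by (metis append_Nil, metis append_Cons append_Nil)
      have "r * scR A c x = scR A c (r * x)"
        by (metis R_algebra mult.commute)
      then show ?thesis
        using Nil by (simp add: hd inR_simps scU_mult U.scale_right_distrib U.scale_right_diff_distrib)
    next
      case us: (Cons s us')
      have "\<phi> (a # us' @ scR A c x # vs) = scU U c (\<phi> (a # us' @ x # vs))" for a
        using Cons.prems unfolding multihomogeneous_def by (metis append_Cons)
      then show ?thesis
        using us by (simp add: scU_mult U.scale_right_distrib U.scale_right_diff_distrib)
    qed
    then show ?case
      using Cons by (simp add: multihomogeneous_Cons U.scale_right_diff_distrib)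
  qed
  show ?thesis
    using assms supp[of m \<phi>] add scale unfolding hochschild_cochains_iff
    by (auto simp: multiadditive_def multihomogeneous_def)
qed

text \<open>Cochains of all degrees together: the set on which the Lie action satisfies the
  identities of \<open>lie_module\<close>.\<close>

definition hochschild_multilinear :: "('r list \<Rightarrow> 'u) set" where
  "hochschild_multilinear = {\<phi>. multiadditive \<phi> \<and> multihomogeneous (scR A) (scU U) \<phi>}"

lemma hochschild_lie_multilinear:
  assumes "\<phi> \<in> hochschild_multilinear"
  shows "hochschild_lie A U X \<phi> \<in> hochschild_multilinear"
proof -
  have "multiadditive (hochschild_lie A U X \<phi>)"
    unfolding hochschild_lie_eq
    by (rule lie_der_multiadditive)
      (use assms additive_anc additive_adU in \<open>auto simp: hochschild_multilinear_def\<close>)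
  moreover have "multihomogeneous (scR A) (scU U) (hochschild_lie A U X \<phi>)"
    unfolding hochschild_lie_eq
    by (rule lie_der_multihomogeneous[where M = UNIV])
      (use assms in \<open>auto simp: hochschild_multilinear_def anc_linear scU_mult U.scale_right_diff_distrib
         additive_def U.scale_right_distrib\<close>)
  ultimately show ?thesis
    by (simp add: hochschild_multilinear_def)
qed

lemma hochschild_lie_in:
  assumes "\<phi> \<in> hochschild_cochains A U m"
  shows "hochschild_lie A U X \<phi> \<in> hochschild_cochains A U m"
proof -
  have "hochschild_lie A U X \<phi> rs = 0" if "length rs \<noteq> m" for rs
    using assms that by (simp add: hochschild_lie_def hochschild_cochains_iff)
  then show ?thesis
    using hochschild_lie_multilinear[of \<phi> X] assms
    by (simp add: hochschild_cochains_iff hochschild_multilinear_def)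
qed

lemma hochschild_lie_add_left:
  assumes "multiadditive \<phi>"
  shows "hochschild_lie A U (X + Y) \<phi> = hochschild_lie A U X \<phi> + hochschild_lie A U Y \<phi>"
proof
  show "hochschild_lie A U (X + Y) \<phi> rs = (hochschild_lie A U X \<phi> + hochschild_lie A U Y \<phi>) rs" for rs
    using assms unfolding hochschild_lie_eq
    by (induction rs arbitrary: \<phi>)
      (simp_all add: anc_add inL_simps multiadditive_hd multiadditive_Cons algebra_simps)
qed

lemma hochschild_lie_scale_left:
  assumes "multihomogeneous (scR A) (scU U) \<phi>"
  shows "hochschild_lie A U (scL A c X) \<phi> = scC U c (hochschild_lie A U X \<phi>)"
proof
  have anc: "anc A (scL A c X) a = scR A c (anc A X a)" for a
    using anc_act[of "scR A c 1" X] by (simp add: act_scalar der_scale_def flip: R_algebra)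
  show "hochschild_lie A U (scL A c X) \<phi> rs = scC U c (hochschild_lie A U X \<phi>) rs" for rs
    using assms unfolding hochschild_lie_eq scC_def
  proof (induction rs arbitrary: \<phi>)
    case (Cons r rs)
    have "\<phi> (scR A c a # vs) = scU U c (\<phi> (a # vs))" for a vs
      using Cons.prems unfolding multihomogeneous_def by (metis append_Nil)
    then show ?case
      using Cons by (simp add: multihomogeneous_Cons anc U.scale_right_diff_distrib)
  qed (simp add: inL_simps scU_mult U.scale_right_diff_distrib)
qed

lemma hochschild_lie_scale: "hochschild_lie A U X (scC U c \<phi>) = scC U c (hochschild_lie A U X \<phi>)"
  by (rule ext)
    (simp add: hochschild_lie_def scC_def scU_mult U.scale_right_distrib U.scale_right_diff_distrib
      U.scale_minus_right U.scale_sum_right)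

lemma hochschild_lie_module: "lie_module (brk A) (hochschild_lie A U) hochschild_multilinear"
proof (rule lie_module.intro)
  fix X Y and \<phi> :: "'r list \<Rightarrow> 'u"
  assume multilinear: "\<phi> \<in> hochschild_multilinear"
  then have \<phi>: "multiadditive \<phi>" by (simp add: hochschild_multilinear_def)
  show "hochschild_lie A U (X + Y) \<phi> = hochschild_lie A U X \<phi> + hochschild_lie A U Y \<phi>"
    by (rule hochschild_lie_add_left[OF \<phi>])
  have "hochschild_lie A U X (hochschild_lie A U Y \<phi>) rs - hochschild_lie A U Y (hochschild_lie A U X \<phi>) rs =
      hochschild_lie A U (brk A X Y) \<phi> rs" for rs
    unfolding hochschild_lie_eq
  proof (rule lie_der_commutator[where M = UNIV])
    show "adU (brk A X Y) u = adU X (adU Y u) - adU Y (adU X u)" for u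
      using inL_commutator[of X Y] by (simp add: algebra_simps flip: mult.assoc)
        (simp add: algebra_simps)
  qed (use \<phi> in \<open>auto simp: additive_adU anc_brk der_bracket_def\<close>)
  then show "hochschild_lie A U (brk A X Y) \<phi> =
      hochschild_lie A U X (hochschild_lie A U Y \<phi>) - hochschild_lie A U Y (hochschild_lie A U X \<phi>)"
    by (simp add: fun_eq_iff)
  show "hochschild_lie A U X \<phi> \<in> hochschild_multilinear"
    by (rule hochschild_lie_multilinear[OF multilinear])
  fix \<psi> :: "'r list \<Rightarrow> 'u" assume "\<psi> \<in> hochschild_multilinear"
  then show "\<phi> - \<psi> \<in> hochschild_multilinear"
    using multilinear
    by (simp add: hochschild_multilinear_def multiadditive_def multihomogeneous_def U.scale_right_diff_distrib)
next
  show "additive (hochschild_lie A U X)" for X by (rule additive_hochschild_lie)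
  show "0 \<in> hochschild_multilinear"
    by (simp add: hochschild_multilinear_def multiadditive_def multihomogeneous_def)
qed (simp_all add: brk_add brk_self brk_brk)

end

section \<open>Operators on \<open>Sym(ad(L))\<close>\<close>

context lie_rinehart
begin

lemma Der_D:
  assumes "D \<in> Der A"
  shows "D (a + b) = D a + D b" "D (scR A c a) = scR A c (D a)" "D (a * b) = D a * b + a * D b"
    "D (a - b) = D a - D b" "D 0 = 0" "D (- a) = - D a"
proof -
  show add: "D (a + b) = D a + D b" and "D (scR A c a) = scR A c (D a)" "D (a * b) = D a * b + a * D b" for a b
    using assms by (simp_all add: Der_def Vector_Spaces.linear_iff)
  then have "additive D" by (simp add: additive_def)
  then show "D (a - b) = D a - D b" "D 0 = 0" "D (- a) = - D a"
    by (simp_all add: additive.diff additive.zero additive.minus)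
qed

lemma scR_mult_right: "a * scR A c b = scR A c (a * b)"
  by (metis R_algebra mult.commute)

lemma Der_I:
  assumes "\<And>a b. D (a + b) = D a + D b" "\<And>c a. D (scR A c a) = scR A c (D a)"
    "\<And>a b. D (a * b) = D a * b + a * D b"
  shows "D \<in> Der A"
  using assms by (simp add: Der_def Vector_Spaces.linear_iff R_vector_space)

lemma Der_closed:
  "D \<in> Der A \<Longrightarrow> E \<in> Der A \<Longrightarrow> D + E \<in> Der A" "D \<in> Der A \<Longrightarrow> E \<in> Der A \<Longrightarrow> D - E \<in> Der A"
  "D \<in> Der A \<Longrightarrow> der_scale r D \<in> Der A" "D \<in> Der A \<Longrightarrow> E \<in> Der A \<Longrightarrow> der_bracket D E \<in> Der A"
  by (rule Der_I;
      simp add: Der_D der_scale_def der_bracket_def algebra_simps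
        R.scale_right_distrib R.scale_right_diff_distrib scR_mult_right)+

lemma anc_in_Der [simp]: "anc A X \<in> Der A"
  by (rule anc_Der)

end

section \<open>Presentation and universal property of Sym(ad(L))\<close>

locale sym_ad_algebra = lie_rinehart A
  for A :: "('k::field, 'r::comm_ring_1, 'l::ab_group_add) lie_rinehart_data" +
  fixes S :: "('r, 'l, 'e::ab_group_add, 's::ab_group_add, 'w::ab_group_add) sym_ad_data"
  assumes sym_ad: "sym_ad A S"
begin

lemma presentations:
  "presented_module (scE S) {us. set us \<subseteq> Der A}
     (multilinear_rels (Der A) der_scale \<union> {formal [(1, us)] |us. set us \<subseteq> Der A \<and> \<not> distinct us}) (wedge S)"
  "presented_module (scS S) {us. set us \<subseteq> UNIV}
     (multilinear_rels UNIV (act A) \<union>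
      {formal [(1, us @ x # y # vs), (-1, us @ y # x # vs)] |us vs x y. set us \<union> set vs \<union> {x, y} \<subseteq> UNIV})
     (symprod S)"
  "presented_module (scW S) UNIV
       ({formal [(1, (x + y, z)), (-1, (x, z)), (-1, (y, z))] |x y z. True} \<union>
        {formal [(1, (x, y + z)), (-1, (x, y)), (-1, (x, z))] |x y z. True} \<union>
        {formal [(1, (scE S a x, y)), (- a, (x, y))] |a x y. True} \<union>
        {formal [(1, (x, scS S a y)), (- a, (x, y))] |a x y. True})
       (\<lambda>(x, y). tns S x y)"
  using sym_ad unfolding sym_ad_def exterior_algebra_def symmetric_algebra_def tensor_product_def
  by blast+

lemma modules: "module (scE S)" "module (scS S)" "module (scW S)"
  using presentations by (simp_all add: presented_module_def)

sublocale E: module "scE S" by (rule modules)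
sublocale S: module "scS S" by (rule modules)
sublocale W: module "scW S" by (rule modules)

lemma wedge_add:
  assumes "set us \<union> set vs \<union> {x, y} \<subseteq> Der A"
  shows "wedge S (us @ (x + y) # vs) = wedge S (us @ x # vs) + wedge S (us @ y # vs)"
proof -
  let ?ts = "[(1, us @ (x + y) # vs), (-1, us @ x # vs), (-1, us @ y # vs)] :: ('r \<times> _) list"
  have "formal ?ts \<in> multilinear_rels (Der A) der_scale"
    using assms unfolding multilinear_rels_def by blast
  then have "(\<Sum>(c, g)\<leftarrow>?ts. scE S c (wedge S g)) = 0"
    by (intro presented_module_relation[OF presentations(1)])
      (use assms Der_closed(1)[of x y] in auto)
  then show ?thesis by (simp add: algebra_simps)
qed

lemma wedge_scale:
  assumes "set us \<union> set vs \<union> {x} \<subseteq> Der A"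
  shows "wedge S (us @ der_scale a x # vs) = scE S a (wedge S (us @ x # vs))"
proof -
  let ?ts = "[(1, us @ der_scale a x # vs), (- a, us @ x # vs)] :: ('r \<times> _) list"
  have "formal ?ts \<in> multilinear_rels (Der A) der_scale"
    using assms unfolding multilinear_rels_def by blast
  then have "(\<Sum>(c, g)\<leftarrow>?ts. scE S c (wedge S g)) = 0"
    by (intro presented_module_relation[OF presentations(1)])
      (use assms Der_closed(3)[of x] in auto)
  then show ?thesis by (simp add: algebra_simps)
qed

lemma wedge_not_distinct:
  assumes "set us \<subseteq> Der A" "\<not> distinct us"
  shows "wedge S us = 0"
proof -
  let ?ts = "[(1, us)] :: ('r \<times> _) list"
  have "(\<Sum>(c, g)\<leftarrow>?ts. scE S c (wedge S g)) = 0"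
    by (intro presented_module_relation[OF presentations(1)]) (use assms in auto)
  then show ?thesis by simp
qed

lemma symprod_add: "symprod S (us @ (x + y) # vs) = symprod S (us @ x # vs) + symprod S (us @ y # vs)"
proof -
  let ?ts = "[(1, us @ (x + y) # vs), (-1, us @ x # vs), (-1, us @ y # vs)] :: ('r \<times> _) list"
  have "formal ?ts \<in> multilinear_rels UNIV (act A)"
    unfolding multilinear_rels_def by blast
  then have "(\<Sum>(c, g)\<leftarrow>?ts. scS S c (symprod S g)) = 0"
    by (intro presented_module_relation[OF presentations(2)]) auto
  then show ?thesis by (simp add: algebra_simps)
qed

lemma symprod_scale: "symprod S (us @ act A a x # vs) = scS S a (symprod S (us @ x # vs))"
proof -
  let ?ts = "[(1, us @ act A a x # vs), (- a, us @ x # vs)] :: ('r \<times> _) list"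
  have "formal ?ts \<in> multilinear_rels UNIV (act A)"
    unfolding multilinear_rels_def by blast
  then have "(\<Sum>(c, g)\<leftarrow>?ts. scS S c (symprod S g)) = 0"
    by (intro presented_module_relation[OF presentations(2)]) auto
  then show ?thesis by (simp add: algebra_simps)
qed

lemma symprod_swap: "symprod S (us @ x # y # vs) = symprod S (us @ y # x # vs)"
proof -
  let ?ts = "[(1, us @ x # y # vs), (-1, us @ y # x # vs)] :: ('r \<times> _) list"
  have "(\<Sum>(c, g)\<leftarrow>?ts. scS S c (symprod S g)) = 0"
    by (intro presented_module_relation[OF presentations(2)]) auto
  then show ?thesis by (simp add: algebra_simps)
qed

lemma tns_simps:
  "tns S (x + y) z = tns S x z + tns S y z" "tns S x (z + z') = tns S x z + tns S x z'"
  "tns S (scE S a x) z = scW S a (tns S x z)" "tns S x (scS S a z) = scW S a (tns S x z)"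
proof -
  let ?ts = "[(1, (x + y, z)), (-1, (x, z)), (-1, (y, z))] :: ('r \<times> _) list"
  have "(\<Sum>(c, g)\<leftarrow>?ts. scW S c (case g of (x, y) \<Rightarrow> tns S x y)) = 0"
    by (rule presented_module_relation[OF presentations(3)]) (blast, simp)
  then show "tns S (x + y) z = tns S x z + tns S y z" by (simp add: algebra_simps)
  let ?ts = "[(1, (x, z + z')), (-1, (x, z)), (-1, (x, z'))] :: ('r \<times> _) list"
  have "(\<Sum>(c, g)\<leftarrow>?ts. scW S c (case g of (x, y) \<Rightarrow> tns S x y)) = 0"
    by (rule presented_module_relation[OF presentations(3)]) (blast, simp)
  then show "tns S x (z + z') = tns S x z + tns S x z'" by (simp add: algebra_simps)
  let ?ts = "[(1, (scE S a x, z)), (- a, (x, z))] :: ('r \<times> _) list"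
  have "(\<Sum>(c, g)\<leftarrow>?ts. scW S c (case g of (x, y) \<Rightarrow> tns S x y)) = 0"
    by (rule presented_module_relation[OF presentations(3)]) (blast, simp)
  then show "tns S (scE S a x) z = scW S a (tns S x z)" by (simp add: algebra_simps)
  let ?ts = "[(1, (x, scS S a z)), (- a, (x, z))] :: ('r \<times> _) list"
  have "(\<Sum>(c, g)\<leftarrow>?ts. scW S c (case g of (x, y) \<Rightarrow> tns S x y)) = 0"
    by (rule presented_module_relation[OF presentations(3)]) (blast, simp)
  then show "tns S x (scS S a z) = scW S a (tns S x z)" by (simp add: algebra_simps)
qed

lemma additive_tns: "additive (tns S x)" "additive (\<lambda>x. tns S x z)"
  by (simp_all add: additive_def tns_simps)

lemma ten_D:
  shows ten_D_add: "set us \<union> set vs \<union> {x, y} \<subseteq> Der A \<Longrightarrow>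
      ten S (us @ (x + y) # vs) Xs = ten S (us @ x # vs) Xs + ten S (us @ y # vs) Xs"
    and ten_D_scale: "set us \<union> set vs \<union> {x} \<subseteq> Der A \<Longrightarrow>
      ten S (us @ der_scale a x # vs) Xs = scW S a (ten S (us @ x # vs) Xs)"
    and ten_not_distinct: "set us \<subseteq> Der A \<Longrightarrow> \<not> distinct us \<Longrightarrow> ten S us Xs = 0"
  by (simp_all add: ten_def wedge_add wedge_scale wedge_not_distinct tns_simps additive.zero[OF additive_tns(2)]
      del: Un_iff)

lemma ten_X:
  shows ten_X_add: "ten S Ds (us @ (x + y) # vs) = ten S Ds (us @ x # vs) + ten S Ds (us @ y # vs)"
    and ten_X_scale: "ten S Ds (us @ act A a x # vs) = scW S a (ten S Ds (us @ x # vs))"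
    and ten_X_swap: "ten S Ds (us @ x # y # vs) = ten S Ds (us @ y # x # vs)"
  by (simp_all add: ten_def symprod_add symprod_scale tns_simps symprod_swap[of us x y])

lemma ten_D_swap:
  assumes "set us \<union> set vs \<union> {x, y} \<subseteq> Der A"
  shows "ten S (us @ x # y # vs) Xs = - ten S (us @ y # x # vs) Xs"
  by (rule swap_adjacent[where M = "Der A"])
    (use assms ten_D_add ten_not_distinct Der_closed in auto)

text \<open>The scalar stays in the generating case because the maps to be compared on generators
  are in general only additive.\<close>

lemma ten_induct:
  assumes "P 0" "\<And>v w. P v \<Longrightarrow> P w \<Longrightarrow> P (v + w)"
    and "\<And>r Ds Xs. set Ds \<subseteq> Der A \<Longrightarrow> P (scW S r (ten S Ds Xs))"
  shows "P w"
proof (rule presented_module_induct[OF presentations(3)])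
  have *: "P (scW S a (tns S e s))" for a e s
  proof (induction e arbitrary: a s rule: presented_module_induct[OF presentations(1)])
    case (3 b Ds)
    show ?case
    proof (induction s arbitrary: a rule: presented_module_induct[OF presentations(2)])
      case (3 c Xs)
      have "scW S a (tns S (scE S b (wedge S Ds)) (scS S c (symprod S Xs))) = scW S (a * c * b) (ten S Ds Xs)"
        by (simp add: tns_simps ten_def mult_ac)
      then show ?case
        using assms(3) \<open>Ds \<in> _\<close> by simp
    qed (simp_all add: assms tns_simps additive.zero[OF additive_tns(1)] W.scale_right_distrib)
  qed (simp_all add: assms tns_simps additive.zero[OF additive_tns(2)] W.scale_right_distrib)
  show "P (scW S a (case g of (x, y) \<Rightarrow> tns S x y))" for a g
    by (cases g) (simp add: *)
qed (use assms in auto)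

lemma ten_eqI:
  assumes "additive f" "additive g" "\<And>r Ds Xs. set Ds \<subseteq> Der A \<Longrightarrow> f (scW S r (ten S Ds Xs)) = g (scW S r (ten S Ds Xs))"
  shows "f w = g w"
  by (induction w rule: ten_induct)
    (simp_all add: assms additive.zero[OF assms(1)] additive.zero[OF assms(2)]
      additive.add[OF assms(1)] additive.add[OF assms(2)])

text \<open>The first argument is the scalar in front of the tensor, and scalars pulled out of any
  entry are collected there. In it the form is additive rather than R-linear, so that derivations
  are covered.\<close>

definition multilinear_form :: "('r \<Rightarrow> ('r \<Rightarrow> 'r) list \<Rightarrow> 'l list \<Rightarrow> 'm::ab_group_add) \<Rightarrow> bool" where
  "multilinear_form \<psi> \<longleftrightarrow>
     (\<forall>Ds Xs. set Ds \<subseteq> Der A \<longrightarrow> additive (\<lambda>a. \<psi> a Ds Xs)) \<and>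
     (\<forall>a us vs x y Xs. set us \<union> set vs \<union> {x, y} \<subseteq> Der A \<longrightarrow>
        \<psi> a (us @ (x + y) # vs) Xs = \<psi> a (us @ x # vs) Xs + \<psi> a (us @ y # vs) Xs) \<and>
     (\<forall>a b us vs x Xs. set us \<union> set vs \<union> {x} \<subseteq> Der A \<longrightarrow>
        \<psi> a (us @ der_scale b x # vs) Xs = \<psi> (a * b) (us @ x # vs) Xs) \<and>
     (\<forall>a us vs x Xs. set us \<union> set vs \<union> {x} \<subseteq> Der A \<longrightarrow> \<psi> a (us @ x # x # vs) Xs = 0) \<and>
     (\<forall>a Ds us vs x y. set Ds \<subseteq> Der A \<longrightarrow>
        \<psi> a Ds (us @ (x + y) # vs) = \<psi> a Ds (us @ x # vs) + \<psi> a Ds (us @ y # vs)) \<and>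
     (\<forall>a b Ds us vs x. set Ds \<subseteq> Der A \<longrightarrow>
        \<psi> a Ds (us @ act A b x # vs) = \<psi> (a * b) Ds (us @ x # vs)) \<and>
     (\<forall>a Ds us vs x y. set Ds \<subseteq> Der A \<longrightarrow> \<psi> a Ds (us @ x # y # vs) = \<psi> a Ds (us @ y # x # vs))"

lemma multilinear_formI:
  assumes "\<And>Ds Xs. set Ds \<subseteq> Der A \<Longrightarrow> additive (\<lambda>a. \<psi> a Ds Xs)"
    and "\<And>a us vs x y Xs. set us \<subseteq> Der A \<Longrightarrow> set vs \<subseteq> Der A \<Longrightarrow> x \<in> Der A \<Longrightarrow> y \<in> Der A \<Longrightarrow>
        \<psi> a (us @ (x + y) # vs) Xs = \<psi> a (us @ x # vs) Xs + \<psi> a (us @ y # vs) Xs"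
    and "\<And>a b us vs x Xs. set us \<subseteq> Der A \<Longrightarrow> set vs \<subseteq> Der A \<Longrightarrow> x \<in> Der A \<Longrightarrow>
        \<psi> a (us @ der_scale b x # vs) Xs = \<psi> (a * b) (us @ x # vs) Xs"
    and "\<And>a us vs x Xs. set us \<subseteq> Der A \<Longrightarrow> set vs \<subseteq> Der A \<Longrightarrow> x \<in> Der A \<Longrightarrow> \<psi> a (us @ x # x # vs) Xs = 0"
    and "\<And>a Ds us vs x y. set Ds \<subseteq> Der A \<Longrightarrow>
        \<psi> a Ds (us @ (x + y) # vs) = \<psi> a Ds (us @ x # vs) + \<psi> a Ds (us @ y # vs)"
    and "\<And>a b Ds us vs x. set Ds \<subseteq> Der A \<Longrightarrow> \<psi> a Ds (us @ act A b x # vs) = \<psi> (a * b) Ds (us @ x # vs)"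
    and "\<And>a Ds us vs x y. set Ds \<subseteq> Der A \<Longrightarrow> \<psi> a Ds (us @ x # y # vs) = \<psi> a Ds (us @ y # x # vs)"
  shows "multilinear_form \<psi>"
  unfolding multilinear_form_def using assms by auto

definition extend :: "('r \<Rightarrow> ('r \<Rightarrow> 'r) list \<Rightarrow> 'l list \<Rightarrow> 'm::ab_group_add) \<Rightarrow> 'w \<Rightarrow> 'm" where
  "extend \<psi> = (SOME h. additive h \<and>
     (\<forall>r Ds Xs. set Ds \<subseteq> Der A \<longrightarrow> h (scW S r (ten S Ds Xs)) = \<psi> r Ds Xs))"

text \<open>The presentations are used in turn: for a fixed list of derivations the form descends to
  Sym, for a fixed element of Sym the result extends over the exterior algebra, and then over the
  tensor product. At each stage the rules in the remaining variable are recovered by comparing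
  additive maps on generators.\<close>

lemma extend_exists:
  fixes \<psi> :: "'r \<Rightarrow> ('r \<Rightarrow> 'r) list \<Rightarrow> 'l list \<Rightarrow> 'm::ab_group_add"
  assumes "multilinear_form \<psi>"
  shows "\<exists>h. additive h \<and> (\<forall>r Ds Xs. set Ds \<subseteq> Der A \<longrightarrow> h (scW S r (ten S Ds Xs)) = \<psi> r Ds Xs)"
proof -
  note form = assms[unfolded multilinear_form_def]
  let ?D = "\<lambda>Ds. set Ds \<subseteq> Der A"
  have "\<exists>h. additive h \<and> (\<forall>a Xs. h (scS S a (symprod S Xs)) = \<psi> a Ds Xs)" if "?D Ds" for Ds
  proof -
    have add: "additive (\<lambda>a. \<psi> a Ds Xs)" for Xs
      using form[THEN conjunct1] that by simp
    have "formal_eval (\<lambda>a. \<psi> a Ds) (free_scale b f) = 0"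
      if "f \<in> multilinear_rels UNIV (act A) \<union>
        {formal [(1, us @ x # y # vs), (-1, us @ y # x # vs)] |us vs x y. set us \<union> set vs \<union> {x, y} \<subseteq> UNIV}"
      for f b
      using that form \<open>?D Ds\<close> unfolding multilinear_rels_def
      by (auto simp: free_scale_formal formal_eval_formal[OF add] additive.minus[OF add])
    from presented_module_extension[OF presentations(2) add this]
    obtain h where "additive h" "\<And>a Xs. h (scS S a (symprod S Xs)) = \<psi> a Ds Xs"
      by auto
    then show ?thesis by blast
  qed
  then obtain hS where hS_add: "\<And>Ds. ?D Ds \<Longrightarrow> additive (hS Ds)"
    and hS: "\<And>Ds a Xs. ?D Ds \<Longrightarrow> hS Ds (scS S a (symprod S Xs)) = \<psi> a Ds Xs"
    by metis
  have hS_eqI: "f s = g s" if "additive f" "additive g"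
    "\<And>a Xs. f (scS S a (symprod S Xs)) = g (scS S a (symprod S Xs))" for f g :: "'s \<Rightarrow> 'm" and s
    by (induction s rule: presented_module_induct[OF presentations(2)])
      (simp_all add: that additive.zero[OF that(1)] additive.zero[OF that(2)]
        additive.add[OF that(1)] additive.add[OF that(2)])
  have "\<exists>h. additive h \<and> (\<forall>a Ds. ?D Ds \<longrightarrow> h (scE S a (wedge S Ds)) = hS Ds (scS S a s))" for s
  proof -
    \<comment> \<open>The default 0 gives additivity on lists outside the set of generators too, as
      \<open>presented_module_extension\<close> asks for every g.\<close>
    let ?\<phi> = "\<lambda>a Ds. if ?D Ds then hS Ds (scS S a s) else 0"
    have add: "additive (\<lambda>a. ?\<phi> a Ds)" for Ds
      by (auto simp: additive_def S.scale_left_distrib additive.add[OF hS_add])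
    have D_add: "hS (us @ (x + y) # vs) t = hS (us @ x # vs) t + hS (us @ y # vs) t"
      if "?D us" "?D vs" "x \<in> Der A" "y \<in> Der A" for us vs x y t
    proof (rule hS_eqI)
      have D: "?D (us @ (x + y) # vs)" "?D (us @ x # vs)" "?D (us @ y # vs)"
        using that Der_closed by auto
      then show "additive (hS (us @ (x + y) # vs))" "additive (\<lambda>t. hS (us @ x # vs) t + hS (us @ y # vs) t)"
        using hS_add[OF D(1)] hS_add[OF D(2)] hS_add[OF D(3)] by (simp_all add: additive_def algebra_simps)
      show "hS (us @ (x + y) # vs) (scS S a (symprod S Xs)) =
         hS (us @ x # vs) (scS S a (symprod S Xs)) + hS (us @ y # vs) (scS S a (symprod S Xs))" for a Xs
        unfolding hS[OF D(1)] hS[OF D(2)] hS[OF D(3)] using that form by simp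
    qed
    have D_scale: "hS (us @ der_scale b x # vs) t = hS (us @ x # vs) (scS S b t)"
      if "?D us" "?D vs" "x \<in> Der A" for us vs x b t
    proof (rule hS_eqI[of "hS (us @ der_scale b x # vs)" "\<lambda>t. hS (us @ x # vs) (scS S b t)"])
      have D: "?D (us @ der_scale b x # vs)" "?D (us @ x # vs)"
        using that Der_closed by auto
      then show "additive (hS (us @ der_scale b x # vs))" "additive (\<lambda>t. hS (us @ x # vs) (scS S b t))"
        using hS_add[OF D(1)] hS_add[OF D(2)] by (simp_all add: additive_def S.scale_right_distrib)
      show "hS (us @ der_scale b x # vs) (scS S a (symprod S Xs)) =
         hS (us @ x # vs) (scS S b (scS S a (symprod S Xs)))" for a Xs
        using that form by (simp add: hS[OF D(1)] hS[OF D(2)] mult.commute[of b])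
    qed
    have D_alt: "hS Ds t = 0" if D: "?D Ds" "\<not> distinct Ds" for Ds t
    proof (rule hS_eqI)
      show "hS Ds (scS S a (symprod S Xs)) = 0" for a Xs
        unfolding hS[OF D(1)]
        by (rule not_distinct_eq_0[where M = "Der A" and \<phi> = "\<lambda>Ds. \<psi> a Ds Xs"])
          (use form D Der_closed in auto)
    qed (use hS_add[OF D(1)] in \<open>simp_all add: additive_def\<close>)
    have "formal_eval ?\<phi> (free_scale b f) = 0"
      if "f \<in> multilinear_rels (Der A) der_scale \<union> {formal [(1, us)] |us. ?D us \<and> \<not> distinct us}"
      for f b
      using that Der_closed unfolding multilinear_rels_def
      by (auto simp: free_scale_formal formal_eval_formal[OF add] D_add D_scale D_alt
          additive.minus[OF hS_add] mult.commute)
    from presented_module_extension[OF presentations(1) add this] show ?thesis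
      by (metis mem_Collect_eq)
  qed
  then obtain hE where hE_add: "\<And>s. additive (hE s)"
    and hE: "\<And>s a Ds. ?D Ds \<Longrightarrow> hE s (scE S a (wedge S Ds)) = hS Ds (scS S a s)"
    by metis
  have hE_eqI: "f e = g e" if "additive f" "additive g"
    "\<And>a Ds. ?D Ds \<Longrightarrow> f (scE S a (wedge S Ds)) = g (scE S a (wedge S Ds))" for f g :: "'e \<Rightarrow> 'm" and e
    by (induction e rule: presented_module_induct[OF presentations(1)])
      (simp_all add: that additive.zero[OF that(1)] additive.zero[OF that(2)]
        additive.add[OF that(1)] additive.add[OF that(2)])
  have add_right: "hE (s + t) e = hE s e + hE t e" for s t e
    by (rule hE_eqI[of "hE (s + t)" "\<lambda>e. hE s e + hE t e"])
      (auto simp: hE_add hE S.scale_right_distrib additive.add[OF hS_add] additive.add[OF hE_add] additive_def)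
  have scale_right: "hE (scS S b s) e = hE s (scE S b e)" for b s e
    by (rule hE_eqI[of "hE (scS S b s)" "\<lambda>e. hE s (scE S b e)"])
      (auto simp: hE_add hE additive.add[OF hE_add] additive_def E.scale_right_distrib mult.commute)
  let ?\<phi> = "\<lambda>a (e, s). hE s (scE S a e)"
  have add: "additive (\<lambda>a. ?\<phi> a g)" for g
    by (cases g) (simp add: additive_def E.scale_left_distrib additive.add[OF hE_add])
  have "formal_eval ?\<phi> (free_scale b f) = 0"
    if "f \<in> {formal [(1, (x + y, z)), (-1, (x, z)), (-1, (y, z))] |x y z. True} \<union>
        {formal [(1, (x, y + z)), (-1, (x, y)), (-1, (x, z))] |x y z. True} \<union>
        {formal [(1, (scE S a x, y)), (- a, (x, y))] |a x y. True} \<union>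
        {formal [(1, (x, scS S a y)), (- a, (x, y))] |a x y. True}" for f b
    using that
  proof -
    note eval = free_scale_formal formal_eval_formal[OF add] additive.minus[OF hE_add]
    from that consider
      x y z where "f = formal [(1, (x + y, z)), (-1, (x, z)), (-1, (y, z))]"
      | x y z where "f = formal [(1, (x, y + z)), (-1, (x, y)), (-1, (x, z))]"
      | a x y where "f = formal [(1, (scE S a x, y)), (- a, (x, y))]"
      | a x y where "f = formal [(1, (x, scS S a y)), (- a, (x, y))]"
      by blast
    then show ?thesis
    proof cases
      case 1
      then show ?thesis
        by (simp add: eval E.scale_right_distrib additive.add[OF hE_add])
    next
      case 2
      then show ?thesis
        by (simp add: eval add_right)
    next
      case 3
      then show ?thesis
        by (simp add: eval)
    next
      case (4 a x y)
      have "hE (scS S a y) (scE S b x) = hE y (scE S (b * a) x)"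
        by (simp add: scale_right mult.commute)
      then show ?thesis
        using 4 by (simp add: eval)
    qed
  qed
  from presented_module_extension[OF presentations(3) add this]
  obtain h where h: "additive h" "\<And>a g. h (scW S a (case g of (x, y) \<Rightarrow> tns S x y)) = ?\<phi> a g"
    using UNIV_I by metis
  have "h (scW S r (ten S Ds Xs)) = \<psi> r Ds Xs" if "?D Ds" for r Ds Xs
    using that h(2)[of r "(wedge S Ds, symprod S Xs)"] hS[of Ds 1 Xs] hE[of Ds _ r] by (simp add: ten_def hS)
  with h(1) show ?thesis by blast
qed

lemma extend:
  assumes "multilinear_form \<psi>"
  shows additive_extend: "additive (extend \<psi>)"
    and extend_ten: "set Ds \<subseteq> Der A \<Longrightarrow> extend \<psi> (scW S r (ten S Ds Xs)) = \<psi> r Ds Xs"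
  using someI_ex[OF extend_exists[OF assms]] by (simp_all add: extend_def)

end

section \<open>Multiplication by derivations and by elements of L\<close>

context sym_ad_algebra
begin

text \<open>Unification leaves sums of derivations in \<open>\<eta>\<close>-long form, where this rule would unfold them.\<close>
declare plus_fun_apply [simp del]

abbreviation one :: 'w where "one \<equiv> ten S [] []"

definition mulD :: "('r \<Rightarrow> 'r) \<Rightarrow> 'w \<Rightarrow> 'w" where
  "mulD D = extend (\<lambda>r Ds Xs. scW S r (ten S (D # Ds) Xs))"

definition mulX :: "'l \<Rightarrow> 'w \<Rightarrow> 'w" where
  "mulX X = extend (\<lambda>r Ds Xs. scW S r (ten S Ds (X # Xs)))"

lemma ten_alternating: "set us \<union> set vs \<union> {x} \<subseteq> Der A \<Longrightarrow> ten S (us @ x # x # vs) Xs = 0"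
  by (rule ten_not_distinct) auto

lemma mulD_form: "D \<in> Der A \<Longrightarrow> multilinear_form (\<lambda>r Ds Xs. scW S r (ten S (D # Ds) Xs))"
proof (rule multilinear_formI, goal_cases)
  case (2 a us vs x y Xs)
  then show ?case
    using ten_D_add[of "D # us" vs x y Xs] by (simp add: W.scale_right_distrib)
next
  case (3 a b us vs x Xs)
  then show ?case
    using ten_D_scale[of "D # us" vs x b Xs] by simp
next
  case (4 a us vs x Xs)
  then show ?case
    using ten_alternating[of "D # us" vs x Xs] by simp
qed (simp_all add: additive_def W.scale_left_distrib W.scale_right_distrib ten_X_add ten_X_scale ten_X_swap)

lemma mulX_form: "multilinear_form (\<lambda>r Ds Xs. scW S r (ten S Ds (X # Xs)))"
proof (rule multilinear_formI, goal_cases)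
  case (5 a Ds us vs x y)
  then show ?case
    using ten_X_add[of Ds "X # us" x y vs] by (simp add: W.scale_right_distrib)
next
  case (6 a b Ds us vs x)
  then show ?case
    using ten_X_scale[of Ds "X # us" b x vs] by simp
next
  case (7 a Ds us vs x y)
  then show ?case
    using ten_X_swap[of Ds "X # us" x y vs] by simp
qed (simp_all add: additive_def W.scale_left_distrib W.scale_right_distrib ten_D_add ten_D_scale ten_alternating)

lemma additive_scW: "additive (scW S a)" "additive (\<lambda>a. scW S a w)"
  by (simp_all add: module_additive modules)

lemma additive_mulD: "D \<in> Der A \<Longrightarrow> additive (mulD D)" and additive_mulX: "additive (mulX X)"
  unfolding mulD_def mulX_def by (simp_all add: additive_extend mulD_form mulX_form)

lemma additive_compose: "additive f \<Longrightarrow> additive g \<Longrightarrow> additive (\<lambda>x. f (g x))"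
  by (simp add: additive_def)

lemma additive_plus: "additive f \<Longrightarrow> additive g \<Longrightarrow> additive (\<lambda>x. f x + g x)"
  and additive_minus: "additive f \<Longrightarrow> additive g \<Longrightarrow> additive (\<lambda>x. f x - g x)"
  and additive_uminus: "additive f \<Longrightarrow> additive (\<lambda>x. - f x)"
  and additive_zero: "additive (\<lambda>x. 0)"
  by (simp_all add: additive_def algebra_simps)

lemma mulD_scW_ten: "D \<in> Der A \<Longrightarrow> set Ds \<subseteq> Der A \<Longrightarrow> mulD D (scW S r (ten S Ds Xs)) = scW S r (ten S (D # Ds) Xs)"
  and mulX_scW_ten: "set Ds \<subseteq> Der A \<Longrightarrow> mulX X (scW S r (ten S Ds Xs)) = scW S r (ten S Ds (X # Xs))"
  by (simp_all add: mulD_def mulX_def extend_ten mulD_form mulX_form)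

lemma mulD_scW: "D \<in> Der A \<Longrightarrow> mulD D (scW S a w) = scW S a (mulD D w)"
  and mulX_scW: "mulX X (scW S a w) = scW S a (mulX X w)"
proof -
  show "mulD D (scW S a w) = scW S a (mulD D w)" if "D \<in> Der A"
    by (rule ten_eqI[where w = w])
      (simp_all add: additive_compose additive_scW additive_mulD that mulD_scW_ten)
  show "mulX X (scW S a w) = scW S a (mulX X w)"
    by (rule ten_eqI[where w = w])
      (simp_all add: additive_compose additive_scW additive_mulX mulX_scW_ten)
qed

lemma mulD_ten: "D \<in> Der A \<Longrightarrow> set Ds \<subseteq> Der A \<Longrightarrow> mulD D (ten S Ds Xs) = ten S (D # Ds) Xs"
  and mulX_ten: "set Ds \<subseteq> Der A \<Longrightarrow> mulX X (ten S Ds Xs) = ten S Ds (X # Xs)"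
  using mulD_scW_ten[of D Ds 1 Xs] mulX_scW_ten[of Ds X 1 Xs] by simp_all

lemmas mulD_simps = additive_mulD[THEN additive.add] additive_mulD[THEN additive.zero]
  additive_mulD[THEN additive.minus] additive_mulD[THEN additive.diff] mulD_scW mulD_ten
lemmas mulX_simps = additive_mulX[THEN additive.add] additive_mulX[THEN additive.zero]
  additive_mulX[THEN additive.minus] additive_mulX[THEN additive.diff] mulX_scW mulX_ten

lemma mulX_commute: "mulX X (mulX Y w) = mulX Y (mulX X w)"
  by (rule ten_eqI[where w = w])
    (simp_all add: additive_compose additive_mulX mulX_simps ten_X_swap[of _ "[]" X, simplified])

lemma mulX_mulD: "D \<in> Der A \<Longrightarrow> mulX X (mulD D w) = mulD D (mulX X w)"
  by (rule ten_eqI[where w = w])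
    (simp_all add: additive_compose additive_mulX additive_mulD mulX_simps mulD_simps)

lemma mulD_mulD: "D \<in> Der A \<Longrightarrow> E \<in> Der A \<Longrightarrow> mulD D (mulD E w) = - mulD E (mulD D w)"
  by (rule ten_eqI[where w = w])
    (auto simp: additive_compose additive_uminus additive_mulX additive_mulD mulX_simps mulD_simps
      ten_D_swap[of "[]" _ D E, simplified])

lemma mulD_self: "D \<in> Der A \<Longrightarrow> mulD D (mulD D w) = 0"
  by (rule ten_eqI[where w = w])
    (auto simp: additive_compose additive_zero additive_mulX additive_mulD mulX_simps mulD_simps
      ten_alternating[of "[]" _ D, simplified])

lemma mulD_left:
  "D \<in> Der A \<Longrightarrow> E \<in> Der A \<Longrightarrow> mulD (D + E) w = mulD D w + mulD E w"
  "D \<in> Der A \<Longrightarrow> mulD (der_scale a D) w = scW S a (mulD D w)"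
proof -
  show "mulD (D + E) w = mulD D w + mulD E w" if assms: "D \<in> Der A" "E \<in> Der A"
    by (rule ten_eqI[where w = w])
      (use assms Der_closed ten_D_add[of "[]" _ D E] in
        \<open>simp_all add: additive_mulD additive_plus mulD_simps W.scale_right_distrib\<close>)
  show "mulD (der_scale a D) w = scW S a (mulD D w)" if assms: "D \<in> Der A"
    by (rule ten_eqI[where w = w])
      (use assms Der_closed ten_D_scale[of "[]" _ D a] in
        \<open>simp_all add: additive_mulD additive_scW additive_compose mulD_simps mult.commute\<close>)
qed

lemma mulX_left:
  "mulX (X + Y) w = mulX X w + mulX Y w" "mulX (act A a X) w = scW S a (mulX X w)"
proof -
  show "mulX (X + Y) w = mulX X w + mulX Y w"
    by (rule ten_eqI[where w = w])
      (use ten_X_add[of _ "[]" X Y] in \<open>simp_all add: additive_mulX additive_plus mulX_simps W.scale_right_distrib\<close>)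
  show "mulX (act A a X) w = scW S a (mulX X w)"
    by (rule ten_eqI[where w = w])
      (use ten_X_scale[of _ "[]" a X] in
        \<open>simp_all add: additive_mulX additive_scW additive_compose mulX_simps mult.commute\<close>)
qed

lemma additive_mulX_left: "additive (\<lambda>X. mulX X w)"
  by (simp add: additive_def mulX_left)

lemma mulD_diff_left: "D \<in> Der A \<Longrightarrow> E \<in> Der A \<Longrightarrow> mulD (D - E) w = mulD D w - mulD E w"
  using mulD_left(1)[of "D - E" E w] Der_closed(2)[of D E] by simp

text \<open>Everything is generated from 1 by these multiplications, so an identity of operators
  reduces to commutators with scalars, \<open>mulD\<close> and \<open>mulX\<close>, and no positions
  or position signs have to be tracked.\<close>

lemma mul_induct [case_names add scale one mulD mulX]:
  assumes "\<And>v w. P v \<Longrightarrow> P w \<Longrightarrow> P (v + w)" "\<And>a w. P w \<Longrightarrow> P (scW S a w)" "P one"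
    and D: "\<And>D w. D \<in> Der A \<Longrightarrow> P w \<Longrightarrow> P (mulD D w)" and X: "\<And>X w. P w \<Longrightarrow> P (mulX X w)"
  shows "P w"
proof (induction w rule: ten_induct)
  case 1
  show ?case using assms(2)[OF assms(3), of 0] by simp
next
  case (3 r Ds Xs)
  have "P (ten S [] Xs)"
    using X[of "ten S [] _"] assms(3) by (induction Xs) (simp_all add: mulX_simps)
  then have "P (ten S Ds Xs)"
    using \<open>set Ds \<subseteq> _\<close> by (induction Ds) (auto intro: D simp flip: mulD_ten)
  then show ?case by (rule assms(2))
qed (rule assms)

subsection \<open>Sums over the symmetric factors\<close>

text \<open>\<open>cosum g w\<close> is \<open>\<Sum>\<^sub>j g(X\<^sub>j, w\<^sub>(\<^sub>j\<^sub>))\<close> for \<open>R\<close>-balanced \<open>g\<close>.\<close>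

definition balanced :: "('l \<Rightarrow> 'w \<Rightarrow> 'm::ab_group_add) \<Rightarrow> bool" where
  "balanced g \<longleftrightarrow> (\<forall>X. additive (g X)) \<and> (\<forall>w. additive (\<lambda>X. g X w)) \<and>
     (\<forall>a X w. g (act A a X) w = g X (scW S a w))"

primrec cosum_list :: "('l \<Rightarrow> 'w \<Rightarrow> 'm::ab_group_add) \<Rightarrow> ('r \<Rightarrow> 'r) list \<Rightarrow> 'l list \<Rightarrow> 'm" where
  "cosum_list g Ds [] = 0"
| "cosum_list g Ds (X # Xs) = g X (ten S Ds Xs) + cosum_list (\<lambda>Y w. g Y (mulX X w)) Ds Xs"

definition cosum :: "('l \<Rightarrow> 'w \<Rightarrow> 'm::ab_group_add) \<Rightarrow> 'w \<Rightarrow> 'm" where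
  "cosum g = extend (\<lambda>r. cosum_list (\<lambda>X w. g X (scW S r w)))"

lemma balancedI:
  assumes "\<And>X. additive (g X)" "\<And>w. additive (\<lambda>X. g X w)" "\<And>a X w. g (act A a X) w = g X (scW S a w)"
  shows "balanced g"
  using assms by (simp add: balanced_def)

lemma balancedD:
  assumes "balanced g"
  shows "g X (v + w) = g X v + g X w" "g X 0 = 0" "g X (- v) = - g X v" "g X (v - w) = g X v - g X w"
    "g (X + Y) w = g X w + g Y w" "g 0 w = 0" "g (- X) w = - g X w" "g (X - Y) w = g X w - g Y w"
    "g (act A a X) w = g X (scW S a w)"
proof -
  have 1: "additive (g X)" and 2: "additive (\<lambda>X. g X w)" for X w
    using assms by (simp_all add: balanced_def)
  show "g X (v + w) = g X v + g X w" "g X 0 = 0" "g X (- v) = - g X v" "g X (v - w) = g X v - g X w"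
    "g (X + Y) w = g X w + g Y w" "g 0 w = 0" "g (- X) w = - g X w" "g (X - Y) w = g X w - g Y w"
    "g (act A a X) w = g X (scW S a w)"
    using additive.add[OF 1] additive.zero[OF 1] additive.minus[OF 1] additive.diff[OF 1]
      additive.add[OF 2] additive.zero[OF 2] additive.minus[OF 2] additive.diff[OF 2] assms
    by (simp_all add: balanced_def)
qed

lemma balanced_additive: "balanced g \<Longrightarrow> additive (g X)"
  by (simp add: balanced_def)

lemma balanced_right:
  assumes "balanced g"
  shows "additive f \<Longrightarrow> (\<And>a w. f (scW S a w) = scW S a (f w)) \<Longrightarrow> balanced (\<lambda>X w. g X (f w))"
    and "additive h \<Longrightarrow> balanced (\<lambda>X w. h (g X w))"
  using assms by (auto intro!: balancedI simp: additive_def balancedD)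

lemma balanced_scW: "balanced g \<Longrightarrow> balanced (\<lambda>X w. g X (scW S a w))"
  by (rule balanced_right(1)) (simp_all add: additive_scW mult.commute)

lemma balanced_mulX: "balanced g \<Longrightarrow> balanced (\<lambda>Y w. g Y (mulX X w))"
  by (rule balanced_right(1)) (simp_all add: additive_mulX mulX_simps)

lemma balanced_mulD: "balanced g \<Longrightarrow> D \<in> Der A \<Longrightarrow> balanced (\<lambda>Y w. g Y (mulD D w))"
  by (rule balanced_right(1)) (simp_all add: additive_mulD mulD_simps)

lemma balanced_plus: "balanced g \<Longrightarrow> balanced h \<Longrightarrow> balanced (\<lambda>X w. g X w + h X w)"
  and balanced_minus: "balanced g \<Longrightarrow> balanced h \<Longrightarrow> balanced (\<lambda>X w. g X w - h X w)"
  by (auto intro!: balancedI simp: additive_def balancedD)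

lemma cosum_list_add: "cosum_list (\<lambda>X w. g X w + h X w) Ds Xs = cosum_list g Ds Xs + cosum_list h Ds Xs"
  by (induction Xs arbitrary: g h) (simp_all add: algebra_simps)

lemma cosum_list_eq_sum:
  "set Ds \<subseteq> Der A \<Longrightarrow> cosum_list g Ds Xs = (\<Sum>j<length Xs. g (Xs ! j) (ten S Ds (remove_nth j Xs)))"
  by (induction Xs arbitrary: g)
    (simp_all add: sum.lessThan_Suc_shift mulX_simps del: sum.lessThan_Suc)

text \<open>The scalar is placed in the second slot of g. Balancedness is what makes this agree with
  pulling a scalar out of the factor that is removed.\<close>

lemma cosum_form:
  assumes "balanced g"
  shows "multilinear_form (\<lambda>r. cosum_list (\<lambda>X w. g X (scW S r w)))"
proof (rule multilinear_formI, goal_cases)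
  case (1 Ds Xs)
  show ?case
    by (rule additive.intro) (simp add: W.scale_left_distrib balancedD[OF assms] cosum_list_add)
next
  case (2 a us vs x y Xs)
  have "set (us @ (x + y) # vs) \<subseteq> Der A" "set (us @ x # vs) \<subseteq> Der A" "set (us @ y # vs) \<subseteq> Der A"
    using 2 Der_closed by auto
  with 2 show ?case
    by (simp only: cosum_list_eq_sum)
      (simp add: ten_D_add W.scale_right_distrib balancedD[OF assms] sum.distrib)
next
  case (3 a b us vs x Xs)
  have "set (us @ der_scale b x # vs) \<subseteq> Der A" "set (us @ x # vs) \<subseteq> Der A"
    using 3 Der_closed by auto
  with 3 show ?case
    by (simp only: cosum_list_eq_sum) (simp add: ten_D_scale)
next
  case (4 a us vs x Xs)
  have "set (us @ x # x # vs) \<subseteq> Der A"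
    using 4 by auto
  with 4 show ?case
    by (simp only: cosum_list_eq_sum) (simp add: ten_alternating balancedD[OF assms])
next
  case (5 a Ds us vs x y)
  have "cosum_list g Ds (us @ (x + y) # vs) = cosum_list g Ds (us @ x # vs) + cosum_list g Ds (us @ y # vs)"
    if "balanced g" for g :: "'l \<Rightarrow> 'w \<Rightarrow> 'a"
    using that
  proof (induction us arbitrary: g)
    case Nil
    show ?case
      by (simp add: balancedD[OF Nil] mulX_left cosum_list_add algebra_simps)
  next
    case (Cons Z us)
    show ?case
      using Cons.IH[OF balanced_mulX[OF Cons.prems]]
      by (simp add: ten_X_add balancedD[OF Cons.prems] algebra_simps)
  qed
  from this[OF balanced_scW[OF assms]] show ?case .
next
  case (6 a b Ds us vs x)
  have "cosum_list g Ds (us @ act A b x # vs) = cosum_list (\<lambda>X w. g X (scW S b w)) Ds (us @ x # vs)"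
    if "balanced g" for g :: "'l \<Rightarrow> 'w \<Rightarrow> 'a"
    using that
  proof (induction us arbitrary: g)
    case Nil
    show ?case
      by (simp add: balancedD[OF Nil] mulX_left)
  next
    case (Cons Z us)
    show ?case
      using Cons.IH[OF balanced_mulX[OF Cons.prems]]
      by (simp add: ten_X_scale mulX_simps)
  qed
  from this[OF balanced_scW[OF assms]] show ?case
    by simp
next
  case (7 a Ds us vs x y)
  have "cosum_list g Ds (us @ x # y # vs) = cosum_list g Ds (us @ y # x # vs)"
    if "balanced g" for g :: "'l \<Rightarrow> 'w \<Rightarrow> 'a"
    using that
  proof (induction us arbitrary: g)
    case Nil
    show ?case
      by (simp add: mulX_ten[OF 7, symmetric] mulX_commute[of x y] algebra_simps)
  next
    case (Cons Z us)
    show ?case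
      using Cons.IH[OF balanced_mulX[OF Cons.prems]]
      by (simp add: ten_X_swap)
  qed
  from this[OF balanced_scW[OF assms]] show ?case .
qed

context
  fixes g :: "'l \<Rightarrow> 'w \<Rightarrow> 'm::ab_group_add"
  assumes g: "balanced g"
begin

lemma additive_cosum: "additive (cosum g)"
  unfolding cosum_def by (rule additive_extend[OF cosum_form[OF g]])

lemma cosum_scW_ten:
  "set Ds \<subseteq> Der A \<Longrightarrow> cosum g (scW S r (ten S Ds Xs)) = cosum_list (\<lambda>X w. g X (scW S r w)) Ds Xs"
  unfolding cosum_def by (rule extend_ten[OF cosum_form[OF g]])

lemma cosum_ten:
  assumes "set Ds \<subseteq> Der A"
  shows "cosum g (ten S Ds Xs) = (\<Sum>j<length Xs. g (Xs ! j) (ten S Ds (remove_nth j Xs)))"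
  using cosum_scW_ten[OF assms, of 1 Xs] by (simp add: cosum_list_eq_sum assms)

lemma cosum_one: "cosum g one = 0"
  using cosum_ten[of "[]" "[]"] by simp

lemmas cosum_lin = additive_cosum[THEN additive.add] additive_cosum[THEN additive.zero]
  additive_cosum[THEN additive.minus] additive_cosum[THEN additive.diff]

end

lemma cosum_scW: "balanced g \<Longrightarrow> cosum g (scW S a w) = cosum (\<lambda>X w. g X (scW S a w)) w"
  by (rule ten_eqI[where w = w])
    (simp_all add: additive_compose additive_scW additive_cosum balanced_scW cosum_scW_ten mult.commute)

lemma cosum_mulX: "balanced g \<Longrightarrow> cosum g (mulX X w) = g X w + cosum (\<lambda>Y w. g Y (mulX X w)) w"
  by (rule ten_eqI[where w = w])
    (simp_all add: additive_compose additive_plus additive_mulX additive_cosum balanced_mulX cosum_scW_ten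
      balanced_additive mulX_simps)

lemma cosum_mulD: "balanced g \<Longrightarrow> D \<in> Der A \<Longrightarrow> cosum g (mulD D w) = cosum (\<lambda>Y w. g Y (mulD D w)) w"
  by (rule ten_eqI[where w = w])
    (simp_all add: additive_compose additive_mulD additive_cosum balanced_mulD cosum_scW_ten
      balanced_additive mulD_simps cosum_list_eq_sum)

lemma cosum_compose:
  assumes "balanced g" "additive f"
  shows "f (cosum g w) = cosum (\<lambda>X w. f (g X w)) w"
proof (rule ten_eqI[where w = w])
  have b: "balanced (\<lambda>X w. f (g X w))"
    by (rule balanced_right(2)) fact+
  show "additive (\<lambda>w. f (cosum g w))"
    by (rule additive_compose[OF assms(2) additive_cosum[OF assms(1)]])
  show "additive (cosum (\<lambda>X w. f (g X w)))"
    by (rule additive_cosum[OF b])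
  fix r Ds Xs assume "set Ds \<subseteq> Der A"
  then show "f (cosum g (scW S r (ten S Ds Xs))) = cosum (\<lambda>X w. f (g X w)) (scW S r (ten S Ds Xs))"
    by (simp add: cosum_scW_ten b assms(1) cosum_list_eq_sum additive.sum[OF assms(2)])
qed

lemma cosum_add: "balanced g \<Longrightarrow> balanced h \<Longrightarrow> cosum (\<lambda>X w. g X w + h X w) w = cosum g w + cosum h w"
  by (rule ten_eqI[where w = w])
    (simp_all add: additive_plus additive_cosum balanced_plus cosum_scW_ten cosum_list_add)

lemma cosum_diff: "balanced g \<Longrightarrow> balanced h \<Longrightarrow> cosum (\<lambda>X w. g X w - h X w) w = cosum g w - cosum h w"
  using cosum_add[of "\<lambda>X w. g X w - h X w" h w] by (simp add: balanced_minus)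

lemma cosum_uminus: "balanced g \<Longrightarrow> cosum (\<lambda>X w. - g X w) w = - cosum g w"
  using cosum_compose[of g uminus w] by (simp add: additive_def)

lemma cosum_cong: "(\<And>X w. g X w = h X w) \<Longrightarrow> cosum g w = cosum h w"
  by presburger

subsection \<open>Contractions\<close>

text \<open>The conditions under which the alternating sum of k(D_i), applied to the tensor without
  D_i, is well defined. Evaluation at r, the maps h_{r,X} and the contractions with \<eta> are all
  of this form.\<close>

definition contraction_form :: "(('r \<Rightarrow> 'r) \<Rightarrow> 'w \<Rightarrow> 'w) \<Rightarrow> bool" where
  "contraction_form k \<longleftrightarrow>
     (\<forall>D\<in>Der A. additive (k D) \<and> (\<forall>a w. k D (scW S a w) = scW S a (k D w)) \<and>
        (\<forall>E\<in>Der A. \<forall>w. k D (mulD E w) = mulD E (k D w)) \<and> (\<forall>X w. k D (mulX X w) = mulX X (k D w)) \<and>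
        (\<forall>E\<in>Der A. \<forall>w. k (D + E) w = k D w + k E w) \<and> (\<forall>a w. k (der_scale a D) w = scW S a (k D w)))"

primrec contract_list :: "(('r \<Rightarrow> 'r) \<Rightarrow> 'w \<Rightarrow> 'w) \<Rightarrow> ('r \<Rightarrow> 'r) list \<Rightarrow> 'l list \<Rightarrow> 'w" where
  "contract_list k [] Xs = 0"
| "contract_list k (D # Ds) Xs = k D (ten S Ds Xs) - mulD D (contract_list k Ds Xs)"

definition contract :: "(('r \<Rightarrow> 'r) \<Rightarrow> 'w \<Rightarrow> 'w) \<Rightarrow> 'w \<Rightarrow> 'w" where
  "contract k = extend (\<lambda>r Ds Xs. scW S r (contract_list k Ds Xs))"

context
  fixes k :: "('r \<Rightarrow> 'r) \<Rightarrow> 'w \<Rightarrow> 'w"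
  assumes k: "contraction_form k"
begin

lemma contraction_formD:
  assumes "D \<in> Der A"
  shows "additive (k D)" "k D (v + w) = k D v + k D w" "k D 0 = 0" "k D (- w) = - k D w"
    "k D (scW S a w) = scW S a (k D w)" "E \<in> Der A \<Longrightarrow> k D (mulD E w) = mulD E (k D w)"
    "k D (mulX X w) = mulX X (k D w)" "E \<in> Der A \<Longrightarrow> k (D + E) w = k D w + k E w"
    "k (der_scale a D) w = scW S a (k D w)"
proof -
  show add: "additive (k D)"
    using assms k by (simp add: contraction_form_def)
  show "k D (v + w) = k D v + k D w" "k D 0 = 0" "k D (- w) = - k D w"
    using additive.add[OF add] additive.zero[OF add] additive.minus[OF add] by simp_all
  show "k D (scW S a w) = scW S a (k D w)" "E \<in> Der A \<Longrightarrow> k D (mulD E w) = mulD E (k D w)"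
    "k D (mulX X w) = mulX X (k D w)" "E \<in> Der A \<Longrightarrow> k (D + E) w = k D w + k E w"
    "k (der_scale a D) w = scW S a (k D w)"
    using assms k by (simp_all add: contraction_form_def)
qed

lemma contract_form: "multilinear_form (\<lambda>r Ds Xs. scW S r (contract_list k Ds Xs))"
proof (rule multilinear_formI, goal_cases)
  case (2 a us vs x y Xs)
  from 2(1) have "contract_list k (us @ (x + y) # vs) Xs =
      contract_list k (us @ x # vs) Xs + contract_list k (us @ y # vs) Xs"
  proof (induction us)
    case Nil
    then show ?case using 2 by (simp add: contraction_formD mulD_left)
  next
    case (Cons D us)
    then show ?case using 2 by (simp add: contraction_formD ten_D_add mulD_simps)
  qed
  then show ?case by (simp add: W.scale_right_distrib)
next
  case (3 a b us vs x Xs)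
  from 3(1) have "contract_list k (us @ der_scale b x # vs) Xs = scW S b (contract_list k (us @ x # vs) Xs)"
  proof (induction us)
    case Nil
    then show ?case using 3 by (simp add: contraction_formD mulD_left W.scale_right_diff_distrib)
  next
    case (Cons D us)
    then show ?case using 3 by (simp add: contraction_formD ten_D_scale mulD_simps W.scale_right_diff_distrib)
  qed
  then show ?case by simp
next
  case (4 a us vs x Xs)
  from 4(1) have "contract_list k (us @ x # x # vs) Xs = 0"
  proof (induction us)
    case Nil
    \<comment> \<open>The term of x multiplied by k(x) occurs twice with opposite signs, and the
      rest contains x twice.\<close>
    then show ?case using 4 by (simp add: mulD_simps(1-5) mulD_self contraction_formD flip: mulD_ten)
  next
    case (Cons D us)
    then show ?case using 4 by (simp add: contraction_formD ten_alternating mulD_simps)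
  qed
  then show ?case by simp
next
  case (5 a Ds us vs x y)
  then have "contract_list k Ds (us @ (x + y) # vs) = contract_list k Ds (us @ x # vs) + contract_list k Ds (us @ y # vs)"
    by (induction Ds) (simp_all add: ten_X_add contraction_formD mulD_simps)
  then show ?case by (simp add: W.scale_right_distrib)
next
  case (6 a b Ds us vs x)
  then have "contract_list k Ds (us @ act A b x # vs) = scW S b (contract_list k Ds (us @ x # vs))"
    by (induction Ds) (simp_all add: ten_X_scale contraction_formD mulD_simps W.scale_right_diff_distrib)
  then show ?case by simp
next
  case (7 a Ds us vs x y)
  then have "contract_list k Ds (us @ x # y # vs) = contract_list k Ds (us @ y # x # vs)"
    by (induction Ds) (simp_all add: ten_X_swap)
  then show ?case by simp
qed (simp add: additive_scW)

lemma additive_contract: "additive (contract k)"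
  unfolding contract_def by (rule additive_extend[OF contract_form])

lemma contract_scW_ten:
  "set Ds \<subseteq> Der A \<Longrightarrow> contract k (scW S r (ten S Ds Xs)) = scW S r (contract_list k Ds Xs)"
  unfolding contract_def by (rule extend_ten[OF contract_form])

lemma contract_ten_list: "set Ds \<subseteq> Der A \<Longrightarrow> contract k (ten S Ds Xs) = contract_list k Ds Xs"
  using contract_scW_ten[of Ds 1 Xs] by simp

lemma contract_ten:
  assumes "set Ds \<subseteq> Der A"
  shows "contract k (ten S Ds Xs) = (\<Sum>i<length Ds. alt_sign i (k (Ds ! i) (ten S (remove_nth i Ds) Xs)))"
proof -
  have "contract_list k Ds Xs = (\<Sum>i<length Ds. alt_sign i (k (Ds ! i) (ten S (remove_nth i Ds) Xs)))"
    using assms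
  proof (induction Ds)
    case (Cons D Ds)
    have set: "set (remove_nth i Ds) \<subseteq> Der A" "Ds ! i \<in> Der A" if "i < length Ds" for i
      using Cons.prems that set_take_subset[of i Ds] set_drop_subset[of "Suc i" Ds]
      by (auto simp: remove_nth_def dest: nth_mem)
    have "mulD D (\<Sum>i<length Ds. alt_sign i (k (Ds ! i) (ten S (remove_nth i Ds) Xs))) =
        (\<Sum>i<length Ds. alt_sign i (k (Ds ! i) (ten S (D # remove_nth i Ds) Xs)))"
      unfolding additive.sum[OF additive_mulD[of D]] 
      using Cons.prems set
      by (intro trans[OF additive.sum[OF additive_mulD]] sum.cong refl)
        (auto simp: additive_alt_sign[OF additive_mulD] contraction_formD simp flip: mulD_ten)
    then show ?case
      using Cons by (simp add: sum.lessThan_Suc_shift sum_negf del: sum.lessThan_Suc)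
  qed simp
  then show ?thesis by (simp add: contract_ten_list assms)
qed

lemma contract_one: "contract k one = 0"
  by (simp add: contract_ten_list)

lemmas contract_lin = additive_contract[THEN additive.add] additive_contract[THEN additive.zero]
  additive_contract[THEN additive.minus] additive_contract[THEN additive.diff]

lemma contract_scW: "contract k (scW S a w) = scW S a (contract k w)"
  by (rule ten_eqI[where w = w])
    (simp_all add: additive_compose additive_scW additive_contract contract_scW_ten)

lemma contract_mulX: "contract k (mulX X w) = mulX X (contract k w)"
proof (rule ten_eqI[where w = w])
  fix r Ds Xs assume D: "set Ds \<subseteq> Der A"
  then have "contract_list k Ds (X # Xs) = mulX X (contract_list k Ds Xs)"
    by (induction Ds) (simp_all add: mulX_simps mulX_mulD contraction_formD flip: mulX_ten)
  with D show "contract k (mulX X (scW S r (ten S Ds Xs))) = mulX X (contract k (scW S r (ten S Ds Xs)))"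
    by (simp add: mulX_simps contract_scW_ten)
qed (simp_all add: additive_compose additive_mulX additive_contract)

lemma contract_mulD: "D \<in> Der A \<Longrightarrow> contract k (mulD D w) = k D w - mulD D (contract k w)"
  by (rule ten_eqI[where w = w])
    (simp_all add: additive_compose additive_minus additive_mulD additive_contract mulD_simps contract_scW_ten
      contraction_formD W.scale_right_diff_distrib)

end

subsection \<open>Derivations\<close>

text \<open>Compatibility of f and g with the derivation \<rho>(Z) of R, so that the Leibniz rule is
  consistent with tensors over R.\<close>

definition derivation_form :: "'l \<Rightarrow> (('r \<Rightarrow> 'r) \<Rightarrow> ('r \<Rightarrow> 'r)) \<Rightarrow> ('l \<Rightarrow> 'l) \<Rightarrow> bool" where
  "derivation_form Z f g \<longleftrightarrow>
     (\<forall>D\<in>Der A. f D \<in> Der A \<and> (\<forall>E\<in>Der A. f (D + E) = f D + f E) \<and>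
        (\<forall>a. f (der_scale a D) = der_scale (anc A Z a) D + der_scale a (f D))) \<and>
     (\<forall>X Y. g (X + Y) = g X + g Y) \<and> (\<forall>a X. g (act A a X) = act A (anc A Z a) X + act A a (g X))"

primrec derive_X :: "('l \<Rightarrow> 'l) \<Rightarrow> 'l list \<Rightarrow> 'w" where
  "derive_X g [] = 0"
| "derive_X g (X # Xs) = ten S [] (g X # Xs) + mulX X (derive_X g Xs)"

primrec derive_list :: "(('r \<Rightarrow> 'r) \<Rightarrow> ('r \<Rightarrow> 'r)) \<Rightarrow> ('l \<Rightarrow> 'l) \<Rightarrow> ('r \<Rightarrow> 'r) list \<Rightarrow> 'l list \<Rightarrow> 'w" where
  "derive_list f g [] Xs = derive_X g Xs"
| "derive_list f g (D # Ds) Xs = ten S (f D # Ds) Xs + mulD D (derive_list f g Ds Xs)"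

definition derivation :: "'l \<Rightarrow> (('r \<Rightarrow> 'r) \<Rightarrow> ('r \<Rightarrow> 'r)) \<Rightarrow> ('l \<Rightarrow> 'l) \<Rightarrow> 'w \<Rightarrow> 'w" where
  "derivation Z f g =
     extend (\<lambda>r Ds Xs. scW S (anc A Z r) (ten S Ds Xs) + scW S r (derive_list f g Ds Xs))"

context
  fixes Z f g
  assumes fg: "derivation_form Z f g"
begin

lemma derivation_formD:
  "D \<in> Der A \<Longrightarrow> f D \<in> Der A" "D \<in> Der A \<Longrightarrow> E \<in> Der A \<Longrightarrow> f (D + E) = f D + f E"
  "D \<in> Der A \<Longrightarrow> f (der_scale a D) = der_scale (anc A Z a) D + der_scale a (f D)"
  "g (X + Y) = g X + g Y" "g (act A a X) = act A (anc A Z a) X + act A a (g X)"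
  using fg by (simp_all add: derivation_form_def)

lemma derive_list_leibniz:
  assumes "set us \<subseteq> Der A" "set vs \<subseteq> Der A" "x \<in> Der A"
  shows "derive_list f g (us @ der_scale b x # vs) Xs =
    scW S (anc A Z b) (ten S (us @ x # vs) Xs) + scW S b (derive_list f g (us @ x # vs) Xs)"
  using assms(1)
proof (induction us)
  case Nil
  then show ?case
    using assms ten_D_add[of "[]" vs "der_scale (anc A Z b) x" "der_scale b (f x)" Xs]
      ten_D_scale[of "[]" vs] Der_closed
    by (simp add: derivation_formD mulD_left W.scale_right_distrib)
next
  case (Cons D us)
  then show ?case
    using assms ten_D_scale[of "f D # us" vs x b Xs]
    by (simp add: derivation_formD mulD_simps W.scale_right_distrib algebra_simps)
qed

lemma derive_list_leibniz_X:
  assumes "set Ds \<subseteq> Der A"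
  shows "derive_list f g Ds (us @ act A b x # vs) =
    scW S (anc A Z b) (ten S Ds (us @ x # vs)) + scW S b (derive_list f g Ds (us @ x # vs))"
  using assms
proof (induction Ds)
  case Nil
  show ?case
  proof (induction us)
    case Nil
    then show ?case
      using ten_X_add[of "[]" "[]"] ten_X_scale[of "[]" "[]"]
      by (simp add: derivation_formD mulX_left W.scale_right_distrib)
  next
    case (Cons X us)
    then show ?case
      using ten_X_scale[of "[]" "g X # us" b x vs]
      by (simp add: mulX_simps W.scale_right_distrib algebra_simps)
  qed
next
  case (Cons D Ds)
  then show ?case
    by (simp add: derivation_formD mulD_simps ten_X_scale W.scale_right_distrib algebra_simps)
qed

lemma derivation_multilinear_form:
  "multilinear_form (\<lambda>r Ds Xs. scW S (anc A Z r) (ten S Ds Xs) + scW S r (derive_list f g Ds Xs))"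
proof (rule multilinear_formI, goal_cases)
  case (1 Ds Xs)
  show ?case
    by (simp add: additive_def anc_linear W.scale_left_distrib algebra_simps)
next
  case (2 a us vs x y Xs)
  from 2(1) have "derive_list f g (us @ (x + y) # vs) Xs =
      derive_list f g (us @ x # vs) Xs + derive_list f g (us @ y # vs) Xs"
  proof (induction us)
    case Nil
    then show ?case
      using 2 ten_D_add[of "[]" vs "f x" "f y" Xs]
      by (simp add: derivation_formD mulD_left algebra_simps)
  next
    case (Cons D us)
    then show ?case
      using 2 ten_D_add[of "f D # us" vs x y Xs] by (simp add: derivation_formD mulD_simps algebra_simps)
  qed
  then show ?case
    using 2 by (simp add: W.scale_right_distrib ten_D_add algebra_simps)
next
  case (3 a b us vs x Xs)
  then show ?case
    by (simp add: derive_list_leibniz ten_D_scale anc_linear W.scale_right_distrib W.scale_left_distrib algebra_simps)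
next
  case (4 a us vs x Xs)
  from 4(1) have "derive_list f g (us @ x # x # vs) Xs = 0"
  proof (induction us)
    case Nil
    then show ?case
      using 4 ten_D_swap[of "[]" vs "f x" x Xs]
      by (simp add: derivation_formD mulD_simps mulD_self)
  next
    case (Cons D us)
    then show ?case
      using 4 ten_alternating[of "f D # us" vs x Xs] by (simp add: derivation_formD mulD_simps)
  qed
  then show ?case
    using 4 by (simp add: ten_alternating)
next
  case (5 a Ds us vs x y)
  from 5 have "derive_list f g Ds (us @ (x + y) # vs) =
      derive_list f g Ds (us @ x # vs) + derive_list f g Ds (us @ y # vs)"
  proof (induction Ds)
    case Nil
    show ?case
    proof (induction us)
      case Nil
      then show ?case
        using ten_X_add[of "[]" "[]"] by (simp add: derivation_formD mulX_left algebra_simps)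
    next
      case (Cons X us)
      then show ?case
        using ten_X_add[of "[]" "g X # us" x y vs] by (simp add: mulX_simps algebra_simps)
    qed
  next
    case (Cons D Ds)
    then show ?case by (simp add: derivation_formD mulD_simps ten_X_add algebra_simps)
  qed
  then show ?case
    by (simp add: W.scale_right_distrib ten_X_add algebra_simps)
next
  case (6 a b Ds us vs x)
  then show ?case
    by (simp add: derive_list_leibniz_X ten_X_scale anc_linear W.scale_right_distrib W.scale_left_distrib algebra_simps)
next
  case (7 a Ds us vs x y)
  from 7 have "derive_list f g Ds (us @ x # y # vs) = derive_list f g Ds (us @ y # x # vs)"
  proof (induction Ds)
    case Nil
    show ?case
    proof (induction us)
      case Nil
      have "ten S [] (g x # y # vs) = ten S [] (y # g x # vs)" "ten S [] (x # g y # vs) = ten S [] (g y # x # vs)"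
        using ten_X_swap[of "[]" "[]"] by simp_all
      then show ?case
        by (simp add: mulX_simps mulX_commute[of x y] algebra_simps)
    next
      case (Cons X us)
      then show ?case
        using ten_X_swap[of "[]" "g X # us" x y vs] by simp
    qed
  next
    case (Cons D Ds)
    then show ?case by (simp add: ten_X_swap[of _ us x y])
  qed
  then show ?case
    using ten_X_swap[of Ds us x y vs] by simp
qed

lemma additive_derivation: "additive (derivation Z f g)"
  unfolding derivation_def by (rule additive_extend[OF derivation_multilinear_form])

lemma derivation_scW_ten:
  "set Ds \<subseteq> Der A \<Longrightarrow> derivation Z f g (scW S r (ten S Ds Xs)) =
     scW S (anc A Z r) (ten S Ds Xs) + scW S r (derive_list f g Ds Xs)"
  unfolding derivation_def by (rule extend_ten[OF derivation_multilinear_form])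

lemma anc_one: "anc A Z 1 = 0"
  using anc_linear(3)[of Z 1 1] by simp

lemma derivation_ten_list: "set Ds \<subseteq> Der A \<Longrightarrow> derivation Z f g (ten S Ds Xs) = derive_list f g Ds Xs"
  using derivation_scW_ten[of Ds 1 Xs] by (simp add: anc_one)

lemma derivation_ten:
  assumes "set Ds \<subseteq> Der A"
  shows "derivation Z f g (ten S Ds Xs) =
    (\<Sum>i<length Ds. ten S (Ds[i := f (Ds ! i)]) Xs) + (\<Sum>j<length Xs. ten S Ds (Xs[j := g (Xs ! j)]))"
proof -
  have X: "derive_X g Xs = (\<Sum>j<length Xs. ten S [] (Xs[j := g (Xs ! j)]))"
    by (induction Xs)
      (simp_all add: sum.lessThan_Suc_shift additive.sum[OF additive_mulX] mulX_simps del: sum.lessThan_Suc)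
  have "derive_list f g Ds Xs =
    (\<Sum>i<length Ds. ten S (Ds[i := f (Ds ! i)]) Xs) + (\<Sum>j<length Xs. ten S Ds (Xs[j := g (Xs ! j)]))"
    using assms
  proof (induction Ds)
    case (Cons D Ds)
    have "set (Ds[i := f (Ds ! i)]) \<subseteq> Der A" if "i < length Ds" for i
    proof -
      have "Ds ! i \<in> Der A"
        using Cons.prems nth_mem[OF that] by auto
      then show ?thesis
        using Cons.prems set_update_subset_insert[of Ds i "f (Ds ! i)"] derivation_formD(1)[of "Ds ! i"]
        by (meson insert_subset order_trans set_subset_Cons)
    qed
    then show ?case
      using Cons
      by (simp add: sum.lessThan_Suc_shift additive.sum[OF additive_mulD] mulD_simps algebra_simps
          del: sum.lessThan_Suc)
  qed (simp add: X)
  then show ?thesis by (simp add: derivation_ten_list assms)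
qed

lemma derivation_one: "derivation Z f g one = 0"
  by (simp add: derivation_ten_list)

lemmas derivation_lin = additive_derivation[THEN additive.add] additive_derivation[THEN additive.zero]
  additive_derivation[THEN additive.minus] additive_derivation[THEN additive.diff]

lemma derivation_scW: "derivation Z f g (scW S a w) = scW S (anc A Z a) w + scW S a (derivation Z f g w)"
  by (rule ten_eqI[where w = w])
    (simp_all add: additive_compose additive_plus additive_scW additive_derivation derivation_scW_ten anc_linear
      W.scale_left_distrib W.scale_right_distrib algebra_simps)

lemma derivation_mulX: "derivation Z f g (mulX X w) = mulX (g X) w + mulX X (derivation Z f g w)"
proof (rule ten_eqI[where w = w])
  fix r Ds Xs assume D: "set Ds \<subseteq> Der A"
  then have "derive_list f g Ds (X # Xs) = ten S Ds (g X # Xs) + mulX X (derive_list f g Ds Xs)"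
  proof (induction Ds)
    case (Cons D Ds)
    then show ?case
      by (simp add: mulX_simps mulD_simps mulX_mulD derivation_formD algebra_simps)
  qed simp
  with D show "derivation Z f g (mulX X (scW S r (ten S Ds Xs))) =
      mulX (g X) (scW S r (ten S Ds Xs)) + mulX X (derivation Z f g (scW S r (ten S Ds Xs)))"
    by (simp add: mulX_simps derivation_scW_ten W.scale_right_distrib)
qed (simp_all add: additive_compose additive_plus additive_mulX additive_derivation)

lemma derivation_mulD:
  "D \<in> Der A \<Longrightarrow> derivation Z f g (mulD D w) = mulD (f D) w + mulD D (derivation Z f g w)"
  by (rule ten_eqI[where w = w])
    (simp_all add: additive_compose additive_plus additive_mulD additive_derivation mulD_simps derivation_scW_ten
      derivation_formD W.scale_right_distrib)

end

end

section \<open>Commutation relations\<close>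

context sym_ad_algebra
begin

declare plus_fun_apply [simp del]

lemma act_add: "act A a (X + Y) = act A a X + act A a Y" "act A (a + b) X = act A a X + act A b X"
  "act A a (X - Y) = act A a X - act A a Y" "act A a (act A b X) = act A (a * b) X"
  by (simp_all add: LR.scale_right_distrib LR.scale_left_distrib LR.scale_right_diff_distrib)

lemma brk_act: "brk A (act A a X) Y = act A a (brk A X Y) - act A (anc A Y a) X"
  using leibniz[of Y a X] brk_anti[of "act A a X" Y] brk_anti[of X Y]
  by (simp add: algebra_simps)

lemma der_bracket_simps:
  "D \<in> Der A \<Longrightarrow> der_bracket D (E + E') = der_bracket D E + der_bracket D E'"
  "D \<in> Der A \<Longrightarrow> der_bracket D (der_scale a E) = der_scale (D a) E + der_scale a (der_bracket D E)"
  "E' \<in> Der A \<Longrightarrow> der_bracket (D + E) E' = der_bracket D E' + der_bracket E E'"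
  "E \<in> Der A \<Longrightarrow> der_bracket (der_scale a D) E = der_scale a (der_bracket D E) - der_scale (E a) D"
  "D \<in> Der A \<Longrightarrow> E \<in> Der A \<Longrightarrow> E' \<in> Der A \<Longrightarrow>
     der_bracket (der_bracket D E) E' = der_bracket D (der_bracket E E') - der_bracket E (der_bracket D E')"
  by (auto simp: fun_eq_iff der_bracket_def der_scale_def Der_D plus_fun_apply algebra_simps)

lemma der_bracket_apply: "der_bracket D E a = D (E a) - E (D a)"
  by (simp add: der_bracket_def)

lemma der_scale_add: "D \<in> Der A \<Longrightarrow> der_scale a (D + E) = der_scale a D + der_scale a E"
  by (auto simp: fun_eq_iff der_scale_def plus_fun_apply algebra_simps)

definition delta :: "'w \<Rightarrow> 'w" where
  "delta = cosum (\<lambda>X. mulD (anc A X))"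

definition lieW :: "'l \<Rightarrow> 'w \<Rightarrow> 'w" where
  "lieW Z = derivation Z (der_bracket (anc A Z)) (brk A Z)"

definition iota :: "'r \<Rightarrow> 'w \<Rightarrow> 'w" where
  "iota r = contract (\<lambda>D. scW S (D r))"

definition kappa :: "(('r \<Rightarrow> 'r) \<Rightarrow> 'l) \<Rightarrow> 'w \<Rightarrow> 'w" where
  "kappa \<theta> = contract (\<lambda>D. mulX (\<theta> D))"

definition hW :: "'r \<Rightarrow> 'l \<Rightarrow> 'w \<Rightarrow> 'w" where
  "hW r X = kappa (\<lambda>D. act A (D r) X)"

subsection \<open>The operator \<open>\<delta>\<close>\<close>

lemma balanced_anc: "balanced (\<lambda>X. mulD (anc A X))"
proof (rule balancedI)
  show "additive (\<lambda>X. mulD (anc A X) w)" for w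
    by (simp add: additive_def anc_add mulD_left)
qed (simp_all add: additive_mulD anc_act mulD_left mulD_scW)

lemmas additive_delta = additive_cosum[OF balanced_anc, folded delta_def]
lemmas delta_lin = cosum_lin[OF balanced_anc, folded delta_def]

lemma delta_one: "delta one = 0"
  unfolding delta_def by (rule cosum_one[OF balanced_anc])

lemma delta_scW: "delta (scW S a w) = scW S a (delta w)"
  using cosum_compose[OF balanced_anc additive_scW(1), of a w]
  by (simp add: delta_def cosum_scW[OF balanced_anc] mulD_scW)

lemma delta_mulX: "delta (mulX X w) = mulD (anc A X) w + mulX X (delta w)"
  using cosum_compose[OF balanced_anc additive_mulX, of X w]
  by (simp add: delta_def cosum_mulX[OF balanced_anc] mulX_mulD)

lemma delta_mulD: "D \<in> Der A \<Longrightarrow> delta (mulD D w) = - mulD D (delta w)"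
  using cosum_compose[OF balanced_anc additive_uminus[OF additive_mulD[of D]], of w]
  by (simp add: delta_def cosum_mulD[OF balanced_anc] mulD_mulD[of "anc A _" D])

lemma delta_delta: "delta (delta w) = 0"
  by (induction w rule: mul_induct)
    (simp_all add: delta_lin delta_scW delta_one delta_mulX delta_mulD mulD_simps mulX_simps)

text \<open>Both sides are the sum over ordered pairs of distinct symmetric factors, one replaced by
  its anchor and the other handed to g.\<close>

lemma cosum_delta: "balanced g \<Longrightarrow> cosum g (delta w) = cosum (\<lambda>X w. g X (delta w)) w"
proof (induction w arbitrary: g rule: mul_induct)
  case (add v w)
  have "balanced (\<lambda>X w. g X (delta w))"
    by (rule balanced_right(1)) (simp_all add: add.prems additive_delta delta_scW)
  then show ?case
    using add by (simp add: delta_lin cosum_lin)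
next
  case (scale a w)
  have b: "balanced (\<lambda>X w. g X (delta w))"
    by (rule balanced_right(1)) (simp_all add: scale.prems additive_delta delta_scW)
  show ?case
    using scale.IH[OF balanced_scW[OF scale.prems, of a]]
    by (simp add: delta_scW cosum_scW scale.prems b)
next
  case one
  have b: "balanced (\<lambda>X w. g X (delta w))"
    by (rule balanced_right(1)) (simp_all add: one.prems additive_delta delta_scW)
  then show ?case by (simp add: delta_one cosum_lin one.prems cosum_one)
next
  case (mulD D w)
  have b: "balanced (\<lambda>X w. g X (delta w))" and b': "balanced (\<lambda>X w. g X (mulD D (delta w)))"
    by (rule balanced_right(1)[OF _ additive_delta] balanced_right(1)[OF balanced_mulD additive_delta];
        simp add: mulD delta_scW)+
  show ?case
    using mulD.IH[OF balanced_mulD[OF mulD.prems mulD.hyps]]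
    by (simp add: delta_mulD mulD.hyps cosum_mulD[OF mulD.prems] cosum_mulD[OF b] cosum_lin mulD.prems
        balancedD[OF mulD.prems] cosum_uminus[OF b'])
next
  case (mulX X w)
  have b: "balanced (\<lambda>X w. g X (delta w))" and b': "balanced (\<lambda>Y w. g Y (mulX X (delta w)))"
    by (rule balanced_right(1)[OF _ additive_delta] balanced_right(1)[OF balanced_mulX additive_delta];
        simp add: mulX delta_scW)+
  show ?case
    using mulX.IH[OF balanced_mulX[OF mulX.prems, of X]]
    by (simp add: delta_mulX cosum_mulD[OF mulX.prems] cosum_mulX[OF mulX.prems] cosum_mulX[OF b] cosum_lin
        mulX.prems balancedD[OF mulX.prems] cosum_add b' balanced_mulD)
qed

subsection \<open>Derivations\<close>

text \<open>\<delta> only trades X for \<rho>(X), so it is enough that \<rho> intertwines g and f.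
  This covers the Lie action and the basic connection at once.\<close>

lemma derivation_delta:
  assumes fg: "derivation_form Z f g" and "\<And>X. f (anc A X) = anc A (g X)"
  shows "derivation Z f g (delta w) = delta (derivation Z f g w)"
  by (induction w rule: mul_induct)
    (simp_all add: delta_lin delta_scW delta_one delta_mulX delta_mulD mulD_simps mulX_simps
      derivation_lin[OF fg] derivation_scW[OF fg] derivation_one[OF fg] derivation_mulX[OF fg]
      derivation_mulD[OF fg] derivation_formD[OF fg] assms)

lemma lieW_form: "derivation_form Z (der_bracket (anc A Z)) (brk A Z)"
  unfolding derivation_form_def
  by (simp add: Der_closed der_bracket_simps brk_add leibniz)

lemmas additive_lieW = additive_derivation[OF lieW_form, folded lieW_def]
lemmas lieW_lin = derivation_lin[OF lieW_form, folded lieW_def]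
lemmas lieW_simps = derivation_scW[OF lieW_form, folded lieW_def] derivation_one[OF lieW_form, folded lieW_def]
  derivation_mulX[OF lieW_form, folded lieW_def] derivation_mulD[OF lieW_form, folded lieW_def]

lemma lieW_delta: "lieW Z (delta w) = delta (lieW Z w)"
  unfolding lieW_def by (rule derivation_delta[OF lieW_form]) (simp add: anc_brk)

lemma mulX_diff_left: "mulX (X - Y) w = mulX X w - mulX Y w"
  using additive.diff[OF additive_mulX_left] .

lemma lieW_lieW: "lieW (brk A X Y) w = lieW X (lieW Y w) - lieW Y (lieW X w)"
proof (induction w rule: mul_induct)
  case (scale a w)
  have anc: "anc A (brk A X Y) a = anc A X (anc A Y a) - anc A Y (anc A X a)"
    by (simp add: anc_brk der_bracket_def)
  show ?case
    by (simp add: anc scale lieW_lin lieW_simps W.scale_left_diff_distrib W.scale_right_diff_distrib algebra_simps)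
next
  case (mulD D w)
  show ?case
    using mulD.hyps
    by (simp add: mulD.IH lieW_lin lieW_simps mulD_simps anc_brk der_bracket_simps mulD_diff_left Der_closed algebra_simps)
next
  case (mulX Z w)
  show ?case
    by (simp add: mulX.IH lieW_lin lieW_simps mulX_simps brk_brk mulX_diff_left algebra_simps)
qed (simp_all add: lieW_lin lieW_simps algebra_simps)

lemma lieW_add: "lieW (X + Y) w = lieW X w + lieW Y w"
  by (induction w rule: mul_induct)
    (simp_all add: lieW_lin lieW_simps mulX_simps mulD_simps anc_add brk_add der_bracket_simps mulD_left mulX_left
      Der_closed W.scale_left_distrib W.scale_right_distrib plus_fun_apply[of "anc A X" "anc A Y"] algebra_simps)

lemma anc_scL: "anc A (scL A c X) = der_scale (scR A c 1) (anc A X)"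
  using anc_act[of "scR A c 1" X] by (simp add: act_scalar)

lemma anc_scR_one: "anc A X (scR A c 1) = 0"
  using anc_linear(3)[of X 1 1] by (simp add: anc_linear(2))

text \<open>Derivations of R kill the constants c1, so that scalars from K pass through brackets and
  through the action.\<close>

lemma lieW_scale:
  "lieW (scL A c X) w = scWK A S c (lieW X w)" "lieW X (scWK A S c w) = scWK A S c (lieW X w)"
proof -
  have D: "der_bracket (der_scale (scR A c 1) (anc A X)) D = der_scale (scR A c 1) (der_bracket (anc A X) D)"
    if "D \<in> Der A" for D
  proof -
    have "D 1 = 0"
      using Der_D(3)[OF that, of 1 1] by simp
    then have "D (scR A c 1) = 0"
      by (simp add: Der_D(2)[OF that])
    then have "D (scR A c 1 * a) = scR A c 1 * D a" for a
      by (simp add: Der_D(3)[OF that])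
    then show ?thesis
      by (simp add: fun_eq_iff der_bracket_def der_scale_def right_diff_distrib)
  qed
  have X: "brk A (scL A c X) Y = act A (scR A c 1) (brk A X Y)" for Y
    by (simp add: brk_scale act_scalar)
  show "lieW (scL A c X) w = scWK A S c (lieW X w)"
    unfolding scWK_def
    by (induction w rule: mul_induct)
      (simp_all add: lieW_lin lieW_simps mulX_simps mulD_simps anc_scL D X mulD_left mulX_left Der_closed
        W.scale_right_distrib, simp_all add: der_scale_def mult_ac)
  show "lieW X (scWK A S c w) = scWK A S c (lieW X w)"
    by (simp add: scWK_def lieW_simps anc_scR_one)
qed

text \<open>The defects of balancedness of the two summands cancel: \<rho>(Z)(a) X from the bracket
  in the first against \<rho>(Z)(a) w from the derivation in the second.\<close>

lemma balanced_lieW_left: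
  assumes g: "balanced g"
  shows "balanced (\<lambda>X w. g (brk A Z X) w + g X (lieW Z w))"
  by (rule balancedI)
    (simp_all add: additive_def balancedD[OF g] brk_add leibniz lieW_lin lieW_simps W.scale_left_distrib
      algebra_simps)

lemma cosum_lieW: "balanced g \<Longrightarrow> cosum g (lieW Z w) = cosum (\<lambda>X w. g (brk A Z X) w + g X (lieW Z w)) w"
proof (induction w arbitrary: g rule: mul_induct)
  case (add v w)
  then show ?case by (simp add: lieW_lin cosum_lin balanced_lieW_left)
next
  case (scale a w)
  have b: "balanced (\<lambda>X w. g X (scW S (anc A Z a) w))" "balanced (\<lambda>X w. g X (scW S a w))"
    using scale.prems balanced_scW by blast+
  have "cosum g (lieW Z (scW S a w)) =
      cosum (\<lambda>X w. g X (scW S (anc A Z a) w)) w +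
      cosum (\<lambda>X w. g (brk A Z X) (scW S a w) + g X (scW S a (lieW Z w))) w"
    using scale.IH[OF b(2)] by (simp add: lieW_simps cosum_lin scale.prems cosum_scW)
  also have "\<dots> = cosum (\<lambda>X w. g X (scW S (anc A Z a) w) +
      (g (brk A Z X) (scW S a w) + g X (scW S a (lieW Z w)))) w"
    using cosum_add[OF b(1) balanced_lieW_left[OF b(2)]] by simp
  also have "\<dots> = cosum (\<lambda>X w. g (brk A Z X) w + g X (lieW Z w)) (scW S a w)"
    by (simp add: cosum_scW balanced_lieW_left scale.prems lieW_simps balancedD[OF scale.prems] algebra_simps)
  finally show ?case .
next
  case one
  then show ?case by (simp add: lieW_simps cosum_lin cosum_one balanced_lieW_left)
next
  case (mulD D w)
  note g = mulD.prems
  have b: "balanced (\<lambda>X w. g X (mulD (der_bracket (anc A Z) D) w))" "balanced (\<lambda>X w. g X (mulD D w))"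
    using g mulD.hyps balanced_mulD Der_closed(4) anc_in_Der by blast+
  have "cosum g (lieW Z (mulD D w)) =
      cosum (\<lambda>X w. g X (mulD (der_bracket (anc A Z) D) w)) w +
      cosum (\<lambda>X w. g (brk A Z X) (mulD D w) + g X (mulD D (lieW Z w))) w"
    using mulD.IH[OF b(2)] by (simp add: lieW_simps cosum_lin g cosum_mulD mulD.hyps Der_closed)
  also have "\<dots> = cosum (\<lambda>X w. g X (mulD (der_bracket (anc A Z) D) w) +
      (g (brk A Z X) (mulD D w) + g X (mulD D (lieW Z w)))) w"
    using cosum_add[OF b(1) balanced_lieW_left[OF b(2)]] by simp
  also have "\<dots> = cosum (\<lambda>X w. g (brk A Z X) w + g X (lieW Z w)) (mulD D w)"
    by (simp add: cosum_mulD balanced_lieW_left g mulD.hyps lieW_simps balancedD[OF g] algebra_simps)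
  finally show ?case .
next
  case (mulX Y w)
  note g = mulX.prems
  have b: "balanced (\<lambda>X w. g X (mulX (brk A Z Y) w))" "balanced (\<lambda>X w. g X (mulX Y w))"
    using g balanced_mulX by blast+
  have "cosum g (lieW Z (mulX Y w)) = g (brk A Z Y) w + g Y (lieW Z w) +
      (cosum (\<lambda>X w. g X (mulX (brk A Z Y) w)) w +
      cosum (\<lambda>X w. g (brk A Z X) (mulX Y w) + g X (mulX Y (lieW Z w))) w)"
    using mulX.IH[OF b(2)] by (simp add: lieW_simps cosum_lin g cosum_mulX algebra_simps)
  also have "\<dots> = g (brk A Z Y) w + g Y (lieW Z w) + cosum (\<lambda>X w. g X (mulX (brk A Z Y) w) +
      (g (brk A Z X) (mulX Y w) + g X (mulX Y (lieW Z w)))) w"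
    using cosum_add[OF b(1) balanced_lieW_left[OF b(2)]] by simp
  also have "\<dots> = cosum (\<lambda>X w. g (brk A Z X) w + g X (lieW Z w)) (mulX Y w)"
    by (simp add: cosum_mulX balanced_lieW_left g lieW_simps balancedD[OF g] algebra_simps)
  finally show ?case .
qed

subsection \<open>Contractions\<close>

lemma iota_form: "contraction_form (\<lambda>D. scW S (D r))"
  unfolding contraction_form_def
  by (simp add: additive_scW mulD_scW mulX_scW W.scale_left_distrib der_scale_def plus_fun_apply mult_ac)

lemmas additive_iota = additive_contract[OF iota_form, folded iota_def]
lemmas iota_lin = contract_lin[OF iota_form, folded iota_def]
lemmas iota_simps = contract_scW[OF iota_form, folded iota_def] contract_one[OF iota_form, folded iota_def]
  contract_mulX[OF iota_form, folded iota_def] contract_mulD[OF iota_form, folded iota_def]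

definition linear_form :: "(('r \<Rightarrow> 'r) \<Rightarrow> 'l) \<Rightarrow> bool" where
  "linear_form \<theta> \<longleftrightarrow>
     (\<forall>D\<in>Der A. (\<forall>E\<in>Der A. \<theta> (D + E) = \<theta> D + \<theta> E) \<and> (\<forall>a. \<theta> (der_scale a D) = act A a (\<theta> D)))"

lemma kappa_form: "linear_form \<theta> \<Longrightarrow> contraction_form (\<lambda>D. mulX (\<theta> D))"
  unfolding contraction_form_def linear_form_def
  by (simp add: additive_mulX mulX_scW mulX_mulD mulX_left) (metis mulX_commute)

context
  fixes \<theta>
  assumes \<theta>: "linear_form \<theta>"
begin

lemmas additive_kappa = additive_contract[OF kappa_form[OF \<theta>], folded kappa_def]
lemmas kappa_lin = contract_lin[OF kappa_form[OF \<theta>], folded kappa_def]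
lemmas kappa_simps = contract_scW[OF kappa_form[OF \<theta>], folded kappa_def]
  contract_one[OF kappa_form[OF \<theta>], folded kappa_def]
  contract_mulX[OF kappa_form[OF \<theta>], folded kappa_def] contract_mulD[OF kappa_form[OF \<theta>], folded kappa_def]

lemma linear_form_bracket: "linear_form (\<lambda>D. brk A Z (\<theta> D) - \<theta> (der_bracket (anc A Z) D))"
  using \<theta> by (auto simp: linear_form_def der_bracket_simps Der_closed brk_add leibniz act_add algebra_simps)

end

text \<open>The correction is the contraction with the Lie derivative of \<theta> along Z.\<close>

lemma lieW_kappa:
  assumes \<theta>: "linear_form \<theta>"
  shows "lieW Z (kappa \<theta> w) = kappa \<theta> (lieW Z w) + kappa (\<lambda>D. brk A Z (\<theta> D) - \<theta> (der_bracket (anc A Z) D)) w"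
  by (induction w rule: mul_induct)
    (simp_all add: kappa_lin kappa_simps \<theta> linear_form_bracket[OF \<theta>] lieW_lin lieW_simps mulD_simps mulX_simps
      W.scale_right_distrib Der_closed mulX_diff_left)

lemma kappa_add:
  assumes "linear_form \<theta>" "linear_form \<theta>'" "linear_form \<theta>''" "\<And>D. D \<in> Der A \<Longrightarrow> \<theta>'' D = \<theta> D + \<theta>' D"
  shows "kappa \<theta>'' w = kappa \<theta> w + kappa \<theta>' w"
  by (induction w rule: mul_induct)
    (simp_all add: kappa_lin kappa_simps assms mulD_simps mulX_simps mulX_left W.scale_right_distrib)

lemma kappa_scale:
  assumes "linear_form \<theta>" "linear_form \<theta>'" "\<And>D. D \<in> Der A \<Longrightarrow> \<theta>' D = act A a (\<theta> D)"
  shows "kappa \<theta>' w = scW S a (kappa \<theta> w)"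
  by (induction w rule: mul_induct)
    (simp_all add: kappa_lin kappa_simps assms mulD_simps mulX_simps mulX_left W.scale_right_distrib
      W.scale_right_diff_distrib mult.commute)

text \<open>The anticommutator of \<delta> with \<open>kappa \<theta>\<close> is thus the R-linear
  derivation sending D to \<rho>(\<theta>(D)) and X to \<theta>(\<rho>(X)). The homotopy formulas
  \<open>lieW_act\<close> and \<open>EW_eq\<close> follow by comparing derivations on
  generators.\<close>

lemma delta_kappa:
  assumes \<theta>: "linear_form \<theta>"
  shows "D \<in> Der A \<Longrightarrow> delta (kappa \<theta> (mulD D w)) + kappa \<theta> (delta (mulD D w)) =
      mulD (anc A (\<theta> D)) w + mulD D (delta (kappa \<theta> w) + kappa \<theta> (delta w))"
    and "delta (kappa \<theta> (mulX X w)) + kappa \<theta> (delta (mulX X w)) =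
      mulX (\<theta> (anc A X)) w + mulX X (delta (kappa \<theta> w) + kappa \<theta> (delta w))"
  by (simp_all add: kappa_lin kappa_simps \<theta> delta_lin delta_mulD delta_mulX mulD_simps mulX_simps)

lemma hW_form: "linear_form (\<lambda>D. act A (D r) X)"
  by (simp add: linear_form_def der_scale_def act_add plus_fun_apply)

lemmas additive_hW = additive_kappa[OF hW_form, folded hW_def]
lemmas hW_lin = kappa_lin[OF hW_form, folded hW_def]
lemmas hW_simps = kappa_simps[OF hW_form, folded hW_def]

lemma lieW_hW: "lieW Z (hW r X w) = hW r X (lieW Z w) + hW (anc A Z r) X w + hW r (brk A Z X) w"
  unfolding hW_def lieW_kappa[OF hW_form] add.assoc
  by (intro arg_cong2[where f = plus] refl kappa_add hW_form linear_form_bracket)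
    (simp add: leibniz der_bracket_def LR.scale_left_diff_distrib algebra_simps)

text \<open>The Lie action is R-linear in X only up to homotopy: [\<rho>(rX), D] and [rX, Y] fall
  short of r[\<rho>(X), D] and r[X, Y] by D(r)\<rho>(X) and Y(r)X, which is the anticommutator of
  \<delta> with h_{r,X}. The condition that defines \<open>Omega_nl\<close> is tailored to this
  defect.\<close>

lemma lieW_act: "lieW (act A r X) w = scW S r (lieW X w) - (delta (hW r X w) + hW r X (delta w))"
proof (induction w rule: mul_induct)
  case (add v w)
  show ?case
    by (simp add: add lieW_lin hW_lin delta_lin W.scale_right_distrib)
next
  case (scale a w)
  show ?case
    by (simp add: scale lieW_simps hW_simps delta_scW anc_act der_scale_def W.scale_right_distrib
        W.scale_right_diff_distrib mult.commute algebra_simps)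
next
  case (mulD D w)
  have "der_bracket (anc A (act A r X)) D = der_scale r (der_bracket (anc A X) D) - anc A (act A (D r) X)"
    using mulD.hyps by (simp add: anc_act der_bracket_simps)
  then have br: "mulD (der_bracket (anc A (act A r X)) D) w =
      scW S r (mulD (der_bracket (anc A X) D) w) - mulD (anc A (act A (D r) X)) w"
    using mulD.hyps by (simp add: mulD_diff_left mulD_left Der_closed)
  show ?case
    using mulD.hyps delta_kappa(1)[OF hW_form, of D r X w]
    by (simp add: br mulD.IH lieW_simps mulD_simps mulD_diff_left mulD_left Der_closed W.scale_right_distrib hW_def[symmetric]
        algebra_simps)
next
  case (mulX Y w)
  show ?case
    using delta_kappa(2)[OF hW_form, of r X Y w]
    by (simp add: mulX.IH lieW_simps mulX_simps brk_act mulX_diff_left mulX_left W.scale_right_distrib hW_def[symmetric]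
        algebra_simps)
qed (simp_all add: lieW_simps hW_lin hW_simps delta_lin delta_one)

lemma lieW_iota: "lieW Z (iota r w) = iota r (lieW Z w) + iota (anc A Z r) w"
proof (induction w rule: mul_induct)
  case (mulD D w)
  then show ?case
    by (simp add: lieW_lin lieW_simps iota_lin iota_simps mulD_simps Der_closed der_bracket_apply
        W.scale_left_diff_distrib)
qed (simp_all add: lieW_lin lieW_simps iota_lin iota_simps mulX_simps W.scale_right_distrib)

lemma iota_mult: "iota (r * s) w = scW S r (iota s w) + scW S s (iota r w)"
proof (induction w rule: mul_induct)
  case (mulD D w)
  then show ?case
    by (simp add: iota_simps mulD_simps Der_D W.scale_left_distrib W.scale_right_diff_distrib mult.commute
        algebra_simps)
qed (simp_all add: iota_lin iota_simps mulX_simps W.scale_right_distrib mult.commute algebra_simps)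

lemma cosum_iota: "balanced g \<Longrightarrow> cosum g (iota r w) = cosum (\<lambda>X w. g X (iota r w)) w"
proof (induction w arbitrary: g rule: mul_induct)
  case (add v w)
  have "balanced (\<lambda>X w. g X (iota r w))"
    by (rule balanced_right(1)) (simp_all add: add.prems additive_iota iota_simps)
  then show ?case
    using add by (simp add: iota_lin cosum_lin)
next
  case (scale a w)
  have b: "balanced (\<lambda>X w. g X (iota r w))"
    by (rule balanced_right(1)) (simp_all add: scale.prems additive_iota iota_simps)
  show ?case
    using scale.IH[OF balanced_scW[OF scale.prems, of a]]
    by (simp add: iota_simps cosum_scW scale.prems b)
next
  case one
  have b: "balanced (\<lambda>X w. g X (iota r w))"
    by (rule balanced_right(1)) (simp_all add: one.prems additive_iota iota_simps)
  then show ?case by (simp add: iota_simps cosum_lin one.prems cosum_one)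
next
  case (mulD D w)
  note g = mulD.prems
  have b: "balanced (\<lambda>X w. g X (iota r w))" and b': "balanced (\<lambda>X w. g X (mulD D (iota r w)))"
    by (rule balanced_right(1)[OF _ additive_iota] balanced_right(1)[OF balanced_mulD additive_iota];
        simp add: mulD iota_simps)+
  show ?case
    using mulD.IH[OF balanced_mulD[OF g mulD.hyps]]
    by (simp add: iota_simps mulD.hyps cosum_mulD[OF g] cosum_mulD[OF b] cosum_lin g balancedD[OF g]
        cosum_diff b' balanced_scW cosum_scW)
next
  case (mulX X w)
  note g = mulX.prems
  have b: "balanced (\<lambda>X w. g X (iota r w))"
    by (rule balanced_right(1)) (simp_all add: g additive_iota iota_simps)
  show ?case
    using mulX.IH[OF balanced_mulX[OF g, of X]]
    by (simp add: iota_simps cosum_mulX[OF g] cosum_mulX[OF b])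
qed

lemma balanced_iota: "balanced (\<lambda>X. scW S (anc A X r))"
proof (rule balancedI)
  show "additive (\<lambda>X. scW S (anc A X r) w)" for w
    by (simp add: additive_def anc_add W.scale_left_distrib plus_fun_apply)
qed (simp_all add: additive_scW anc_act der_scale_def mult.commute)

text \<open>Contraction after \<delta> hits either the new factor \<rho>(X_j) or an old derivation;
  in the second case it has passed the new factor, which gives the minus sign.\<close>

lemma iota_delta: "iota r (delta w) = cosum (\<lambda>X. scW S (anc A X r)) w - delta (iota r w)"
proof -
  have "balanced (\<lambda>X w. mulD (anc A X) (iota r w))"
    by (rule balanced_right(1)[OF balanced_anc additive_iota]) (simp add: iota_simps)
  then show ?thesis
    using cosum_compose[OF balanced_anc additive_iota[of r], of w] cosum_iota[OF balanced_anc, of r w]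
    by (simp add: delta_def iota_simps cosum_diff balanced_iota)
qed

subsection \<open>Comparison with the defining formulas\<close>

lemma remove_nth_set: "set Xs \<subseteq> M \<Longrightarrow> set (remove_nth i Xs) \<subseteq> M"
  using set_take_subset[of i Xs] set_drop_subset[of "Suc i" Xs] by (auto simp: remove_nth_def)

lemma R_linear_map_eq:
  assumes "additive g" "\<And>r w. g (scW S r w) = scW S r (g w)"
    and "\<And>Ds Xs. set Ds \<subseteq> Der A \<Longrightarrow> g (ten S Ds Xs) = f Ds Xs"
  shows "R_linear_map A S f = g"
  unfolding R_linear_map_def
proof (rule the_equality)
  fix g' assume g': "(\<forall>v w. g' (v + w) = g' v + g' w) \<and> (\<forall>r w. g' (scW S r w) = scW S r (g' w)) \<and>
    (\<forall>Ds Xs. set Ds \<subseteq> Der A \<longrightarrow> g' (ten S Ds Xs) = f Ds Xs)"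
  show "g' = g"
    by (rule ext, rule ten_eqI) (use g' assms in \<open>simp_all add: additive_def\<close>)
qed (use assms in \<open>simp add: additive_def\<close>)

lemma derivation_map_eq:
  assumes fg: "derivation_form Z f g"
  shows "derivation_map A S Z f g = derivation Z f g"
  unfolding derivation_map_def
proof (rule the_equality)
  let ?spec = "\<lambda>h. (\<forall>v w. h (v + w) = h v + h w) \<and>
    (\<forall>r w. h (scW S r w) = scW S (anc A Z r) w + scW S r (h w)) \<and>
    (\<forall>Ds Xs. set Ds \<subseteq> Der A \<longrightarrow> h (ten S Ds Xs) =
       (\<Sum>i<length Ds. ten S (Ds[i := f (Ds ! i)]) Xs) + (\<Sum>j<length Xs. ten S Ds (Xs[j := g (Xs ! j)])))"
  show *: "?spec (derivation Z f g)"
    by (simp add: derivation_lin derivation_scW derivation_ten fg)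
  show "h = derivation Z f g" if "?spec h" for h
    by (rule ext, rule ten_eqI) (use that * in \<open>simp_all add: additive_def\<close>)
qed

lemma sym_lie_eq: "sym_lie A S Z = lieW Z"
  unfolding sym_lie_def lieW_def by (rule derivation_map_eq[OF lieW_form])

lemma delta_ten:
  "set Ds \<subseteq> Der A \<Longrightarrow> delta (ten S Ds Xs) = (\<Sum>i<length Xs. ten S (anc A (Xs ! i) # Ds) (remove_nth i Xs))"
  by (simp add: delta_def cosum_ten balanced_anc mulD_ten)

lemma sym_delta_eq: "sym_delta A S = delta"
  unfolding sym_delta_def by (rule R_linear_map_eq) (simp_all add: additive_delta delta_scW delta_ten)

lemma kappa_ten:
  assumes "linear_form \<theta>" "set Ds \<subseteq> Der A"
  shows "kappa \<theta> (ten S Ds Xs) = (\<Sum>i<length Ds. alt_sign i (ten S (remove_nth i Ds) (\<theta> (Ds ! i) # Xs)))"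
  by (simp add: kappa_def contract_ten kappa_form assms mulX_ten remove_nth_set)

text \<open>Reconciles h, which appends X, with \<open>mulX\<close>, which prepends it.\<close>

lemma ten_snoc: "ten S Ds (Xs @ [X]) = ten S Ds (X # Xs)"
proof -
  have "ten S Ds (us @ Xs @ [X]) = ten S Ds (us @ X # Xs)" for us
  proof (induction Xs arbitrary: us)
    case (Cons Y Xs)
    show ?case
      using Cons.IH[of "us @ [Y]"] ten_X_swap[of Ds us X Y Xs] by simp
  qed simp
  from this[of "[]"] show ?thesis by simp
qed

lemma sym_h_eq: "sym_h A S r X = hW r X"
  unfolding sym_h_def
proof (rule R_linear_map_eq)
  fix Ds Xs assume D: "set Ds \<subseteq> Der A"
  show "hW r X (ten S Ds Xs) =
      (\<Sum>i<length Ds. alt_sign i (scW S ((Ds ! i) r) (ten S (remove_nth i Ds) (Xs @ [X]))))"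
    unfolding hW_def kappa_ten[OF hW_form D] ten_snoc
    using ten_X_scale[of _ "[]"] by simp
qed (simp_all add: additive_hW hW_simps)

subsection \<open>The grading\<close>

lemma sym_ad_degree_induct [consumes 1, case_names add scW_ten]:
  assumes "w \<in> sym_ad_degree A S p"
    and "\<And>v w. P v \<Longrightarrow> P w \<Longrightarrow> P (v + w)"
    and "\<And>r Ds Xs. set Ds \<subseteq> Der A \<Longrightarrow> length Ds = p \<Longrightarrow> P (scW S r (ten S Ds Xs))" and "P 0"
  shows "P w"
  using assms(1) unfolding sym_ad_degree_def
  by (induction rule: W.span_induct_alt) (use assms in blast)+

lemma subspace_degree: "W.subspace (sym_ad_degree A S p)"
  unfolding sym_ad_degree_def by (rule W.subspace_span)

lemmas degree_closed = W.subspace_0[OF subspace_degree] W.subspace_add[OF subspace_degree]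
  W.subspace_scale[OF subspace_degree] W.subspace_neg[OF subspace_degree] W.subspace_diff[OF subspace_degree]
  W.subspace_sum[OF subspace_degree]

lemma ten_in_degree: "set Ds \<subseteq> Der A \<Longrightarrow> ten S Ds Xs \<in> sym_ad_degree A S (length Ds)"
  unfolding sym_ad_degree_def by (rule W.span_base) blast

lemma ten_in_degree': "set Ds \<subseteq> Der A \<Longrightarrow> length Ds = p \<Longrightarrow> ten S Ds Xs \<in> sym_ad_degree A S p"
  using ten_in_degree by blast

lemma delta_degree: "w \<in> sym_ad_degree A S p \<Longrightarrow> delta w \<in> sym_ad_degree A S (Suc p)"
  by (induction rule: sym_ad_degree_induct)
    (auto simp: delta_lin delta_scW delta_ten intro!: degree_closed ten_in_degree')

lemma list_update_Der:
  assumes "set Ds \<subseteq> Der A" "i < length Ds" "\<And>D. D \<in> Der A \<Longrightarrow> f D \<in> Der A"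
  shows "set (Ds[i := f (Ds ! i)]) \<subseteq> Der A"
proof -
  have "f (Ds ! i) \<in> Der A"
    using assms nth_mem by blast
  then show ?thesis
    using assms(1) set_update_subset_insert[of Ds i "f (Ds ! i)"] by (meson insert_subset order_trans)
qed

lemma derivation_degree:
  assumes fg: "derivation_form Z f g" and "w \<in> sym_ad_degree A S p"
  shows "derivation Z f g w \<in> sym_ad_degree A S p"
  using assms(2)
proof (induction rule: sym_ad_degree_induct)
  case (scW_ten r Ds Xs)
  have "ten S (Ds[i := f (Ds ! i)]) Xs \<in> sym_ad_degree A S p" if "i < length Ds" for i
    using list_update_Der[OF scW_ten(1) that, of f] derivation_formD(1)[OF fg] scW_ten(2)
    by (intro ten_in_degree') auto
  moreover have "ten S Ds Xs \<in> sym_ad_degree A S p" for Xs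
    using scW_ten ten_in_degree' by blast
  ultimately show ?case
    using scW_ten by (auto simp: derivation_scW[OF fg] derivation_ten[OF fg] intro!: degree_closed)
qed (auto simp: derivation_lin[OF fg] intro: degree_closed)

lemma lieW_degree: "w \<in> sym_ad_degree A S p \<Longrightarrow> lieW Z w \<in> sym_ad_degree A S p"
  unfolding lieW_def by (rule derivation_degree[OF lieW_form])

text \<open>Settles the boundary case of the nonlinearity condition: \<phi>_0 with all its n
  arguments has degree 0, and there is no component with n + 1 arguments to match its image under
  h.\<close>

lemma hW_degree_0: "w \<in> sym_ad_degree A S 0 \<Longrightarrow> hW r X w = 0"
  by (induction rule: sym_ad_degree_induct) (simp_all add: hW_lin hW_simps hW_def[symmetric] kappa_ten[OF hW_form, folded hW_def])

end

section \<open>The basic connection\<close>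

locale lr_connection = envelope A U + sym_ad_algebra A S + connection A nab
  for A :: "('k::field, 'r::comm_ring_1, 'l::ab_group_add) lie_rinehart_data"
    and U :: "('k, 'r, 'l, 'u::ring_1) envelope_data"
    and S :: "('r, 'l, 'e::ab_group_add, 's::ab_group_add, 'w::ab_group_add) sym_ad_data"
    and nab :: "('r \<Rightarrow> 'r) \<Rightarrow> 'l \<Rightarrow> 'l"
begin

declare plus_fun_apply [simp del]

lemma nab_right: "D \<in> Der A \<Longrightarrow> nab D (X + Y) = nab D X + nab D Y"
  "D \<in> Der A \<Longrightarrow> nab D (scL A c X) = scL A c (nab D X)"
  using nab_linear[of D] by (simp_all add: Vector_Spaces.linear_iff)

lemma anc_diff: "anc A (X - Y) = anc A X - anc A Y"
  using anc_add[of "X - Y" Y] by simp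

abbreviation nabla_D :: "'l \<Rightarrow> ('r \<Rightarrow> 'r) \<Rightarrow> ('r \<Rightarrow> 'r)" where
  "nabla_D X D \<equiv> anc A (nab D X) + der_bracket (anc A X) D"

abbreviation nabla_L :: "'l \<Rightarrow> 'l \<Rightarrow> 'l" where
  "nabla_L X Y \<equiv> nab (anc A Y) X + brk A X Y"

definition nabW :: "'l \<Rightarrow> 'w \<Rightarrow> 'w" where
  "nabW X = derivation X (nabla_D X) (nabla_L X)"

lemma nabW_form: "derivation_form X (nabla_D X) (nabla_L X)"
  unfolding derivation_form_def
  by (auto simp: Der_closed der_bracket_simps nab_add nab_scale anc_add anc_act der_scale_add brk_add leibniz
      act_add algebra_simps)

lemmas nabW_lin = derivation_lin[OF nabW_form, folded nabW_def]
lemmas nabW_simps = derivation_scW[OF nabW_form, folded nabW_def] derivation_one[OF nabW_form, folded nabW_def]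
  derivation_mulX[OF nabW_form, folded nabW_def] derivation_mulD[OF nabW_form, folded nabW_def]

lemma basic_connection_eq: "basic_connection A nab S X = nabW X"
  unfolding basic_connection_def nabW_def by (rule derivation_map_eq[OF nabW_form])

lemma nabW_delta: "nabW X (delta w) = delta (nabW X w)"
  unfolding nabW_def by (rule derivation_delta[OF nabW_form]) (simp add: anc_brk anc_add)

lemma nabW_add: "nabW (X + Y) w = nabW X w + nabW Y w"
proof (induction w rule: mul_induct)
  case (mulD D w)
  have "nabla_D (X + Y) D = nabla_D X D + nabla_D Y D"
    using mulD.hyps by (simp add: nab_right anc_add der_bracket_simps)
  then show ?case
    using mulD by (simp add: nabW_lin nabW_simps mulD_simps mulD_left Der_closed)
next
  case (mulX Z w)
  have "nabla_L (X + Y) Z = nabla_L X Z + nabla_L Y Z"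
    by (simp add: nab_right brk_add)
  then show ?case
    using mulX by (simp add: nabW_lin nabW_simps mulX_simps mulX_left)
qed (simp_all add: nabW_lin nabW_simps anc_add plus_fun_apply W.scale_left_distrib W.scale_right_distrib)

text \<open>On derivations, the term D(a)\<rho>(X) from \<nabla>_D(aX) cancels the one from
  [a\<rho>(X), D], and similarly on L. This R-linearity in X makes the recursion for s well defined
  over R.\<close>

lemma nabW_act: "nabW (act A a X) w = scW S a (nabW X w)"
proof (induction w rule: mul_induct)
  case (scale b w)
  then show ?case
    by (simp add: nabW_simps anc_act der_scale_def W.scale_right_distrib mult.commute)
next
  case (mulD D w)
  have "nabla_D (act A a X) D = der_scale a (nabla_D X D)"
    using mulD.hyps
    by (simp add: nab_leibniz anc_add anc_act der_bracket_simps der_scale_add Der_closed)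
  then show ?case
    using mulD by (simp add: nabW_simps mulD_simps mulD_left Der_closed W.scale_right_distrib)
next
  case (mulX Z w)
  have "nabla_L (act A a X) Z = act A a (nabla_L X Z)"
    by (simp add: nab_leibniz brk_act act_add)
  then show ?case
    using mulX by (simp add: nabW_simps mulX_simps mulX_left W.scale_right_distrib)
qed (simp_all add: nabW_lin nabW_simps W.scale_right_distrib)

subsection \<open>The tensor \<open>\<eta>\<close> and the operator \<open>F\<close>\<close>

text \<open>\<eta>_Y measures the change of \<nabla> under the Lie action of Y. The terms in which a
  coefficient is differentiated cancel, so it is a tensor in D and, by the next lemma, in X,
  although \<nabla> is not.\<close>

lemma eta_D: "D \<in> Der A \<Longrightarrow> E \<in> Der A \<Longrightarrow> eta A nab Y (D + E) X = eta A nab Y D X + eta A nab Y E X"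
  "D \<in> Der A \<Longrightarrow> eta A nab Y (der_scale a D) X = act A a (eta A nab Y D X)"
  by (simp_all add: eta_def nab_add nab_scale der_bracket_simps Der_closed brk_add leibniz act_add algebra_simps)

lemma eta_X: "D \<in> Der A \<Longrightarrow> eta A nab Y D (X + X') = eta A nab Y D X + eta A nab Y D X'"
  "D \<in> Der A \<Longrightarrow> eta A nab Y D (act A a X) = act A a (eta A nab Y D X)"
  by (simp_all add: eta_def nab_right nab_leibniz der_bracket_simps Der_closed brk_add leibniz act_add
      der_bracket_apply LR.scale_left_diff_distrib algebra_simps)

lemma eta_Y: "D \<in> Der A \<Longrightarrow> eta A nab (Y + Y') D X = eta A nab Y D X + eta A nab Y' D X"
  by (simp add: eta_def anc_add nab_right nab_add der_bracket_simps Der_closed brk_add algebra_simps)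

lemma eta_scale:
  assumes "D \<in> Der A"
  shows "eta A nab (scL A c Y) D X = act A (scR A c 1) (eta A nab Y D X)"
proof -
  have "D 1 = 0"
    using Der_D(3)[OF assms, of 1 1] by simp
  then have "D (scR A c 1) = 0"
    by (simp add: Der_D(2)[OF assms])
  then have "der_bracket (anc A (scL A c Y)) D = der_scale (scR A c 1) (der_bracket (anc A Y) D)"
    using assms by (simp add: anc_scL der_bracket_simps) (simp add: fun_eq_iff der_scale_def)
  then show ?thesis
    using assms
    by (simp add: eta_def brk_scale nab_right nab_scale Der_closed act_scalar L.scale_right_diff_distrib)
qed

lemma eta_form: "linear_form (\<lambda>D. eta A nab Y D X)"
  by (simp add: linear_form_def eta_D)

text \<open>The part of F_Y that belongs to one removed symmetric factor X, as an operator on the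
  remaining tensor.\<close>

definition GW :: "'l \<Rightarrow> 'l \<Rightarrow> 'w \<Rightarrow> 'w" where
  "GW Y X = kappa (\<lambda>D. eta A nab Y D X)"

definition FW :: "'l \<Rightarrow> 'w \<Rightarrow> 'w" where
  "FW Y = cosum (GW Y)"

lemmas additive_GW = additive_kappa[OF eta_form, folded GW_def]
lemmas GW_lin = kappa_lin[OF eta_form, folded GW_def]
lemmas GW_simps = kappa_simps[OF eta_form, folded GW_def]

lemma GW_act: "GW Y (act A a X) w = scW S a (GW Y X w)"
  unfolding GW_def by (rule kappa_scale) (simp_all add: eta_form eta_X)

lemma balanced_GW: "balanced (GW Y)"
proof (rule balancedI)
  show "additive (\<lambda>X. GW Y X w)" for w
    unfolding GW_def by (rule additive.intro, rule kappa_add) (simp_all add: eta_form eta_X)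
qed (simp_all add: additive_GW GW_act GW_simps)

lemmas additive_FW = additive_cosum[OF balanced_GW, folded FW_def]

lemma FW_scW: "FW Y (scW S a w) = scW S a (FW Y w)"
  using cosum_compose[OF balanced_GW additive_scW(1), of a Y w]
  by (simp add: FW_def cosum_scW[OF balanced_GW] GW_simps)

lemma FW_add: "FW (Y + Y') w = FW Y w + FW Y' w"
proof -
  have "GW (Y + Y') = (\<lambda>X w. GW Y X w + GW Y' X w)"
    unfolding GW_def by (intro ext, rule kappa_add) (simp_all add: eta_form eta_Y)
  then show ?thesis
    by (simp add: FW_def cosum_add balanced_GW)
qed

lemma FW_scale: "FW (scL A c Y) w = scWK A S c (FW Y w)"
proof -
  have "GW (scL A c Y) = (\<lambda>X w. scWK A S c (GW Y X w))"
    unfolding GW_def scWK_def by (intro ext, rule kappa_scale) (simp_all add: eta_form eta_scale)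
  then show ?thesis
    using cosum_compose[OF balanced_GW additive_scW(1), of "scR A c 1" Y w]
    by (simp add: FW_def scWK_def)
qed

lemma FW_ten:
  assumes "set Ds \<subseteq> Der A"
  shows "FW Y (ten S Ds Xs) = (\<Sum>i<length Ds. \<Sum>j<length Xs.
     alt_sign i (ten S (remove_nth i Ds) (eta A nab Y (Ds ! i) (Xs ! j) # remove_nth j Xs)))"
  unfolding FW_def cosum_ten[OF balanced_GW assms] GW_def kappa_ten[OF eta_form assms]
  by (rule sum.swap)

lemma F_map_eq: "F_map A nab S Y = FW Y"
  unfolding F_map_def by (rule R_linear_map_eq) (simp_all add: additive_FW FW_scW FW_ten)

definition EW :: "'l \<Rightarrow> 'l \<Rightarrow> 'w \<Rightarrow> 'w" where
  "EW Y X w = delta (GW Y X w) + GW Y X (delta w)"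

lemma balanced_delta_GW: "balanced (\<lambda>X w. delta (GW Y X w))" "balanced (\<lambda>X w. GW Y X (delta w))"
  by (rule balanced_right[OF balanced_GW] additive_delta delta_scW)+

lemma balanced_EW: "balanced (EW Y)"
  unfolding EW_def[abs_def] by (rule balanced_plus[OF balanced_delta_GW])

lemma delta_FW: "delta (FW Y w) + FW Y (delta w) = cosum (EW Y) w"
  using cosum_compose[OF balanced_GW additive_delta, of Y w] cosum_add[OF balanced_delta_GW]
  by (simp add: FW_def cosum_delta balanced_GW EW_def[abs_def])

text \<open>The basic connection is not L-invariant, but its defect is an anticommutator with
  \<delta>. Both sides are R-linear derivations, since the anchors on the right cancel, so only
  generators matter: D is sent to \<rho>(\<eta>_Z(D, X)) and Y to \<eta>_Z(\<rho>(Y), X).\<close>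

lemma EW_eq: "EW Z X w = lieW Z (nabW X w) - nabW X (lieW Z w) - nabW (brk A Z X) w"
proof (induction w rule: mul_induct)
  case (add v w)
  have "EW Z X (v + w) = EW Z X v + EW Z X w"
    by (simp add: EW_def GW_lin delta_lin)
  then show ?case
    by (simp add: add lieW_lin nabW_lin)
next
  case (scale a w)
  have anc: "anc A (brk A Z X) a = anc A Z (anc A X a) - anc A X (anc A Z a)"
    by (simp add: anc_brk der_bracket_def)
  have "EW Z X (scW S a w) = scW S a (EW Z X w)"
    by (simp add: EW_def GW_simps delta_scW W.scale_right_distrib)
  then show ?case
    by (simp add: scale lieW_lin nabW_lin lieW_simps nabW_simps anc W.scale_left_diff_distrib
        W.scale_right_diff_distrib algebra_simps)
next
  case one
  then show ?case
    by (simp add: EW_def GW_lin GW_simps delta_lin delta_one lieW_simps lieW_lin nabW_simps nabW_lin)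
next
  case (mulD D w)
  note D = mulD.hyps
  have "anc A (eta A nab Z D X) + nabla_D X (der_bracket (anc A Z) D) + nabla_D (brk A Z X) D =
      der_bracket (anc A Z) (nabla_D X D)"
  proof -
    have "anc A (eta A nab Z D X) = der_bracket (anc A Z) (anc A (nab D X)) -
        anc A (nab (der_bracket (anc A Z) D) X) - anc A (nab D (brk A Z X))"
      by (simp add: eta_def anc_diff anc_brk)
    then show ?thesis
      using D by (simp add: anc_brk der_bracket_simps Der_closed algebra_simps)
  qed
  then have "mulD (der_bracket (anc A Z) (nabla_D X D)) w =
      mulD (anc A (eta A nab Z D X) + nabla_D X (der_bracket (anc A Z) D) + nabla_D (brk A Z X) D) w"
    by simp
  also have "\<dots> = mulD (anc A (eta A nab Z D X)) w + mulD (nabla_D X (der_bracket (anc A Z) D)) w +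
      mulD (nabla_D (brk A Z X) D) w"
    using D by (subst mulD_left | simp add: Der_closed)+
  finally have f: "mulD (der_bracket (anc A Z) (nabla_D X D)) w = \<dots>" .
  have "EW Z X (mulD D w) = mulD (anc A (eta A nab Z D X)) w + mulD D (EW Z X w)"
    unfolding EW_def GW_def by (rule delta_kappa(1)[OF eta_form D])
  moreover have "nabla_D X D \<in> Der A"
    using D by (simp add: Der_closed)
  ultimately show ?case
    using D by (simp add: mulD.IH lieW_lin nabW_lin lieW_simps nabW_simps mulD_simps Der_closed f)
next
  case (mulX Y w)
  have "brk A Z (nabla_L X Y) = eta A nab Z (anc A Y) X + nabla_L X (brk A Z Y) + nabla_L (brk A Z X) Y"
    by (simp add: eta_def anc_brk brk_add brk_brk)
  then have g: "mulX (brk A Z (nabla_L X Y)) w =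
      mulX (eta A nab Z (anc A Y) X) w + mulX (nabla_L X (brk A Z Y)) w + mulX (nabla_L (brk A Z X) Y) w"
    by (simp only: mulX_left)
  have "EW Z X (mulX Y w) = mulX (eta A nab Z (anc A Y) X) w + mulX Y (EW Z X w)"
    unfolding EW_def GW_def by (rule delta_kappa(2)[OF eta_form])
  then show ?case
    by (simp add: mulX.IH lieW_lin nabW_lin lieW_simps nabW_simps mulX_simps g del: mulX_left)
qed

text \<open>F_Y is built naturally from the Lie derivative of \<nabla> along Y, and Lie derivatives
  represent the bracket of L; so Y \<mapsto> F_Y is a closed one-cochain with values in
  operators.\<close>

lemma lieW_FW: "lieW Z (FW Y w) - FW Y (lieW Z w) - (lieW Y (FW Z w) - FW Z (lieW Y w)) = FW (brk A Z Y) w"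
proof -
  \<comment> \<open>\<open>?\<theta>\<close> is the Lie derivative of \<eta>_Y in D and in its
    value; \<open>?\<zeta>\<close> also differentiates X and is the full Lie derivative along
    Z.\<close>
  let ?\<theta> = "\<lambda>Z Y X D. brk A Z (eta A nab Y D X) - eta A nab Y (der_bracket (anc A Z) D) X"
  let ?\<zeta> = "\<lambda>Z Y X D. ?\<theta> Z Y X D - eta A nab Y D (brk A Z X)"
  let ?g = "\<lambda>Z Y X w. lieW Z (GW Y X w) - (GW Y (brk A Z X) w + GW Y X (lieW Z w))"
  have form: "linear_form (?\<zeta> Z Y X)" for Z Y X
    using linear_form_bracket[OF eta_form[of Y X], of Z] eta_form[of Y "brk A Z X"]
    by (auto simp: linear_form_def act_add)
  have g: "?g Z Y X w = kappa (?\<zeta> Z Y X) w" for Z Y X w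
  proof -
    have "kappa (?\<theta> Z Y X) w = GW Y (brk A Z X) w + kappa (?\<zeta> Z Y X) w"
      unfolding GW_def by (rule kappa_add[OF eta_form form linear_form_bracket[OF eta_form]]) simp
    then show ?thesis
      using lieW_kappa[OF eta_form, of Z Y X w] by (simp add: GW_def)
  qed
  have balanced_g: "balanced (\<lambda>X w. lieW Z (GW Y X w))" "balanced (?g Z Y)" for Z Y
    using balanced_minus[OF _ balanced_lieW_left[OF balanced_GW]] balanced_right(2)[OF balanced_GW additive_lieW]
    by blast+
  have comm: "lieW Z (FW Y w) - FW Y (lieW Z w) = cosum (?g Z Y) w" for Z Y
    using cosum_compose[OF balanced_GW additive_lieW, of Z Y w] cosum_lieW[OF balanced_GW, of Y Z w]
      cosum_diff[OF balanced_g(1) balanced_lieW_left[OF balanced_GW], of Z Y Y Z w]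
    by (simp add: FW_def)
  have "kappa (?\<zeta> Z Y X) w = kappa (?\<zeta> Y Z X) w + GW (brk A Z Y) X w" for X w
    unfolding GW_def
  proof (rule kappa_add[OF form eta_form form])
    fix D assume D: "D \<in> Der A"
    let ?Z = "anc A Z" and ?Y = "anc A Y"
    have J: "brk A Z (brk A Y V) = brk A (brk A Z Y) V + brk A Y (brk A Z V)" for V
      by (simp add: brk_brk)
    have J': "der_bracket ?Z (der_bracket ?Y D) = der_bracket (der_bracket ?Z ?Y) D + der_bracket ?Y (der_bracket ?Z D)"
      using D by (simp add: der_bracket_simps)
    have br_diff: "brk A V (V1 - V2) = brk A V V1 - brk A V V2" for V V1 V2
      using additive.diff[OF additive_brk(1)] .
    show "?\<zeta> Z Y X D = ?\<zeta> Y Z X D + eta A nab (brk A Z Y) D X"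
      using D
      by (simp add: eta_def br_diff J J' nab_add nab_right Der_closed anc_brk)
  qed
  then have "cosum (?g Z Y) w = cosum (\<lambda>X w. ?g Y Z X w + GW (brk A Z Y) X w) w"
    unfolding g by simp
  also have "\<dots> = cosum (?g Y Z) w + FW (brk A Z Y) w"
    unfolding FW_def by (rule cosum_add[OF balanced_g(2) balanced_GW])
  finally show ?thesis
    unfolding comm by simp
qed

end

section \<open>The maps \<open>s\<close>\<close>

context lr_connection
begin

lemma left_mult_simps:
  "left_mult u (\<phi> + \<psi>) = left_mult u \<phi> + left_mult u \<psi>" "left_mult (u + v) \<phi> = left_mult u \<phi> + left_mult v \<phi>"
  "left_mult u (\<phi> - \<psi>) = left_mult u \<phi> - left_mult u \<psi>" "left_mult u (- \<phi>) = - left_mult u \<phi>"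
  "left_mult u 0 = 0" "left_mult u (left_mult v \<phi>) = left_mult (u * v) \<phi>" "left_mult u \<phi> rs = u * \<phi> rs"
  by (simp_all add: left_mult_def fun_eq_iff plus_fun_apply algebra_simps)

lemma additive_left_mult: "additive (left_mult u)"
  by (simp add: additive_def left_mult_simps)

text \<open>R-linear maps into arbitrary functions on lists. Neither a degree nor multilinearity of
  the values is part of it, so the recursion can be solved inside one space; both are recovered in
  \<open>t_map_in\<close>.\<close>

definition hom :: "('w \<Rightarrow> 'r list \<Rightarrow> 'u) set" where
  "hom = {f. additive f \<and> (\<forall>a w. f (scW S a w) = left_mult (inR U a) (f w))}"

lemma homI: "additive f \<Longrightarrow> (\<And>a w. f (scW S a w) = left_mult (inR U a) (f w)) \<Longrightarrow> f \<in> hom"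
  by (simp add: hom_def)

lemma homD:
  assumes "f \<in> hom"
  shows "additive f" "f (v + w) = f v + f w" "f 0 = 0" "f (- w) = - f w" "f (v - w) = f v - f w"
    "f (scW S a w) = left_mult (inR U a) (f w)" "f (sum h I) = (\<Sum>i\<in>I. f (h i))" "f (alt_sign n w) = alt_sign n (f w)"
  using assms additive.add[of f] additive.zero[of f] additive.minus[of f] additive.diff[of f]
    additive.sum[of f] additive_alt_sign[of f]
  by (simp_all add: hom_def)

lemma alt_sign_fun: "alt_sign n (f :: 'a \<Rightarrow> 'b::group_add) x = alt_sign n (f x)"
  by (simp add: alt_sign_def)

lemma hom_closed:
  "0 \<in> hom" "f \<in> hom \<Longrightarrow> g \<in> hom \<Longrightarrow> f + g \<in> hom" "f \<in> hom \<Longrightarrow> g \<in> hom \<Longrightarrow> f - g \<in> hom"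
  "f \<in> hom \<Longrightarrow> - f \<in> hom" "f \<in> hom \<Longrightarrow> alt_sign n f \<in> hom"
  by (auto intro!: homI simp: additive_def homD left_mult_simps alt_sign_def plus_fun_apply fun_eq_iff algebra_simps)

lemma hom_compose: "f \<in> hom \<Longrightarrow> additive T \<Longrightarrow> (\<And>a w. T (scW S a w) = scW S a (T w)) \<Longrightarrow> (\<lambda>w. f (T w)) \<in> hom"
  by (rule homI) (simp_all add: additive_def homD)

lemma hom_delta: "f \<in> hom \<Longrightarrow> (\<lambda>w. f (delta w)) \<in> hom"
  and hom_FW: "f \<in> hom \<Longrightarrow> (\<lambda>w. f (FW Y w)) \<in> hom"
  by (simp_all add: hom_compose additive_delta delta_scW additive_FW FW_scW)

lemma hom_scC: "f \<in> hom \<Longrightarrow> (\<lambda>w. scC U c (f w)) \<in> hom"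
  by (rule homI)
    (simp_all add: additive_def homD fun_eq_iff scC_def left_mult_simps plus_fun_apply U.scale_right_distrib scU_mult)

subsection \<open>The recursion operator\<close>

text \<open>\<open>cup\<close> with the derivations \<open>D\<^sub>i\<close> amounts to contraction with the first argument.\<close>

definition Jop :: "('w \<Rightarrow> 'r list \<Rightarrow> 'u) \<Rightarrow> 'w \<Rightarrow> 'r list \<Rightarrow> 'u" where
  "Jop f w rs = (case rs of [] \<Rightarrow> 0 | r # ss \<Rightarrow> f (iota r w) ss)"

definition Qg :: "('w \<Rightarrow> 'r list \<Rightarrow> 'u) \<Rightarrow> 'l \<Rightarrow> 'w \<Rightarrow> 'r list \<Rightarrow> 'u" where
  "Qg f X w = left_mult (inL U X) (f w) - f (nabW X w)"

definition Qop :: "('w \<Rightarrow> 'r list \<Rightarrow> 'u) \<Rightarrow> 'w \<Rightarrow> 'r list \<Rightarrow> 'u" where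
  "Qop f = cosum (Qg f)"

definition Pop :: "nat \<Rightarrow> ('w \<Rightarrow> 'r list \<Rightarrow> 'u) \<Rightarrow> 'w \<Rightarrow> 'r list \<Rightarrow> 'u" where
  "Pop e f = alt_sign e (Jop f) + Qop f"

lemma Jop_simps [simp]: "Jop f w [] = 0" "Jop f w (r # rs) = f (iota r w) rs"
  by (simp_all add: Jop_def)

lemma Jop_linear: "Jop (f + g) = Jop f + Jop g" "Jop (f - g) = Jop f - Jop g" "Jop (- f) = - Jop f" "Jop 0 = 0"
  by (auto simp: fun_eq_iff Jop_def plus_fun_apply split: list.split)

lemma hom_Jop: "f \<in> hom \<Longrightarrow> Jop f \<in> hom"
  by (rule homI)
    (auto simp: additive_def fun_eq_iff Jop_def homD iota_lin iota_simps left_mult_simps plus_fun_apply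
      split: list.split)

context
  fixes f assumes f: "f \<in> hom"
begin

text \<open>X(a) f(w) arises twice, from moving X past a in U and from the Leibniz rule of the basic
  connection, and cancels.\<close>

lemma Qg_scW: "Qg f X (scW S a w) = left_mult (inR U a) (Qg f X w)"
  by (simp add: Qg_def homD[OF f] nabW_simps left_mult_simps inL_inR)

lemma balanced_Qg: "balanced (Qg f)"
proof (rule balancedI)
  show "additive (Qg f X)" "additive (\<lambda>X. Qg f X w)" for X w
    by (simp_all add: additive_def Qg_def homD[OF f] nabW_lin nabW_add inL_simps left_mult_simps algebra_simps)
  show "Qg f (act A a X) w = Qg f X (scW S a w)" for a X w
    by (simp only: Qg_scW) (simp add: Qg_def homD[OF f] nabW_act inL_simps left_mult_simps)
qed

lemma hom_Qop: "Qop f \<in> hom"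
proof (rule homI)
  show "Qop f (scW S a w) = left_mult (inR U a) (Qop f w)" for a w
    using cosum_compose[OF balanced_Qg additive_left_mult, of "inR U a" w]
    by (simp add: Qop_def cosum_scW balanced_Qg Qg_scW)
qed (simp add: Qop_def additive_cosum balanced_Qg)

lemma hom_Pop: "Pop e f \<in> hom"
  unfolding Pop_def by (intro hom_closed hom_Jop hom_Qop f)

end

lemma Qop_linear:
  assumes "f \<in> hom" "g \<in> hom"
  shows Qop_add: "Qop (f + g) = Qop f + Qop g" and Qop_diff: "Qop (f - g) = Qop f - Qop g"
proof -
  have Qg: "Qg (f + g) = (\<lambda>X w. Qg f X w + Qg g X w)" "Qg (f - g) = (\<lambda>X w. Qg f X w - Qg g X w)"
    by (simp_all add: Qg_def fun_eq_iff plus_fun_apply left_mult_simps algebra_simps)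
  show "Qop (f + g) = Qop f + Qop g" "Qop (f - g) = Qop f - Qop g"
    by (rule ext; simp add: Qop_def Qg plus_fun_apply cosum_add cosum_diff balanced_Qg assms)+
qed

lemma Qop_zero: "Qop 0 = 0" and Qop_minus: "f \<in> hom \<Longrightarrow> Qop (- f) = - Qop f"
  using Qop_diff[of 0 0] Qop_diff[of 0 f] by (simp_all add: hom_closed)

lemma Pop_linear:
  assumes "f \<in> hom" "g \<in> hom"
  shows "Pop e (f + g) = Pop e f + Pop e g" "Pop e (f - g) = Pop e f - Pop e g"
  using assms by (simp_all add: Pop_def Jop_linear Qop_linear alt_sign_linear)

text \<open>A filtration by the number of tensor factors. \<open>Pop\<close> raises it by one and
  only 0 lies in all its steps, so f \<mapsto> f - \<open>Pop\<close> f is injective on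
  \<open>hom\<close>.\<close>

definition vanishes :: "nat \<Rightarrow> ('w \<Rightarrow> 'r list \<Rightarrow> 'u) \<Rightarrow> bool" where
  "vanishes n f \<longleftrightarrow> (\<forall>Ds Xs. set Ds \<subseteq> Der A \<longrightarrow> length Ds + length Xs < n \<longrightarrow> f (ten S Ds Xs) = 0)"

lemma vanishesD: "vanishes n f \<Longrightarrow> set Ds \<subseteq> Der A \<Longrightarrow> length Ds + length Xs < n \<Longrightarrow> f (ten S Ds Xs) = 0"
  by (simp add: vanishes_def)

lemma length_remove_nth: "i < length xs \<Longrightarrow> length (remove_nth i xs) = length xs - 1"
  by (simp add: remove_nth_def)

lemma iota_ten:
  "set Ds \<subseteq> Der A \<Longrightarrow> iota r (ten S Ds Xs) = (\<Sum>i<length Ds. alt_sign i (scW S ((Ds ! i) r) (ten S (remove_nth i Ds) Xs)))"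
  by (simp add: iota_def contract_ten iota_form)

lemma nabW_ten:
  assumes "set Ds \<subseteq> Der A"
  shows "nabW X (ten S Ds Xs) = (\<Sum>i<length Ds. ten S (Ds[i := nabla_D X (Ds ! i)]) Xs) +
    (\<Sum>j<length Xs. ten S Ds (Xs[j := nabla_L X (Xs ! j)]))"
  unfolding nabW_def by (rule derivation_ten[OF nabW_form assms])

lemma nabla_D_update: "set Ds \<subseteq> Der A \<Longrightarrow> i < length Ds \<Longrightarrow> set (Ds[i := nabla_D X (Ds ! i)]) \<subseteq> Der A"
  by (rule list_update_Der) (simp_all add: Der_closed)

text \<open>Contraction uses up a derivation and Q a symmetric factor; the basic connection keeps
  the number of factors.\<close>

lemma Pop_vanishes:
  assumes f: "f \<in> hom" and v: "vanishes n f"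
  shows "vanishes (Suc n) (Pop e f)"
  unfolding vanishes_def
proof (intro allI impI)
  fix Ds and Xs :: "'l list" assume D: "set Ds \<subseteq> Der A" and n: "length Ds + length Xs < Suc n"
  have "f (iota r (ten S Ds Xs)) = 0" for r
    using n by (simp add: iota_ten D homD[OF f] left_mult_simps vanishesD[OF v] remove_nth_set length_remove_nth)
  then have "Jop f (ten S Ds Xs) = 0"
    by (auto simp: fun_eq_iff Jop_def split: list.split)
  moreover have "Qop f (ten S Ds Xs) = 0"
    unfolding Qop_def cosum_ten[OF balanced_Qg[OF f] D]
  proof (rule sum.neutral, rule ballI)
    fix j assume "j \<in> {..<length Xs}"
    then have len: "length Ds + length (remove_nth j Xs) < n"
      using n by (simp add: length_remove_nth)
    then show "Qg f (Xs ! j) (ten S Ds (remove_nth j Xs)) = 0"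
      by (simp add: Qg_def vanishesD[OF v] D nabW_ten homD[OF f] left_mult_simps nabla_D_update)
  qed
  ultimately show "Pop e f (ten S Ds Xs) = 0"
    by (simp add: Pop_def plus_fun_apply) (simp add: alt_sign_def)
qed

lemma hom_eq_0:
  assumes "f \<in> hom" "\<And>n. vanishes n f"
  shows "f = 0"
proof
  show "f w = 0 w" for w
    by (rule ten_eqI) (use assms vanishesD[OF assms(2) _ lessI] in \<open>auto simp: homD left_mult_simps additive_def\<close>)
qed

lemma Pop_fixpoint:
  assumes f: "f \<in> hom" and eq: "f = Pop e f"
  shows "f = 0"
proof (rule hom_eq_0[OF f])
  show "vanishes n f" for n
  proof (induction n)
    case (Suc n)
    from Pop_vanishes[OF f Suc, of e] show ?case
      using eq by simp
  qed (simp add: vanishes_def)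
qed

text \<open>The Neumann series of iterates of \<open>Pop\<close> on g. Its n-th term vanishes on
  tensors with fewer than n factors, so the sum is finite on every element.\<close>

lemma Pop_solution:
  assumes g: "g \<in> hom"
  shows "\<exists>!f. f \<in> hom \<and> f = Pop e f + g"
proof (rule ex_ex1I)
  define p where "p n = (Pop e ^^ n) g" for n
  define F where "F n = (\<lambda>w. \<Sum>i<n. p i w)" for n
  have p_hom: "p n \<in> hom" for n
    unfolding p_def by (induction n) (simp_all add: g hom_Pop)
  have p_van: "vanishes n (p n)" for n
    unfolding p_def
    by (induction n) (simp_all add: p_hom[unfolded p_def] Pop_vanishes, simp add: vanishes_def)
  have F_0: "F 0 = 0" and F_step: "F (Suc n) = F n + p n" for n
    by (simp_all add: F_def fun_eq_iff plus_fun_apply)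
  have F_hom: "F n \<in> hom" for n
  proof (induction n)
    case 0
    show ?case unfolding F_0 by (rule hom_closed)
  next
    case (Suc n)
    then show ?case unfolding F_step by (intro hom_closed p_hom)
  qed
  have F_Suc: "F (Suc n) = Pop e (F n) + g" for n
  proof (induction n)
    case 0
    have "Pop e 0 = 0"
      using Pop_linear(2)[OF g g, of e] by simp
    moreover have "F (Suc 0) = g"
      by (simp add: F_def p_def)
    ultimately show ?case
      by (metis F_0 add_0)
  next
    case (Suc n)
    have "F (Suc (Suc n)) = (Pop e (F n) + g) + p (Suc n)"
      using F_step[of "Suc n"] Suc by simp
    also have "p (Suc n) = Pop e (p n)"
      by (simp add: p_def)
    also have "Pop e (F n) + g + Pop e (p n) = Pop e (F n + p n) + g"
      by (simp add: Pop_linear F_hom p_hom)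
    finally show ?case by (simp add: F_step[symmetric])
  qed
  have ex: "\<exists>N. \<forall>n\<ge>N. p n w = 0" for w
  proof (induction w rule: ten_induct)
    case 1
    then show ?case by (simp add: homD[OF p_hom])
  next
    case (2 v w)
    then obtain N M where "\<forall>n\<ge>N. p n v = 0" "\<forall>n\<ge>M. p n w = 0" by blast
    then show ?case
      by (intro exI[of _ "max N M"]) (simp add: homD[OF p_hom])
  next
    case (3 r Ds Xs)
    then have "\<forall>n\<ge>Suc (length Ds + length Xs). p n (ten S Ds Xs) = 0"
      using vanishesD[OF p_van] by auto
    then show ?case
      by (intro exI[of _ "Suc (length Ds + length Xs)"]) (simp add: homD[OF p_hom] left_mult_simps)
  qed
  \<comment> \<open>A bound past which the series has no terms at w. Any larger bound gives the same
    partial sum, so values at several elements are compared at a common bound.\<close>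
  define N where "N w = (SOME N. \<forall>n\<ge>N. p n w = 0)" for w
  have N: "p n w = 0" if "n \<ge> N w" for n w
    using someI_ex[OF ex] that unfolding N_def by blast
  define f where "f w = F (N w) w" for w
  have f_eq: "f w = F M w" if "M \<ge> N w" for M w
    unfolding f_def F_def
    by (rule sum.mono_neutral_left) (use that N in auto)
  have f_hom: "f \<in> hom"
  proof (rule homI)
    show "additive f"
    proof
      fix v w
      let ?M = "max (N (v + w)) (max (N v) (N w))"
      have "f (v + w) = F ?M (v + w)" "f v = F ?M v" "f w = F ?M w"
        by (rule f_eq; simp)+
      then show "f (v + w) = f v + f w"
        by (simp add: homD[OF F_hom])
    qed
    fix a w
    let ?M = "max (N (scW S a w)) (N w)"
    have "f (scW S a w) = F ?M (scW S a w)" "f w = F ?M w"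
      by (rule f_eq; simp)+
    then show "f (scW S a w) = left_mult (inR U a) (f w)"
      by (simp add: homD[OF F_hom])
  qed
  have f_ten: "f (ten S Ds Xs) = F n (ten S Ds Xs)" if D: "set Ds \<subseteq> Der A" and n: "length Ds + length Xs < n" for Ds Xs n
  proof -
    have z: "p m (ten S Ds Xs) = 0" if "m \<ge> n" for m
      using that n by (intro vanishesD[OF p_van D]) simp
    have "f (ten S Ds Xs) = F (max n (N (ten S Ds Xs))) (ten S Ds Xs)"
      by (rule f_eq) simp
    also have "\<dots> = F n (ten S Ds Xs)"
      unfolding F_def by (rule sum.mono_neutral_right) (use z in auto)
    finally show ?thesis .
  qed
  have "f - (Pop e f + g) = 0"
  proof (rule hom_eq_0)
    show "f - (Pop e f + g) \<in> hom"
      by (intro hom_closed hom_Pop f_hom g)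
    fix n
    have "vanishes n (f - F n)"
      using f_ten by (simp add: vanishes_def)
    then have "vanishes (Suc n) (Pop e (f - F n))"
      by (intro Pop_vanishes hom_closed f_hom F_hom)
    then have P: "Pop e f (ten S Ds Xs) = Pop e (F n) (ten S Ds Xs)"
      if "set Ds \<subseteq> Der A" "length Ds + length Xs < Suc n" for Ds Xs
      using vanishesD[of "Suc n" "Pop e (f - F n)" Ds Xs] that by (simp add: Pop_linear f_hom F_hom)
    show "vanishes n (f - (Pop e f + g))"
      unfolding vanishes_def
      using P f_ten[of _ _ "Suc n"] F_Suc[of n] by (simp add: plus_fun_apply)
  qed
  then show "\<exists>f. f \<in> hom \<and> f = Pop e f + g"
    using f_hom by (intro exI[of _ f]) simp
next
  fix f f' assume f: "f \<in> hom \<and> f = Pop e f + g" and f': "f' \<in> hom \<and> f' = Pop e f' + g"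
  have "f - f' = 0"
  proof (rule Pop_fixpoint)
    have "f - f' = (Pop e f + g) - (Pop e f' + g)"
      using f f' by argo
    also have "\<dots> = Pop e f - Pop e f'"
      by simp
    also have "\<dots> = Pop e (f - f')"
      by (rule Pop_linear(2)[symmetric]) (use f f' in auto)
    finally show "f - f' = Pop e (f - f')" .
  qed (use f f' hom_closed in auto)
  then show "f = f'" by simp
qed

definition resolvent :: "nat \<Rightarrow> ('w \<Rightarrow> 'r list \<Rightarrow> 'u) \<Rightarrow> 'w \<Rightarrow> 'r list \<Rightarrow> 'u" where
  "resolvent e g = (THE f. f \<in> hom \<and> f = Pop e f + g)"

lemma resolvent:
  assumes "g \<in> hom"
  shows hom_resolvent: "resolvent e g \<in> hom" and resolvent_eq: "resolvent e g = Pop e (resolvent e g) + g"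
  using theI'[OF Pop_solution[OF assms, of e]] unfolding resolvent_def by blast+

lemma resolvent_unique: "g \<in> hom \<Longrightarrow> f \<in> hom \<Longrightarrow> f = Pop e f + g \<Longrightarrow> resolvent e g = f"
  using Pop_solution[of g e] resolvent[of g e] by blast

lemma resolvent_add:
  assumes "g \<in> hom" "h \<in> hom"
  shows "resolvent e (g + h) = resolvent e g + resolvent e h"
proof (rule resolvent_unique)
  have "resolvent e g + resolvent e h = (Pop e (resolvent e g) + g) + (Pop e (resolvent e h) + h)"
    using assms resolvent_eq by metis
  then show "resolvent e g + resolvent e h = Pop e (resolvent e g + resolvent e h) + (g + h)"
    unfolding Pop_linear(1)[OF hom_resolvent[OF assms(1)] hom_resolvent[OF assms(2)]]
    by (simp only: ac_simps)
qed (use assms in \<open>auto intro: hom_closed hom_resolvent\<close>)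

lemma resolvent_zero: "resolvent e 0 = 0"
  using resolvent_add[of 0 0 e] hom_closed(1) by simp

lemma Pop_scC:
  assumes f: "f \<in> hom"
  shows "Pop e (\<lambda>w. scC U c (f w)) = (\<lambda>w. scC U c (Pop e f w))"
proof -
  have scC_add: "additive (scC U c)"
    by (simp add: additive_def scC_def fun_eq_iff plus_fun_apply U.scale_right_distrib)
  have Qg: "Qg (\<lambda>w. scC U c (f w)) = (\<lambda>X w. scC U c (Qg f X w))"
    by (simp add: Qg_def fun_eq_iff left_mult_simps scC_def scU_mult U.scale_right_diff_distrib)
  have "Qop (\<lambda>w. scC U c (f w)) = (\<lambda>w. scC U c (Qop f w))"
    unfolding Qop_def Qg by (rule ext) (rule cosum_compose[OF balanced_Qg[OF f] scC_add, symmetric])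
  moreover have "Jop (\<lambda>w. scC U c (f w)) = (\<lambda>w. scC U c (Jop f w))"
    by (auto simp: Jop_def fun_eq_iff scC_def split: list.split)
  ultimately show ?thesis
    by (simp add: Pop_def fun_eq_iff plus_fun_apply alt_sign_def additive.add[OF scC_add] additive.minus[OF scC_add])
qed

lemma resolvent_scC:
  assumes "g \<in> hom"
  shows "resolvent e (\<lambda>w. scC U c (g w)) = (\<lambda>w. scC U c (resolvent e g w))"
proof (rule resolvent_unique)
  have "scC U c (resolvent e g w) = scC U c ((Pop e (resolvent e g) + g) w)" for w
    using resolvent_eq[OF assms, of e] by simp
  then have "scC U c (resolvent e g w) = scC U c (Pop e (resolvent e g) w) + scC U c (g w)" for w
    by (simp add: scC_def fun_eq_iff plus_fun_apply U.scale_right_distrib)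
  then show "(\<lambda>w. scC U c (resolvent e g w)) = Pop e (\<lambda>w. scC U c (resolvent e g w)) + (\<lambda>w. scC U c (g w))"
    using assms by (simp add: Pop_scC hom_resolvent fun_eq_iff plus_fun_apply)
qed (use assms in \<open>auto intro: hom_scC hom_resolvent\<close>)

subsection \<open>The normalised family \<open>t\<close>\<close>

text \<open>The inclusion R \<rightarrow> U, as a cochain of degree 0, extended by zero to tensors
  with at least one factor.\<close>

definition epsilon :: "'w \<Rightarrow> 'r list \<Rightarrow> 'u" where
  "epsilon w rs = (if rs = [] then extend (\<lambda>r Ds Xs. if Ds = [] \<and> Xs = [] then inR U r else 0) w else 0)"

lemma epsilon_form: "multilinear_form (\<lambda>r Ds Xs. if Ds = [] \<and> Xs = [] then inR U r else 0)"
  by (rule multilinear_formI) (auto simp: additive_def inR_simps)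

lemma additive_epsilon: "additive epsilon"
  by (rule additive.intro, rule ext)
    (simp add: epsilon_def plus_fun_apply additive.add[OF additive_extend[OF epsilon_form]])

lemma epsilon_ten:
  "set Ds \<subseteq> Der A \<Longrightarrow> epsilon (scW S r (ten S Ds Xs)) rs = (if rs = [] \<and> Ds = [] \<and> Xs = [] then inR U r else 0)"
  by (simp add: epsilon_def extend_ten[OF epsilon_form])

lemma hom_epsilon: "epsilon \<in> hom"
proof (rule homI[OF additive_epsilon])
  show "epsilon (scW S a w) = left_mult (inR U a) (epsilon w)" for a w
  proof (rule ten_eqI[where w = w])
    show "additive (\<lambda>w. epsilon (scW S a w))"
      by (rule additive_compose[OF additive_epsilon additive_scW(1)])
    show "additive (\<lambda>w. left_mult (inR U a) (epsilon w))"
      by (rule additive_compose[OF additive_left_mult additive_epsilon])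
  qed (auto simp: epsilon_ten left_mult_simps inR_simps fun_eq_iff)
qed

abbreviation FT :: "'l \<Rightarrow> ('w \<Rightarrow> 'r list \<Rightarrow> 'u) \<Rightarrow> 'w \<Rightarrow> 'r list \<Rightarrow> 'u" where
  "FT Y c \<equiv> \<lambda>w. c (FW Y w)"

text \<open>The default 0 at level 0 propagates: \<open>t_level k\<close> vanishes on lists of
  length other than k. It is defined on all lists so that the lemmas on \<open>star\<close> apply to
  it.\<close>

primrec t_level :: "nat \<Rightarrow> 'l list \<Rightarrow> 'w \<Rightarrow> 'r list \<Rightarrow> 'u" where
  "t_level 0 Ys = (if Ys = [] then resolvent 0 epsilon else 0)"
| "t_level (Suc k) Ys = resolvent (Suc k) (one_star FT (t_level k) Ys)"

text \<open>Up to the sign \<open>(-1)\<^sup>k\<^sup>(\<^sup>k\<^sup>-\<^sup>1\<^sup>)\<^sup>/\<^sup>2\<close> these are the maps \<open>s\<close>;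
  the sign turns the last term of their recursion into a product of cochains.\<close>
definition t_map :: "'l list \<Rightarrow> 'w \<Rightarrow> 'r list \<Rightarrow> 'u" where
  "t_map Ys = t_level (length Ys) Ys"

lemma pairing_compose: "pairing (\<lambda>f c w. c (f w)) hom"
  by (rule pairing.intro)
    (auto simp: fun_eq_iff plus_fun_apply homD hom_closed)

lemma one_star_in_hom:
  assumes "\<And>Xs. c Xs \<in> hom"
  shows "one_star FT c Ys \<in> hom"
  using assms by (induction Ys arbitrary: c) (auto intro!: hom_closed hom_FW)

lemma t_level_hom: "t_level k Ys \<in> hom"
  by (induction k arbitrary: Ys) (auto intro: hom_closed hom_epsilon hom_resolvent one_star_in_hom)

lemma t_map_hom: "t_map Ys \<in> hom"
  by (simp add: t_map_def t_level_hom)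

lemma t_map_eq:
  "t_map Ys = Pop (length Ys) (t_map Ys) + one_star FT t_map Ys + (if Ys = [] then epsilon else 0)"
proof (cases Ys)
  case Nil
  then show ?thesis
    using resolvent_eq[OF hom_epsilon] by (simp add: t_map_def)
next
  case (Cons Y Ys')
  have "one_star FT t_map Ys = one_star FT (t_level (length Ys')) Ys"
    unfolding one_star_eq_sum t_map_def using Cons
    by (intro sum.cong refl) (simp add: length_remove_nth)
  moreover have "one_star FT (t_level (length Ys')) Ys \<in> hom"
    by (rule one_star_in_hom) (rule t_level_hom)
  ultimately show ?thesis
    using Cons resolvent_eq[of "one_star FT (t_level (length Ys')) Ys" "length Ys"]
    by (simp add: t_map_def)
qed

lemma FW_cochain:
  "multiadditive (one_cochain FW)" "alternating (one_cochain FW)"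
  "multihomogeneous (scL A) (\<lambda>c f w. scWK A S c (f w)) (one_cochain FW)"
proof -
  have "FW (x + y) = FW x + FW y" "FW (scL A c x) = (\<lambda>w. scWK A S c (FW x w))" for x y c
    by (simp_all add: fun_eq_iff plus_fun_apply FW_add FW_scale)
  moreover have "(\<lambda>w. scWK A S c ((0::'w \<Rightarrow> 'w) w)) = 0" for c
    by (simp add: fun_eq_iff scWK_def)
  ultimately show "multiadditive (one_cochain FW)" "alternating (one_cochain FW)"
    "multihomogeneous (scL A) (\<lambda>c f w. scWK A S c (f w)) (one_cochain FW)"
    by (auto simp: multiadditive_def alternating_def multihomogeneous_def one_cochain_def append_eq_Cons_conv
        split: list.split)
qed

lemma one_star_eq_star:
  "(\<And>Xs. c Xs \<in> hom) \<Longrightarrow> one_star FT c = star (\<lambda>f c w. c (f w)) (one_cochain FW) c"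
  using pairing.star_one_cochain[OF pairing_compose, of c FW] by (simp add: fun_eq_iff)

lemma hom_scWK: "c \<in> hom \<Longrightarrow> c (scWK A S a w) = scC U a (c w)"
  by (simp add: scWK_def homD inR_simps scC_def fun_eq_iff left_mult_simps scU_mult)

text \<open>Linearity and alternation in the arguments from L pass through the product with the
  one-cochain F and then through the resolvent, which is K-linear.\<close>

lemma t_level_multilinear:
  "multiadditive (t_level k) \<and> alternating (t_level k) \<and>
   multihomogeneous (scL A) (\<lambda>c f w. scC U c (f w)) (t_level k)"
proof (induction k)
  case 0
  have "(\<lambda>w. scC U c ((0::'w \<Rightarrow> 'r list \<Rightarrow> 'u) w)) = 0" for c
    by (simp add: fun_eq_iff scC_def)
  then show ?case
    by (auto simp: multiadditive_def alternating_def multihomogeneous_def)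
next
  case (Suc k)
  let ?s = "one_star FT (t_level k)"
  have s: "?s = star (\<lambda>f c w. c (f w)) (one_cochain FW) (t_level k)"
    by (rule one_star_eq_star[OF t_level_hom])
  have "multiadditive ?s" "alternating ?s"
    unfolding s
    using FW_cochain Suc t_level_hom
    by (auto intro!: pairing.star_multiadditive[OF pairing_compose] pairing.star_alternating[OF pairing_compose])
  moreover have "multihomogeneous (scL A) (\<lambda>c f w. scC U c (f w)) ?s"
    unfolding s
  proof (rule pairing.star_multihomogeneous[OF pairing_compose])
    show "additive (\<lambda>f w. scC U c (f w))" "additive (\<lambda>f w. scWK A S c (f w))" for c
      by (simp_all add: additive_def fun_eq_iff plus_fun_apply scC_def scWK_def U.scale_right_distrib
          W.scale_right_distrib)
    show "(\<lambda>w. c (scWK A S a (x w))) = (\<lambda>w. scC U a (c (x w)))" if "c \<in> hom" for a x c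
      by (simp add: hom_scWK that)
  qed (use FW_cochain Suc t_level_hom in auto)
  ultimately have "multiadditive ?s" "alternating ?s" "multihomogeneous (scL A) (\<lambda>c f w. scC U c (f w)) ?s"
    by blast+
  then show ?case
    using one_star_in_hom[of "t_level k", OF t_level_hom]
    by (simp add: multiadditive_def alternating_def multihomogeneous_def resolvent_add resolvent_zero resolvent_scC)
qed

lemma t_map_multilinear:
  "multiadditive t_map" "alternating t_map" "multihomogeneous (scL A) (\<lambda>c f w. scC U c (f w)) t_map"
  using t_level_multilinear unfolding multiadditive_def alternating_def multihomogeneous_def t_map_def
  by simp_all

end

subsection \<open>The fundamental identity\<close>

context lr_connection
begin

lemma additive_b: "additive (hochschild_b U)"
  by (rule additive.intro, rule ext) (simp add: plus_fun_def hochschild_b_add)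

lemma b_left_mult_inR: "hochschild_b U (left_mult (inR U a) \<phi>) = left_mult (inR U a) (hochschild_b U \<phi>)"
  by (rule ext) (simp add: left_mult_def hochschild_b_left_mult)

text \<open>The correction is the cup product with \<rho>(X); it comes from moving the first entry
  past X in U.\<close>

lemma b_left_mult_inL:
  "hochschild_b U (left_mult (inL U X) \<phi>) rs =
     inL U X * hochschild_b U \<phi> rs - (case rs of [] \<Rightarrow> 0 | r # ss \<Rightarrow> inR U (anc A X r) * \<phi> ss)"
  unfolding left_mult_def
proof (induction rs arbitrary: \<phi>)
  case (Cons r rs)
  have comm: "inR U a * (inL U X * u) = inL U X * (inR U a * u) - inR U (anc A X a) * u" for a u
    using inL_inR[of X a] by (simp add: algebra_simps flip: mult.assoc)
  show ?case
    using Cons.IH[of "\<lambda>ss. \<phi> (r # ss)"]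
    by (cases rs) (simp_all add: comm algebra_simps)
qed simp

lemma lie_left_mult:
  "hochschild_lie A U Z (left_mult (inR U a) \<phi>) =
     left_mult (inR U a) (hochschild_lie A U Z \<phi>) + left_mult (inR U (anc A Z a)) \<phi>"
  "hochschild_lie A U Z (left_mult (inL U Y) \<phi>) =
     left_mult (inL U Y) (hochschild_lie A U Z \<phi>) + left_mult (inL U (brk A Z Y)) \<phi>"
  by (rule ext; simp add: hochschild_lie_eq left_mult_def lie_der_inR_mult lie_der_inL_mult plus_fun_apply)+

lemmas lie_lin = additive.add[OF additive_hochschild_lie] additive.zero[OF additive_hochschild_lie]
  additive.minus[OF additive_hochschild_lie] additive.diff[OF additive_hochschild_lie]

lemmas b_lin = additive.add[OF additive_b] additive.zero[OF additive_b]
  additive.minus[OF additive_b] additive.diff[OF additive_b]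

section \<open>Operators on maps from Sym(ad(L)) to Hochschild cochains\<close>

definition MW :: "'l \<Rightarrow> ('w \<Rightarrow> 'r list \<Rightarrow> 'u) \<Rightarrow> 'w \<Rightarrow> 'r list \<Rightarrow> 'u" where
  "MW Z f = (\<lambda>w. hochschild_lie A U Z (f w) - f (lieW Z w))"

definition bW :: "('w \<Rightarrow> 'r list \<Rightarrow> 'u) \<Rightarrow> 'w \<Rightarrow> 'r list \<Rightarrow> 'u" where
  "bW f = (\<lambda>w. hochschild_b U (f w))"

text \<open>The sum over j of the cup product of \<rho>(X_j) with f of the remaining tensor. It is
  the correction in both \<open>bW_Qop\<close> and \<open>Jop_delta\<close>, and its two occurrences
  in \<open>bt_eq\<close> and \<open>td_eq\<close> have opposite signs.\<close>

definition Kop :: "('w \<Rightarrow> 'r list \<Rightarrow> 'u) \<Rightarrow> 'w \<Rightarrow> 'r list \<Rightarrow> 'u" where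
  "Kop f = cosum (\<lambda>X w rs. case rs of [] \<Rightarrow> 0 | r # ss \<Rightarrow> inR U (anc A X r) * f w ss)"

lemma additive_MW: "additive (MW Z)"
  by (rule additive.intro, rule ext) (simp add: MW_def plus_fun_apply lie_lin algebra_simps)

lemma additive_bW: "additive bW"
  by (rule additive.intro, rule ext) (simp add: bW_def plus_fun_apply b_lin)

lemma hom_MW: "f \<in> hom \<Longrightarrow> MW Z f \<in> hom"
  by (rule homI)
    (simp_all add: MW_def additive_def homD lieW_lin lieW_simps lie_lin lie_left_mult left_mult_simps(1-6) algebra_simps)

lemma hom_bW: "f \<in> hom \<Longrightarrow> bW f \<in> hom"
  by (rule homI) (simp_all add: bW_def additive_def homD b_lin b_left_mult_inR)

lemma MW_Jop:
  assumes f: "f \<in> hom"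
  shows "MW Z (Jop f) = Jop (MW Z f)"
proof (intro ext)
  fix w rs show "MW Z (Jop f) w rs = Jop (MW Z f) w rs"
  proof (cases rs)
    case (Cons r ss)
    then show ?thesis
      by (simp add: MW_def hochschild_lie_eq lieW_iota homD[OF f] plus_fun_apply)
  qed (simp add: MW_def hochschild_lie_eq)
qed

text \<open>Left multiplication by X and its bracket term combine to Q of \<open>MW Z f\<close>.
  What is left is f applied to the invariance defect of the basic connection, which is
  \<open>EW\<close>.\<close>

lemma MW_Qop:
  assumes f: "f \<in> hom"
  shows "MW Z (Qop f) = Qop (MW Z f) + (\<lambda>w. - f (cosum (EW Z) w))"
proof
  fix w
  let ?L = "hochschild_lie A U Z"
  have b1: "balanced (\<lambda>X w. ?L (Qg f X w))"
    by (rule balanced_right(2)[OF balanced_Qg[OF f] additive_hochschild_lie])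
  have b2: "balanced (\<lambda>X w. f (EW Z X w))"
    by (rule balanced_right(2)[OF balanced_EW homD(1)[OF f]])
  note b3 = balanced_lieW_left[OF balanced_Qg[OF f], of Z]
  have "MW Z (Qop f) w = cosum (\<lambda>X w. ?L (Qg f X w) - (Qg f (brk A Z X) w + Qg f X (lieW Z w))) w"
    using cosum_compose[OF balanced_Qg[OF f] additive_hochschild_lie, of Z w] cosum_lieW[OF balanced_Qg[OF f], of Z w]
    by (simp add: MW_def Qop_def cosum_diff[OF b1 b3])
  also have "\<dots> = cosum (\<lambda>X w. Qg (MW Z f) X w - f (EW Z X w)) w"
    by (rule cosum_cong)
      (simp add: Qg_def MW_def EW_eq homD[OF f] lie_lin lie_left_mult left_mult_simps algebra_simps)
  also have "\<dots> = Qop (MW Z f) w - f (cosum (EW Z) w)"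
    using cosum_compose[OF balanced_EW homD(1)[OF f], of Z w]
    by (simp add: Qop_def cosum_diff balanced_Qg hom_MW f b2)
  finally show "MW Z (Qop f) w = (Qop (MW Z f) + (\<lambda>w. - f (cosum (EW Z) w))) w"
    by (simp add: plus_fun_apply)
qed

text \<open>The contraction is a derivation in r, so \<open>hochschild_N r\<close> annihilates the
  values of J, and only the second term of the recursion for b survives.\<close>

lemma bW_Jop:
  assumes f: "f \<in> hom"
  shows "bW (Jop f) = - Jop (bW f)"
proof (intro ext)
  fix w rs
  have "hochschild_N r (Jop f w) rs = 0" for r rs
    by (cases rs) (simp_all add: iota_mult homD[OF f] left_mult_simps plus_fun_apply)
  then show "bW (Jop f) w rs = (- Jop (bW f)) w rs"
    by (cases rs) (simp_all add: bW_def)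
qed

lemma balanced_K:
  assumes f: "f \<in> hom"
  shows "balanced (\<lambda>X w rs. case rs of [] \<Rightarrow> 0 | r # ss \<Rightarrow> inR U (anc A X r) * f w ss)"
  by (rule balancedI)
    (auto simp: additive_def fun_eq_iff plus_fun_apply homD[OF f] anc_add anc_act der_scale_def inR_simps left_mult_simps
      distrib_left distrib_right inR_commute mult.assoc[symmetric] split: list.split)

lemma bW_Qop:
  assumes f: "f \<in> hom"
  shows "bW (Qop f) = Qop (bW f) - Kop f"
proof
  fix w
  have "bW (Qop f) w = cosum (\<lambda>X w. hochschild_b U (Qg f X w)) w"
    by (simp add: bW_def Qop_def cosum_compose[OF balanced_Qg[OF f] additive_b])
  also have "\<dots> = cosum (\<lambda>X w. Qg (bW f) X w - (\<lambda>rs. case rs of [] \<Rightarrow> 0 | r # ss \<Rightarrow> inR U (anc A X r) * f w ss)) w"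
    by (rule cosum_cong)
      (simp add: Qg_def bW_def b_lin fun_eq_iff b_left_mult_inL left_mult_simps)
  also have "\<dots> = (Qop (bW f) - Kop f) w"
    by (simp add: Qop_def Kop_def cosum_diff balanced_Qg hom_bW f balanced_K)
  finally show "bW (Qop f) w = (Qop (bW f) - Kop f) w" .
qed

lemma Jop_delta:
  assumes f: "f \<in> hom"
  shows "Jop f (delta w) = Kop f w - Jop (\<lambda>w. f (delta w)) w"
proof
  fix rs
  have eval: "additive (\<lambda>\<phi>::'r list \<Rightarrow> 'u. \<phi> rs)" for rs
    by (simp add: additive_def plus_fun_apply)
  show "Jop f (delta w) rs = (Kop f w - Jop (\<lambda>w. f (delta w)) w) rs"
  proof (cases rs)
    case Nil
    have "Kop f w [] = cosum (\<lambda>X w. 0) w"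
      using cosum_compose[OF balanced_K[OF f] eval, of w "[]"] by (simp add: Kop_def)
    also have "\<dots> = (0::'u)"
      using cosum_compose[OF balanced_anc additive_zero, of w] by simp
    finally show ?thesis using Nil by simp
  next
    case (Cons r ss)
    have "Kop f w (r # ss) = cosum (\<lambda>X w. inR U (anc A X r) * f w ss) w"
      using cosum_compose[OF balanced_K[OF f] eval, of w "r # ss"] by (simp add: Kop_def)
    also have "\<dots> = cosum (\<lambda>X w. f (scW S (anc A X r) w) ss) w"
      by (simp add: homD[OF f] left_mult_simps)
    also have "\<dots> = f (cosum (\<lambda>X. scW S (anc A X r)) w) ss"
      using cosum_compose[OF balanced_iota, of "\<lambda>w. f w ss" r w] homD(1)[OF f]
      by (simp add: additive_def plus_fun_apply)
    finally show ?thesis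
      using Cons by (simp add: iota_delta homD[OF f])
  qed
qed

lemma Qop_delta:
  assumes f: "f \<in> hom"
  shows "Qop f (delta w) = Qop (\<lambda>w. f (delta w)) w"
  unfolding Qop_def cosum_delta[OF balanced_Qg[OF f]]
  by (rule cosum_cong) (simp add: Qg_def nabW_delta)

lemma hom_ten_eq_0:
  assumes "f \<in> hom" "\<And>Ds Xs. set Ds \<subseteq> Der A \<Longrightarrow> f (ten S Ds Xs) = 0"
  shows "f = 0"
  by (rule hom_eq_0[OF assms(1)]) (simp add: vanishes_def assms(2))

lemma epsilon_relations: "MW Z epsilon = 0" "bW epsilon = 0" "epsilon (delta w) = 0"
proof -
  let ?z = "\<lambda>u rs. if rs = [] then u else (0::'u)"
  have eps: "epsilon (scW S r (ten S Ds Xs)) = ?z (if Ds = [] \<and> Xs = [] then inR U r else 0)"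
    if "set Ds \<subseteq> Der A" for r Ds Xs
    by (rule ext) (simp add: epsilon_ten that)
  have eps1: "epsilon (ten S Ds Xs) = ?z (if Ds = [] \<and> Xs = [] then 1 else 0)" if "set Ds \<subseteq> Der A" for Ds Xs
    using epsilon_ten[OF that, of 1 Xs] by (auto simp: fun_eq_iff inR_simps)
  have "epsilon (lieW Z (ten S Ds Xs)) = 0" if D: "set Ds \<subseteq> Der A" for Ds Xs
  proof -
    have "epsilon (ten S (Ds[i := der_bracket (anc A Z) (Ds ! i)]) Xs) = 0" if "i < length Ds" for i
      using list_update_Der[OF D that, of "der_bracket (anc A Z)"] that
      by (subst eps1) (auto simp: Der_closed)
    moreover have "epsilon (ten S Ds (Xs[j := brk A Z (Xs ! j)])) = 0" if "j < length Xs" for j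
      using that by (subst eps1) (auto simp: D)
    ultimately show ?thesis
      by (simp add: lieW_def derivation_ten[OF lieW_form D] homD[OF hom_epsilon])
  qed
  note lie0 = this
  have lie: "hochschild_lie A U Z (?z u) = ?z (adU Z u)" for u
    by (rule ext) (simp add: hochschild_lie_def)
  have ad: "adU Z (inR U r) = inR U (anc A Z r)" for r
    using inL_inR[of Z r] by simp
  show "MW Z epsilon = 0"
  proof (rule hom_ten_eq_0)
    fix Ds and Xs :: "'l list" assume D: "set Ds \<subseteq> Der A"
    have "adU Z (if Ds = [] \<and> Xs = [] then 1 else 0) = 0"
      by simp
    then show "MW Z epsilon (ten S Ds Xs) = 0"
      unfolding MW_def lie0[OF D] eps1[OF D] lie by (simp add: fun_eq_iff)
  qed (rule hom_MW[OF hom_epsilon])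
  have "hochschild_b U (?z (inR U a)) rs = 0" for a rs
  proof (cases rs)
    case (Cons r ss)
    have "hochschild_b U (\<lambda>ss. ?z (inR U a) (r # ss)) ss = 0"
      by (simp add: hochschild_b_zero)
    with Cons show ?thesis by (cases ss) (simp_all add: inR_commute)
  qed simp
  then have b: "hochschild_b U (?z (inR U a)) = 0" for a
    by (simp add: fun_eq_iff)
  show "bW epsilon = 0"
  proof (rule hom_ten_eq_0)
    fix Ds and Xs :: "'l list" assume D: "set Ds \<subseteq> Der A"
    have "inR U (if Ds = [] \<and> Xs = [] then 1 else 0) = (if Ds = [] \<and> Xs = [] then 1 else 0)"
      by (simp add: inR_simps)
    with b[of "if Ds = [] \<and> Xs = [] then 1 else 0"] show "bW epsilon (ten S Ds Xs) = 0"
      unfolding bW_def eps1[OF D] by (simp only:)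
  qed (rule hom_bW[OF hom_epsilon])
  have "(\<lambda>w. epsilon (delta w)) = 0"
  proof (rule hom_ten_eq_0)
    fix Ds and Xs :: "'l list" assume D: "set Ds \<subseteq> Der A"
    have "epsilon (ten S (anc A X # Ds) Ys) = 0" for X Ys
      using D by (subst eps1) (auto simp: fun_eq_iff)
    then show "epsilon (delta (ten S Ds Xs)) = 0"
      by (simp add: delta_ten D homD[OF hom_epsilon])
  qed (rule hom_delta[OF hom_epsilon])
  then show "epsilon (delta w) = 0"
    by (rule fun_cong[of _ 0, simplified])
qed

lemma ced_zero_cochain:
  assumes "\<And>Z. additive (lie Z)" "\<And>Z. lie Z x = 0"
  shows "ced br lie (\<lambda>Xs. if Xs = [] then x else 0) Ys = 0"
proof (cases Ys)
  case (Cons Z Zs)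
  have "lie_der (br Z) (lie Z) (\<lambda>_. 0) Ws = 0" for Ws
    by (rule lie_der_zero[OF assms(1)])
  then have "lie_der (br Z) (lie Z) (\<lambda>Xs. if Xs = [] then x else 0) Zs = 0"
    by (cases Zs) (simp_all add: assms)
  with Cons show ?thesis
    by (simp add: ced_zero assms(1))
qed simp

lemma ced_one_cochain:
  assumes lie: "\<And>Z. additive (lie Z)" and F: "\<And>Z Y. lie Z (F Y) - lie Y (F Z) = F (br Z Y)"
  shows "ced br lie (one_cochain F) Ys = 0"
proof (cases Ys)
  case (Cons Z Zs)
  have one: "(\<lambda>Xs. one_cochain F (Y # Xs)) = (\<lambda>Xs. if Xs = [] then F Y else 0)" for Y
    by (auto simp: one_cochain_def split: list.split)
  have zero: "lie_der a (lie Y) (\<lambda>Xs. if Xs = [] then x else 0) Xs = (if Xs = [] then lie Y x else 0)" for a Y x Xs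
    by (cases Xs) (simp_all add: lie_der_zero[OF lie])
  have "lie_der (br Z) (lie Z) (one_cochain F) Zs =
      (case Zs of [Y] \<Rightarrow> lie Z (F Y) - F (br Z Y) | _ \<Rightarrow> 0)"
    by (cases Zs) (auto simp: one zero one_cochain_def additive.zero[OF lie] lie_der_zero[OF lie] split: list.split)
  moreover have "ced br lie (\<lambda>Xs. if Xs = [] then F Z else 0) Zs = (case Zs of [Y] \<Rightarrow> lie Y (F Z) | _ \<Rightarrow> 0)"
    by (cases Zs) (auto simp: zero ced_zero[OF lie] lie_der_zero[OF lie] split: list.split)
  ultimately show ?thesis
    using Cons F[of Z] by (auto simp: one algebra_simps split: list.split)
qed simp

lemma one_star_zero: "(\<And>Z c. T Z c = 0) \<Longrightarrow> one_star T c Ys = 0"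
  by (simp add: one_star_eq_sum)

lemma one_star_apply:
  "(\<And>Z c. c \<in> H \<Longrightarrow> g (T Z c) = T' Z c) \<Longrightarrow> additive g \<Longrightarrow> (\<And>Xs. c Xs \<in> H) \<Longrightarrow>
    g (one_star T c Ys) = one_star T' c Ys"
  by (induction Ys arbitrary: c) (simp_all add: additive.zero additive.diff)

definition dt :: "'l list \<Rightarrow> 'w \<Rightarrow> 'r list \<Rightarrow> 'u" where
  "dt = ced (brk A) MW t_map"

lemma hom_dt: "dt Ys \<in> hom"
  unfolding dt_def by (rule ced_in) (auto intro: hom_closed hom_MW t_map_hom)

text \<open>The differential of the recursion for t, term by term: the sign (-1)^k in front of J
  anticommutes with it, Q contributes its commutator with the Lie action, and F is a closed
  one-cochain, so the Leibniz rule leaves only minus the product of F with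
  \<open>dt\<close>.\<close>

lemma dt_eq:
  "dt Ys = - alt_sign (length Ys) (Jop (dt Ys)) + Qop (dt Ys) +
    one_star (\<lambda>Z c w. - c (cosum (EW Z) w)) t_map Ys - one_star FT dt Ys"
proof -
  let ?c = "ced (brk A) MW"
  note lin = ced_add[OF additive_MW]
  have J: "?c (\<lambda>Ys. Jop (t_map Ys)) Ys = Jop (dt Ys)" for Ys
  proof -
    have "?c (\<lambda>Ys. Jop (t_map Ys)) Ys = Jop (?c t_map Ys) + one_star (\<lambda>Z x. 0) t_map Ys"
      by (rule ced_operator[where H = hom and Op = Jop and T = "\<lambda>Z x. 0"])
        (simp_all add: additive_MW hom_closed hom_MW t_map_hom Jop_linear MW_Jop)
    then show ?thesis by (simp add: dt_def one_star_zero)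
  qed
  have bJ: "?c (\<lambda>Ys. alt_sign (length Ys) (Jop (t_map Ys))) Ys = - alt_sign (length Ys) (Jop (dt Ys))"
    using ced_bar[where lie = MW and br = "brk A" and \<phi> = "\<lambda>Ys. Jop (t_map Ys)" and Xs = Ys, OF additive_MW]
    by (simp add: bar_def[abs_def] J)
  have Q: "?c (\<lambda>Ys. Qop (t_map Ys)) Ys = Qop (dt Ys) + one_star (\<lambda>Z c w. - c (cosum (EW Z) w)) t_map Ys"
    unfolding dt_def
    by (rule ced_operator[where H = hom and Op = Qop])
      (simp_all add: additive_MW hom_closed hom_MW t_map_hom Qop_diff MW_Qop)
  have F: "?c (one_star FT t_map) Ys = - one_star FT dt Ys"
  proof -
    let ?P = "\<lambda>(f::'w \<Rightarrow> 'w) c w. c (f w)" and ?lie = "\<lambda>Z f w. lieW Z (f w) - f (lieW Z w)"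
    have add: "additive (?lie Z)" for Z
      by (simp add: additive_def fun_eq_iff plus_fun_apply lieW_lin algebra_simps)
    have 0: "ced (brk A) ?lie (one_cochain FW) = (\<lambda>Ys. 0)"
      by (rule ext, rule ced_one_cochain[OF add]) (simp add: fun_eq_iff lieW_FW)
    have b: "bar (one_cochain FW) = (\<lambda>Xs. - one_cochain FW Xs)"
      by (auto simp: bar_def one_cochain_def fun_eq_iff split: list.split)
    have "?c (star ?P (one_cochain FW) t_map) Ys =
        star ?P (ced (brk A) ?lie (one_cochain FW)) t_map Ys + star ?P (bar (one_cochain FW)) (?c t_map) Ys"
      by (rule pairing.ced_star[OF pairing_compose])
        (simp_all add: add additive_MW hom_MW t_map_hom, simp add: MW_def homD fun_eq_iff plus_fun_apply)
    also have "\<dots> = - star ?P (one_cochain FW) dt Ys"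
      unfolding 0 b dt_def[symmetric]
      by (simp add: pairing.star_zero_left[OF pairing_compose] pairing.star_minus_left[OF pairing_compose]
          t_map_hom hom_dt)
    finally show ?thesis
      using one_star_eq_star[of t_map] one_star_eq_star[of dt] by (simp add: t_map_hom hom_dt)
  qed
  have e: "?c (\<lambda>Ys. if Ys = [] then epsilon else 0) Ys = 0"
    by (rule ced_zero_cochain) (simp_all add: additive_MW epsilon_relations)
  have t: "t_map = (\<lambda>Ys. alt_sign (length Ys) (Jop (t_map Ys)) + Qop (t_map Ys) + one_star FT t_map Ys +
      (if Ys = [] then epsilon else 0))"
    using t_map_eq unfolding Pop_def by (intro ext) (rule fun_cong, rule fun_cong)
  have "dt Ys = ?c (\<lambda>Ys. alt_sign (length Ys) (Jop (t_map Ys)) + Qop (t_map Ys) + one_star FT t_map Ys +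
      (if Ys = [] then epsilon else 0)) Ys"
    unfolding dt_def using t by metis
  also have "\<dots> = ?c (\<lambda>Ys. alt_sign (length Ys) (Jop (t_map Ys))) Ys + ?c (\<lambda>Ys. Qop (t_map Ys)) Ys +
      ?c (one_star FT t_map) Ys + ?c (\<lambda>Ys. if Ys = [] then epsilon else 0) Ys"
    by (simp only: lin)
  finally show ?thesis
    by (simp only: bJ Q F e) (simp add: algebra_simps)
qed

definition bt :: "'l list \<Rightarrow> 'w \<Rightarrow> 'r list \<Rightarrow> 'u" where
  "bt Ys = alt_sign (length Ys) (bW (t_map Ys))"

lemma hom_bt: "bt Ys \<in> hom"
  unfolding bt_def by (intro hom_closed hom_bW t_map_hom)

lemma Jop_alt_sign: "Jop (alt_sign n f) = alt_sign n (Jop f)" and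
  Qop_alt_sign: "f \<in> hom \<Longrightarrow> Qop (alt_sign n f) = alt_sign n (Qop f)"
  by (simp_all add: alt_sign_def Jop_linear Qop_minus)

text \<open>b anticommutes with J, commutes with Q up to \<open>Kop\<close> and passes F freely. The
  factor (-1)^k in \<open>bt\<close> changes the sign of the F-term, whose product has one more
  argument than its factor t.\<close>

lemma bt_eq:
  "bt Ys = - alt_sign (length Ys) (Jop (bt Ys)) + Qop (bt Ys) - alt_sign (length Ys) (Kop (t_map Ys)) - one_star FT bt Ys"
proof -
  let ?n = "length Ys"
  have F: "bW (one_star FT c Ys) = one_star FT (\<lambda>Ys. bW (c Ys)) Ys" for c
    by (induction Ys arbitrary: c)
      (simp_all add: additive.zero[OF additive_bW] additive.diff[OF additive_bW], simp add: bW_def)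
  have F': "one_star FT bt Ys = - alt_sign ?n (one_star FT (\<lambda>Ys. bW (t_map Ys)) Ys)"
    unfolding one_star_eq_sum alt_sign_sum sum_negf[symmetric]
  proof (rule sum.cong)
    fix i assume "i \<in> {..<?n}"
    then show "alt_sign i (\<lambda>w. bt (remove_nth i Ys) (FW (Ys ! i) w)) =
        - alt_sign ?n (alt_sign i (\<lambda>w. bW (t_map (remove_nth i Ys)) (FW (Ys ! i) w)))"
      by (cases ?n) (auto simp: bt_def length_remove_nth fun_eq_iff alt_sign_fun alt_sign_linear add.commute)
  qed simp
  have "bW (t_map Ys) = bW (alt_sign ?n (Jop (t_map Ys)) + Qop (t_map Ys) + one_star FT t_map Ys +
      (if Ys = [] then epsilon else 0))"
    using t_map_eq[of Ys] unfolding Pop_def by (rule arg_cong)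
  also have "\<dots> = - alt_sign ?n (Jop (bW (t_map Ys))) + (Qop (bW (t_map Ys)) - Kop (t_map Ys)) +
      one_star FT (\<lambda>Ys. bW (t_map Ys)) Ys"
    by (simp add: additive.add[OF additive_bW] additive_alt_sign[OF additive_bW] bW_Jop bW_Qop t_map_hom F
        epsilon_relations additive.zero[OF additive_bW] alt_sign_linear)
  finally have "bt Ys = alt_sign ?n \<dots>"
    unfolding bt_def by (rule arg_cong)
  moreover have "Jop (bt Ys) = alt_sign ?n (Jop (bW (t_map Ys)))" "Qop (bt Ys) = alt_sign ?n (Qop (bW (t_map Ys)))"
    by (simp_all add: bt_def Jop_alt_sign Qop_alt_sign hom_bW t_map_hom)
  ultimately show ?thesis
    unfolding F' by (simp add: alt_sign_linear)
qed

definition td :: "'l list \<Rightarrow> 'w \<Rightarrow> 'r list \<Rightarrow> 'u" where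
  "td Ys = (\<lambda>w. t_map Ys (delta w))"

lemma hom_td: "td Ys \<in> hom"
  unfolding td_def by (intro hom_delta t_map_hom)

text \<open>F and \<delta> are not interchanged here. The term with F after \<delta> is to be
  combined with the \<open>EW\<close>-term of \<open>dt_eq\<close>, for which it has the right
  sign.\<close>

lemma td_eq:
  "td Ys = - alt_sign (length Ys) (Jop (td Ys)) + alt_sign (length Ys) (Kop (t_map Ys)) + Qop (td Ys) +
    one_star (\<lambda>Z c w. c (FW Z (delta w))) t_map Ys"
proof
  fix w
  have F: "one_star FT t_map Ys (delta w) = one_star (\<lambda>Z c w. c (FW Z (delta w))) t_map Ys w"
    by (rule one_star_apply[where g = "\<lambda>f w. f (delta w)" and H = UNIV and T = FT, THEN fun_cong])
      (simp_all add: additive_def fun_eq_iff plus_fun_apply)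
  have "t_map Ys (delta w) = (Pop (length Ys) (t_map Ys) + one_star FT t_map Ys + (if Ys = [] then epsilon else 0)) (delta w)"
    using t_map_eq[of Ys] by (rule fun_cong)
  then show "td Ys w = (- alt_sign (length Ys) (Jop (td Ys)) + alt_sign (length Ys) (Kop (t_map Ys)) + Qop (td Ys) +
      one_star (\<lambda>Z c w. c (FW Z (delta w))) t_map Ys) w"
    by (simp add: Pop_def plus_fun_apply alt_sign_fun Jop_delta Qop_delta t_map_hom F td_def epsilon_relations
        alt_sign_linear)
qed

theorem fundamental_identity: "dt Ys + bt Ys + td Ys = 0"
proof (induction "length Ys" arbitrary: Ys rule: less_induct)
  case less
  let ?A = "\<lambda>Ys. dt Ys + bt Ys + td Ys"
  have FA: "one_star FT ?A Ys = 0"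
    unfolding one_star_eq_sum
  proof (rule sum.neutral, rule ballI)
    fix i assume "i \<in> {..<length Ys}"
    then have "?A (remove_nth i Ys) = 0"
      by (intro less) (simp add: length_remove_nth)
    then have "?A (remove_nth i Ys) w = 0" for w
      by simp
    then show "alt_sign i (\<lambda>w. ?A (remove_nth i Ys) (FW (Ys ! i) w)) = 0"
      by (simp add: alt_sign_def fun_eq_iff)
  qed
  have split: "one_star FT ?A Ys = one_star FT dt Ys + one_star FT bt Ys + one_star FT td Ys"
    unfolding one_star_eq_sum sum.distrib[symmetric]
    by (intro sum.cong refl) (simp add: fun_eq_iff plus_fun_apply alt_sign_fun alt_sign_linear)
  \<comment> \<open>By \<open>delta_FW\<close>, the \<open>EW\<close>-term and the term with F after
    \<delta> leave minus t of \<delta> after F, so the two leftover sums merge into a product of F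
    with \<open>td\<close>.\<close>
  have E: "one_star (\<lambda>Z c w. - c (cosum (EW Z) w)) t_map Ys + one_star (\<lambda>Z c w. c (FW Z (delta w))) t_map Ys =
      - one_star FT td Ys"
  proof -
    have "- c (cosum (EW Z) w) + c (FW Z (delta w)) = - c (delta (FW Z w))" if "c \<in> hom" for c Z w
      using delta_FW[of Z w] homD(2)[OF that, of "delta (FW Z w)" "FW Z (delta w)"] by (simp add: algebra_simps)
    then show ?thesis
      unfolding one_star_eq_sum sum.distrib[symmetric] sum_negf[symmetric]
      by (intro sum.cong refl)
        (simp add: fun_eq_iff plus_fun_apply alt_sign_fun td_def t_map_hom flip: alt_sign_linear)
  qed
  have hom: "?A Ys \<in> hom"
    by (intro hom_closed hom_dt hom_bt hom_td)
  have "?A Ys = - alt_sign (length Ys) (Jop (dt Ys) + Jop (bt Ys) + Jop (td Ys)) +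
      (Qop (dt Ys) + Qop (bt Ys) + Qop (td Ys)) +
      (one_star (\<lambda>Z c w. - c (cosum (EW Z) w)) t_map Ys + one_star (\<lambda>Z c w. c (FW Z (delta w))) t_map Ys) -
      one_star FT dt Ys - one_star FT bt Ys"
    by (subst dt_eq, subst bt_eq, subst td_eq) (simp add: alt_sign_linear)
  \<comment> \<open>The exponent \<open>Suc (length Ys)\<close> encodes the reversed sign in front
    of J.\<close>
  also have "\<dots> = Pop (Suc (length Ys)) (?A Ys) - one_star FT ?A Ys"
    unfolding E split by (simp add: Pop_def Jop_linear Qop_add hom_closed hom_dt hom_bt hom_td)
  finally have "?A Ys = Pop (Suc (length Ys)) (?A Ys)"
    unfolding FA by simp
  then show ?case
    by (rule Pop_fixpoint[OF hom])
qed

end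

subsection \<open>Existence and uniqueness of the maps \<open>s\<close>\<close>

context lr_connection
begin

definition s_normal :: "'l list \<Rightarrow> 'w \<Rightarrow> 'r list \<Rightarrow> 'u" where
  "s_normal Ys = alt_sign (length Ys * (length Ys - 1) div 2) (t_map Ys)"

lemma hom_s_normal: "s_normal Ys \<in> hom"
  unfolding s_normal_def by (intro hom_closed t_map_hom)

lemma cup_sum:
  assumes f: "f \<in> hom" and D: "set Ds \<subseteq> Der A"
  shows "(\<Sum>i<length Ds. alt_sign (i + k) (cup 1 (der_cochain U (Ds ! i)) (f (ten S (remove_nth i Ds) Xs)))) =
    alt_sign k (Jop f (ten S Ds Xs))"
proof
  fix rs
  have ev: "(\<Sum>i<n. alt_sign (i + k) (\<phi> i)) rs = (\<Sum>i<n. alt_sign (i + k) (\<phi> i rs))" for \<phi> :: "nat \<Rightarrow> 'r list \<Rightarrow> 'u" and n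
    by (induction n) (simp_all add: plus_fun_apply alt_sign_fun)
  have ev': "(\<Sum>i<n. \<phi> i) rs = (\<Sum>i<n. \<phi> i rs)" for \<phi> :: "nat \<Rightarrow> 'r list \<Rightarrow> 'u" and n rs
    by (induction n) (simp_all add: plus_fun_apply)
  show "(\<Sum>i<length Ds. alt_sign (i + k) (cup 1 (der_cochain U (Ds ! i)) (f (ten S (remove_nth i Ds) Xs)))) rs =
      alt_sign k (Jop f (ten S Ds Xs)) rs"
  proof (cases rs)
    case Nil
    have "Jop f (ten S Ds Xs) [] = 0" by simp
    then show ?thesis
      using Nil unfolding ev by (simp add: cup_def der_cochain_def alt_sign_fun)
  next
    case (Cons r ss)
    then show ?thesis
      unfolding ev
      by (simp add: cup_def der_cochain_def alt_sign_fun iota_ten D homD[OF f] left_mult_simps ev' alt_sign_sum add.commute)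
  qed
qed

lemma Qop_ten:
  assumes f: "f \<in> hom" and D: "set Ds \<subseteq> Der A"
  shows "Qop f (ten S Ds Xs) = (\<Sum>j<length Xs. left_mult (inL U (Xs ! j)) (f (ten S Ds (remove_nth j Xs)))) -
    (\<Sum>j<length Xs. f (nabW (Xs ! j) (ten S Ds (remove_nth j Xs))))"
  by (simp add: Qop_def cosum_ten[OF balanced_Qg[OF f] D] Qg_def sum_subtractf)

lemma t_map_ten:
  assumes D: "set Ds \<subseteq> Der A" and ne: "(Ds, Xs) \<noteq> ([], [])"
  shows "t_map Ys (ten S Ds Xs) = alt_sign (length Ys) (Jop (t_map Ys) (ten S Ds Xs)) + Qop (t_map Ys) (ten S Ds Xs) +
    (\<Sum>i<length Ys. alt_sign i (t_map (remove_nth i Ys) (FW (Ys ! i) (ten S Ds Xs))))"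
proof -
  have eps: "epsilon (ten S Ds Xs) = 0"
    using epsilon_ten[OF D, of 1 Xs] ne by (auto simp: fun_eq_iff)
  have ev: "one_star FT t_map Ys w = (\<Sum>i<length Ys. alt_sign i (t_map (remove_nth i Ys) (FW (Ys ! i) w)))" for w
  proof -
    have "(\<Sum>i<n. alt_sign i (\<lambda>w. c i w)) w = (\<Sum>i<n. alt_sign i (c i w))" for c :: "nat \<Rightarrow> 'w \<Rightarrow> 'r list \<Rightarrow> 'u" and n
      by (induction n) (simp_all add: plus_fun_apply alt_sign_fun)
    then show ?thesis by (simp add: one_star_eq_sum)
  qed
  have "t_map Ys (ten S Ds Xs) = (Pop (length Ys) (t_map Ys) + one_star FT t_map Ys + (if Ys = [] then epsilon else 0)) (ten S Ds Xs)"
    using t_map_eq[of Ys] by (rule fun_cong)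
  then show ?thesis
    by (simp add: Pop_def plus_fun_apply alt_sign_fun ev eps)
qed

lemma nabW_ten_eq_0:
  assumes D: "set Ds \<subseteq> Der A" and f: "f \<in> hom"
    and z: "\<And>Ds' Xs'. set Ds' \<subseteq> Der A \<Longrightarrow> length Ds' = length Ds \<Longrightarrow> length Xs' = length Xs \<Longrightarrow> f (ten S Ds' Xs') = 0"
  shows "f (nabW X (ten S Ds Xs)) = 0"
  by (simp add: nabW_ten D homD[OF f] z nabla_D_update)

text \<open>Each term of the recursion has fewer tensor factors and still fewer derivations than
  arguments Y; the F-term takes away one of each.\<close>

lemma t_map_vanishes:
  "set Ds \<subseteq> Der A \<Longrightarrow> length Ds < length Ys \<Longrightarrow> t_map Ys (ten S Ds Xs) = 0"
proof (induction "length Ds + length Xs" arbitrary: Ds Xs Ys rule: less_induct)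
  case less
  note D = less.prems(1)
  show ?case
  proof (cases "(Ds, Xs) = ([], [])")
    case False
    have "t_map Ys (ten S (remove_nth i Ds) Xs) = 0" if "i < length Ds" for i
      using less.prems that by (intro less.hyps) (auto simp: length_remove_nth remove_nth_set)
    moreover have "cup 1 \<phi> 0 = (0 :: 'r list \<Rightarrow> 'u)" for \<phi>
      by (simp add: cup_def fun_eq_iff)
    ultimately have "Jop (t_map Ys) (ten S Ds Xs) = 0"
      using cup_sum[OF t_map_hom[of Ys] D, where k = 0 and Xs = Xs] by simp
    moreover have "Qop (t_map Ys) (ten S Ds Xs) = 0"
    proof -
      have "t_map Ys (ten S Ds (remove_nth j Xs)) = 0" if "j < length Xs" for j
        using less.prems that by (intro less.hyps) (auto simp: length_remove_nth)
      moreover have "t_map Ys (nabW X (ten S Ds (remove_nth j Xs))) = 0" if "j < length Xs" for j X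
      proof (rule nabW_ten_eq_0[OF D t_map_hom])
        fix Ds' and Xs' :: "'l list"
        assume "set Ds' \<subseteq> Der A" "length Ds' = length Ds" "length Xs' = length (remove_nth j Xs)"
        then show "t_map Ys (ten S Ds' Xs') = 0"
          using less.prems that by (intro less.hyps) (simp_all add: length_remove_nth)
      qed
      ultimately show ?thesis
        by (simp add: Qop_ten t_map_hom D left_mult_simps)
    qed
    moreover have "t_map (remove_nth i Ys) (FW (Ys ! i) (ten S Ds Xs)) = 0" if i: "i < length Ys" for i
    proof -
      have "t_map (remove_nth i Ys) (ten S (remove_nth i' Ds) Zs) = 0"
        if "i' < length Ds" "length Zs \<le> length Xs" for i' Zs
        using less.prems that i by (intro less.hyps) (auto simp: length_remove_nth remove_nth_set)
      moreover have "length (Z # remove_nth j Xs) \<le> length Xs" if "j < length Xs" for j Z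
        using that by (simp add: length_remove_nth)
      ultimately show ?thesis
        by (simp add: FW_ten D homD[OF t_map_hom])
    qed
    ultimately show ?thesis
      using t_map_ten[OF D False, of Ys] by simp
  next
    case True
    define f where "f = t_map Ys"
    have "vanishes 0 f" by (simp add: vanishes_def)
    then have "Pop (length Ys) f (ten S Ds Xs) = 0"
      using Pop_vanishes[of f 0 "length Ys"] True t_map_hom vanishesD[of 1 "Pop (length Ys) f" "[]" "[]"]
      by (simp add: f_def)
    moreover have "one_star FT t_map Ys (ten S Ds Xs) = 0"
    proof -
      have "FW Y (ten S Ds Xs) = 0" for Y
        using True by (simp add: FW_ten)
      then have "one_star FT c Ys (ten S Ds Xs) = 0" if "\<And>Ys. c Ys \<in> hom" for c
        using that by (induction Ys arbitrary: c) (simp_all add: homD fun_eq_iff)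
      then show ?thesis by (simp add: t_map_hom)
    qed
    moreover have "Ys \<noteq> []"
      using less.prems by auto
    ultimately show ?thesis
      using fun_cong[OF t_map_eq[of Ys], of "ten S Ds Xs"] by (simp add: plus_fun_apply f_def)
  qed
qed

lemma s_normal_family: "is_s_family A U S nab s_normal"
proof -
  let ?e = "\<lambda>Ys::'l list. length Ys * (length Ys - 1) div 2"
  have one: "t_map [] one rs = (if rs = [] then 1 else 0)" for rs
  proof -
    have "vanishes 0 (t_map [])" by (simp add: vanishes_def)
    then have "Pop 0 (t_map []) one = 0"
      using vanishesD[OF Pop_vanishes[OF t_map_hom], of 0 "[]" "[]" "[]" 0] by simp
    then show ?thesis
      using fun_cong[OF t_map_eq[of "[]"], of one] epsilon_ten[of "[]" 1 "[]" rs]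
      by (simp add: plus_fun_apply inR_simps)
  qed
  have rec: "s_normal Ys (ten S Ds Xs) =
      (\<Sum>i<length Ds. alt_sign (i + length Ys) (cup 1 (der_cochain U (Ds ! i)) (s_normal Ys (ten S (remove_nth i Ds) Xs)))) +
      (\<Sum>j<length Xs. left_mult (inL U (Xs ! j)) (s_normal Ys (ten S Ds (remove_nth j Xs)))) -
      (\<Sum>j<length Xs. s_normal Ys (basic_connection A nab S (Xs ! j) (ten S Ds (remove_nth j Xs)))) +
      (\<Sum>i<length Ys. alt_sign (i + 1 + length Ys) (s_normal (remove_nth i Ys) (F_map A nab S (Ys ! i) (ten S Ds Xs))))"
    if D: "set Ds \<subseteq> Der A" and ne: "(Ds, Xs) \<noteq> ([], [])" for Ys Ds Xs
  proof -
    have F: "alt_sign (i + 1 + length Ys) (s_normal (remove_nth i Ys) w) =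
        alt_sign (?e Ys) (alt_sign i (t_map (remove_nth i Ys) w))" if i: "i < length Ys" for i w
    proof -
      obtain m where m: "length Ys = Suc m"
        using i by (cases "length Ys") auto
      \<comment> \<open>With k = m + 1, the exponents k(k-1)/2 for k and for k - 1 differ by k - 1.
        Together with the sign (-1)^(i+1+k) of the F-term this leaves (-1)^i.\<close>
      have "m * Suc m = 2 * m + m * (m - 1)"
        by (cases m) (auto simp: algebra_simps)
      then have "Suc m * m div 2 = m + m * (m - 1) div 2"
        by (simp add: mult.commute)
      then show ?thesis
        using i m by (simp add: s_normal_def length_remove_nth alt_sign_fun) (auto intro!: alt_sign_cong)
    qed
    have "s_normal Ys (ten S Ds Xs) = alt_sign (length Ys) (Jop (s_normal Ys) (ten S Ds Xs)) +
        Qop (s_normal Ys) (ten S Ds Xs) +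
        (\<Sum>i<length Ys. alt_sign (i + 1 + length Ys) (s_normal (remove_nth i Ys) (FW (Ys ! i) (ten S Ds Xs))))"
    proof -
      have s: "s_normal Ys w = alt_sign (?e Ys) (t_map Ys w)" for w
        by (simp add: s_normal_def alt_sign_fun)
      have "(\<Sum>i<length Ys. alt_sign (i + 1 + length Ys) (s_normal (remove_nth i Ys) (FW (Ys ! i) (ten S Ds Xs)))) =
          alt_sign (?e Ys) (\<Sum>i<length Ys. alt_sign i (t_map (remove_nth i Ys) (FW (Ys ! i) (ten S Ds Xs))))"
        unfolding alt_sign_sum by (intro sum.cong refl F) simp
      moreover have "Jop (s_normal Ys) = alt_sign (?e Ys) (Jop (t_map Ys))"
        "Qop (s_normal Ys) = alt_sign (?e Ys) (Qop (t_map Ys))"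
        by (simp_all add: s_normal_def Jop_alt_sign Qop_alt_sign t_map_hom)
      ultimately show ?thesis
        unfolding s t_map_ten[OF D ne] by (simp only: alt_sign_linear alt_sign_fun alt_sign_alt_sign add.commute)
    qed
    then show ?thesis
      unfolding basic_connection_eq F_map_eq cup_sum[OF hom_s_normal D] Qop_ten[OF hom_s_normal D]
      by (simp add: algebra_simps)
  qed
  show ?thesis
    unfolding is_s_family_def
  proof (intro conjI allI impI)
    show "s_normal [] one = (\<lambda>rs. if rs = [] then 1 else 0)"
      by (simp add: s_normal_def one fun_eq_iff)
    show "s_normal Ys (v + w) = s_normal Ys v + s_normal Ys w"
      "s_normal Ys (scW S r w) = left_mult (inR U r) (s_normal Ys w)" for Ys v w r
      by (simp_all add: homD[OF hom_s_normal])
    show "s_normal Ys (ten S Ds Xs) = 0" if "set Ds \<subseteq> Der A" "length Ds < length Ys" for Ys Ds Xs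
      using that by (simp add: s_normal_def alt_sign_fun t_map_vanishes)
  qed (rule rec)
qed

lemma s_family_hom: "is_s_family A U S nab s \<Longrightarrow> s Ys \<in> hom"
  unfolding is_s_family_def by (intro homI additive.intro) blast+

lemma s_family_ten:
  assumes "is_s_family A U S nab s" "set Ds \<subseteq> Der A"
  shows "length Ds < length Ys \<Longrightarrow> s Ys (ten S Ds Xs) = 0"
    and "length Ys \<le> length Ds \<Longrightarrow> (Ds, Xs) \<noteq> ([], []) \<Longrightarrow> s Ys (ten S Ds Xs) =
      (\<Sum>i<length Ds. alt_sign (i + length Ys) (cup 1 (der_cochain U (Ds ! i)) (s Ys (ten S (remove_nth i Ds) Xs)))) +
      (\<Sum>j<length Xs. left_mult (inL U (Xs ! j)) (s Ys (ten S Ds (remove_nth j Xs)))) -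
      (\<Sum>j<length Xs. s Ys (nabW (Xs ! j) (ten S Ds (remove_nth j Xs)))) +
      (\<Sum>i<length Ys. alt_sign (i + 1 + length Ys) (s (remove_nth i Ys) (FW (Ys ! i) (ten S Ds Xs))))"
  using assms unfolding is_s_family_def basic_connection_eq F_map_eq by blast+

text \<open>Every value on the right of the recursion is taken on fewer factors in total: the basic
  connection keeps their number after X_j is removed, and F removes one derivation while replacing a
  symmetric factor.\<close>

lemma s_family_unique:
  assumes s: "is_s_family A U S nab s" and s': "is_s_family A U S nab s'"
  shows "s = s'"
proof -
  have ten: "s Ys (ten S Ds Xs) = s' Ys (ten S Ds Xs)" if "set Ds \<subseteq> Der A" for Ys Ds Xs
    using that
  proof (induction "length Ds + length Xs" arbitrary: Ds Xs Ys rule: less_induct)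
    case less
    note D = less.prems
    consider "length Ds < length Ys" | "length Ys \<le> length Ds" "(Ds, Xs) = ([], [])"
      | "length Ys \<le> length Ds" "(Ds, Xs) \<noteq> ([], [])"
      by linarith
    then show ?case
    proof cases
      case 1
      then show ?thesis
        using s_family_ten(1)[OF s D] s_family_ten(1)[OF s' D] by simp
    next
      case 2
      then have "Ys = []" by auto
      with 2 show ?thesis
        using s s' unfolding is_s_family_def by auto
    next
      case 3
      have 1: "s Ys (ten S (remove_nth i Ds) Xs) = s' Ys (ten S (remove_nth i Ds) Xs)" if "i < length Ds" for i
        by (rule less.hyps) (use that D in \<open>auto simp: length_remove_nth remove_nth_set\<close>)
      have 2: "s Ys (ten S Ds (remove_nth j Xs)) = s' Ys (ten S Ds (remove_nth j Xs))" if "j < length Xs" for j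
        by (rule less.hyps) (use that D in \<open>auto simp: length_remove_nth\<close>)
      have nab: "s Ys (nabW X (ten S Ds (remove_nth j Xs))) = s' Ys (nabW X (ten S Ds (remove_nth j Xs)))"
        if j: "j < length Xs" for j X
      proof -
        have "s Ys (ten S Ds' Xs') = s' Ys (ten S Ds' Xs')"
          if "set Ds' \<subseteq> Der A" "length Ds' = length Ds" "length Xs' = length (remove_nth j Xs)" for Ds' Xs'
          by (rule less.hyps) (use that j in \<open>auto simp: length_remove_nth\<close>)
        then show ?thesis
          by (simp add: nabW_ten D nabla_D_update homD[OF s_family_hom[OF s]] homD[OF s_family_hom[OF s']])
      qed
      have 4: "s (remove_nth i Ys) (FW Y (ten S Ds Xs)) = s' (remove_nth i Ys) (FW Y (ten S Ds Xs))" for i Y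
      proof -
        have "s Zs (ten S (remove_nth i' Ds) (Z # remove_nth j Xs)) = s' Zs (ten S (remove_nth i' Ds) (Z # remove_nth j Xs))"
          if "i' < length Ds" "j < length Xs" for i' j Z Zs
          by (rule less.hyps) (use that D in \<open>auto simp: length_remove_nth remove_nth_set\<close>)
        then show ?thesis
          by (simp add: FW_ten D homD[OF s_family_hom[OF s]] homD[OF s_family_hom[OF s']])
      qed
      show ?thesis
        unfolding s_family_ten(2)[OF s D 3] s_family_ten(2)[OF s' D 3]
        by (simp add: 1 2 nab 4)
    qed
  qed
  have "s Ys - s' Ys = 0" for Ys
    by (rule hom_ten_eq_0) (auto intro: hom_closed s_family_hom s s' simp: ten)
  then show ?thesis by (simp add: fun_eq_iff)
qed

lemma s_map_eq: "s_map A U S nab Ys = alt_sign (length Ys * (length Ys - 1) div 2) (t_map Ys)"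
proof -
  have "s_map A U S nab = s_normal"
    unfolding s_map_def by (rule the_equality) (use s_normal_family s_family_unique in blast)+
  then show ?thesis by (simp add: s_normal_def)
qed

subsection \<open>The values of \<open>t\<close>\<close>

lemma vector_space_scC: "vector_space (scC U)"
  by unfold_locales
    (simp_all add: scC_def fun_eq_iff plus_fun_apply U.scale_right_distrib U.scale_left_distrib)

lemma cochains_closed:
  "0 \<in> hochschild_cochains A U m"
  "\<phi> \<in> hochschild_cochains A U m \<Longrightarrow> \<psi> \<in> hochschild_cochains A U m \<Longrightarrow> \<phi> + \<psi> \<in> hochschild_cochains A U m"
  "\<phi> \<in> hochschild_cochains A U m \<Longrightarrow> \<psi> \<in> hochschild_cochains A U m \<Longrightarrow> \<phi> - \<psi> \<in> hochschild_cochains A U m"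
  "\<phi> \<in> hochschild_cochains A U m \<Longrightarrow> - \<phi> \<in> hochschild_cochains A U m"
  "\<phi> \<in> hochschild_cochains A U m \<Longrightarrow> scC U c \<phi> \<in> hochschild_cochains A U m"
  "\<phi> \<in> hochschild_cochains A U m \<Longrightarrow> left_mult u \<phi> \<in> hochschild_cochains A U m"
  by (auto simp: hochschild_cochains_iff multiadditive_def multihomogeneous_def plus_fun_apply scC_def
      left_mult_def U.scale_right_distrib U.scale_right_diff_distrib scU_mult distrib_left mult.commute)

lemma cochains_alt_sign: "\<phi> \<in> hochschild_cochains A U m \<Longrightarrow> alt_sign n \<phi> \<in> hochschild_cochains A U m"
  by (simp add: alt_sign_def cochains_closed)

lemma cochains_sum: "(\<And>i. i \<in> I \<Longrightarrow> \<phi> i \<in> hochschild_cochains A U m) \<Longrightarrow> sum \<phi> I \<in> hochschild_cochains A U m"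
  by (induction I rule: infinite_finite_induct) (auto intro: cochains_closed)

lemma cup_der_in:
  assumes D: "D \<in> Der A" and \<phi>: "\<phi> \<in> hochschild_cochains A U m"
  shows "cup 1 (der_cochain U D) \<phi> \<in> hochschild_cochains A U (Suc m)"
proof -
  have Nil: "cup 1 (der_cochain U D) \<phi> [] = 0" and Cons: "cup 1 (der_cochain U D) \<phi> (r # rs) = inR U (D r) * \<phi> rs" for r rs
    by (simp_all add: cup_def der_cochain_def)
  note c = \<phi>[unfolded hochschild_cochains_iff]
  have "cup 1 (der_cochain U D) \<phi> rs = 0" if "length rs \<noteq> Suc m" for rs
    using that c by (cases rs) (auto simp only: Nil Cons, auto)
  moreover have "cup 1 (der_cochain U D) \<phi> (us @ (x + y) # vs) =
      cup 1 (der_cochain U D) \<phi> (us @ x # vs) + cup 1 (der_cochain U D) \<phi> (us @ y # vs)" for us x y vs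
    using c
    by (cases us) (simp_all only: append_Nil append_Cons Cons Der_D[OF D] inR_simps distrib_right multiadditive_def distrib_left)
  moreover have "cup 1 (der_cochain U D) \<phi> (us @ scR A a x # vs) = scU U a (cup 1 (der_cochain U D) \<phi> (us @ x # vs))" for us a x vs
    using c
    by (cases us) (simp_all only: append_Nil append_Cons Cons Der_D[OF D] inR_simps scU_mult multihomogeneous_def)
  ultimately show ?thesis
    by (auto simp: hochschild_cochains_iff multiadditive_def multihomogeneous_def)
qed

lemma s_normal_ten_in:
  "set Ds \<subseteq> Der A \<Longrightarrow> length Ys \<le> length Ds \<Longrightarrow>
     s_normal Ys (ten S Ds Xs) \<in> hochschild_cochains A U (length Ds - length Ys)"
proof (induction "length Ds + length Xs" arbitrary: Ds Xs Ys rule: less_induct)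
  case less
  note D = less.prems(1)
  note fam = s_normal_family
  let ?C = "hochschild_cochains A U (length Ds - length Ys)"
  show ?case
  proof (cases "(Ds, Xs) = ([], [])")
    case True
    moreover have "s_normal [] one = (\<lambda>rs. if rs = [] then 1 else 0)"
      using fam by (simp add: is_s_family_def)
    ultimately show ?thesis
      using less.prems by (auto simp: hochschild_cochains_iff multiadditive_def multihomogeneous_def)
  next
    case False
    have 1: "cup 1 (der_cochain U (Ds ! i)) (s_normal Ys (ten S (remove_nth i Ds) Xs)) \<in> ?C" if i: "i < length Ds" for i
    proof (cases "length Ys = length Ds")
      case True
      \<comment> \<open>The degree of this factor would be -1, which truncated subtraction does not
        express; the factor is zero here.\<close>
      have "s_normal Ys (ten S (remove_nth i Ds) Xs) = 0"
        by (rule s_family_ten(1)[OF fam]) (use True i D in \<open>auto simp: length_remove_nth remove_nth_set\<close>)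
      then have "cup 1 (der_cochain U (Ds ! i)) (s_normal Ys (ten S (remove_nth i Ds) Xs)) = 0"
        by (simp add: cup_def fun_eq_iff)
      then show ?thesis by (simp add: cochains_closed)
    next
      case neq: False
      have "s_normal Ys (ten S (remove_nth i Ds) Xs) \<in> hochschild_cochains A U (length (remove_nth i Ds) - length Ys)"
        by (rule less.hyps) (use less.prems neq i in \<open>auto simp: length_remove_nth remove_nth_set\<close>)
      moreover have "Ds ! i \<in> Der A"
        using D i nth_mem by blast
      ultimately have "cup 1 (der_cochain U (Ds ! i)) (s_normal Ys (ten S (remove_nth i Ds) Xs)) \<in>
          hochschild_cochains A U (Suc (length (remove_nth i Ds) - length Ys))"
        by (intro cup_der_in)
      moreover have "Suc (length (remove_nth i Ds) - length Ys) = length Ds - length Ys"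
        using less.prems neq i by (simp add: length_remove_nth)
      ultimately show ?thesis by simp
    qed
    have 2: "s_normal Ys (ten S Ds' Xs') \<in> ?C"
      if "set Ds' \<subseteq> Der A" "length Ds' = length Ds" "length Xs' < length Xs" for Ds' Xs'
      using less.hyps[of Ds' Xs' Ys] that less.prems by simp
    have 3: "s_normal Ys (nabW X (ten S Ds (remove_nth j Xs))) \<in> ?C" if "j < length Xs" for j X
      unfolding nabW_ten[OF D] homD(2,7)[OF hom_s_normal] using that D
      by (intro cochains_closed cochains_sum 2) (simp_all add: nabla_D_update length_remove_nth)
    have 4: "s_normal (remove_nth i Ys) (FW Y (ten S Ds Xs)) \<in> ?C" if i: "i < length Ys" for i Y
    proof -
      have "s_normal (remove_nth i Ys) (ten S (remove_nth i' Ds) (Z # remove_nth j Xs)) \<in> ?C"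
        if "i' < length Ds" "j < length Xs" for i' j Z
      proof -
        have "s_normal (remove_nth i Ys) (ten S (remove_nth i' Ds) (Z # remove_nth j Xs)) \<in>
            hochschild_cochains A U (length (remove_nth i' Ds) - length (remove_nth i Ys))"
          by (rule less.hyps) (use that i less.prems in \<open>auto simp: length_remove_nth remove_nth_set\<close>)
        moreover have "length (remove_nth i' Ds) - length (remove_nth i Ys) = length Ds - length Ys"
          using that i by (simp add: length_remove_nth)
        ultimately show ?thesis by simp
      qed
      then show ?thesis
        by (auto simp: FW_ten D homD[OF hom_s_normal] intro!: cochains_sum cochains_alt_sign)
    qed
    show ?thesis
      unfolding s_family_ten(2)[OF fam D less.prems(2) False]
      using D by (intro cochains_closed cochains_sum cochains_alt_sign 1 3 4 2) (auto simp: length_remove_nth)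
  qed
qed

lemma t_map_in:
  assumes w: "w \<in> sym_ad_degree A S p"
  shows "length Ys \<le> p \<Longrightarrow> t_map Ys w \<in> hochschild_cochains A U (p - length Ys)"
    and "p < length Ys \<Longrightarrow> t_map Ys w = 0"
proof -
  let ?e = "length Ys * (length Ys - 1) div 2"
  have t: "t_map Ys w = alt_sign ?e (s_normal Ys w)" for w
    by (simp add: s_normal_def alt_sign_def)
  show "t_map Ys w \<in> hochschild_cochains A U (p - length Ys)" if "length Ys \<le> p"
    using w
  proof (induction rule: sym_ad_degree_induct)
    case (scW_ten r Ds Xs)
    then have "s_normal Ys (ten S Ds Xs) \<in> hochschild_cochains A U (p - length Ys)"
      using s_normal_ten_in[of Ds Ys Xs] that by simp
    then show ?case
      by (simp add: homD[OF t_map_hom] t cochains_closed cochains_alt_sign)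
  qed (simp_all add: homD[OF t_map_hom] cochains_closed cochains_closed(1)[unfolded zero_fun_def])
  show "t_map Ys w = 0" if "p < length Ys"
    using w
    by (induction rule: sym_ad_degree_induct)
      (use that in \<open>simp_all add: homD[OF t_map_hom] t_map_vanishes left_mult_simps fun_eq_iff plus_fun_apply\<close>)
qed

end

section \<open>The total complex\<close>

text \<open>A tuple \<open>(\<phi>\<^sub>0, \<dots>, \<phi>\<^sub>n)\<close> in \<open>Omega\<close> amounts to a single function on lists, since the number of
  arguments determines the component.\<close>

definition join :: "nat \<Rightarrow> (nat \<Rightarrow> 'x list \<Rightarrow> 'm::zero) \<Rightarrow> 'x list \<Rightarrow> 'm" where
  "join n \<phi> Xs = (if length Xs \<le> n then \<phi> (n - length Xs) Xs else 0)"

definition unjoin :: "nat \<Rightarrow> ('x list \<Rightarrow> 'm::zero) \<Rightarrow> nat \<Rightarrow> 'x list \<Rightarrow> 'm" where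
  "unjoin n \<psi> i Xs = (if length Xs + i = n then \<psi> Xs else 0)"

lemma lie_der_restrict:
  assumes "m 0 = 0"
  shows "lie_der a m (\<lambda>Zs. if length Zs + i = n then \<psi> Zs else 0) Xs =
    (if length Xs + i = n then lie_der a m \<psi> Xs else 0)"
proof (induction Xs arbitrary: \<psi> i)
  case (Cons X Xs)
  show ?case
    using Cons.IH[of "Suc i" "\<lambda>Zs. \<psi> (X # Zs)"] by simp
qed (simp add: assms)

lemma ced_restrict:
  assumes "\<And>Z. lie Z 0 = 0"
  shows "ced br lie (\<lambda>Zs. if length Zs + i = n then \<psi> Zs else 0) Xs =
    (if length Xs + i = Suc n then ced br lie \<psi> Xs else 0)"
proof (induction Xs arbitrary: \<psi> i)
  case (Cons X Xs)
  show ?case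
    using Cons.IH[of "Suc i" "\<lambda>Zs. \<psi> (X # Zs)"] by (simp add: lie_der_restrict[where m = "lie X", OF assms])
qed simp

lemma lie_der_degree:
  assumes "\<And>x y. x \<in> N \<Longrightarrow> y \<in> N \<Longrightarrow> x - y \<in> N" "\<And>x. x \<in> N \<Longrightarrow> m x \<in> N"
    and "\<And>Xs. length Xs = l \<Longrightarrow> \<psi> Xs \<in> N" "length Xs = l"
  shows "lie_der a m \<psi> Xs \<in> N"
  using assms(3,4)
proof (induction Xs arbitrary: \<psi> l)
  case (Cons X Xs)
  have "lie_der a m (\<lambda>Ys. \<psi> (X # Ys)) Xs \<in> N"
    by (rule Cons.IH[of "length Xs"]) (use Cons.prems in auto)
  then show ?case
    using Cons.prems by (auto intro: assms(1))
qed (use assms in auto)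

lemma ced_degree:
  assumes "0 \<in> N" "\<And>x y. x \<in> N \<Longrightarrow> y \<in> N \<Longrightarrow> x - y \<in> N" "\<And>Z x. x \<in> N \<Longrightarrow> lie Z x \<in> N"
    and "\<And>Xs. Suc (length Xs) = l \<Longrightarrow> \<psi> Xs \<in> N" "length Xs = l"
  shows "ced br lie \<psi> Xs \<in> N"
  using assms(4,5)
proof (induction Xs arbitrary: \<psi> l)
  case (Cons X Xs)
  have "ced br lie (\<lambda>Ys. \<psi> (X # Ys)) Xs \<in> N"
    by (rule Cons.IH[of "length Xs"]) (use Cons.prems in auto)
  moreover have "lie_der (br X) (lie X) \<psi> Xs \<in> N"
    by (rule lie_der_degree[where l = "length Xs"]) (use assms Cons.prems in auto)
  ultimately show ?case
    by (simp add: assms)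
qed (simp add: assms)

text \<open>Common framework for source and target: \<open>M\<close> is where \<open>lie\<close> is
  an action, and the \<open>N i\<close> inside it are the graded pieces between which d
  maps.\<close>

locale ce_double_complex = lie_module br lie M + X: vector_space scX + V: vector_space scM
  for br :: "'x::ab_group_add \<Rightarrow> 'x \<Rightarrow> 'x" and lie :: "'x \<Rightarrow> 'm::ab_group_add \<Rightarrow> 'm" and M :: "'m set"
    and scX :: "'k::field \<Rightarrow> 'x \<Rightarrow> 'x" and scM :: "'k \<Rightarrow> 'm \<Rightarrow> 'm" +
  fixes N :: "nat \<Rightarrow> 'm set" and d :: "'m \<Rightarrow> 'm"
  assumes br_scale: "br X (scX c Y) = scX c (br X Y)" "br (scX c X) Y = scX c (br X Y)"
    and lie_scale: "x \<in> M \<Longrightarrow> lie X (scM c x) = scM c (lie X x)" "x \<in> M \<Longrightarrow> lie (scX c X) x = scM c (lie X x)"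
    and N_M: "N i \<subseteq> M" and subspace_N: "V.subspace (N i)" and lie_N: "x \<in> N i \<Longrightarrow> lie Z x \<in> N i"
    and d_N: "x \<in> N i \<Longrightarrow> d x \<in> N (Suc i)"
    and d_additive: "additive d" and d_scale: "d (scM c x) = scM c (d x)"
    and d_lie: "x \<in> M \<Longrightarrow> lie Z (d x) = d (lie Z x)" and d_d: "d (d x) = 0"
begin

definition is_cochain :: "nat \<Rightarrow> ('x list \<Rightarrow> 'm) \<Rightarrow> bool" where
  "is_cochain n \<psi> \<longleftrightarrow> multiadditive \<psi> \<and> multihomogeneous scX scM \<psi> \<and> alternating \<psi> \<and>
     (\<forall>Xs. \<psi> Xs \<in> (if length Xs \<le> n then N (n - length Xs) else {0}))"

definition diff :: "('x list \<Rightarrow> 'm) \<Rightarrow> 'x list \<Rightarrow> 'm" where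
  "diff \<psi> Xs = ced br lie \<psi> Xs + bar (\<lambda>Xs. d (\<psi> Xs)) Xs"

lemmas N_closed = V.subspace_0[OF subspace_N] V.subspace_add[OF subspace_N] V.subspace_scale[OF subspace_N]
  V.subspace_diff[OF subspace_N] V.subspace_neg[OF subspace_N]

lemma d_zero: "d 0 = 0"
  by (rule additive.zero[OF d_additive])

lemma lie_zero: "lie Z 0 = 0"
  by (rule additive.zero[OF lie_additive])

lemma scM_additive: "additive (scM c)"
  by (simp add: additive_def V.scale_right_distrib)

lemma is_cochainD:
  assumes "is_cochain n \<psi>"
  shows "multiadditive \<psi>" "multihomogeneous scX scM \<psi>" "alternating \<psi>" "\<psi> Xs \<in> M"
    "length Xs \<le> n \<Longrightarrow> \<psi> Xs \<in> N (n - length Xs)" "n < length Xs \<Longrightarrow> \<psi> Xs = 0"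
proof -
  show "multiadditive \<psi>" "multihomogeneous scX scM \<psi>" "alternating \<psi>"
    using assms by (simp_all add: is_cochain_def)
  have v: "\<psi> Xs \<in> (if length Xs \<le> n then N (n - length Xs) else {0})"
    using assms unfolding is_cochain_def by blast
  then show "\<psi> Xs \<in> M"
    using N_M M_zero by (auto split: if_splits)
  show "length Xs \<le> n \<Longrightarrow> \<psi> Xs \<in> N (n - length Xs)" "n < length Xs \<Longrightarrow> \<psi> Xs = 0"
    using v by auto
qed

lemma Omega_join:
  assumes "\<phi> \<in> Omega scX scM N n"
  shows "is_cochain n (join n \<phi>)" and "\<phi> = unjoin n (join n \<phi>)"
proof -
  have ce: "\<phi> i \<in> ce_cochains scX scM (n - i) (N i)" if "i \<le> n" for i
    using assms that by (simp add: Omega_def)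
  have lin: "multiadditive (\<phi> i)" "multihomogeneous scX scM (\<phi> i)" and supp: "length Xs \<noteq> n - i \<Longrightarrow> \<phi> i Xs = 0"
    if "i \<le> n" for i Xs
    using ce[OF that] by (simp_all add: ce_cochains_def multilinear_iff X.vector_space_axioms V.vector_space_axioms)
  have alt: "\<phi> i Xs = 0" if "i \<le> n" "\<not> distinct Xs" for i Xs
    using ce[OF that(1)] that(2) by (simp add: ce_cochains_def)
  have deg: "\<phi> i Xs \<in> N i" if "i \<le> n" "length Xs = n - i" for i Xs
    using ce[OF that(1)] that(2) by (simp add: ce_cochains_def)
  show "is_cochain n (join n \<phi>)"
    unfolding is_cochain_def
  proof (intro conjI)
    show "multiadditive (join n \<phi>)"
      using lin(1)[of "n - _"] by (auto simp: multiadditive_def join_def)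
    show "multihomogeneous scX scM (join n \<phi>)"
      using lin(2)[of "n - _"] by (auto simp: multihomogeneous_def join_def)
    show "alternating (join n \<phi>)"
      using alt[of "n - _"] by (auto simp: alternating_def join_def)
    show "\<forall>Xs. join n \<phi> Xs \<in> (if length Xs \<le> n then N (n - length Xs) else {0})"
      using deg[of "n - _"] by (auto simp: join_def)
  qed
  show "\<phi> = unjoin n (join n \<phi>)"
  proof (intro ext)
    fix i Xs show "\<phi> i Xs = unjoin n (join n \<phi>) i Xs"
    proof (cases "i \<le> n")
      case True
      then show ?thesis
        using supp[OF True, of Xs] by (auto simp: unjoin_def join_def)
    next
      case False
      then have "\<phi> i = 0"
        using assms by (simp add: Omega_def)
      then show ?thesis
        using False by (auto simp: unjoin_def)
    qed
  qed
qed

lemma unjoin_Omega: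
  assumes "is_cochain n \<psi>"
  shows "unjoin n \<psi> \<in> Omega scX scM N n" and "join n (unjoin n \<psi>) = \<psi>"
proof -
  note c = is_cochainD[OF assms]
  have "unjoin n \<psi> i \<in> ce_cochains scX scM (n - i) (N i)" if i: "i \<le> n" for i
  proof -
    have "multiadditive (unjoin n \<psi> i)" "multihomogeneous scX scM (unjoin n \<psi> i)" "\<And>Xs. length Xs \<noteq> n - i \<Longrightarrow> unjoin n \<psi> i Xs = 0"
      using c(1,2) i by (auto simp: multiadditive_def multihomogeneous_def unjoin_def)
    moreover have "unjoin n \<psi> i Xs \<in> N i" if "length Xs = n - i" for Xs
      using c(5)[of Xs] that i by (simp add: unjoin_def)
    moreover have "unjoin n \<psi> i Xs = 0" if "\<not> distinct Xs" for Xs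
      using alternating_not_distinct[OF c(1,3) that] by (simp add: unjoin_def)
    ultimately show ?thesis
      by (simp add: ce_cochains_def multilinear_iff X.vector_space_axioms V.vector_space_axioms)
  qed
  moreover have "unjoin n \<psi> i = 0" if "n < i" for i
    using that by (auto simp: unjoin_def fun_eq_iff)
  ultimately show "unjoin n \<psi> \<in> Omega scX scM N n"
    by (simp add: Omega_def)
  show "join n (unjoin n \<psi>) = \<psi>"
    using c(6) by (auto simp: join_def unjoin_def fun_eq_iff)
qed

lemma total_diff_unjoin:
  assumes "is_cochain n \<psi>"
  shows "total_diff br lie d (unjoin n \<psi>) = unjoin (Suc n) (diff \<psi>)"
proof (intro ext)
  fix i Xs
  note c = is_cochainD[OF assms]
  have "multiadditive (unjoin n \<psi> i)" "alternating (unjoin n \<psi> i)"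
    using c(1,3) by (auto simp: multiadditive_def alternating_def unjoin_def)
  then have "ce_delta br lie (unjoin n \<psi> i) Xs = ced br lie (\<lambda>Zs. if length Zs + i = n then \<psi> Zs else 0) Xs"
    by (simp add: ce_delta_eq_ced lie_additive) (simp add: unjoin_def[abs_def])
  then have ce: "ce_delta br lie (unjoin n \<psi> i) Xs = (if length Xs + i = Suc n then ced br lie \<psi> Xs else 0)"
    by (simp add: ced_restrict lie_zero)
  show "total_diff br lie d (unjoin n \<psi>) i Xs = unjoin (Suc n) (diff \<psi>) i Xs"
  proof (cases i)
    \<comment> \<open>For i = 0 there is no term with d in \<open>total_diff\<close>; in
      \<open>diff\<close> that term involves \<psi> on n + 1 arguments, which is zero.\<close>
    case 0
    then show ?thesis
      using c(6)[of Xs] ce by (auto simp: total_diff_def unjoin_def diff_def bar_def d_zero)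
  next
    case (Suc j)
    then show ?thesis
      unfolding total_diff_def ce by (auto simp: unjoin_def diff_def bar_def d_zero)
  qed
qed

lemma diff_cochain:
  assumes "is_cochain n \<psi>"
  shows "is_cochain (Suc n) (diff \<psi>)"
  unfolding is_cochain_def
proof (intro conjI allI)
  note c = is_cochainD[OF assms]
  show "multiadditive (diff \<psi>)"
    using ced_multiadditive[OF c(4,1)] c(1)
    by (auto simp: multiadditive_def diff_def bar_def additive.add[OF d_additive] alt_sign_linear)
  show "alternating (diff \<psi>)"
    using ced_alternating[OF c(1,3)] c(3) by (auto simp: alternating_def diff_def bar_def d_zero)
  have "multihomogeneous scX scM (ced br lie \<psi>)"
    by (rule ced_multihomogeneous[OF c(2) scM_additive br_scale lie_scale c(4)])
  then show "multihomogeneous scX scM (diff \<psi>)"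
    using c(2)
    by (auto simp: multihomogeneous_def diff_def bar_def d_scale V.scale_right_distrib
        additive_alt_sign[OF scM_additive] V.scale_right_diff_distrib)
  fix Xs
  show "diff \<psi> Xs \<in> (if length Xs \<le> Suc n then N (Suc n - length Xs) else {0})"
  proof (cases "length Xs \<le> Suc n")
    case True
    have "ced br lie \<psi> Xs \<in> N (Suc n - length Xs)"
    proof (rule ced_degree[where l = "length Xs"])
      show "\<psi> Zs \<in> N (Suc n - length Xs)" if "Suc (length Zs) = length Xs" for Zs
      proof -
        have "length Zs \<le> n" "Suc n - length Xs = n - length Zs"
          using that True by linarith+
        then show ?thesis
          using c(5) by metis
      qed
    qed (simp_all add: N_closed lie_N)
    moreover have "d (\<psi> Xs) \<in> N (Suc n - length Xs)"
    proof (cases "length Xs \<le> n")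
      case True
      then show ?thesis
        using d_N[OF c(5)[OF True]] by (simp add: Suc_diff_le)
    qed (simp add: c(6) d_zero N_closed)
    ultimately show ?thesis
      using True by (simp add: diff_def bar_def alt_sign_def N_closed)
  next
    case False
    have "ced br lie \<psi> Xs \<in> {0}"
      by (rule ced_degree[where l = "length Xs"]) (use c(6) False in \<open>auto simp: lie_zero\<close>)
    then show ?thesis
      using False c(6)[of Xs] by (simp add: diff_def bar_def d_zero)
  qed
qed

text \<open>The mixed terms cancel because \<open>ced\<close> adds an argument and so flips the sign
  in front of d.\<close>

lemma diff_diff:
  assumes "is_cochain n \<psi>"
  shows "diff (diff \<psi>) = (\<lambda>_. 0)"
proof
  fix Xs
  note c = is_cochainD[OF assms]
  have ced_d: "ced br lie (\<lambda>Xs. d (\<psi> Xs)) Xs = d (ced br lie \<psi> Xs)" for Xs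
  proof -
    have "ced br lie (\<lambda>Xs. d (\<psi> Xs)) Xs = d (ced br lie \<psi> Xs) + one_star (\<lambda>Z x. 0) \<psi> Xs"
      by (rule ced_operator[where H = M])
        (auto simp: lie_additive M_diff lie_in M_zero d_lie c(4) additive.diff[OF d_additive])
    then show ?thesis by (simp add: one_star_eq_sum)
  qed
  have "ced br lie (diff \<psi>) Xs = - alt_sign (length Xs) (d (ced br lie \<psi> Xs))"
    unfolding diff_def[abs_def]
    by (simp add: ced_add lie_additive ced_ced c ced_bar) (simp add: bar_def ced_d)
  moreover have "d (diff \<psi> Xs) = d (ced br lie \<psi> Xs)"
    by (simp add: diff_def additive.add[OF d_additive] bar_def additive_alt_sign[OF d_additive] d_d)
  ultimately show "diff (diff \<psi>) Xs = 0"
    unfolding diff_def[of "diff \<psi>"] bar_def by simp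
qed

lemma ced_scale:
  assumes "\<And>Xs. \<psi> Xs \<in> M"
  shows "ced br lie (\<lambda>Xs. scM c (\<psi> Xs)) Xs = scM c (ced br lie \<psi> Xs)"
proof -
  have "ced br lie (\<lambda>Xs. scM c (\<psi> Xs)) Xs = scM c (ced br lie \<psi> Xs) + one_star (\<lambda>Z x. 0) \<psi> Xs"
    by (rule ced_operator[where H = M])
      (auto simp: lie_additive M_diff lie_in M_zero lie_scale assms V.scale_right_diff_distrib)
  then show ?thesis by (simp add: one_star_eq_sum)
qed

lemma tuple_vector_space: "vector_space (tuple_scale scM)"
  by unfold_locales
    (simp_all add: tuple_scale_def fun_eq_iff V.scale_right_distrib V.scale_left_distrib)

lemma is_cochain_closed:
  "is_cochain n (\<lambda>_. 0)" "is_cochain n \<psi> \<Longrightarrow> is_cochain n \<chi> \<Longrightarrow> is_cochain n (\<lambda>Xs. \<psi> Xs + \<chi> Xs)"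
  "is_cochain n \<psi> \<Longrightarrow> is_cochain n (\<lambda>Xs. scM c (\<psi> Xs))"
proof -
  show "is_cochain n (\<lambda>_. 0)"
    by (simp add: is_cochain_def multiadditive_def multihomogeneous_def alternating_def N_closed)
  show "is_cochain n (\<lambda>Xs. \<psi> Xs + \<chi> Xs)" if "is_cochain n \<psi>" "is_cochain n \<chi>"
    unfolding is_cochain_def
  proof (intro conjI)
    note c = is_cochainD[OF that(1)] and e = is_cochainD[OF that(2)]
    show "multiadditive (\<lambda>Xs. \<psi> Xs + \<chi> Xs)" "alternating (\<lambda>Xs. \<psi> Xs + \<chi> Xs)"
      "multihomogeneous scX scM (\<lambda>Xs. \<psi> Xs + \<chi> Xs)"
      using c(1-3) e(1-3)
      by (simp_all add: multiadditive_def multihomogeneous_def alternating_def V.scale_right_distrib algebra_simps)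
    show "\<forall>Xs. \<psi> Xs + \<chi> Xs \<in> (if length Xs \<le> n then N (n - length Xs) else {0})"
      using c(5,6) e(5,6) by (simp add: N_closed)
  qed
  show "is_cochain n (\<lambda>Xs. scM c (\<psi> Xs))" if "is_cochain n \<psi>"
    unfolding is_cochain_def
  proof (intro conjI)
    note c = is_cochainD[OF that]
    show "multiadditive (\<lambda>Xs. scM c (\<psi> Xs))" "alternating (\<lambda>Xs. scM c (\<psi> Xs))"
      using c(1,3) by (simp_all add: multiadditive_def alternating_def V.scale_right_distrib)
    show "multihomogeneous scX scM (\<lambda>Xs. scM c (\<psi> Xs))"
      using c(2) by (simp add: multihomogeneous_def V.scale_left_commute mult.commute)
    show "\<forall>Xs. scM c (\<psi> Xs) \<in> (if length Xs \<le> n then N (n - length Xs) else {0})"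
      using c(5,6) by (simp add: N_closed)
  qed
qed

lemma join_linear:
  "join n (\<phi> + \<psi>) = (\<lambda>Xs. join n \<phi> Xs + join n \<psi> Xs)"
  "join n (tuple_scale scM c \<phi>) = (\<lambda>Xs. scM c (join n \<phi> Xs))"
  by (auto simp: join_def tuple_scale_def fun_eq_iff)

lemma unjoin_linear:
  "unjoin n (\<lambda>Xs. \<psi> Xs + \<chi> Xs) = unjoin n \<psi> + unjoin n \<chi>"
  "unjoin n (\<lambda>Xs. scM c (\<psi> Xs)) = tuple_scale scM c (unjoin n \<psi>)"
  "unjoin n (\<lambda>_. 0) = (0 :: nat \<Rightarrow> 'x list \<Rightarrow> 'm)"
  by (auto simp: unjoin_def tuple_scale_def fun_eq_iff)

lemma diff_linear:
  "diff (\<lambda>Xs. \<psi> Xs + \<chi> Xs) = (\<lambda>Xs. diff \<psi> Xs + diff \<chi> Xs)"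
  "is_cochain n \<psi> \<Longrightarrow> diff (\<lambda>Xs. scM c (\<psi> Xs)) = (\<lambda>Xs. scM c (diff \<psi> Xs))"
  by (auto simp: fun_eq_iff diff_def ced_add lie_additive additive.add[OF d_additive] bar_def alt_sign_linear
      ced_scale is_cochainD d_scale V.scale_right_distrib additive_alt_sign[OF scM_additive])

lemma Omega_closed:
  "0 \<in> Omega scX scM N n"
  "\<phi> \<in> Omega scX scM N n \<Longrightarrow> \<phi>' \<in> Omega scX scM N n \<Longrightarrow> \<phi> + \<phi>' \<in> Omega scX scM N n"
  "\<phi> \<in> Omega scX scM N n \<Longrightarrow> tuple_scale scM c \<phi> \<in> Omega scX scM N n"
proof -
  show "0 \<in> Omega scX scM N n"
    using unjoin_Omega(1)[OF is_cochain_closed(1)] by (simp add: unjoin_linear)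
  show "\<phi> + \<phi>' \<in> Omega scX scM N n" if "\<phi> \<in> Omega scX scM N n" "\<phi>' \<in> Omega scX scM N n"
    using unjoin_Omega(1)[OF is_cochain_closed(2)[OF Omega_join(1)[OF that(1)] Omega_join(1)[OF that(2)]]]
      Omega_join(2)[OF that(1)] Omega_join(2)[OF that(2)]
    by (simp add: unjoin_linear)
  show "tuple_scale scM c \<phi> \<in> Omega scX scM N n" if "\<phi> \<in> Omega scX scM N n"
    using unjoin_Omega(1)[OF is_cochain_closed(3)[OF Omega_join(1)[OF that]]] Omega_join(2)[OF that]
    by (simp add: unjoin_linear)
qed

lemma total_diff_Omega:
  assumes "\<phi> \<in> Omega scX scM N n"
  shows "total_diff br lie d \<phi> = unjoin (Suc n) (diff (join n \<phi>))"
    and "total_diff br lie d \<phi> \<in> Omega scX scM N (Suc n)"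
    and "join (Suc n) (total_diff br lie d \<phi>) = diff (join n \<phi>)"
proof -
  note c = Omega_join[OF assms]
  show eq: "total_diff br lie d \<phi> = unjoin (Suc n) (diff (join n \<phi>))"
    using total_diff_unjoin[OF c(1)] c(2) by simp
  show "total_diff br lie d \<phi> \<in> Omega scX scM N (Suc n)" "join (Suc n) (total_diff br lie d \<phi>) = diff (join n \<phi>)"
    unfolding eq by (rule unjoin_Omega[OF diff_cochain[OF c(1)]])+
qed

lemma subcomplex:
  assumes sub: "\<And>n. C n \<subseteq> Omega scX scM N n"
    and closed: "\<And>n. 0 \<in> C n" "\<And>n \<phi> \<psi>. \<phi> \<in> C n \<Longrightarrow> \<psi> \<in> C n \<Longrightarrow> \<phi> + \<psi> \<in> C n"
      "\<And>n c \<phi>. \<phi> \<in> C n \<Longrightarrow> tuple_scale scM c \<phi> \<in> C n"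
    and stable: "\<And>n \<phi>. \<phi> \<in> C n \<Longrightarrow> total_diff br lie d \<phi> \<in> C (Suc n)"
  shows "cochain_complex (tuple_scale scM) C (\<lambda>n. total_diff br lie d)"
proof (intro cochain_complex.intro cochain_complex_axioms.intro tuple_vector_space)
  interpret T: vector_space "tuple_scale scM" by (rule tuple_vector_space)
  show "T.subspace (C n)" for n
    using closed by (simp add: T.subspace_def)
  show "total_diff br lie d \<phi> \<in> C (Suc n)" if "\<phi> \<in> C n" for \<phi> n
    using stable that .
  fix \<phi> n assume \<phi>: "\<phi> \<in> C n"
  then have O: "\<phi> \<in> Omega scX scM N n"
    using sub by blast
  show "total_diff br lie d (\<phi> + \<psi>) = total_diff br lie d \<phi> + total_diff br lie d \<psi>" if "\<psi> \<in> C n" for \<psi>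
    using O sub that by (auto simp: total_diff_Omega(1)[of _ n] Omega_closed join_linear diff_linear unjoin_linear subset_iff)
  show "total_diff br lie d (tuple_scale scM c \<phi>) = tuple_scale scM c (total_diff br lie d \<phi>)" for c
    using O Omega_join(1)[OF O]
    by (simp add: total_diff_Omega(1)[of _ n] Omega_closed join_linear diff_linear unjoin_linear)
  show "total_diff br lie d (total_diff br lie d \<phi>) = 0"
    using diff_diff[OF Omega_join(1)[OF O]]
    by (simp add: total_diff_Omega(1)[OF total_diff_Omega(2)[OF O]] total_diff_Omega(3)[OF O] unjoin_linear)
qed

end

context sym_ad_algebra
begin

lemma vector_space_scWK: "vector_space (scWK A S)"
proof
  have one: "scR A (a * b) 1 = scR A a 1 * scR A b 1" for a b
    using R_algebra[of a 1 "scR A b 1"] by simp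
  show "scWK A S a (scWK A S b w) = scWK A S (a * b) w" for a b w
    by (simp add: scWK_def one)
qed (simp_all add: scWK_def W.scale_right_distrib W.scale_left_distrib R.scale_left_distrib)

lemma scWK_commute: "scWK A S c (scW S r w) = scW S r (scWK A S c w)"
  by (simp add: scWK_def mult.commute)

lemma source_complex:
  "ce_double_complex (brk A) lieW UNIV (scL A) (scWK A S) (sym_ad_degree A S) (\<lambda>w. - delta w)"
proof (intro ce_double_complex.intro lie_module.intro ce_double_complex_axioms.intro)
  interpret K: vector_space "scWK A S" by (rule vector_space_scWK)
  show "vector_space (scL A)" "vector_space (scWK A S)"
    by (rule L_vector_space vector_space_scWK)+
  show "K.subspace (sym_ad_degree A S i)" for i
    by (simp add: K.subspace_def scWK_def degree_closed)
qed (simp_all add: brk_add brk_self brk_brk brk_scale additive_lieW lieW_add lieW_lieW lieW_scale lieW_degree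
      lieW_lin lieW_delta delta_degree degree_closed additive_def delta_lin delta_delta scWK_def
      delta_scW lieW_simps(1) anc_scR_one)

sublocale src: ce_double_complex "brk A" lieW UNIV "scL A" "scWK A S" "sym_ad_degree A S" "\<lambda>w. - delta w"
  by (rule source_complex)

subsection \<open>The nonlinear subcomplex\<close>

text \<open>The condition of \<open>Omega_nl\<close> on all components at once. It concerns the last
  argument, which the recursions on the first argument leave in place until the end.\<close>

definition nonlinear :: "('l list \<Rightarrow> 'w) \<Rightarrow> bool" where
  "nonlinear \<psi> \<longleftrightarrow>
     (\<forall>Xs X r. \<psi> (Xs @ [act A r X]) = scW S r (\<psi> (Xs @ [X])) + hW r X (\<psi> Xs))"

lemma nonlinearD: "nonlinear \<psi> \<Longrightarrow> \<psi> (Xs @ [act A r X]) = scW S r (\<psi> (Xs @ [X])) + hW r X (\<psi> Xs)"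
  by (simp add: nonlinear_def)

lemma nonlinear_Cons: "nonlinear \<psi> \<Longrightarrow> nonlinear (\<lambda>Xs. \<psi> (Z # Xs))"
  unfolding nonlinear_def by (metis append_Cons)

lemma lie_der_nonlinear:
  assumes "multiadditive \<psi>" "nonlinear \<psi>"
  shows "nonlinear (lie_der (brk A Z) (lieW Z) \<psi>)"
  unfolding nonlinear_def
proof (intro allI)
  fix Xs X r
  show "lie_der (brk A Z) (lieW Z) \<psi> (Xs @ [act A r X]) =
      scW S r (lie_der (brk A Z) (lieW Z) \<psi> (Xs @ [X])) + hW r X (lie_der (brk A Z) (lieW Z) \<psi> Xs)"
    using assms
  proof (induction Xs arbitrary: \<psi>)
    case Nil
    note nl = nonlinearD[OF Nil(2), of "[]", simplified]
    show ?case
      by (simp add: nl leibniz multiadditive_hd[OF Nil(1)] lieW_lin lieW_simps lieW_hW W.scale_right_diff_distrib)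
  next
    case (Cons Y Xs)
    have "\<psi> (brk A Z Y # Xs @ [act A r X]) =
        scW S r (\<psi> (brk A Z Y # Xs @ [X])) + hW r X (\<psi> (brk A Z Y # Xs))"
      using nonlinearD[OF Cons.prems(2), of "brk A Z Y # Xs"] by simp
    then show ?case
      by (simp add: Cons.IH[OF multiadditive_Cons[OF Cons.prems(1)] nonlinear_Cons[OF Cons.prems(2)]]
          hW_lin W.scale_right_diff_distrib)
  qed
qed

text \<open>Lie derivatives along earlier arguments preserve nonlinearity. Only when rX is the sole
  argument left does it act itself; there \<open>lieW_act\<close> yields the anticommutator, with
  one sign for each argument removed before.\<close>

lemma ced_nonlinear:
  assumes "multiadditive \<psi>" "nonlinear \<psi>"
  shows "ced (brk A) lieW \<psi> (Xs @ [act A r X]) =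
    scW S r (ced (brk A) lieW \<psi> (Xs @ [X])) + hW r X (ced (brk A) lieW \<psi> Xs) -
    alt_sign (length Xs) (delta (hW r X (\<psi> Xs)) + hW r X (delta (\<psi> Xs)))"
  using assms
proof (induction Xs arbitrary: \<psi>)
  case Nil
  then show ?case by (simp add: lieW_act hW_lin)
next
  case (Cons Z Xs)
  show ?case
    using nonlinearD[OF lie_der_nonlinear[OF Cons.prems], of Z Xs r X]
    by (simp add: Cons.IH[OF multiadditive_Cons[OF Cons.prems(1)] nonlinear_Cons[OF Cons.prems(2)]]
        hW_lin W.scale_right_diff_distrib)
qed

text \<open>With the sign (-1)^p in front of -\<delta>, the anticommutator left over by
  \<open>ced_nonlinear\<close> is exactly what is needed to exchange \<delta> and h_{r,X}.\<close>

lemma diff_nonlinear: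
  assumes "multiadditive \<psi>" "nonlinear \<psi>"
  shows "nonlinear (src.diff \<psi>)"
  unfolding nonlinear_def
proof (intro allI)
  fix Xs X r
  have W_alt: "scW S r (alt_sign n w) = alt_sign n (scW S r w)" for n w
    by (simp add: alt_sign_def)
  show "src.diff \<psi> (Xs @ [act A r X]) = scW S r (src.diff \<psi> (Xs @ [X])) + hW r X (src.diff \<psi> Xs)"
    by (simp add: src.diff_def ced_nonlinear[OF assms] bar_def nonlinearD[OF assms(2)] delta_lin delta_scW hW_lin
        additive_alt_sign[OF additive_hW] W_alt W.scale_right_distrib alt_sign_linear)
qed

lemma Omega_nl_iff:
  "\<phi> \<in> Omega_nl A S n \<longleftrightarrow> \<phi> \<in> Omega (scL A) (scWK A S) (sym_ad_degree A S) n \<and> nonlinear (join n \<phi>)"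
proof (cases "\<phi> \<in> Omega (scL A) (scWK A S) (sym_ad_degree A S) n")
  case True
  note c = src.Omega_join(1)[OF True]
  let ?nl = "\<lambda>Xs X r. join n \<phi> (Xs @ [act A r X]) = scW S r (join n \<phi> (Xs @ [X])) + hW r X (join n \<phi> Xs)"
  have long: "?nl Xs X r" if "n \<le> length Xs" for Xs X r
  proof (cases "length Xs = n")
    case True
    then have "join n \<phi> Xs \<in> sym_ad_degree A S 0"
      using src.is_cochainD(5)[OF c, of Xs] by simp
    then show ?thesis
      using True by (simp add: join_def hW_degree_0)
  qed (use that in \<open>simp add: join_def hW_lin\<close>)
  have short: "?nl Xs X r \<longleftrightarrow>
      \<phi> i (Xs @ [act A r X]) - scW S r (\<phi> i (Xs @ [X])) = sym_h A S r X (\<phi> (i + 1) Xs)"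
    if "i < n" "length Xs = n - i - 1" for i Xs X r
  proof -
    have "n - length (Xs @ [Y]) = i" "n - length Xs = i + 1" for Y
      using that by auto
    then show ?thesis
      using that by (auto simp: join_def sym_h_eq algebra_simps)
  qed
  have "(\<forall>Xs X r. ?nl Xs X r) \<longleftrightarrow> (\<forall>i<n. \<forall>Xs X r. length Xs = n - i - 1 \<longrightarrow> ?nl Xs X r)"
  proof (intro iffI allI impI)
    fix Xs X r assume *: "\<forall>i<n. \<forall>Xs X r. length Xs = n - i - 1 \<longrightarrow> ?nl Xs X r"
    show "?nl Xs X r"
    proof (cases "n \<le> length Xs")
      case False
      then have "n - length Xs - 1 < n" "length Xs = n - (n - length Xs - 1) - 1"
        by auto
      then show ?thesis using * by blast
    qed (rule long)
  qed blast
  then show ?thesis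
    using True short by (simp add: Omega_nl_def nonlinear_def)
qed (simp add: Omega_nl_def)

lemma source_cochain_complex:
  "cochain_complex (tuple_scale (scWK A S)) (Omega_nl A S)
     (\<lambda>n. total_diff (brk A) (sym_lie A S) (\<lambda>w. - sym_delta A S w))"
  unfolding sym_lie_eq[abs_def] sym_delta_eq
proof (rule src.subcomplex)
  show "Omega_nl A S n \<subseteq> Omega (scL A) (scWK A S) (sym_ad_degree A S) n" for n
    by (auto simp: Omega_nl_iff)
  show "0 \<in> Omega_nl A S n" for n
    by (simp add: Omega_nl_iff src.Omega_closed nonlinear_def join_def hW_lin)
  show "\<phi> + \<psi> \<in> Omega_nl A S n" if "\<phi> \<in> Omega_nl A S n" "\<psi> \<in> Omega_nl A S n" for \<phi> \<psi> n
    using that by (simp add: Omega_nl_iff src.Omega_closed src.join_linear nonlinear_def hW_lin W.scale_right_distrib)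
  show "tuple_scale (scWK A S) c \<phi> \<in> Omega_nl A S n" if "\<phi> \<in> Omega_nl A S n" for c \<phi> n
    using that
    by (simp add: Omega_nl_iff src.Omega_closed src.join_linear nonlinear_def src.V.scale_right_distrib scWK_commute)
      (simp add: scWK_def hW_simps)
  show "total_diff (brk A) lieW (\<lambda>w. - delta w) \<phi> \<in> Omega_nl A S (Suc n)" if "\<phi> \<in> Omega_nl A S n" for \<phi> n
    using that src.total_diff_Omega(2,3)[of \<phi> n] diff_nonlinear[of "join n \<phi>"] src.Omega_join(1)[of \<phi> n]
    by (simp add: Omega_nl_iff src.is_cochain_def)
qed

end

section \<open>The morphism\<close>

lemma (in pairing) star_in:
  assumes c: "\<And>Xs. c Xs \<in> B"
    and C: "\<And>x y. x \<in> C \<Longrightarrow> y \<in> C \<Longrightarrow> x + y \<in> C" "\<And>x. x \<in> C \<Longrightarrow> - x \<in> C"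
    and "\<And>Xs Zs. length Xs + length Zs = length Ys \<Longrightarrow> P (\<phi> Xs) (c Zs) \<in> C"
  shows "star P \<phi> c Ys \<in> C"
  using assms(1,4)
proof (induction Ys arbitrary: \<phi> c)
  case (Cons Y Ys)
  note c = Cons.prems(1) and mem = Cons.prems(2)
  have "P (bar \<phi> Xs) (c (Y # Zs)) \<in> C" if "length Xs + length Zs = length Ys" for Xs Zs
    using mem[of Xs "Y # Zs"] that C(2) by (simp add: bar_def alt_sign_def P_left_simps c)
  then have "star P (bar \<phi>) (\<lambda>Xs. c (Y # Xs)) Ys \<in> C"
    by (intro Cons.IH c)
  moreover have "star P (\<lambda>Xs. \<phi> (Y # Xs)) c Ys \<in> C"
    using mem by (intro Cons.IH c) simp
  ultimately show ?case
    by (simp add: C)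
qed simp

lemma (in pairing) star_sum_left:
  assumes "\<And>Xs. c Xs \<in> B"
  shows "star P (\<lambda>Xs. \<Sum>i\<in>I. \<phi> i Xs) c Ys = (\<Sum>i\<in>I. star P (\<phi> i) c Ys)"
  by (induction I rule: infinite_finite_induct) (simp_all add: star_zero_left star_add_left assms)

lemma star_apply_right:
  assumes "additive g" "\<And>x c. c \<in> B \<Longrightarrow> g (P x c) = P x (G c)" "\<And>Xs. c Xs \<in> B"
  shows "g (star P \<phi> c Ys) = star P \<phi> (\<lambda>Xs. G (c Xs)) Ys"
  using assms(3) by (induction Ys arbitrary: \<phi> c) (simp_all add: additive.add[OF assms(1)] assms(2))

lemma star_apply_left:
  assumes "additive g" "additive f" "\<And>x c. c \<in> B \<Longrightarrow> g (P x c) = P (f x) c" "\<And>Xs. c Xs \<in> B"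
  shows "g (star P \<phi> c Ys) = star P (\<lambda>Xs. f (\<phi> Xs)) c Ys"
  using assms(4)
proof (induction Ys arbitrary: \<phi> c)
  case (Cons Y Ys)
  have "bar (\<lambda>Xs. f (\<phi> Xs)) = (\<lambda>Xs. f (bar \<phi> Xs))"
    by (simp add: bar_def fun_eq_iff additive_alt_sign[OF assms(2)])
  then show ?case
    by (simp add: Cons additive.add[OF assms(1)])
qed (simp add: assms(3))

context lr_connection
begin

lemma target_complex:
  "ce_double_complex (brk A) (hochschild_lie A U) hochschild_multilinear (scL A) (scC U)
     (hochschild_cochains A U) (hochschild_b U)"
proof (intro ce_double_complex.intro hochschild_lie_module L_vector_space vector_space_scC
    ce_double_complex_axioms.intro)
  interpret C: vector_space "scC U" by (rule vector_space_scC)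
  show "C.subspace (hochschild_cochains A U i)" for i
    by (simp add: C.subspace_def cochains_closed)
  show "hochschild_cochains A U i \<subseteq> hochschild_multilinear" for i
    by (auto simp: hochschild_cochains_iff hochschild_multilinear_def)
  show "hochschild_b U (hochschild_b U \<phi>) = 0" for \<phi>
    by (simp add: fun_eq_iff hochschild_b_b)
  show "hochschild_b U (scC U c \<phi>) = scC U c (hochschild_b U \<phi>)" for c \<phi>
    by (simp add: fun_eq_iff scC_def hochschild_b_scale)
qed (simp_all add: brk_scale hochschild_lie_scale hochschild_lie_scale_left hochschild_multilinear_def
    hochschild_lie_in hochschild_b_in additive_b hochschild_lie_b)

sublocale tgt: ce_double_complex "brk A" "hochschild_lie A U" hochschild_multilinear "scL A" "scC U"
    "hochschild_cochains A U" "hochschild_b U"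
  by (rule target_complex)

definition Phi_star :: "('l list \<Rightarrow> 'w) \<Rightarrow> 'l list \<Rightarrow> 'r list \<Rightarrow> 'u" where
  "Phi_star \<psi> = star (\<lambda>w f. f w) \<psi> t_map"

sublocale ev: pairing "\<lambda>w f. f w" hom
  by unfold_locales (simp_all add: homD hom_closed plus_fun_apply fun_eq_iff)

lemma Phi_star_add: "Phi_star (\<lambda>Xs. \<phi> Xs + \<psi> Xs) = (\<lambda>Xs. Phi_star \<phi> Xs + Phi_star \<psi> Xs)"
  by (simp add: Phi_star_def fun_eq_iff ev.star_add_left t_map_hom plus_fun_apply)

lemma Phi_star_scale: "Phi_star (\<lambda>Xs. scWK A S c (\<psi> Xs)) = (\<lambda>Xs. scC U c (Phi_star \<psi> Xs))"
  unfolding Phi_star_def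
  by (intro ext, rule star_apply_left[where B = hom, symmetric, THEN fun_cong])
    (simp_all add: tgt.scM_additive src.scM_additive hom_scWK t_map_hom)

lemma Phi_star_cochain:
  assumes "src.is_cochain n \<psi>"
  shows "tgt.is_cochain n (Phi_star \<psi>)"
  unfolding tgt.is_cochain_def Phi_star_def
proof (intro conjI allI)
  note c = src.is_cochainD[OF assms]
  show "multiadditive (star (\<lambda>w f. f w) \<psi> t_map)"
    by (rule ev.star_multiadditive[OF t_map_hom c(1) t_map_multilinear(1)])
  show "alternating (star (\<lambda>w f. f w) \<psi> t_map)"
    by (rule ev.star_alternating[OF t_map_hom c(3) t_map_multilinear(2)])
  show "multihomogeneous (scL A) (scC U) (star (\<lambda>w f. f w) \<psi> t_map)"
    by (rule ev.star_multihomogeneous[OF _ _ tgt.scM_additive src.scM_additive t_map_hom c(2) t_map_multilinear(3)])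
      (simp_all add: hom_scWK)
  fix Ys
  show "star (\<lambda>w f. f w) \<psi> t_map Ys \<in> (if length Ys \<le> n then hochschild_cochains A U (n - length Ys) else {0})"
  proof (rule ev.star_in[OF t_map_hom])
    fix Xs Zs :: "'l list" assume len: "length Xs + length Zs = length Ys"
    show "t_map Zs (\<psi> Xs) \<in> (if length Ys \<le> n then hochschild_cochains A U (n - length Ys) else {0})"
    proof (cases "length Xs \<le> n")
      case True
      note t = t_map_in[OF c(5)[OF True], of Zs]
      show ?thesis
      proof (cases "length Ys \<le> n")
        case True
        then have "length Zs \<le> n - length Xs" "n - length Xs - length Zs = n - length Ys"
          using len by linarith+
        then show ?thesis
          using t(1) True by simp
      qed (use t(2) len True in simp)
    next
      case False
      then show ?thesis
        using len c(6)[of Xs] by (simp add: homD[OF t_map_hom])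
    qed
  qed (auto simp: cochains_closed)
qed

text \<open>By the Leibniz rule for \<open>star\<close>, the right side minus the left side is the
  product of \<open>bar \<psi>\<close> with \<open>dt + bt + td\<close>.\<close>

lemma Phi_star_diff: "Phi_star (src.diff \<psi>) = tgt.diff (Phi_star \<psi>)"
proof
  fix Ys
  let ?star = "star (\<lambda>w (f :: 'w \<Rightarrow> 'r list \<Rightarrow> 'u). f w)"
  have bar_delta: "bar (\<lambda>Xs. - delta (\<psi> Xs)) = (\<lambda>Xs. - delta (bar \<psi> Xs))"
    by (simp add: bar_def fun_eq_iff additive_alt_sign[OF additive_delta] alt_sign_linear)
  have bar_bW: "bar (\<lambda>Xs. bW (t_map Xs)) = bt"
    by (simp add: fun_eq_iff bar_def bt_def)
  have ced: "ced (brk A) (hochschild_lie A U) (?star \<psi> t_map) Ys =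
      ?star (ced (brk A) lieW \<psi>) t_map Ys + ?star (bar \<psi>) dt Ys"
    unfolding dt_def
    by (rule ev.ced_star)
      (simp_all add: additive_lieW additive_hochschild_lie hom_MW t_map_hom, simp add: MW_def)
  have "bar (\<lambda>Xs. hochschild_b U (?star \<psi> t_map Xs)) Ys = alt_sign (length Ys) (?star \<psi> (\<lambda>Xs. bW (t_map Xs)) Ys)"
    unfolding bar_def
    by (subst star_apply_right[where B = hom and G = bW]) (simp_all add: additive_b t_map_hom bW_def)
  \<comment> \<open>The sign of the total length is the product of the signs of the two factors,
    absorbed in \<open>bar \<psi>\<close> and in \<open>bt\<close>.\<close>
  also have "\<dots> = ?star (bar \<psi>) bt Ys"
    using ev.star_bar_right[of "\<lambda>Xs. bW (t_map Xs)" "bar \<psi>" Ys] hom_bW[OF t_map_hom]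
    by (simp add: bar_bW)
  finally have b: "bar (\<lambda>Xs. hochschild_b U (?star \<psi> t_map Xs)) Ys = ?star (bar \<psi>) bt Ys" .
  have delta: "?star (\<lambda>Xs. delta (bar \<psi> Xs)) t_map Ys = ?star (bar \<psi>) td Ys"
  proof -
    have "?star (\<lambda>Xs. delta (\<phi> Xs)) c Ys = ?star \<phi> (\<lambda>Xs w. c Xs (delta w)) Ys" for \<phi> and c :: "'l list \<Rightarrow> 'w \<Rightarrow> 'r list \<Rightarrow> 'u"
    proof (induction Ys arbitrary: \<phi> c)
      case (Cons Y Ys)
      have "bar (\<lambda>Xs. delta (\<phi> Xs)) = (\<lambda>Xs. delta (bar \<phi> Xs))"
        by (simp add: bar_def fun_eq_iff additive_alt_sign[OF additive_delta])
      then show ?case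
        by (simp add: Cons)
    qed simp
    then show ?thesis
      by (simp add: td_def[abs_def])
  qed
  have "?star (bar \<psi>) (\<lambda>Xs. dt Xs + bt Xs + td Xs) Ys = 0"
    by (simp add: fundamental_identity ev.star_zero_right)
  then have td: "?star (bar \<psi>) td Ys = - (?star (bar \<psi>) dt Ys + ?star (bar \<psi>) bt Ys)"
    by (simp only: ev.star_add_right eq_neg_iff_add_eq_0 add.commute[of "?star (bar \<psi>) td Ys"])
  then show "Phi_star (src.diff \<psi>) Ys = tgt.diff (Phi_star \<psi>) Ys"
    unfolding Phi_star_def src.diff_def[abs_def] tgt.diff_def bar_delta
    by (simp add: ev.star_diff_left t_map_hom ced b delta td)
qed

end

section \<open>Identification of \<Phi> with the product by t\<close>

locale lr_connection_char_0 = lr_connection A U S nab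
  for A :: "('k::field_char_0, 'r::comm_ring_1, 'l::ab_group_add) lie_rinehart_data"
    and U :: "('k, 'r, 'l, 'u::ring_1) envelope_data"
    and S :: "('r, 'l, 'e::ab_group_add, 's::ab_group_add, 'w::ab_group_add) sym_ad_data"
    and nab :: "('r \<Rightarrow> 'r) \<Rightarrow> 'l \<Rightarrow> 'l"
begin

text \<open>The sign in \<open>frak_s\<close> cancels (-1)^(k i) from
  \<open>antisymmetrization_eq_star\<close> and (-1)^(k(k-1)/2) between s and t. The factorials
  cancel too, which is where characteristic 0 enters.\<close>

lemma frak_s_eq:
  assumes \<phi>: "multiadditive \<phi>" "alternating \<phi>" "\<And>Xs. length Xs \<noteq> i \<Longrightarrow> \<phi> Xs = 0"
  shows "frak_s A U S nab k i \<phi> Ys = (if length Ys = k + i then Phi_star \<phi> Ys else 0)"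
proof (cases "length Ys = k + i")
  case True
  let ?e = "k * (k - 1) div 2"
  interpret C: vector_space "scC U" by (rule vector_space_scC)
  have alt: "scC U c (alt_sign n f) = alt_sign n (scC U c f)" for c n f
    by (simp add: alt_sign_def)
  have "scC U (of_int (sign \<sigma>)) (s_map A U S nab (map (\<lambda>t. Ys ! \<sigma> t) [0..<k])
        (\<phi> (map (\<lambda>t. Ys ! \<sigma> t) [k..<k + i]))) =
      alt_sign ?e (scC U (of_int (sign \<sigma>)) (t_map (take k (map (\<lambda>t. Ys ! \<sigma> t) [0..<k + i]))
        (\<phi> (drop k (map (\<lambda>t. Ys ! \<sigma> t) [0..<k + i])))))" for \<sigma>
    by (simp add: s_map_eq alt take_map drop_map alt_sign_def)
  then have "(\<Sum>\<sigma> | \<sigma> permutes {..<k + i}. scC U (of_int (sign \<sigma>))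
        (s_map A U S nab (map (\<lambda>t. Ys ! \<sigma> t) [0..<k]) (\<phi> (map (\<lambda>t. Ys ! \<sigma> t) [k..<k + i])))) =
      alt_sign ?e (antisymmetrization (scC U) (k + i) (\<lambda>Zs. t_map (take k Zs) (\<phi> (drop k Zs))) Ys)"
    by (simp add: antisymmetrization_def alt_sign_sum)
  also have "\<dots> = alt_sign (k * i + ?e) (scC U (fact k * fact i) (Phi_star \<phi> Ys))"
    unfolding Phi_star_def
    by (subst ev.antisymmetrization_eq_star[OF vector_space_scC t_map_hom t_map_multilinear(1,2) \<phi> True])
      (simp_all add: add.commute)
  finally show ?thesis
    using True by (simp add: frak_s_def alt) (simp add: alt_sign_def)
qed (simp add: frak_s_def)

text \<open>A component \<phi>_m is nonzero only on n - m arguments. Summing its products with t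
  over m therefore gives the product with the joined function.\<close>

lemma Phi_eq:
  assumes \<phi>: "\<phi> \<in> Omega (scL A) (scWK A S) (sym_ad_degree A S) n"
  shows "Phi A U S nab n \<phi> = unjoin n (Phi_star (join n \<phi>))"
proof (intro ext)
  fix j Ys rs
  have comp: "multiadditive (\<phi> m)" "alternating (\<phi> m)" "\<And>Xs. length Xs \<noteq> n - m \<Longrightarrow> \<phi> m Xs = 0"
    if "m \<le> n" for m
  proof -
    have "\<phi> m \<in> ce_cochains (scL A) (scWK A S) (n - m) (sym_ad_degree A S m)"
      using \<phi> that by (simp add: Omega_def)
    then show "multiadditive (\<phi> m)" "alternating (\<phi> m)" "\<And>Xs. length Xs \<noteq> n - m \<Longrightarrow> \<phi> m Xs = 0"
      by (simp_all add: ce_cochains_def multilinear_iff L_vector_space vector_space_scWK alternating_def)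
  qed
  have "Phi A U S nab n \<phi> j Ys = unjoin n (Phi_star (join n \<phi>)) j Ys"
  proof (cases "j \<le> n")
    case True
    have frak: "frak_s A U S nab i (n - (i + j)) (\<phi> (i + j)) Ys = (if length Ys + j = n then Phi_star (\<phi> (i + j)) Ys else 0)"
      if "i \<le> n - j" for i
      using True that by (subst frak_s_eq) (auto simp: comp)
    have "(\<Sum>i\<le>n - j. Phi_star (\<phi> (i + j)) Ys) = Phi_star (join n \<phi>) Ys" if "length Ys + j = n"
    proof -
      have "join n \<phi> Zs = (\<Sum>i\<le>n - j. \<phi> (i + j) Zs)" if "length Zs \<le> length Ys" for Zs
      proof -
        \<comment> \<open>On \<open>Zs\<close> only the component with index i + j = n - length Zs
          survives.\<close>
        have "(\<Sum>i\<le>n - j. \<phi> (i + j) Zs) = (\<Sum>i\<in>{n - j - length Zs}. \<phi> (i + j) Zs)"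
        proof (intro sum.mono_neutral_right ballI)
          fix i assume i: "i \<in> {..n - j} - {n - j - length Zs}"
          show "\<phi> (i + j) Zs = 0"
            by (rule comp(3)) (use i True that \<open>length Ys + j = n\<close> in auto)
        qed auto
        also have "n - j - length Zs + j = n - length Zs"
          using that \<open>length Ys + j = n\<close> by simp
        then have "(\<Sum>i\<in>{n - j - length Zs}. \<phi> (i + j) Zs) = join n \<phi> Zs"
          using that \<open>length Ys + j = n\<close> by (simp add: join_def)
        finally show ?thesis by simp
      qed
      then have "Phi_star (join n \<phi>) Ys = Phi_star (\<lambda>Zs. \<Sum>i\<le>n - j. \<phi> (i + j) Zs) Ys"
        unfolding Phi_star_def by (intro ev.star_cong) simp_all
      then show ?thesis
        by (simp add: Phi_star_def ev.star_sum_left t_map_hom)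
    qed
    moreover have "sum f I Ys = (\<Sum>i\<in>I. f i Ys)" for f :: "nat \<Rightarrow> 'l list \<Rightarrow> 'r list \<Rightarrow> 'u" and I
      by (induction I rule: infinite_finite_induct) (simp_all add: plus_fun_apply)
    ultimately show ?thesis
      using True by (simp add: Phi_def frak unjoin_def)
  qed (simp add: Phi_def unjoin_def)
  then show "Phi A U S nab n \<phi> j Ys rs = unjoin n (Phi_star (join n \<phi>)) j Ys rs"
    by simp
qed

lemma Phi_cochain_map:
  "cochain_map (tuple_scale (scWK A S)) (Omega_nl A S)
     (\<lambda>n. total_diff (brk A) (sym_lie A S) (\<lambda>w. - sym_delta A S w))
     (tuple_scale (scC U)) (Omega (scL A) (scC U) (hochschild_cochains A U))
     (\<lambda>n. total_diff (brk A) (hochschild_lie A U) (hochschild_b U)) (Phi A U S nab)"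
proof (intro cochain_map.intro source_cochain_complex cochain_map_axioms.intro)
  show "cochain_complex (tuple_scale (scC U)) (Omega (scL A) (scC U) (hochschild_cochains A U))
      (\<lambda>n. total_diff (brk A) (hochschild_lie A U) (hochschild_b U))"
    by (rule tgt.subcomplex) (simp_all add: tgt.Omega_closed tgt.total_diff_Omega(2))
  fix \<phi> n assume "\<phi> \<in> Omega_nl A S n"
  then have \<phi>: "\<phi> \<in> Omega (scL A) (scWK A S) (sym_ad_degree A S) n"
    by (simp add: Omega_nl_iff)
  note c = Phi_star_cochain[OF src.Omega_join(1)[OF \<phi>]]
  show "Phi A U S nab n \<phi> \<in> Omega (scL A) (scC U) (hochschild_cochains A U) n"
    by (simp add: Phi_eq[OF \<phi>] tgt.unjoin_Omega(1)[OF c])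
  show "Phi A U S nab n (\<phi> + \<psi>) = Phi A U S nab n \<phi> + Phi A U S nab n \<psi>" if "\<psi> \<in> Omega_nl A S n" for \<psi>
    using \<phi> that
    by (simp add: Omega_nl_iff Phi_eq src.Omega_closed src.join_linear Phi_star_add tgt.unjoin_linear)
  show "Phi A U S nab n (tuple_scale (scWK A S) a \<phi>) = tuple_scale (scC U) a (Phi A U S nab n \<phi>)" for a
    using \<phi> by (simp add: Phi_eq src.Omega_closed src.join_linear Phi_star_scale tgt.unjoin_linear)
  show "Phi A U S nab (Suc n) (total_diff (brk A) (sym_lie A S) (\<lambda>w. - sym_delta A S w) \<phi>) =
      total_diff (brk A) (hochschild_lie A U) (hochschild_b U) (Phi A U S nab n \<phi>)"
    unfolding sym_lie_eq[abs_def] sym_delta_eq Phi_eq[OF \<phi>]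
    using src.total_diff_Omega(2,3)[OF \<phi>] tgt.total_diff_unjoin[OF c]
    by (simp add: Phi_eq Phi_star_diff)
qed

end

theorem theorem3p4:
  fixes A :: "('k::field_char_0, 'r::comm_ring_1, 'l::ab_group_add) lie_rinehart_data"
    and U :: "('k, 'r, 'l, 'u::ring_1) envelope_data"
    and S :: "('r, 'l, 'e::ab_group_add, 's::ab_group_add, 'w::ab_group_add) sym_ad_data"
    and nab :: "('r \<Rightarrow> 'r) \<Rightarrow> 'l \<Rightarrow> 'l"
  assumes "lie_rinehart A"
    and "universal_envelope A U"
    and "sym_ad A S"
    and "connection A nab"
  shows "cochain_map
    (tuple_scale (scWK A S))
    (Omega_nl A S)
    (\<lambda>n. total_diff (brk A) (sym_lie A S) (\<lambda>w. - sym_delta A S w))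
    (tuple_scale (scC U))
    (Omega (scL A) (scC U) (hochschild_cochains A U))
    (\<lambda>n. total_diff (brk A) (hochschild_lie A U) (hochschild_b U))
    (Phi A U S nab)"
proof -
  interpret lr_connection_char_0 A U S nab
    using assms
    by (intro lr_connection_char_0.intro lr_connection.intro envelope.intro envelope_axioms.intro
        sym_ad_algebra.intro sym_ad_algebra_axioms.intro)
  show ?thesis by (rule Phi_cochain_map)
qed

end
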